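(* Let $f\in C^3(\iota(M))$, let the regularization order be $\rho=3$, and let $\epsilon=\epsilon(n)$ be such that $\frac{\sqrt{\log(n)}}{n^{1/2}\epsilon^{d/2+1}}\to0$ and $\epsilon\to0$ as $n\to\infty$. Then, as $n\to\infty$ (with implied constants not depending on $n$), with probability greater than $1-n^{-2}$, for all $x_k\in\mathcal{X}$, $$\frac{1}{\epsilon^2}\Big[\sum_{j=1}^N w_k(j)f(x_{k,j})-f(x_k)\Big]=\frac{1}{2(d+2)}\Delta f(x_k)+O(\epsilon)+O\Big(\frac{\sqrt{\log (n)}}{n^{1/2}\epsilon^{d/2+1}}\Big).$$
   Context: Notation: $\chi$ denotes an indicator function; $B^{\mathbb{R}^p}_\epsilon(z)$ is the closed Euclidean ball; $|S^{d-1}|$ is the volume of the unit sphere; $\Delta$ is the Laplace–Beltrami operator of $(M,g)$. $O(\cdot)$ may hide constants depending on $M,\iota,P,f$. Manifold setup. $(M,g)$ is a $d$-dimensional compact smooth Riemannian manifold without boundary, isometrically embedded by $\iota:M\hookrightarrow\mathbb{R}^p$. $X$ is a $p$-dimensional random vector with range supported on $\iota(M)$, whose law is absolutely continuous with respect to the Riemannian volume on $\iota(M)$, with density $P\in C^5(\iota(M))$ satisfying $0<P_m\le P\le P_M<\infty$. Functions on $\iota(M)$ are identified with functions on $M$; points $x\in M$ are identified with $\iota(x)$ where convenient. $\mathcal{X}=\{\iota(x_i)\}_{i=1}^n$ are i.i.d. samples of $X$. LLE weights. For each $k$ let $\iota(x_{k,1}),\dots,\iota(x_{k,N})$ be the points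 of $\mathcal{X}\setminus\{\iota(x_k)\}$ in $B^{\mathbb{R}^p}_\epsilon(\iota(x_k))$ ($N$ depends on $k$), let $G_n\in\mathbb{R}^{p\times N}$ have columns $\iota(x_{k,j})-\iota(x_k)$, let $y$ solve $(G_n^\top G_n+cI_{N\times N})y=\boldsymbol{1}_N$ with $c=n\epsilon^{d+\rho}=n\epsilon^{d+3}$, where $\boldsymbol 1_N$ is the all-ones vector, and set $w_k=y/(y^\top\boldsymbol{1}_N)\in\mathbb{R}^N$. Standing assumption on the local geometry. Let $C_x=\mathbb{E}[(X-\iota(x))(X-\iota(x))^\top\chi_{B^{\mathbb{R}^p}_\epsilon(\iota(x))}(X)]$. Fix $x\in M$ and apply a rigid motion of $\mathbb{R}^p$ so that $\iota_*T_xM$ is spanned by $e_1,\dots,e_d$. For small $\epsilon$, $$C_x=\tfrac{|S^{d-1}|P(x)}{d(d+2)}\epsilon^{d+2}\Big(\begin{bmatrix}I_{d\times d}&0\\ 0&0\end{bmatrix}+\begin{bmatrix}M^{(2)}_{11}&M^{(2)}_{12}\\ M^{(2)}_{21}&M^{(2)}_{22}\end{bmatrix}\epsilon^2+\begin{bmatrix}M^{(4)}_{11}&M^{(4)}_{12}\\ M^{(4)}_{21}&M^{(4)}_{22}\end{bmatrix}\epsilon^4+O(\epsilon^6)\Big),$$ which defines the blocks $M^{(j)}_{ab}$ (at $x$). Choose $e_{d+1},\dots,e_p$ so that $M^{(2)}_{22}=\mathrm{diag}(\lambda^{(2)}_{d+1},\dots,\lambda^{(2)}_p)$. If exactly $l\ge1$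 of these vanish, order them so that $\lambda^{(2)}_{p-l+1}=\dots=\lambda^{(2)}_p=0$; let $M^{(4)}_{22,22}$ be the lower-right $l\times l$ block of $M^{(4)}_{22}$, $M^{(2)}_{12,2}$ the last $l$ columns of $M^{(2)}_{12}$, $M^{(2)}_{21,2}=M^{(2)\top}_{12,2}$, and let $\lambda^{(4)}_{p-l+1},\dots,\lambda^{(4)}_p$ be the eigenvalues of $M^{(4)}_{22,22}-2M^{(2)}_{21,2}M^{(2)}_{12,2}$. With $r$ the rank of $C_x$, it is assumed that each point under consideration satisfies one of: Case 0: $r=d$. Case 1: $r=p>d$ and $\lambda^{(2)}_{d+1},\dots,\lambda^{(2)}_p$ are all nonzero. Case 2: $r=p>d$, $\lambda^{(2)}_{d+1},\dots,\lambda^{(2)}_{p-l}$ are nonzero, $\lambda^{(2)}_{p-l+1}=\dots=\lambda^{(2)}_p=0$ for some $1\le l\le p-d$, and $\lambda^{(4)}_{p-l+1},\dots,\lambda^{(4)}_p$ are all nonzero. *)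

theory Defs
  imports "HOL-Probability.Probability"
begin

primrec Ck_on ::
  "nat \<Rightarrow> 'a::real_normed_vector set \<Rightarrow> ('a \<Rightarrow> 'b::real_normed_vector) \<Rightarrow> bool" where
  "Ck_on 0 U h \<longleftrightarrow> continuous_on U h"
| "Ck_on (Suc k) U h \<longleftrightarrow>
     (\<forall>x\<in>U. h differentiable (at x)) \<and> (\<forall>v. Ck_on k U (\<lambda>x. frechet_derivative h (at x) v))"

definition smooth_on :: "'a::real_normed_vector set \<Rightarrow> ('a \<Rightarrow> 'b::real_normed_vector) \<Rightarrow> bool" where
  "smooth_on U h \<longleftrightarrow> (\<forall>k. Ck_on k U h)"

text \<open>A manifold is a subset \<open>M\<close> of a topological space, with the subspace topology, together with
  an atlas given by local parametrizations: an element \<open>(U, \<psi>)\<close> of the atlas consists of an open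
  subset \<open>U\<close> of Euclidean space and a homeomorphism \<open>\<psi>\<close> of \<open>U\<close> onto an open subset of \<open>M\<close>
  (the inverse of a chart). All the domains \<open>U\<close> are open subsets of the full space, so
  there is no boundary. The dimension is the cardinality of the index type \<open>'d\<close>.\<close>

type_synonym ('d, 'm) param = "(real ^ 'd) set \<times> (real ^ 'd \<Rightarrow> 'm)"

definition overlap :: "('d::finite, 'm) param \<Rightarrow> ('d, 'm) param \<Rightarrow> (real ^ 'd) set" where
  "overlap c c' = {u \<in> fst c. snd c u \<in> snd c' ` fst c'}"

definition transition ::
  "('d::finite, 'm) param \<Rightarrow> ('d, 'm) param \<Rightarrow> real ^ 'd \<Rightarrow> real ^ 'd" where
  "transition c c' = inv_into (fst c') (snd c') \<circ> snd c"

definition smooth_manifold ::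
  "'m::topological_space set \<Rightarrow> ('d::finite, 'm) param set \<Rightarrow> bool" where
  "smooth_manifold M \<A> \<longleftrightarrow>
     Hausdorff_space (top_of_set M) \<and> second_countable (top_of_set M) \<and>
     (\<Union>(U, \<psi>)\<in>\<A>. \<psi> ` U) = M \<and>
     (\<forall>(U, \<psi>)\<in>\<A>. open U \<and> openin (top_of_set M) (\<psi> ` U) \<and>
        homeomorphism U (\<psi> ` U) \<psi> (inv_into U \<psi>)) \<and>
     (\<forall>c\<in>\<A>. \<forall>c'\<in>\<A>. smooth_on (overlap c c') (transition c c'))"

definition Ck_manifold_map ::
  "nat \<Rightarrow> ('d::finite, 'm) param set \<Rightarrow> ('m \<Rightarrow> 'b::real_normed_vector) \<Rightarrow> bool" where
  "Ck_manifold_map k \<A> h \<longleftrightarrow> (\<forall>(U, \<psi>)\<in>\<A>. Ck_on k U (h \<circ> \<psi>))"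

text \<open>A Riemannian metric is given by its coordinate matrices: \<open>g c u\<close> is the Gram matrix of the
  coordinate vector fields of the parametrization \<open>c\<close> at the point with coordinates \<open>u\<close>.
  The last condition is the tensorial transformation law.\<close>

definition riemannian_metric ::
  "('d::finite, 'm) param set \<Rightarrow> (('d, 'm) param \<Rightarrow> real ^ 'd \<Rightarrow> real ^ 'd ^ 'd) \<Rightarrow> bool" where
  "riemannian_metric \<A> g \<longleftrightarrow>
     (\<forall>c\<in>\<A>. (\<forall>i j. smooth_on (fst c) (\<lambda>u. g c u $ i $ j)) \<and>
        (\<forall>u\<in>fst c. transpose (g c u) = g c u \<and> (\<forall>v. v \<noteq> 0 \<longrightarrow> v \<bullet> (g c u *v v) > 0))) \<and>
     (\<forall>c\<in>\<A>. \<forall>c'\<in>\<A>. \<forall>u\<in>overlap c c'.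
        g c u = transpose (jacobian (transition c c') (at u)) ** g c' (transition c c' u)
                  ** jacobian (transition c c') (at u))"

definition isometric_embedding ::
  "'m::topological_space set \<Rightarrow> ('d::finite, 'm) param set \<Rightarrow>
   (('d, 'm) param \<Rightarrow> real ^ 'd \<Rightarrow> real ^ 'd ^ 'd) \<Rightarrow> ('m \<Rightarrow> real ^ 'p::finite) \<Rightarrow> bool" where
  "isometric_embedding M \<A> g \<iota> \<longleftrightarrow>
     (\<forall>k. Ck_manifold_map k \<A> \<iota>) \<and>
     homeomorphism M (\<iota> ` M) \<iota> (inv_into M \<iota>) \<and>
     (\<forall>c\<in>\<A>. \<forall>u\<in>fst c. inj (frechet_derivative (\<iota> \<circ> snd c) (at u))) \<and>
     (\<forall>c\<in>\<A>. \<forall>u\<in>fst c. \<forall>i j.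
        g c u $ i $ j = frechet_derivative (\<iota> \<circ> snd c) (at u) (axis i 1) \<bullet>
                        frechet_derivative (\<iota> \<circ> snd c) (at u) (axis j 1))"

definition embedded_tangent_space ::
  "('d::finite, 'm) param set \<Rightarrow> ('m \<Rightarrow> real ^ 'p::finite) \<Rightarrow> 'm \<Rightarrow> (real ^ 'p) set" where
  "embedded_tangent_space \<A> \<iota> x =
     {frechet_derivative (\<iota> \<circ> \<psi>) (at u) v | U \<psi> u v. (U, \<psi>) \<in> \<A> \<and> u \<in> U \<and> \<psi> u = x}"

definition riemannian_volume ::
  "'m::topological_space set \<Rightarrow> ('d::finite, 'm) param set \<Rightarrow>
   (('d, 'm) param \<Rightarrow> real ^ 'd \<Rightarrow> real ^ 'd ^ 'd) \<Rightarrow> 'm measure \<Rightarrow> bool" where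
  "riemannian_volume M \<A> g V \<longleftrightarrow>
     space V = M \<and> sets V = sets (restrict_space borel M) \<and>
     (\<forall>(U, \<psi>)\<in>\<A>. \<forall>B\<in>sets V. B \<subseteq> \<psi> ` U \<longrightarrow>
        emeasure V B =
          (\<integral>\<^sup>+u. ennreal (sqrt (det (g (U, \<psi>) u))) * indicator {u \<in> U. \<psi> u \<in> B} u \<partial>lborel))"

definition partial_deriv :: "'d::finite \<Rightarrow> (real ^ 'd \<Rightarrow> real) \<Rightarrow> real ^ 'd \<Rightarrow> real" where
  "partial_deriv i h u = frechet_derivative h (at u) (axis i 1)"

text \<open>The Laplace--Beltrami operator, with the sign convention div grad. The coordinate
  expression does not depend on the parametrization around \<open>x\<close>, so an arbitrary one is selected.\<close>

definition laplace_coord ::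
  "(real ^ 'd \<Rightarrow> real ^ 'd ^ 'd) \<Rightarrow> (real ^ 'd \<Rightarrow> real) \<Rightarrow> real ^ 'd::finite \<Rightarrow> real" where
  "laplace_coord G h u =
     (1 / sqrt (det (G u))) *
     (\<Sum>i\<in>UNIV. \<Sum>j\<in>UNIV.
        partial_deriv i (\<lambda>v. sqrt (det (G v)) * matrix_inv (G v) $ i $ j * partial_deriv j h v) u)"

definition laplace_beltrami ::
  "('d::finite, 'm) param set \<Rightarrow> (('d, 'm) param \<Rightarrow> real ^ 'd \<Rightarrow> real ^ 'd ^ 'd) \<Rightarrow>
   ('m \<Rightarrow> real) \<Rightarrow> 'm \<Rightarrow> real" where
  "laplace_beltrami \<A> g h x =
     (let c = (SOME c. c \<in> \<A> \<and> x \<in> snd c ` fst c)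
      in laplace_coord (g c) (h \<circ> snd c) (inv_into (fst c) (snd c) x))"

definition embedded_volume ::
  "'m set \<Rightarrow> ('m \<Rightarrow> real ^ 'p::finite) \<Rightarrow> 'm measure \<Rightarrow> (real ^ 'p) measure" where
  "embedded_volume M \<iota> V = distr V (restrict_space borel (\<iota> ` M)) \<iota>"

definition iid_samples ::
  "'w measure \<Rightarrow> (real ^ 'p::finite) measure \<Rightarrow> (real ^ 'p \<Rightarrow> real) \<Rightarrow> nat \<Rightarrow>
   (nat \<Rightarrow> 'w \<Rightarrow> real ^ 'p) \<Rightarrow> bool" where
  "iid_samples \<Omega> N P n X \<longleftrightarrow>
     prob_space \<Omega> \<and> prob_space.indep_vars \<Omega> (\<lambda>_. N) X {..<n} \<and>
     (\<forall>i<n. distributed \<Omega> N (X i) (\<lambda>y. ennreal (P y)))"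

definition lle_neighbours :: "(real ^ 'p::finite) set \<Rightarrow> real \<Rightarrow> real ^ 'p \<Rightarrow> (real ^ 'p) set" where
  "lle_neighbours \<X> r x = (\<X> - {x}) \<inter> cball x r"

text \<open>Vectors indexed by the neighbours are represented as functions on the finite set \<open>S\<close> of
  neighbours. The matrix \<open>G\<close> has the columns \<open>z - x\<close> for \<open>z \<in> S\<close>, so the entries of the product of
  its transpose with \<open>G\<close> are the inner products below. For \<open>c > 0\<close> the solution is unique on \<open>S\<close>.\<close>

definition lle_solution ::
  "(real ^ 'p::finite) set \<Rightarrow> real ^ 'p \<Rightarrow> real \<Rightarrow> (real ^ 'p \<Rightarrow> real) \<Rightarrow> bool" where
  "lle_solution S x c y \<longleftrightarrow> (\<forall>z\<in>S. (\<Sum>z'\<in>S. ((z - x) \<bullet> (z' - x)) * y z') + c * y z = 1)"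

definition lle_weight ::
  "(real ^ 'p::finite) set \<Rightarrow> real ^ 'p \<Rightarrow> real \<Rightarrow> real ^ 'p \<Rightarrow> real" where
  "lle_weight S x c z = (let y = (SOME y. lle_solution S x c y) in y z / (\<Sum>z'\<in>S. y z'))"

definition lle_average ::
  "(real ^ 'p::finite) set \<Rightarrow> real \<Rightarrow> real \<Rightarrow> (real ^ 'p \<Rightarrow> real) \<Rightarrow> real ^ 'p \<Rightarrow> real" where
  "lle_average \<X> r c f x =
     (let S = lle_neighbours \<X> r x in \<Sum>z\<in>S. lle_weight S x c z * f z)"

definition local_cov :: "(real ^ 'p::finite) measure \<Rightarrow> real ^ 'p \<Rightarrow> real \<Rightarrow> real ^ 'p ^ 'p" where
  "local_cov \<nu> z r =
     (\<chi> i j. \<integral>y. (y - z) $ i * (y - z) $ j * indicator (cball z r) y \<partial>\<nu>)"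

text \<open>\<open>sphere_vol d\<close> is the volume of the unit sphere in d-dimensional Euclidean space, which is
  d times the volume of the unit ball.\<close>

definition sphere_vol :: "nat \<Rightarrow> real" where
  "sphere_vol d = real d * unit_ball_vol (real d)"

text \<open>The rigid motion is encoded by an orthonormal basis \<open>e 1, \<dots>, e p\<close> whose first \<open>d\<close> vectors
  span the tangent space; matrices in this basis are functions of indices in \<open>{1..p}\<close>.\<close>

definition adapted_frame :: "nat \<Rightarrow> (real ^ 'p::finite) set \<Rightarrow> (nat \<Rightarrow> real ^ 'p) \<Rightarrow> bool" where
  "adapted_frame d T e \<longleftrightarrow>
     (\<forall>i\<in>{1..CARD('p)}. \<forall>j\<in>{1..CARD('p)}. e i \<bullet> e j = (if i = j then 1 else 0)) \<and>
     span (e ` {1..d}) = T"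

text \<open>In \<open>cov_expansion d a C e M2 M4\<close>, \<open>a\<close> is the value of the density at the base point and \<open>C\<close>
  is the local covariance matrix as a function of the radius. The remainder \<open>O(r ^ 6)\<close>
  inside the bracket is multiplied by the prefactor of order \<open>r ^ (d + 2)\<close>.\<close>

definition cov_expansion ::
  "nat \<Rightarrow> real \<Rightarrow> (real \<Rightarrow> real ^ 'p ^ 'p) \<Rightarrow> (nat \<Rightarrow> real ^ 'p::finite) \<Rightarrow>
   (nat \<Rightarrow> nat \<Rightarrow> real) \<Rightarrow> (nat \<Rightarrow> nat \<Rightarrow> real) \<Rightarrow> bool" where
  "cov_expansion d a C e M2 M4 \<longleftrightarrow>
     (\<forall>i\<in>{1..CARD('p)}. \<forall>j\<in>{1..CARD('p)}.
        (\<lambda>r. e i \<bullet> (C r *v e j) -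
             sphere_vol d * a / (real d * (real d + 2)) * r ^ (d + 2) *
               ((if i = j \<and> i \<le> d then 1 else 0) + M2 i j * r ^ 2 + M4 i j * r ^ 4))
          \<in> O[at_right 0](\<lambda>r. r ^ (d + 2) * r ^ 6))"

definition block_eigenvalue :: "nat set \<Rightarrow> (nat \<Rightarrow> nat \<Rightarrow> real) \<Rightarrow> real \<Rightarrow> bool" where
  "block_eigenvalue I B \<mu> \<longleftrightarrow>
     (\<exists>v. (\<exists>i\<in>I. v i \<noteq> 0) \<and> (\<forall>i\<in>I. (\<Sum>j\<in>I. B i j * v j) = \<mu> * v i))"

definition geometry_case0 :: "nat \<Rightarrow> (real \<Rightarrow> real ^ 'p ^ 'p::finite) \<Rightarrow> bool" where
  "geometry_case0 d C \<longleftrightarrow> (\<forall>\<^sub>F r in at_right 0. rank (C r) = d)"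

definition geometry_case1 ::
  "nat \<Rightarrow> real \<Rightarrow> (real \<Rightarrow> real ^ 'p ^ 'p::finite) \<Rightarrow> (real ^ 'p) set \<Rightarrow> bool" where
  "geometry_case1 d a C T \<longleftrightarrow>
     CARD('p) > d \<and> (\<forall>\<^sub>F r in at_right 0. rank (C r) = CARD('p)) \<and>
     (\<exists>e M2 M4 ev. adapted_frame d T e \<and> cov_expansion d a C e M2 M4 \<and>
        (\<forall>i\<in>{d+1..CARD('p)}. \<forall>j\<in>{d+1..CARD('p)}. M2 i j = (if i = j then ev i else 0)) \<and>
        (\<forall>i\<in>{d+1..CARD('p)}. ev i \<noteq> 0))"

text \<open>In the last condition the sum over \<open>k\<close> is the entry of the product of the transpose of the
  last \<open>l\<close> columns of the upper-right block of \<open>M2\<close> with these columns.\<close>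

definition geometry_case2 ::
  "nat \<Rightarrow> real \<Rightarrow> (real \<Rightarrow> real ^ 'p ^ 'p::finite) \<Rightarrow> (real ^ 'p) set \<Rightarrow> bool" where
  "geometry_case2 d a C T \<longleftrightarrow>
     CARD('p) > d \<and> (\<forall>\<^sub>F r in at_right 0. rank (C r) = CARD('p)) \<and>
     (\<exists>e M2 M4 ev. \<exists>l\<in>{1..CARD('p) - d}. adapted_frame d T e \<and> cov_expansion d a C e M2 M4 \<and>
        (\<forall>i\<in>{d+1..CARD('p)}. \<forall>j\<in>{d+1..CARD('p)}. M2 i j = (if i = j then ev i else 0)) \<and>
        (\<forall>i\<in>{d+1..CARD('p) - l}. ev i \<noteq> 0) \<and>
        (\<forall>i\<in>{CARD('p) - l + 1..CARD('p)}. ev i = 0) \<and>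
        (\<forall>\<mu>. block_eigenvalue {CARD('p) - l + 1..CARD('p)}
                (\<lambda>i j. M4 i j - 2 * (\<Sum>k\<in>{1..d}. M2 k i * M2 k j)) \<mu> \<longrightarrow> \<mu> \<noteq> 0))"

end

theory Submission
  imports Defs
begin

text \<open>
  Let \<open>x\<close> be a sample, \<open>G\<close> the matrix of the differences \<open>z - x\<close> to its neighbours \<open>z\<close>, and
  \<open>v = (G G\<^sup>T + c)\<inverse> G 1\<close>. The unnormalised LLE weights are \<open>(1 - (z - x) \<bullet> v) / c\<close>, so only the vector
  \<open>v\<close> of the ambient space matters. Split \<open>v\<close> into its tangential part \<open>v\<^sub>1\<close> and its normal part \<open>v\<^sub>2\<close>.
  The covariance is bounded below by a multiple of \<open>n \<epsilon>\<^bsup>d+2\<^esup>\<close> in tangential directions, and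
  \<open>c = n \<epsilon>\<^bsup>d+3\<^esup>\<close> bounds the system from below in normal directions, where \<open>z - x\<close> is of order
  \<open>\<epsilon>\<^sup>2\<close>; this gives \<open>v\<^sub>1 = O(1)\<close>, \<open>v\<^sub>2 = O(1 / \<epsilon>)\<close> and \<open>(z - x) \<bullet> v = O(\<epsilon>)\<close>, whatever the rank of the
  covariance matrix is. In the weighted sum of \<open>f z - f x\<close>, the gradient \<open>a\<close> contributes exactly
  \<open>c (a \<bullet> v\<^sub>1)\<close>, which is of order \<open>n \<epsilon>\<^bsup>d+3\<^esup>\<close>, while the second order remainder of \<open>f\<close> contributes its
  mean over the sampled ball, that is the Laplacian times \<open>\<epsilon>\<^sup>2 / (2 (d + 2))\<close>, up to a relative
  error \<open>O(\<epsilon>)\<close>.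

  Zeroth, first and second moments and the Taylor remainder are finitely many test functions, which
  have variance \<open>O(\<epsilon>\<^sup>d)\<close>. By an exponential moment bound and a union bound over the base points,
  deviations of order \<open>n \<epsilon>\<^bsup>d+1\<^esup>\<close> have probability below \<open>1 / n\<^sup>2\<close> as soon as
  \<open>n \<epsilon>\<^bsup>d+2\<^esup>\<close> dominates \<open>ln n\<close>. The population moments are computed in charts, where small Euclidean balls
  are ellipsoids up to higher order; compactness makes the constants uniform.
\<close>

section \<open>Taylor expansions in several variables\<close>

text \<open>The power of eps in c balances the errors: relative to the total weight, of order n
  eps^d, the gradient term c (a . v1) is of order eps^3, hence O(eps) after division by eps^2. This
  needs |v1| bounded, but one energy estimate for v only gives |v1| = O(eps^(-1/2)). So v2 is
  bounded first, and its bound is fed back into the equation tested with v1 alone.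

  A second obstacle is that gradient, tangent space and Laplacian are found chart by chart, while
  \<open>laplace_beltrami\<close> evaluates in a chart picked by choice. Instead of transforming
  coordinates, the proof shows that the moment conditions collected in \<open>lle_geometry\<close>
  determine gradient and Laplacian, so that the data of different charts agree.

  Finally, the base point is itself a sample. Given this point the other samples are still
  independent, which turns the random centre into a parameter of an integral. The test functions
  must then be jointly measurable in both points, and this is why the gradient is shown to depend
  continuously on the base point.\<close>

lemma Ck_on_Suc_imp: "Ck_on (Suc k) U h \<Longrightarrow> Ck_on k U h"
proof (induction k arbitrary: h)
  case 0
  then have "h differentiable_on U"
    by (auto simp: differentiable_on_def intro: differentiable_at_withinI)
  then show ?case
    by (simp add: differentiable_imp_continuous_on)
next
  case (Suc k)
  show ?case
    unfolding Ck_on.simps(2)[of k]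
  proof safe
    fix x assume "x \<in> U"
    then show "h differentiable at x" using Suc.prems by simp
  next
    fix v
    show "Ck_on k U (\<lambda>x. frechet_derivative h (at x) v)"
      using Suc.prems by (intro Suc.IH) simp
  qed
qed

lemma Ck_on_mono: "k \<le> l \<Longrightarrow> Ck_on l U h \<Longrightarrow> Ck_on k U h"
  by (induction l rule: dec_induct) (auto dest: Ck_on_Suc_imp simp del: Ck_on.simps)

lemma Ck_on_continuous: "Ck_on k U h \<Longrightarrow> continuous_on U h"
  using Ck_on_mono[of 0 k U h] by simp

lemma Ck_on_has_derivative:
  "Ck_on (Suc k) U h \<Longrightarrow> x \<in> U \<Longrightarrow> (h has_derivative frechet_derivative h (at x)) (at x)"
  by (simp add: frechet_derivative_works)

lemma Ck_on_linear:
  "Ck_on (Suc k) U h \<Longrightarrow> x \<in> U \<Longrightarrow> linear (frechet_derivative h (at x))"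
  using Ck_on_has_derivative has_derivative_linear by blast

lemma Ck_on_direction: "Ck_on (Suc k) U h \<Longrightarrow> Ck_on k U (\<lambda>x. frechet_derivative h (at x) v)"
  by simp

lemma has_derivative_along_line:
  assumes "(h has_derivative L) (at (c + t *\<^sub>R b))"
  shows "((\<lambda>t. h (c + t *\<^sub>R b)) has_derivative (\<lambda>r. L (r *\<^sub>R b))) (at t within S)"
  by (rule has_derivative_compose[where f = "\<lambda>t. c + t *\<^sub>R b" and g = h and g' = L])
     (use assms in \<open>auto intro!: derivative_eq_intros\<close>)

lemma linear_axis_expand:
  fixes L :: "real ^ 'd::finite \<Rightarrow> 'b::real_vector"
  assumes "linear L"
  shows "L v = (\<Sum>i\<in>UNIV. (v $ i) *\<^sub>R L (axis i 1))"
proof -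
  have "L v = L (\<Sum>i\<in>UNIV. (v $ i) *\<^sub>R axis i 1)"
    by (simp add: basis_expansion scalar_mult_eq_scaleR[symmetric])
  also have "\<dots> = (\<Sum>i\<in>UNIV. (v $ i) *\<^sub>R L (axis i 1))"
    using assms by (simp add: linear_sum linear_scale)
  finally show ?thesis .
qed

text \<open>\<open>Ck_on\<close> controls derivatives in one fixed direction at a time. Bounds in
  the finitely many coordinate directions are turned here into a bound that is uniform in the
  direction.\<close>

lemma linear_axis_bound:
  fixes L :: "real ^ 'd::finite \<Rightarrow> 'b::real_normed_vector"
  assumes "linear L" "\<And>i. norm (L (axis i 1)) \<le> B i"
  shows "norm (L v) \<le> (\<Sum>i\<in>UNIV. B i) * norm v"
proof -
  have "norm (L v) \<le> (\<Sum>i\<in>UNIV. norm ((v $ i) *\<^sub>R L (axis i 1)))"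
    by (subst linear_axis_expand[OF assms(1)]) (rule norm_sum)
  also have "\<dots> \<le> (\<Sum>i\<in>UNIV. norm v * B i)"
    using assms(2) by (intro sum_mono) (auto intro!: mult_mono component_le_norm_cart)
  finally show ?thesis by (simp add: sum_distrib_left mult.commute)
qed

lemma Ck_on_lipschitz:
  fixes h :: "real ^ 'd::finite \<Rightarrow> 'b::real_normed_vector"
  assumes h: "Ck_on 1 U h" and S: "S \<subseteq> U" "convex S" "compact S"
  shows "\<exists>K\<ge>0. \<forall>u\<in>S. \<forall>w\<in>S. norm (h w - h u) \<le> K * norm (w - u)"
proof -
  have h1: "Ck_on (Suc 0) U h" using h by simp
  have "\<exists>B. \<forall>x\<in>S. norm (frechet_derivative h (at x) (axis i 1)) \<le> B" for i
  proof -
    have "continuous_on S (\<lambda>x. frechet_derivative h (at x) (axis i 1))"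
      using h1 S by (auto intro: continuous_on_subset)
    then have "bounded ((\<lambda>x. frechet_derivative h (at x) (axis i 1)) ` S)"
      using S compact_continuous_image compact_imp_bounded by blast
    then show ?thesis by (auto simp: bounded_iff)
  qed
  then obtain B where B: "\<And>i x. x \<in> S \<Longrightarrow> norm (frechet_derivative h (at x) (axis i 1)) \<le> B i"
    by metis
  let ?K = "\<Sum>i\<in>UNIV. \<bar>B i\<bar>"
  have "norm (h w - h u) \<le> ?K * norm (w - u)" if "u \<in> S" "w \<in> S" for u w
  proof (rule differentiable_bound[OF S(2)])
    fix x assume x: "x \<in> S"
    then have "x \<in> U" using S by auto
    then show "(h has_derivative frechet_derivative h (at x)) (at x within S)"
      using Ck_on_has_derivative[OF h1] has_derivative_at_withinI by blast
    have "norm (frechet_derivative h (at x) v) \<le> ?K * norm v" for v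
      using B[OF x] by (intro linear_axis_bound Ck_on_linear[OF h1 \<open>x \<in> U\<close>]) (meson abs_ge_self order_trans)
    then show "onorm (frechet_derivative h (at x)) \<le> ?K"
      by (intro onorm_bound) (auto simp: sum_nonneg)
  qed (use that in auto)
  moreover have "?K \<ge> 0" by (simp add: sum_nonneg)
  ultimately show ?thesis by blast
qed

text \<open>Mean value inequality on the segment from u to w for h minus its linear part at u: the
  derivative of this function is a difference of derivatives, which is Lipschitz in the
  point.\<close>

lemma Ck_on_taylor1:
  fixes h :: "real ^ 'd::finite \<Rightarrow> 'b::real_normed_vector"
  assumes h: "Ck_on 2 U h" and S: "S \<subseteq> U" "convex S" "compact S"
  shows "\<exists>K\<ge>0. \<forall>u\<in>S. \<forall>w\<in>S.
    norm (h w - h u - frechet_derivative h (at u) (w - u)) \<le> K * norm (w - u) ^ 2"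
proof -
  have h2: "Ck_on (Suc 1) U h" using h by (simp add: numeral_2_eq_2)
  have "\<exists>K\<ge>0. \<forall>u\<in>S. \<forall>w\<in>S. norm (frechet_derivative h (at w) (axis i 1) - frechet_derivative h (at u) (axis i 1))
      \<le> K * norm (w - u)" for i
    by (rule Ck_on_lipschitz[OF Ck_on_direction[OF h2] S])
  then obtain B where B0: "\<And>i. B i \<ge> 0" and B: "\<And>i u w. u \<in> S \<Longrightarrow> w \<in> S \<Longrightarrow>
      norm (frechet_derivative h (at w) (axis i 1) - frechet_derivative h (at u) (axis i 1)) \<le> B i * norm (w - u)"
    by metis
  let ?K = "\<Sum>i\<in>UNIV. B i"
  have K0: "?K \<ge> 0" by (simp add: sum_nonneg B0)
  have "norm (h w - h u - frechet_derivative h (at u) (w - u)) \<le> ?K * norm (w - u) ^ 2"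
    if u: "u \<in> S" and w: "w \<in> S" for u w
  proof -
    let ?D = "frechet_derivative h (at u)"
    have lin: "linear ?D" using Ck_on_linear[OF h2] u S by blast
    then have bl: "bounded_linear ?D" by (simp add: linear_conv_bounded_linear)
    have seg: "closed_segment u w \<subseteq> S" using u w S closed_segment_subset by blast
    have "norm ((h w - ?D w) - (h u - ?D u)) \<le> (?K * norm (w - u)) * norm (w - u)"
    proof (rule differentiable_bound[of "closed_segment u w" "\<lambda>x. h x - ?D x"
          "\<lambda>x v. frechet_derivative h (at x) v - ?D v"])
      fix x assume x: "x \<in> closed_segment u w"
      then have xS: "x \<in> S" "x \<in> U" using seg S by auto
      show "((\<lambda>x. h x - ?D x) has_derivative (\<lambda>v. frechet_derivative h (at x) v - ?D v))
            (at x within closed_segment u w)"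
        by (intro has_derivative_diff has_derivative_at_withinI[OF Ck_on_has_derivative[OF h2 xS(2)]]
              bounded_linear_imp_has_derivative[OF bl])
      have "norm (frechet_derivative h (at x) v - ?D v) \<le> (\<Sum>i\<in>UNIV. B i * norm (x - u)) * norm v" for v
        by (rule linear_axis_bound) (auto intro!: linear_compose_sub Ck_on_linear[OF h2 xS(2)] lin B xS u)
      also have "(\<Sum>i\<in>UNIV. B i * norm (x - u)) * norm v \<le> (?K * norm (w - u)) * norm v" for v
        using segment_bound[OF x] K0 by (auto simp: sum_distrib_right[symmetric] intro!: mult_right_mono mult_left_mono)
      finally show "onorm (\<lambda>v. frechet_derivative h (at x) v - ?D v) \<le> ?K * norm (w - u)"
        by (intro onorm_bound) (auto simp: K0)
    qed auto
    moreover have "(h w - ?D w) - (h u - ?D u) = h w - h u - ?D (w - u)"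
      by (simp add: linear_diff[OF lin])
    ultimately show ?thesis by (simp add: power2_eq_square mult.assoc)
  qed
  then show ?thesis using K0 by blast
qed

text \<open>The second difference \<open>\<Delta>\<close> does not change when a and b are swapped,
  and it is s^2 times the mixed second derivative up to O(s^3). Dividing by s^2 and letting s tend
  to 0 identifies the two orders of differentiation. Three derivatives provide the quadratic
  remainder of the first directional derivative, hence the rate O(s^3).\<close>

lemma Ck_on_second_symmetric:
  fixes h :: "real ^ 'd::finite \<Rightarrow> 'b::real_normed_vector"
  assumes h: "Ck_on 3 U h" and U: "open U" "u \<in> U"
  shows "frechet_derivative (\<lambda>x. frechet_derivative h (at x) a) (at u) b =
         frechet_derivative (\<lambda>x. frechet_derivative h (at x) b) (at u) a"
proof -
  define B where "B \<equiv> \<lambda>a b. frechet_derivative (\<lambda>x. frechet_derivative h (at x) a) (at u) b"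
  obtain e where e: "e > 0" "cball u e \<subseteq> U" using U open_contains_cball by blast
  have h3: "Ck_on (Suc 2) U h" using h by (simp add: numeral_3_eq_3 numeral_2_eq_2)
  define N where "N = norm a + norm b + 1"
  have N0: "N > 0" unfolding N_def by (simp add: add_nonneg_pos)
  define \<Delta> where "\<Delta> = (\<lambda>a b s. h (u + s *\<^sub>R a + s *\<^sub>R b) - h (u + s *\<^sub>R a) - h (u + s *\<^sub>R b) + h u)"
  have key: "\<exists>C. \<forall>s. 0 < s \<longrightarrow> s * N \<le> e \<longrightarrow> norm (\<Delta> a b s - s ^ 2 *\<^sub>R B b a) \<le> C * s ^ 3"
    if ab: "norm a + norm b \<le> N" for a b
  proof -
    let ?Db = "\<lambda>x. frechet_derivative h (at x) b"
    have c2: "Ck_on 2 U ?Db" by (rule Ck_on_direction[OF h3])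
    then have linB: "linear (B b)"
      unfolding B_def using Ck_on_linear[of 1 U ?Db u] U by (simp add: numeral_2_eq_2)
    obtain K where K: "K \<ge> 0" "\<And>v w. v \<in> cball u e \<Longrightarrow> w \<in> cball u e \<Longrightarrow>
        norm (?Db w - ?Db v - frechet_derivative ?Db (at v) (w - v)) \<le> K * norm (w - v) ^ 2"
      using Ck_on_taylor1[OF c2 e(2)] by auto
    have "norm (\<Delta> a b s - s ^ 2 *\<^sub>R B b a) \<le> (2 * K * N ^ 2) * s ^ 3" if s: "0 < s" "s * N \<le> e" for s
    proof -
      \<comment> \<open>The increment of this function from 0 to s is the second difference minus
        its expected value. Its derivative compares the derivative of h in direction b at two
        points, and both are expanded at the same base point u.\<close>
      let ?\<phi> = "\<lambda>t. h (u + s *\<^sub>R a + t *\<^sub>R b) - h (u + t *\<^sub>R b) - (t * s) *\<^sub>R B b a"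
      let ?\<phi>' = "\<lambda>t. ?Db (u + s *\<^sub>R a + t *\<^sub>R b) - ?Db (u + t *\<^sub>R b) - s *\<^sub>R B b a"
      have bd: "norm (s *\<^sub>R a + t *\<^sub>R b) \<le> s * N \<and> norm (t *\<^sub>R b) \<le> s * N" if "t \<in> {0..s}" for t
      proof -
        have "norm (s *\<^sub>R a + t *\<^sub>R b) \<le> s * norm a + t * norm b"
          using that s by (intro order_trans[OF norm_triangle_ineq]) auto
        also have "\<dots> \<le> s * norm a + s * norm b" using that by (intro add_mono mult_right_mono) auto
        also have "\<dots> \<le> s * N" using ab s by (simp add: distrib_left[symmetric])
        finally have 1: "norm (s *\<^sub>R a + t *\<^sub>R b) \<le> s * N" .
        have "norm (t *\<^sub>R b) \<le> s * norm b" using that by (auto intro!: mult_right_mono)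
        also have "\<dots> \<le> s * N" using ab s norm_ge_zero[of a] by (intro mult_left_mono) linarith+
        finally show ?thesis using 1 by simp
      qed
      have inb: "u + s *\<^sub>R a + t *\<^sub>R b \<in> cball u e \<and> u + t *\<^sub>R b \<in> cball u e" if "t \<in> {0..s}" for t
        using bd[OF that] s by (auto simp: dist_norm algebra_simps norm_minus_commute)
      have der: "(?\<phi> has_derivative (\<lambda>r. r *\<^sub>R ?\<phi>' t)) (at t within {0..s})" if t: "t \<in> {0..s}" for t
      proof -
        have hd: "((\<lambda>t. h (c + t *\<^sub>R b)) has_derivative (\<lambda>r. frechet_derivative h (at (c + t *\<^sub>R b)) (r *\<^sub>R b)))
             (at t within {0..s})" if "c + t *\<^sub>R b \<in> U" for c
          by (rule has_derivative_along_line[OF Ck_on_has_derivative[OF h3 that]])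
        have i1: "u + s *\<^sub>R a + t *\<^sub>R b \<in> U" "u + t *\<^sub>R b \<in> U" using inb[OF t] e by auto
        show ?thesis
          by (rule has_derivative_eq_rhs[OF has_derivative_diff[OF has_derivative_diff[OF hd[OF i1(1)] hd[OF i1(2)]]]])
             (auto intro!: derivative_eq_intros simp: scaleR_diff_right linear_scale[OF Ck_on_linear[OF h3 i1(1)]]
                linear_scale[OF Ck_on_linear[OF h3 i1(2)]])
      qed
      have "norm (?\<phi>' t) \<le> 2 * K * (s * N) ^ 2" if t: "t \<in> {0..s}" for t
      proof -
        let ?w = "u + s *\<^sub>R a + t *\<^sub>R b" and ?v = "u + t *\<^sub>R b"
        have uu: "u \<in> cball u e" using e by simp
        have 1: "norm (?Db ?w - ?Db u - B b (?w - u)) \<le> K * norm (?w - u) ^ 2"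
          using K(2)[OF uu] inb[OF t] unfolding B_def by blast
        have 2: "norm (?Db ?v - ?Db u - B b (?v - u)) \<le> K * norm (?v - u) ^ 2"
          using K(2)[OF uu] inb[OF t] unfolding B_def by blast
        have eq: "?\<phi>' t = (?Db ?w - ?Db u - B b (?w - u)) - (?Db ?v - ?Db u - B b (?v - u))"
        proof -
          have "B b (?w - u) - B b (?v - u) = B b (s *\<^sub>R a)"
            by (subst linear_diff[OF linB, symmetric]) simp
          also have "\<dots> = s *\<^sub>R B b a" by (rule linear_scale[OF linB])
          finally show ?thesis by (simp add: algebra_simps)
        qed
        have "norm (?w - u) \<le> s * N" "norm (?v - u) \<le> s * N" using bd[OF t] by (auto simp: algebra_simps)
        then have "K * norm (?w - u) ^ 2 \<le> K * (s * N) ^ 2" "K * norm (?v - u) ^ 2 \<le> K * (s * N) ^ 2"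
          using K by (auto intro!: mult_left_mono power_mono)
        then show ?thesis unfolding eq using 1 2 by (intro order_trans[OF norm_triangle_ineq4]) linarith
      qed
      then have "norm (?\<phi> s - ?\<phi> 0) \<le> (2 * K * (s * N) ^ 2) * norm (s - 0)"
        using s K by (intro differentiable_bound[OF _ der]) (auto intro!: onorm_bound mult_left_mono mult_right_mono simp: mult.commute)
      moreover have "?\<phi> s - ?\<phi> 0 = \<Delta> a b s - s ^ 2 *\<^sub>R B b a"
        unfolding \<Delta>_def by (simp add: algebra_simps power2_eq_square)
      ultimately show ?thesis using s by (simp add: power2_eq_square power3_eq_cube algebra_simps)
    qed
    then show ?thesis by blast
  qed
  obtain C1 where C1: "\<And>s. 0 < s \<Longrightarrow> s * N \<le> e \<Longrightarrow> norm (\<Delta> a b s - s ^ 2 *\<^sub>R B b a) \<le> C1 * s ^ 3"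
    using key[of a b] unfolding N_def by auto
  obtain C2 where C2: "\<And>s. 0 < s \<Longrightarrow> s * N \<le> e \<Longrightarrow> norm (\<Delta> b a s - s ^ 2 *\<^sub>R B a b) \<le> C2 * s ^ 3"
    using key[of b a] unfolding N_def by auto
  have "norm (B a b - B b a) \<le> (C1 + C2) * s" if s: "0 < s" "s < e / N" for s
  proof -
    have sN: "s * N \<le> e" using s N0 by (simp add: field_simps)
    have sym: "\<Delta> a b s = \<Delta> b a s" unfolding \<Delta>_def by (simp add: algebra_simps)
    have "s ^ 2 * norm (B a b - B b a) = norm ((\<Delta> a b s - s ^ 2 *\<^sub>R B b a) - (\<Delta> b a s - s ^ 2 *\<^sub>R B a b))"
      unfolding sym by (simp add: scaleR_diff_right[symmetric])
    also have "\<dots> \<le> C1 * s ^ 3 + C2 * s ^ 3"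
      using C1[OF s(1) sN] C2[OF s(1) sN] by (intro order_trans[OF norm_triangle_ineq4]) linarith
    also have "\<dots> = s ^ 2 * ((C1 + C2) * s)" by (simp add: power2_eq_square power3_eq_cube algebra_simps)
    finally show ?thesis using s by simp
  qed
  then have "eventually (\<lambda>s. norm (B a b - B b a) \<le> (C1 + C2) * s) (at_right 0)"
    using e N0 by (auto simp: eventually_at_right intro!: exI[of _ "e / N"])
  moreover have "((\<lambda>s. (C1 + C2) * s) \<longlongrightarrow> (C1 + C2) * 0) (at_right 0)"
    by (intro tendsto_intros)
  ultimately have "norm (B a b - B b a) \<le> (C1 + C2) * 0"
    by (intro tendsto_lowerbound[of "\<lambda>s. (C1 + C2) * s" _ "at_right 0"]) auto
  then show ?thesis unfolding B_def by simp
qed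

text \<open>Along the segment from u to w the remainder is a function of one variable; its
  derivative is a first order remainder of the directional derivatives, to which
  \<open>Ck_on_taylor1\<close> applies.\<close>

lemma Ck_on_taylor2:
  fixes h :: "real ^ 'd::finite \<Rightarrow> 'b::real_normed_vector"
  assumes h: "Ck_on 3 U h" and U: "open U" and S: "S \<subseteq> U" "convex S" "compact S"
  shows "\<exists>K\<ge>0. \<forall>u\<in>S. \<forall>w\<in>S.
    norm (h w - h u - frechet_derivative h (at u) (w - u) -
      (1/2) *\<^sub>R frechet_derivative (\<lambda>x. frechet_derivative h (at x) (w - u)) (at u) (w - u))
       \<le> K * norm (w - u) ^ 3"
proof -
  have h3: "Ck_on (Suc 2) U h" using h by (simp add: numeral_3_eq_3 numeral_2_eq_2)
  have "\<exists>K\<ge>0. \<forall>u\<in>S. \<forall>w\<in>S. norm (frechet_derivative h (at w) (axis i 1) - frechet_derivative h (at u) (axis i 1)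
         - frechet_derivative (\<lambda>x. frechet_derivative h (at x) (axis i 1)) (at u) (w - u))
      \<le> K * norm (w - u) ^ 2" for i
    by (rule Ck_on_taylor1[OF Ck_on_direction[OF h3] S])
  then obtain B where B0: "\<And>i. B i \<ge> 0" and B: "\<And>i u w. u \<in> S \<Longrightarrow> w \<in> S \<Longrightarrow>
      norm (frechet_derivative h (at w) (axis i 1) - frechet_derivative h (at u) (axis i 1)
       - frechet_derivative (\<lambda>x. frechet_derivative h (at x) (axis i 1)) (at u) (w - u)) \<le> B i * norm (w - u) ^ 2"
    by metis
  let ?K = "\<Sum>i\<in>UNIV. B i"
  have K0: "?K \<ge> 0" by (simp add: sum_nonneg B0)
  have "norm (h w - h u - frechet_derivative h (at u) (w - u) -
      (1/2) *\<^sub>R frechet_derivative (\<lambda>x. frechet_derivative h (at x) (w - u)) (at u) (w - u))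
       \<le> ?K * norm (w - u) ^ 3"
    if u: "u \<in> S" and w: "w \<in> S" for u w
  proof -
    let ?D = "frechet_derivative h (at u)"
    define H where "H = (\<lambda>a. frechet_derivative (\<lambda>x. frechet_derivative h (at x) a) (at u))"
    define d where "d = w - u"
    have uU: "u \<in> U" using u S by auto
    have linH: "linear (H a)" for a unfolding H_def
      using Ck_on_linear[of 1 U "\<lambda>x. frechet_derivative h (at x) a" u] Ck_on_direction[OF h3, of a] uU
      by (simp add: numeral_2_eq_2)
    have symH: "H a b = H b a" for a b unfolding H_def by (rule Ck_on_second_symmetric[OF h U uU])
    \<comment> \<open>Linearity in the direction that is differentiated first is read off, by
      symmetry, from linearity in the second direction. It is needed to expand the remainder
      \<open>?L\<close> below along the axes.\<close>
    have linH2: "linear (\<lambda>a. H a b)" for b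
    proof -
      have "(\<lambda>a. H a b) = H b" by (rule ext) (rule symH)
      then show ?thesis using linH[of b] by simp
    qed
    have linD: "linear ?D" using Ck_on_linear[OF h3 uU] .
    have seg: "u + t *\<^sub>R d \<in> S" if "t \<in> {0..1}" for t
    proof -
      have "u + t *\<^sub>R d = (1 - t) *\<^sub>R u + t *\<^sub>R w" unfolding d_def by (simp add: algebra_simps)
      then show ?thesis using S(2) u w that by (simp add: convexD)
    qed
    let ?\<phi> = "\<lambda>t. h (u + t *\<^sub>R d) - t *\<^sub>R ?D d - (t ^ 2 / 2) *\<^sub>R H d d"
    let ?\<phi>' = "\<lambda>t. frechet_derivative h (at (u + t *\<^sub>R d)) d - ?D d - t *\<^sub>R H d d"
    have der: "(?\<phi> has_derivative (\<lambda>r. r *\<^sub>R ?\<phi>' t)) (at t within {0..1})" if t: "t \<in> {0..1}" for t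
    proof -
      have i: "u + t *\<^sub>R d \<in> U" using seg[OF t] S by auto
      have hd: "((\<lambda>t. h (u + t *\<^sub>R d)) has_derivative (\<lambda>r. frechet_derivative h (at (u + t *\<^sub>R d)) (r *\<^sub>R d)))
             (at t within {0..1})"
        by (rule has_derivative_along_line[OF Ck_on_has_derivative[OF h3 i]])
      show ?thesis
        by (rule has_derivative_eq_rhs[OF has_derivative_diff[OF has_derivative_diff[OF hd]]])
           (auto intro!: derivative_eq_intros simp: algebra_simps linear_scale[OF Ck_on_linear[OF h3 i]])
    qed
    have "norm (?\<phi>' t) \<le> ?K * norm d ^ 3" if t: "t \<in> {0..1}" for t
    proof -
      let ?x = "u + t *\<^sub>R d"
      have xU: "?x \<in> U" using seg[OF t] S by auto
      let ?L = "\<lambda>v. frechet_derivative h (at ?x) v - ?D v - H v (?x - u)"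
      have "linear ?L" by (intro linear_compose_sub Ck_on_linear[OF h3 xU] linD linH2)
      moreover have "norm (?L (axis i 1)) \<le> B i * norm (?x - u) ^ 2" for i
        unfolding H_def using B[OF u seg[OF t]] .
      ultimately have "norm (?L d) \<le> (\<Sum>i\<in>UNIV. B i * norm (?x - u) ^ 2) * norm d"
        by (rule linear_axis_bound)
      also have "\<dots> = ?K * (norm (?x - u) ^ 2 * norm d)" by (simp add: sum_distrib_right[symmetric])
      also have "\<dots> \<le> ?K * (norm d ^ 2 * norm d)"
        using t by (intro mult_left_mono mult_right_mono power_mono K0) (auto intro: mult_left_le_one_le)
      finally show ?thesis by (simp add: linear_scale[OF linH] power2_eq_square power3_eq_cube)
    qed
    then have "norm (?\<phi> 1 - ?\<phi> 0) \<le> (?K * norm d ^ 3) * norm (1 - 0::real)"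
      by (intro differentiable_bound[OF _ der]) (auto intro!: onorm_bound mult_left_mono mult_right_mono simp: mult.commute K0)
    then show ?thesis unfolding H_def d_def by (simp add: algebra_simps)
  qed
  then show ?thesis using K0 by blast
qed

section \<open>The Laplacian of an embedded metric in coordinates\<close>

text \<open>The range of A has dimension d, so it is isometric to Euclidean d-space; composing A
  with such an isometry gives a square matrix with the same inner products. Gram matrices thereby
  factor as the transpose of B times B and get a positive determinant.\<close>

lemma ex_isometric_matrix:
  fixes A :: "real ^ 'd::finite \<Rightarrow> real ^ 'p::finite"
  assumes A: "linear A" "inj A"
  shows "\<exists>B :: real ^ 'd ^ 'd. (\<forall>x y. (B *v x) \<bullet> (B *v y) = A x \<bullet> A y) \<and> det B \<noteq> 0"
proof -
  have sub: "subspace (range A)" using A by (simp add: linear_subspace_image)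
  have "dim (range A) = DIM(real ^ 'd)"
    using dim_image_eq[of A UNIV] A by (simp add: dim_UNIV)
  then have "dim (range A) = dim (UNIV :: (real ^ 'd) set)" by (simp add: dim_UNIV)
  then obtain f :: "real ^ 'p \<Rightarrow> real ^ 'd" where f: "linear f" "\<And>x. x \<in> range A \<Longrightarrow> norm (f x) = norm x"
    using isometries_subspaces[OF sub subspace_UNIV] by metis
  define B where "B = matrix (f \<circ> A)"
  have lin: "linear (f \<circ> A)" using A(1) f(1) by (rule linear_compose)
  have Bv: "B *v x = f (A x)" for x
    unfolding B_def using matrix_works[of "f \<circ> A" x] lin by (simp add: linear_matrix_vector_mul_eq)
  have n: "norm (B *v x) = norm (A x)" for x unfolding Bv using f(2) by blast
  have "(B *v x) \<bullet> (B *v y) = A x \<bullet> A y" for x y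
  proof -
    have 1: "norm (B *v x + B *v y) = norm (A x + A y)"
      using n[of "x + y"] by (simp add: matrix_vector_right_distrib linear_add[OF A(1)])
    show ?thesis
      using 1 n[of x] n[of y] by (simp add: dot_norm)
  qed
  moreover have "inj ((*v) B)"
  proof (subst linear_injective_0, simp, safe)
    fix x assume "B *v x = 0"
    then have "A x = 0" using n[of x] by simp
    then show "x = 0" using A linear_injective_0 by blast
  qed
  then have "det B \<noteq> 0" using det_nz_iff_inj[of "(*v) B"] by (simp add: matrix_of_matrix_vector_mul)
  ultimately show ?thesis by blast
qed

section \<open>Derivatives of determinants and of inverse matrices\<close>

lemma matrix_mul_entry: "(A ** B) $ i $ j = (\<Sum>k\<in>UNIV. A $ i $ k * B $ k $ j)"
  by (simp add: matrix_matrix_mult_def)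

lemma matrix_inv_props:
  fixes G :: "real ^ 'd::finite ^ 'd"
  assumes "det G \<noteq> 0"
  shows "G ** matrix_inv G = mat 1" "matrix_inv G ** G = mat 1"
proof -
  have "invertible G" using assms by (simp add: invertible_det_nz)
  then show "G ** matrix_inv G = mat 1" "matrix_inv G ** G = mat 1"
    unfolding matrix_inv_def invertible_def by - (drule someI_ex, blast)+
qed

text \<open>In the Leibniz formula at the identity matrix only the identity permutation has a first
  order term: any other permutation moves at least two points, so after one factor is differentiated
  another vanishing factor remains.\<close>

lemma has_real_derivative_det_at_mat_1:
  fixes B :: "real \<Rightarrow> real ^ 'd::finite ^ 'd"
  assumes B: "\<And>i j. ((\<lambda>t. B t $ i $ j) has_real_derivative B' $ i $ j) (at s)" and B0: "B s = mat 1"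
  shows "((\<lambda>t. det (B t)) has_real_derivative trace B') (at s)"
proof -
  have der: "((\<lambda>t. \<Prod>i\<in>UNIV. B t $ i $ p i) has_real_derivative
      (\<Sum>i\<in>UNIV. B' $ i $ p i * (\<Prod>j\<in>UNIV - {i}. B s $ j $ p j))) (at s)" for p
    by (rule has_field_derivative_prod[OF B])
  have val: "(\<Sum>i\<in>UNIV. B' $ i $ p i * (\<Prod>j\<in>UNIV - {i}. B s $ j $ p j)) = (if p = id then trace B' else 0)"
    if p: "p permutes UNIV" for p
  proof (cases "p = id")
    case True
    then show ?thesis by (simp add: B0 mat_def trace_def)
  next
    case False
    have "(\<Prod>j\<in>UNIV - {i}. B s $ j $ p j) = 0" for i
    proof -
      obtain j where j: "p j \<noteq> j" using False by (auto simp: fun_eq_iff)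
      have "\<exists>j. j \<noteq> i \<and> p j \<noteq> j"
      proof (cases "j = i")
        case True
        have "p (p j) \<noteq> p j" using j permutes_inj[OF p] by (auto dest: injD)
        then show ?thesis using True j by metis
      qed (use j in auto)
      then obtain k where "k \<noteq> i" "p k \<noteq> k" by blast
      then show ?thesis by (intro prod_zero) (auto simp: B0 mat_def intro!: bexI[of _ k])
    qed
    then show ?thesis using False by (simp del: prod_zero_iff)
  qed
  have fin: "finite {p. p permutes (UNIV :: 'd set)}" by (simp add: finite_permutations)
  have "((\<lambda>t. \<Sum>p\<in>{p. p permutes (UNIV :: 'd set)}. of_int (sign p) * (\<Prod>i\<in>UNIV. B t $ i $ p i)) has_real_derivative
     (\<Sum>p\<in>{p. p permutes (UNIV :: 'd set)}. of_int (sign p) * (if p = id then trace B' else 0))) (at s)"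
  proof (intro DERIV_sum DERIV_cmult)
    fix p assume "p \<in> {p. p permutes (UNIV :: 'd set)}"
    then show "((\<lambda>t. \<Prod>i\<in>UNIV. B t $ i $ p i) has_real_derivative (if p = id then trace B' else 0)) (at s)"
      using der[of p] val[of p] by (simp only: mem_Collect_eq)
  qed
  moreover have "(\<Sum>p\<in>{p. p permutes (UNIV :: 'd set)}. of_int (sign p) * (if p = id then trace B' else 0)) =
     (\<Sum>p\<in>{p. p permutes (UNIV :: 'd set)}. (if p = id then trace B' else 0))"
    by (intro sum.cong) (auto simp: sign_id)
  also have "\<dots> = trace B'" using fin by (simp add: permutes_id)
  ultimately show ?thesis unfolding det_def by simp
qed

text \<open>Jacobi's formula, reduced to the previous lemma by multiplying with the fixed matrix
  inverse at s.\<close>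

lemma has_real_derivative_det:
  fixes G :: "real \<Rightarrow> real ^ 'd::finite ^ 'd"
  assumes G: "\<And>i j. ((\<lambda>t. G t $ i $ j) has_real_derivative G' $ i $ j) (at s)" and G0: "det (G s) \<noteq> 0"
  shows "((\<lambda>t. det (G t)) has_real_derivative det (G s) * trace (matrix_inv (G s) ** G')) (at s)"
proof -
  let ?B = "\<lambda>t. matrix_inv (G s) ** G t"
  have "((\<lambda>t. det (?B t)) has_real_derivative trace (matrix_inv (G s) ** G')) (at s)"
    by (rule has_real_derivative_det_at_mat_1)
       (auto simp: matrix_mul_entry matrix_inv_props[OF G0] intro!: DERIV_sum DERIV_cmult G)
  then have "((\<lambda>t. det (G s) * det (?B t)) has_real_derivative det (G s) * trace (matrix_inv (G s) ** G')) (at s)"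
    by (rule DERIV_cmult)
  moreover have "det (G s) * det (?B t) = det (G t)" for t
    by (simp add: det_mul[symmetric] matrix_mul_assoc matrix_inv_props[OF G0])
  ultimately show ?thesis by simp
qed

lemma differentiable_det:
  fixes A :: "'a::real_normed_vector \<Rightarrow> real ^ 'd::finite ^ 'd"
  assumes "\<And>i j. (\<lambda>v. A v $ i $ j) differentiable (at u)"
  shows "(\<lambda>v. det (A v)) differentiable (at u)"
proof -
  have "(\<lambda>v. \<Prod>i\<in>I. A v $ i $ p i) differentiable (at u)" if "finite I" for I p
    using that by (induction I) (auto intro: assms differentiable_mult)
  then show ?thesis unfolding det_def
    by (intro differentiable_sum differentiable_mult ballI) (auto simp: finite_permutations)
qed

text \<open>Cramer's rule. It writes the entries of the inverse as quotients of polynomials, from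
  which differentiability here and continuity later are obtained.\<close>

lemma matrix_inv_entry:
  fixes A :: "real ^ 'd::finite ^ 'd"
  assumes "det A \<noteq> 0"
  shows "matrix_inv A $ i $ j =
    det (\<chi> k l. if l = i then axis j 1 $ k else A $ k $ l) / det A"
proof -
  have "A *v (matrix_inv A *v axis j 1) = axis j 1"
    by (simp add: matrix_vector_mul_assoc matrix_inv_props[OF assms])
  then have "matrix_inv A *v axis j 1 =
      (\<chi> k. det (\<chi> i l. if l = k then axis j 1 $ i else A $ i $ l) / det A)"
    using cramer[OF assms, of "matrix_inv A *v axis j 1" "axis j 1"] by simp
  moreover have "matrix_inv A $ i $ j = (matrix_inv A *v axis j 1) $ i"
    by (simp add: matrix_vector_mult_basis column_def)
  ultimately show ?thesis by simp
qed

lemma differentiable_eventually_cong: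
  assumes "f differentiable (at u)" "open U" "u \<in> U" "\<And>v. v \<in> U \<Longrightarrow> f v = h v"
  shows "h differentiable (at u)"
  using assms has_derivative_transform_within_open unfolding differentiable_def by blast

lemma differentiable_matrix_inv:
  fixes A :: "'a::real_normed_vector \<Rightarrow> real ^ 'd::finite ^ 'd"
  assumes "\<And>i j. (\<lambda>v. A v $ i $ j) differentiable (at u)"
    and U: "open U" "u \<in> U" "\<And>v. v \<in> U \<Longrightarrow> det (A v) \<noteq> 0"
  shows "(\<lambda>v. matrix_inv (A v) $ i $ j) differentiable (at u)"
proof -
  have "(\<lambda>v. (\<chi> k l. if l = i then axis j (1::real) $ k else A v $ k $ l) $ k $ l) differentiable (at u)" for k l
    by (cases "l = i") (auto simp: assms)
  then have "(\<lambda>v. det (\<chi> k l. if l = i then axis j 1 $ k else A v $ k $ l) / det (A v)) differentiable (at u)"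
    using U assms by (intro differentiable_divide differentiable_det) blast+
  then show ?thesis
    by (rule differentiable_eventually_cong[OF _ U(1,2)]) (simp add: matrix_inv_entry[OF U(3)])
qed

lemma partial_deriv_has_real_derivative:
  assumes "h differentiable (at u)"
  shows "((\<lambda>t. h (u + t *\<^sub>R axis i 1)) has_real_derivative partial_deriv i h u) (at 0)"
proof -
  have hd: "(h has_derivative frechet_derivative h (at u)) (at (u + 0 *\<^sub>R axis i 1))"
    using assms by (simp add: frechet_derivative_works)
  then have lin: "linear (frechet_derivative h (at u))" using has_derivative_linear by blast
  have "((\<lambda>t. h (u + t *\<^sub>R axis i 1)) has_derivative (\<lambda>t. frechet_derivative h (at u) (t *\<^sub>R axis i 1))) (at 0)"
    by (rule has_derivative_along_line[OF hd])
  moreover have "(\<lambda>t. frechet_derivative h (at u) (t *\<^sub>R axis i 1)) = (*) (partial_deriv i h u)"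
    by (auto simp: partial_deriv_def linear_scale[OF lin])
  ultimately show ?thesis by (simp add: has_field_derivative_def)
qed

text \<open>Separates existence from computation: once total differentiability is known, the value
  may be found along the coordinate line with the rules for one variable.\<close>

lemma partial_deriv_eqI:
  assumes "h differentiable (at u)" "((\<lambda>t. h (u + t *\<^sub>R axis i 1)) has_real_derivative D) (at 0)"
  shows "partial_deriv i h u = D"
  using DERIV_unique[OF partial_deriv_has_real_derivative[OF assms(1)] assms(2)] .

text \<open>Cramer's rule shows that the derivative exists; differentiating the product of
  \<open>G t\<close> with its inverse, which is constant, then gives its value.\<close>

lemma has_real_derivative_matrix_inv:
  fixes G :: "real \<Rightarrow> real ^ 'd::finite ^ 'd"
  assumes G: "\<And>i j. ((\<lambda>t. G t $ i $ j) has_real_derivative G' $ i $ j) (at s)"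
    and U: "open U" "s \<in> U" "\<And>t. t \<in> U \<Longrightarrow> det (G t) \<noteq> 0"
  shows "((\<lambda>t. matrix_inv (G t) $ i $ j) has_real_derivative
     - (matrix_inv (G s) ** G' ** matrix_inv (G s)) $ i $ j) (at s)"
proof -
  have "(\<lambda>t. matrix_inv (G t) $ i $ j) differentiable (at s)" for i j
    using G U by (intro differentiable_matrix_inv[of G s U])
      (auto simp: real_differentiable_def)
  then obtain R where R: "\<And>i j. ((\<lambda>t. matrix_inv (G t) $ i $ j) has_real_derivative R i j) (at s)"
    unfolding real_differentiable_def by metis
  define R' where "R' = (\<chi> i j. R i j)"
  have "(\<Sum>k\<in>UNIV. G' $ i $ k * matrix_inv (G s) $ k $ j + G s $ i $ k * R k j) = 0" for i j
  proof -
    have "((\<lambda>t. \<Sum>k\<in>UNIV. G t $ i $ k * matrix_inv (G t) $ k $ j) has_real_derivative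
        (\<Sum>k\<in>UNIV. G' $ i $ k * matrix_inv (G s) $ k $ j + R k j * G s $ i $ k)) (at s)"
      by (intro DERIV_sum DERIV_mult G R)
    moreover have "((\<lambda>t. \<Sum>k\<in>UNIV. G t $ i $ k * matrix_inv (G t) $ k $ j) has_real_derivative 0) (at s)"
      by (rule has_field_derivative_transform_within_open[OF _ U(1,2), of "\<lambda>_. (mat 1 :: real ^ 'd ^ 'd) $ i $ j"])
         (auto simp: matrix_mul_entry[symmetric] matrix_inv_props[OF U(3)])
    ultimately show ?thesis by (metis (no_types, lifting) DERIV_unique mult.commute sum.cong)
  qed
  then have "G' ** matrix_inv (G s) + G s ** R' = 0"
    by (simp add: vec_eq_iff matrix_mul_entry R'_def sum.distrib)
  then have "matrix_inv (G s) ** (G' ** matrix_inv (G s)) + matrix_inv (G s) ** (G s ** R') = 0"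
    by (metis matrix_add_ldistrib times0_right)
  then have "R' = - (matrix_inv (G s) ** G' ** matrix_inv (G s))"
    using matrix_inv_props[OF U(3)[OF U(2)]]
    by (simp add: matrix_mul_assoc add_eq_0_iff2 add_eq_0_iff)
  then show ?thesis using R[of i j] by (metis (no_types, lifting) R'_def vec_lambda_beta vector_uminus_component)
qed

text \<open>The derivative of D is assumed in the form delivered by Jacobi's formula, with \<tau> a
  trace. The common factor \<open>sqrt (D s)\<close> then comes out and cancels the prefactor in
  \<open>laplace_coord\<close>.\<close>

lemma has_real_derivative_ln_weighted_product:
  fixes D I F :: "real \<Rightarrow> real"
  assumes "(D has_real_derivative D s * \<tau>) (at s)" "D s > 0"
    "(I has_real_derivative I') (at s)" "(F has_real_derivative F') (at s)"
  shows "((\<lambda>t. sqrt (D t) * I t * F t) has_real_derivative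
    sqrt (D s) * (\<tau> / 2 * I s * F s + I' * F s + I s * F')) (at s)"
proof -
  have "((\<lambda>t. sqrt (D t)) has_real_derivative inverse (sqrt (D s)) / 2 * (D s * \<tau>)) (at s)"
    by (rule DERIV_chain2[OF DERIV_real_sqrt[OF assms(2)] assms(1)])
  moreover have "inverse (sqrt (D s)) / 2 * (D s * \<tau>) = sqrt (D s) * (\<tau> / 2)"
  proof -
    have "inverse (sqrt (D s)) * D s = sqrt (D s)"
      using real_div_sqrt[of "D s"] assms(2) by (simp add: divide_inverse mult.commute)
    then show ?thesis by (simp add: mult.assoc[symmetric])
  qed
  ultimately have "((\<lambda>t. sqrt (D t)) has_real_derivative sqrt (D s) * (\<tau> / 2)) (at s)"
    by (rule DERIV_cong)
  from DERIV_mult[OF DERIV_mult[OF this assms(3)] assms(4)]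
  show ?thesis by (rule DERIV_cong) (simp add: algebra_simps)
qed

text \<open>\<Gamma> stands for the Christoffel symbols of the first kind. The term from
  differentiating the volume density and one half of the term from differentiating the inverse
  metric both equal the sum of \<open>c i * ?T i\<close> and cancel; the other half is the
  Christoffel term of the Laplacian.\<close>

lemma laplace_christoffel_identity:
  fixes Gi :: "real ^ 'd::finite ^ 'd" and \<Gamma> :: "'d \<Rightarrow> 'd \<Rightarrow> 'd \<Rightarrow> real" and F :: "'d \<Rightarrow> real"
  assumes sym: "\<And>i j. Gi $ i $ j = Gi $ j $ i" and sym\<Gamma>: "\<And>i k l. \<Gamma> i k l = \<Gamma> k i l"
  defines "c \<equiv> \<lambda>l. \<Sum>j\<in>UNIV. Gi $ l $ j * F j"
  shows "(\<Sum>i\<in>UNIV. \<Sum>j\<in>UNIV. (\<Sum>k\<in>UNIV. \<Sum>l\<in>UNIV. Gi $ k $ l * (\<Gamma> i l k + \<Gamma> i k l)) / 2 * Gi $ i $ j * F j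
      - (\<Sum>l\<in>UNIV. (\<Sum>k\<in>UNIV. Gi $ i $ k * (\<Gamma> i k l + \<Gamma> i l k)) * Gi $ l $ j) * F j)
    = - (\<Sum>i\<in>UNIV. \<Sum>j\<in>UNIV. Gi $ i $ j * (\<Sum>l\<in>UNIV. c l * \<Gamma> i j l))"
proof -
  let ?T = "\<lambda>i. \<Sum>k\<in>UNIV. \<Sum>l\<in>UNIV. Gi $ k $ l * \<Gamma> i k l"
  have half: "(\<Sum>k\<in>UNIV. \<Sum>l\<in>UNIV. Gi $ k $ l * (\<Gamma> i l k + \<Gamma> i k l)) / 2 = ?T i" for i
  proof -
    have "(\<Sum>k\<in>UNIV. \<Sum>l\<in>UNIV. Gi $ k $ l * \<Gamma> i l k) = ?T i"
      by (subst sum.swap) (simp add: sym[of _ _])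
    then show ?thesis by (simp add: distrib_left sum.distrib)
  qed
  have A: "(\<Sum>i\<in>UNIV. \<Sum>j\<in>UNIV. ?T i * Gi $ i $ j * F j) = (\<Sum>i\<in>UNIV. c i * ?T i)"
  proof -
    have "(\<Sum>j\<in>UNIV. t * Gi $ i $ j * F j) = c i * t" for i t
      by (simp add: c_def sum_distrib_left mult_ac)
    then show ?thesis by simp
  qed
  have B: "(\<Sum>i\<in>UNIV. \<Sum>j\<in>UNIV. (\<Sum>l\<in>UNIV. (\<Sum>k\<in>UNIV. Gi $ i $ k * X i k l) * Gi $ l $ j) * F j)
     = (\<Sum>i\<in>UNIV. \<Sum>k\<in>UNIV. \<Sum>l\<in>UNIV. Gi $ i $ k * X i k l * c l)" for X
  proof -
    have "(\<Sum>j\<in>UNIV. (\<Sum>l\<in>UNIV. (\<Sum>k\<in>UNIV. Gi $ i $ k * X i k l) * Gi $ l $ j) * F j)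
       = (\<Sum>l\<in>UNIV. (\<Sum>k\<in>UNIV. Gi $ i $ k * X i k l) * c l)" for i
      unfolding c_def sum_distrib_left sum_distrib_right
      by (subst sum.swap) (simp add: mult_ac)
    also have "\<dots> i = (\<Sum>k\<in>UNIV. \<Sum>l\<in>UNIV. Gi $ i $ k * X i k l * c l)" for i
      unfolding sum_distrib_right by (rule sum.swap)
    finally show ?thesis by simp
  qed
  have C: "(\<Sum>i\<in>UNIV. \<Sum>k\<in>UNIV. \<Sum>l\<in>UNIV. Gi $ i $ k * \<Gamma> i l k * c l) = (\<Sum>i\<in>UNIV. c i * ?T i)"
  proof -
    have "(\<Sum>i\<in>UNIV. \<Sum>k\<in>UNIV. \<Sum>l\<in>UNIV. Gi $ i $ k * \<Gamma> i l k * c l)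
       = (\<Sum>i\<in>UNIV. \<Sum>l\<in>UNIV. \<Sum>k\<in>UNIV. Gi $ i $ k * \<Gamma> i l k * c l)"
      by (intro sum.cong refl sum.swap)
    also have "\<dots> = (\<Sum>l\<in>UNIV. \<Sum>i\<in>UNIV. \<Sum>k\<in>UNIV. Gi $ i $ k * \<Gamma> i l k * c l)"
      by (rule sum.swap)
    also have "\<dots> = (\<Sum>l\<in>UNIV. c l * ?T l)"
      by (simp add: sum_distrib_left mult_ac sym\<Gamma>[of _ "_"])
    finally show ?thesis .
  qed
  show ?thesis
    unfolding half sum_subtractf A B
    unfolding distrib_left distrib_right sum.distrib C
    by (simp add: sum_distrib_left mult_ac)
qed

text \<open>Here a is the gradient of F as an ambient vector. The matrix contracted with the inverse
  metric is the second derivative at u of F - a . \<Psi> with a frozen, which is the quadratic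
  Taylor coefficient of the remainder that LLE averages. This is how the Laplacian gets into the
  limit.\<close>

lemma laplace_coord_embedded:
  fixes \<Psi> :: "real ^ 'd::finite \<Rightarrow> real ^ 'p::finite" and F :: "real ^ 'd \<Rightarrow> real"
  assumes U: "open U" "u \<in> U" and \<Psi>: "Ck_on 3 U \<Psi>" and F: "Ck_on 2 U F"
    and inj: "\<And>v. v \<in> U \<Longrightarrow> inj (frechet_derivative \<Psi> (at v))"
    and G: "\<And>v i j. v \<in> U \<Longrightarrow> G v $ i $ j =
      frechet_derivative \<Psi> (at v) (axis i 1) \<bullet> frechet_derivative \<Psi> (at v) (axis j 1)"
  defines "a \<equiv> \<Sum>l\<in>UNIV. \<Sum>j\<in>UNIV. (matrix_inv (G u) $ l $ j * frechet_derivative F (at u) (axis j 1)) *\<^sub>R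
      frechet_derivative \<Psi> (at u) (axis l 1)"
  shows "laplace_coord G F u = (\<Sum>i\<in>UNIV. \<Sum>j\<in>UNIV. matrix_inv (G u) $ i $ j *
     (frechet_derivative (\<lambda>x. frechet_derivative F (at x) (axis j 1)) (at u) (axis i 1)
      - a \<bullet> frechet_derivative (\<lambda>x. frechet_derivative \<Psi> (at x) (axis j 1)) (at u) (axis i 1)))"
proof -
  define \<psi> where "\<psi> = (\<lambda>i v. frechet_derivative \<Psi> (at v) (axis i 1))"
  define \<psi>2 where "\<psi>2 = (\<lambda>i k. frechet_derivative (\<psi> k) (at u) (axis i 1))"
  define \<phi> where "\<phi> = (\<lambda>i v. frechet_derivative F (at v) (axis i 1))"
  have \<Psi>3: "Ck_on (Suc 2) U \<Psi>" using \<Psi> by (simp add: numeral_3_eq_3 numeral_2_eq_2)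
  have c1: "Ck_on (Suc 1) U (\<psi> i)" for i
    using Ck_on_direction[OF \<Psi>3, of "axis i 1"] unfolding \<psi>_def by (simp add: numeral_2_eq_2)
  have dF: "\<phi> i differentiable (at u)" for i
    using F U unfolding \<phi>_def by (simp add: numeral_2_eq_2)
  have sym\<psi>: "\<psi>2 i k = \<psi>2 k i" for i k
    unfolding \<psi>2_def \<psi>_def by (rule Ck_on_second_symmetric[OF \<Psi> U])
  have Ge: "G v $ i $ j = \<psi> i v \<bullet> \<psi> j v" if "v \<in> U" for v i j using G[OF that] unfolding \<psi>_def .
  have detpos: "det (G v) > 0" if v: "v \<in> U" for v
  proof -
    obtain B :: "real ^ 'd ^ 'd" where B: "\<And>x y. (B *v x) \<bullet> (B *v y) =
        frechet_derivative \<Psi> (at v) x \<bullet> frechet_derivative \<Psi> (at v) y" "det B \<noteq> 0"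
      using ex_isometric_matrix[OF Ck_on_linear[OF \<Psi>3 v] inj[OF v]] by blast
    have "G v = transpose B ** B"
      unfolding vec_eq_iff
    proof (intro allI)
      fix i j
      have "G v $ i $ j = (B *v axis i 1) \<bullet> (B *v axis j 1)" unfolding B by (rule G[OF v])
      then show "G v $ i $ j = (transpose B ** B) $ i $ j"
        by (simp add: matrix_vector_mult_basis column_def inner_vec_def matrix_mul_entry transpose_def)
    qed
    then have "det (G v) = det B ^ 2" by (simp add: det_mul det_transpose power2_eq_square)
    then show ?thesis using B(2) by simp
  qed
  have dG: "(\<lambda>v. G v $ i $ j) differentiable (at u)" for i j
    by (rule differentiable_eventually_cong[OF _ U, of "\<lambda>v. \<psi> i v \<bullet> \<psi> j v"])
       (use c1 U in \<open>auto simp: Ge intro: differentiable_inner\<close>)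
  \<comment> \<open>The Gram matrix is differentiated through the embedding, so its derivatives are
    sums of the symbols \<Gamma> introduced below.\<close>
  define G' where "G' = (\<lambda>i. \<chi> k l. \<psi>2 i k \<bullet> \<psi> l u + \<psi> k u \<bullet> \<psi>2 i l)"
  have pG: "partial_deriv i (\<lambda>v. G v $ k $ l) u = G' i $ k $ l" for i k l
  proof -
    have "((\<lambda>v. \<psi> k v \<bullet> \<psi> l v) has_derivative (\<lambda>h. \<psi> k u \<bullet> frechet_derivative (\<psi> l) (at u) h
         + frechet_derivative (\<psi> k) (at u) h \<bullet> \<psi> l u)) (at u)"
      by (intro has_derivative_inner Ck_on_has_derivative[OF c1 U(2)])
    then have "((\<lambda>v. G v $ k $ l) has_derivative (\<lambda>h. \<psi> k u \<bullet> frechet_derivative (\<psi> l) (at u) h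
         + frechet_derivative (\<psi> k) (at u) h \<bullet> \<psi> l u)) (at u)"
      by (rule has_derivative_transform_within_open[OF _ U]) (simp add: Ge)
    from frechet_derivative_at[OF this, THEN fun_cong, of "axis i 1"] show ?thesis
      unfolding partial_deriv_def G'_def \<psi>2_def by simp
  qed
  define Gi where "Gi = matrix_inv (G u)"
  obtain e where e: "e > 0" "ball u e \<subseteq> U" using U open_contains_ball by blast
  have line: "u + t *\<^sub>R axis i 1 \<in> U" if "t \<in> ball 0 e" for t i
    using that e by (auto simp: dist_norm subset_iff)
  have main: "partial_deriv i (\<lambda>v. sqrt (det (G v)) * matrix_inv (G v) $ i $ j * partial_deriv j F v) u =
     sqrt (det (G u)) * (trace (Gi ** G' i) / 2 * Gi $ i $ j * \<phi> j u - (Gi ** G' i ** Gi) $ i $ j * \<phi> j u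
        + Gi $ i $ j * frechet_derivative (\<phi> j) (at u) (axis i 1))" for i j
  proof (rule partial_deriv_eqI)
    have "(\<lambda>v. sqrt (det (G v))) differentiable (at u)"
    proof -
      have "sqrt differentiable (at (det (G u)))"
        using DERIV_real_sqrt[OF detpos[OF U(2)]] real_differentiable_def by blast
      then show ?thesis
        using differentiable_chain_at[OF differentiable_det[OF dG]] by (simp add: o_def)
    qed
    moreover have "(\<lambda>v. matrix_inv (G v) $ i $ j) differentiable (at u)"
      by (rule differentiable_matrix_inv[OF dG U]) (use detpos in fastforce)
    ultimately show "(\<lambda>v. sqrt (det (G v)) * matrix_inv (G v) $ i $ j * partial_deriv j F v) differentiable (at u)"
      using dF[of j] unfolding \<phi>_def partial_deriv_def by (intro differentiable_mult)
    have Gt: "((\<lambda>t. G (u + t *\<^sub>R axis i 1) $ k $ l) has_real_derivative G' i $ k $ l) (at 0)" for k l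
      using partial_deriv_has_real_derivative[OF dG] by (simp add: pG)
    have d1: "((\<lambda>t. det (G (u + t *\<^sub>R axis i 1))) has_real_derivative
        det (G (u + 0 *\<^sub>R axis i 1)) * trace (Gi ** G' i)) (at 0)"
      using has_real_derivative_det[OF Gt] detpos[OF U(2)] unfolding Gi_def by simp
    have d2: "((\<lambda>t. matrix_inv (G (u + t *\<^sub>R axis i 1)) $ i $ j) has_real_derivative
        - (Gi ** G' i ** Gi) $ i $ j) (at 0)"
    proof -
      have "det (G (u + t *\<^sub>R axis i 1)) \<noteq> 0" if "t \<in> ball 0 e" for t
        using detpos[OF line[OF that, of i]] by simp
      then show ?thesis
        using has_real_derivative_matrix_inv[OF Gt open_ball, of 0 e i j] e unfolding Gi_def by simp
    qed
    have d3: "((\<lambda>t. \<phi> j (u + t *\<^sub>R axis i 1)) has_real_derivative frechet_derivative (\<phi> j) (at u) (axis i 1)) (at 0)"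
      using partial_deriv_has_real_derivative[OF dF] unfolding partial_deriv_def .
    have "det (G (u + 0 *\<^sub>R axis i 1)) > 0" using detpos[OF U(2)] by simp
    from has_real_derivative_ln_weighted_product[OF d1 this d2 d3]
    show "((\<lambda>t. sqrt (det (G (u + t *\<^sub>R axis i 1))) * matrix_inv (G (u + t *\<^sub>R axis i 1)) $ i $ j *
       partial_deriv j F (u + t *\<^sub>R axis i 1)) has_real_derivative
       sqrt (det (G u)) * (trace (Gi ** G' i) / 2 * Gi $ i $ j * \<phi> j u - (Gi ** G' i ** Gi) $ i $ j * \<phi> j u
        + Gi $ i $ j * frechet_derivative (\<phi> j) (at u) (axis i 1))) (at 0)"
      unfolding partial_deriv_def \<phi>_def Gi_def by simp
  qed
  have symGi: "Gi $ i $ j = Gi $ j $ i" for i j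
  proof -
    have "transpose (G u) = G u" using Ge[OF U(2)] by (simp add: vec_eq_iff transpose_def inner_commute)
    then have "transpose Gi ** G u = mat 1"
      using matrix_inv_props(1)[of "G u"] detpos[OF U(2)] unfolding Gi_def
      by (metis less_irrefl matrix_transpose_mul transpose_mat)
    then have "transpose Gi ** (G u ** Gi) = Gi" by (simp add: matrix_mul_assoc)
    then have "transpose Gi = Gi"
      using matrix_inv_props(1)[of "G u"] detpos[OF U(2)] unfolding Gi_def by simp
    then show ?thesis by (metis transpose_def vec_lambda_beta)
  qed
  define \<Gamma> where "\<Gamma> = (\<lambda>i k l. \<psi>2 i k \<bullet> \<psi> l u)"
  have tr: "trace (Gi ** G' i) = (\<Sum>k\<in>UNIV. \<Sum>l\<in>UNIV. Gi $ k $ l * (\<Gamma> i l k + \<Gamma> i k l))" for i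
    by (simp add: trace_def matrix_mul_entry G'_def \<Gamma>_def inner_commute)
  have inn: "(Gi ** G' i ** Gi) $ i $ j = (\<Sum>l\<in>UNIV. (\<Sum>k\<in>UNIV. Gi $ i $ k * (\<Gamma> i k l + \<Gamma> i l k)) * Gi $ l $ j)" for i j
    by (simp add: matrix_mul_entry G'_def \<Gamma>_def inner_commute)
 have a\<psi>: "(\<Sum>l\<in>UNIV. (\<Sum>j\<in>UNIV. Gi $ l $ j * \<phi> j u) * \<Gamma> i j l) = a \<bullet> \<psi>2 i j" for i j
    unfolding a_def \<Gamma>_def Gi_def \<phi>_def \<psi>_def
    by (simp add: inner_sum_left sum_distrib_right inner_commute[of _ "\<psi>2 i j"] inner_sum_right)
  have sq: "sqrt (det (G u)) > 0" using detpos[OF U(2)] by simp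
  have "laplace_coord G F u = (\<Sum>i\<in>UNIV. \<Sum>j\<in>UNIV.
     (trace (Gi ** G' i) / 2 * Gi $ i $ j * \<phi> j u - (Gi ** G' i ** Gi) $ i $ j * \<phi> j u)
        + Gi $ i $ j * frechet_derivative (\<phi> j) (at u) (axis i 1))"
    unfolding laplace_coord_def main sum_distrib_left using sq by (intro sum.cong refl) simp
  also have "\<dots> = (\<Sum>i\<in>UNIV. \<Sum>j\<in>UNIV. trace (Gi ** G' i) / 2 * Gi $ i $ j * \<phi> j u - (Gi ** G' i ** Gi) $ i $ j * \<phi> j u)
     + (\<Sum>i\<in>UNIV. \<Sum>j\<in>UNIV. Gi $ i $ j * frechet_derivative (\<phi> j) (at u) (axis i 1))"
    by (simp add: sum.distrib)
  also have "(\<Sum>i\<in>UNIV. \<Sum>j\<in>UNIV. trace (Gi ** G' i) / 2 * Gi $ i $ j * \<phi> j u - (Gi ** G' i ** Gi) $ i $ j * \<phi> j u)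
    = - (\<Sum>i\<in>UNIV. \<Sum>j\<in>UNIV. Gi $ i $ j * (\<Sum>l\<in>UNIV. (\<Sum>j\<in>UNIV. Gi $ l $ j * \<phi> j u) * \<Gamma> i j l))"
    unfolding tr inn by (rule laplace_christoffel_identity[OF symGi]) (simp add: \<Gamma>_def sym\<psi>)
  finally show ?thesis
    unfolding a\<psi> unfolding Gi_def \<phi>_def \<psi>2_def \<psi>_def by (simp add: right_diff_distrib sum_subtractf)
qed

section \<open>The LLE average of a point configuration\<close>

text \<open>Pairing the equation for the difference of two solutions with the difference itself
  gives |g|^2 + c |\<delta>|^2 = 0. Since \<open>lle_weight\<close> uses a solution picked by
  \<open>SOME\<close>, this is what allows it to be replaced by an explicit one.\<close>

lemma lle_solution_unique:
  assumes S: "finite S" and c: "c > 0" and y: "lle_solution S x c y" "lle_solution S x c y'" and z: "z \<in> S"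
  shows "y z = y' z"
proof -
  define \<delta> where "\<delta> = (\<lambda>z. y z - y' z)"
  define g where "g = (\<Sum>z\<in>S. \<delta> z *\<^sub>R (z - x))"
  have eq: "(z - x) \<bullet> g + c * \<delta> z = 0" if "z \<in> S" for z
  proof -
    have "(z - x) \<bullet> g = (\<Sum>z'\<in>S. ((z - x) \<bullet> (z' - x)) * y z') - (\<Sum>z'\<in>S. ((z - x) \<bullet> (z' - x)) * y' z')"
      unfolding g_def \<delta>_def inner_sum_right sum_subtractf[symmetric]
      by (intro sum.cong refl) (simp add: left_diff_distrib mult.commute)
    moreover have "(\<Sum>z'\<in>S. ((z - x) \<bullet> (z' - x)) * y z') + c * y z = 1"
      "(\<Sum>z'\<in>S. ((z - x) \<bullet> (z' - x)) * y' z') + c * y' z = 1"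
      using y that unfolding lle_solution_def by blast+
    ultimately show ?thesis by (simp add: \<delta>_def right_diff_distrib)
  qed
  have "(\<Sum>z\<in>S. \<delta> z * ((z - x) \<bullet> g + c * \<delta> z)) = g \<bullet> g + c * (\<Sum>z\<in>S. (\<delta> z)\<^sup>2)"
    unfolding g_def
    by (simp add: inner_sum_left distrib_left sum.distrib sum_distrib_left power2_eq_square mult_ac)
  then have "g \<bullet> g + c * (\<Sum>z\<in>S. (\<delta> z)\<^sup>2) = 0" using eq by simp
  then have "(\<Sum>z\<in>S. (\<delta> z)\<^sup>2) = 0"
    using c by (smt (verit) inner_ge_zero mult_pos_pos sum_nonneg zero_le_power2)
  then have "(\<delta> z)\<^sup>2 = 0" using S z by (simp add: sum_nonneg_eq_0_iff)
  then show ?thesis by (simp add: \<delta>_def)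
qed

text \<open>Since the matrix inversion happens in the ambient space, \<open>v\<close> is a vector of fixed dimension.\<close>

lemma lle_average_push_through:
  fixes x :: "real ^ 'p::finite"
  assumes c: "c > 0" and S: "S = lle_neighbours \<X> r x" "finite S"
    and v: "(\<Sum>z\<in>S. ((z - x) \<bullet> v) *\<^sub>R (z - x)) + c *\<^sub>R v = (\<Sum>z\<in>S. z - x)"
    and nz: "(\<Sum>z\<in>S. 1 - (z - x) \<bullet> v) \<noteq> 0"
  shows "lle_average \<X> r c f x - f x =
    (\<Sum>z\<in>S. (1 - (z - x) \<bullet> v) * (f z - f x)) / (\<Sum>z\<in>S. 1 - (z - x) \<bullet> v)"
proof -
  \<comment> \<open>In matrix terms y is (1 - G^T v) / c. The equation for v says that G (1 - G^T v)
    = c v, so G^T G y = G^T v, and adding c y = 1 - G^T v gives the all-ones vector.\<close>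
  define y where "y = (\<lambda>z. (1 - (z - x) \<bullet> v) / c)"
  have "lle_solution S x c y"
    unfolding lle_solution_def
  proof
    fix z assume "z \<in> S"
    have pull: "(1 - t) * (p \<bullet> w) = p \<bullet> (w - t *\<^sub>R w)" for t and p w :: "real ^ 'p"
      by (simp add: inner_diff_right left_diff_distrib)
    have "(\<Sum>z'\<in>S. ((z - x) \<bullet> (z' - x)) * y z') =
        (z - x) \<bullet> ((\<Sum>z\<in>S. z - x) - (\<Sum>z\<in>S. ((z - x) \<bullet> v) *\<^sub>R (z - x))) / c"
      unfolding y_def inner_diff_right[of "z - x" "\<Sum>z\<in>S. z - x"] inner_sum_right sum_subtractf[symmetric] sum_divide_distrib inner_scaleR_right
      by (intro sum.cong refl) (simp add: pull mult.commute)
    also have "\<dots> = (z - x) \<bullet> v"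
      using c by (simp add: v[symmetric])
    finally show "(\<Sum>z'\<in>S. ((z - x) \<bullet> (z' - x)) * y z') + c * y z = 1"
      using c by (simp add: y_def)
  qed
  then have sol: "lle_solution S x c (SOME y. lle_solution S x c y)" by (rule someI[of "lle_solution S x c"])
  have w: "lle_weight S x c z = y z / (\<Sum>z\<in>S. y z)" if "z \<in> S" for z
    unfolding lle_weight_def Let_def
    using lle_solution_unique[OF S(2) c sol \<open>lle_solution S x c y\<close>] that by (simp cong: sum.cong)
  have sy: "(\<Sum>z\<in>S. y z) = (\<Sum>z\<in>S. 1 - (z - x) \<bullet> v) / c"
    by (simp add: y_def sum_divide_distrib)
  then have sy0: "(\<Sum>z\<in>S. y z) \<noteq> 0" using nz c by simp
  have pull: "s / c * a - b * (s / c) = s * (a - b) / c" for s a b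
    by (simp add: right_diff_distrib diff_divide_distrib mult.commute)
  have "lle_average \<X> r c f x = (\<Sum>z\<in>S. y z * f z) / (\<Sum>z\<in>S. y z)"
    unfolding lle_average_def Let_def S(1)[symmetric] using w by (simp add: sum_divide_distrib)
  also have "\<dots> - f x = ((\<Sum>z\<in>S. y z * f z) - f x * (\<Sum>z\<in>S. y z)) / (\<Sum>z\<in>S. y z)"
    using sy0 by (simp add: diff_divide_distrib)
  also have "(\<Sum>z\<in>S. y z * f z) - f x * (\<Sum>z\<in>S. y z) = (\<Sum>z\<in>S. (1 - (z - x) \<bullet> v) * (f z - f x)) / c"
    unfolding y_def sum_divide_distrib sum_distrib_left sum_subtractf[symmetric]
    by (intro sum.cong refl) (rule pull)
  finally show ?thesis unfolding sy using c by simp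
qed

text \<open>The operator is c times the identity plus a positive semidefinite part, hence injective,
  hence onto in finite dimension.\<close>

lemma ex_regularized_solution:
  fixes x :: "real ^ 'p::finite"
  assumes c: "c > 0"
  shows "\<exists>v. (\<Sum>z\<in>S. ((z - x) \<bullet> v) *\<^sub>R (z - x)) + c *\<^sub>R v = b"
proof -
  let ?\<Phi> = "\<lambda>v. (\<Sum>z\<in>S. ((z - x) \<bullet> v) *\<^sub>R (z - x)) + c *\<^sub>R v"
  have lin: "linear ?\<Phi>"
    by (auto simp: linear_iff inner_add_right scaleR_add_left scaleR_add_right sum.distrib scaleR_sum_right)
  have "v = 0" if "?\<Phi> v = 0" for v
  proof -
    have "?\<Phi> v \<bullet> v = (\<Sum>z\<in>S. ((z - x) \<bullet> v)\<^sup>2) + c * (v \<bullet> v)"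
      by (simp add: inner_add_left inner_sum_left power2_eq_square)
    then have "(\<Sum>z\<in>S. ((z - x) \<bullet> v)\<^sup>2) + c * (v \<bullet> v) = 0" using that by simp
    moreover have "(\<Sum>z\<in>S. ((z - x) \<bullet> v)\<^sup>2) \<ge> 0" by (simp add: sum_nonneg)
    ultimately have "c * (v \<bullet> v) \<le> 0" by linarith
    then have "v \<bullet> v \<le> 0" using c by (simp add: mult_le_0_iff)
    then show "v = 0" using inner_ge_zero[of v] inner_eq_zero_iff[of v] by linarith
  qed
  then have "inj ?\<Phi>" using linear_injective_0[OF lin] by blast
  then have "surj ?\<Phi>" by (rule linear_inj_imp_surj[OF lin])
  then obtain v where "b = ?\<Phi> v" by (rule surjE)
  then show ?thesis by (intro exI[of _ v]) (rule sym)
qed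

text \<open>In the application m is n r^d, so m r^3 is the regularization constant. The equation is
  tested twice. Tested with v it bounds r |v2|, but |v1| only by a multiple of r^(-1/2), since the
  right side still contains |v2|. Tested with v1, with the bound on v2 inserted in the mixed term,
  it bounds |v1| by a constant.\<close>

lemma regularized_solution_bounds:
  fixes x :: "real ^ 'p::finite"
  assumes \<kappa>: "\<kappa> \<ge> 1" and r: "0 < r" "r \<le> 1 / (4 * \<kappa> ^ 3)" and m: "m > 0"
    and N: "real (card S) \<le> 2 * \<kappa> * m"
    and near: "\<And>z. z \<in> S \<Longrightarrow> norm (z - x) \<le> r"
    and normal: "\<And>z v. z \<in> S \<Longrightarrow> (\<And>t. t \<in> T \<Longrightarrow> t \<bullet> v = 0) \<Longrightarrow> \<bar>(z - x) \<bullet> v\<bar> \<le> \<kappa> * r\<^sup>2 * norm v"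
    and first: "norm (\<Sum>z\<in>S. z - x) \<le> \<kappa> * m * r\<^sup>2"
    and second: "\<And>t. t \<in> T \<Longrightarrow> (\<Sum>z\<in>S. ((z - x) \<bullet> t)\<^sup>2) \<ge> m * r\<^sup>2 * (norm t)\<^sup>2 / \<kappa>"
    and v: "(\<Sum>z\<in>S. ((z - x) \<bullet> v) *\<^sub>R (z - x)) + (m * r ^ 3) *\<^sub>R v = (\<Sum>z\<in>S. z - x)"
    and v12: "v = v1 + v2" "v1 \<in> T" "\<And>t. t \<in> T \<Longrightarrow> t \<bullet> v2 = 0"
  shows "norm v1 \<le> 7 * \<kappa> ^ 5" "r * norm v2 \<le> 3 * \<kappa>\<^sup>2"
proof -
  define E where "E = (\<Sum>z\<in>S. z - x)"
  have k23: "\<kappa> \<le> \<kappa>\<^sup>2" "\<kappa>\<^sup>2 \<le> \<kappa> ^ 3" "1 \<le> \<kappa> ^ 3" using \<kappa> power_increasing[of 1 2 \<kappa>] power_increasing[of 2 3 \<kappa>] by auto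
  have r1: "r \<le> 1" using r k23(3) by (smt (verit) divide_le_eq_1)
  have "0 < 4 * \<kappa> ^ 3" using k23(3) by linarith
  then have rk: "4 * \<kappa> ^ 3 * r \<le> 1" using r(2) by (simp only: pos_le_divide_eq mult.commute)
  have orth: "v1 \<bullet> v2 = 0" using v12 by blast
  have n2: "\<bar>(z - x) \<bullet> v2\<bar> \<le> \<kappa> * r\<^sup>2 * norm v2" if "z \<in> S" for z using normal that v12(3) by blast
  have n1: "\<bar>(z - x) \<bullet> v1\<bar> \<le> r * norm v1" if "z \<in> S" for z
    using Cauchy_Schwarz_ineq2[of "z - x" v1] near[OF that] by (meson mult_right_mono norm_ge_zero order_trans)
  have dot: "(\<Sum>z\<in>S. ((z - x) \<bullet> v) * ((z - x) \<bullet> w)) + m * r ^ 3 * (v \<bullet> w) = E \<bullet> w" for w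
    unfolding E_def v[symmetric] by (simp add: inner_add_left inner_sum_left)
  \<comment> \<open>Neighbours are within \<kappa> r^2 of x in normal directions, so the sum is at
    most 2 \<kappa>^3 m r^4 |v2|^2. The smallness of r makes this half of the regularization term,
    which can therefore absorb it.\<close>
  have bound2: "(\<Sum>z\<in>S. ((z - x) \<bullet> v2)\<^sup>2) \<le> m * r ^ 3 * (norm v2)\<^sup>2 / 2"
  proof -
    have "(\<Sum>z\<in>S. ((z - x) \<bullet> v2)\<^sup>2) \<le> (\<Sum>z\<in>S. (\<kappa> * r\<^sup>2 * norm v2)\<^sup>2)"
      using n2 by (intro sum_mono abs_le_square_iff[THEN iffD1]) (meson abs_ge_self order_trans)
    also have "\<dots> = real (card S) * (\<kappa> * r\<^sup>2 * norm v2)\<^sup>2" by simp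
    also have "\<dots> \<le> (2 * \<kappa> * m) * (\<kappa> * r\<^sup>2 * norm v2)\<^sup>2" by (intro mult_right_mono N) auto
    also have "\<dots> = (4 * \<kappa> ^ 3 * r) * (m * r ^ 3 * (norm v2)\<^sup>2 / 2)"
      by (simp add: power2_eq_square power3_eq_cube)
    also have "\<dots> \<le> 1 * (m * r ^ 3 * (norm v2)\<^sup>2 / 2)" by (intro mult_right_mono rk) (use m r in auto)
    finally show ?thesis by simp
  qed
  have half: "(\<Sum>z\<in>S. ((z - x) \<bullet> v)\<^sup>2) \<ge> (\<Sum>z\<in>S. ((z - x) \<bullet> v1)\<^sup>2) / 2 - (\<Sum>z\<in>S. ((z - x) \<bullet> v2)\<^sup>2)"
  proof -
    have "((z - x) \<bullet> v1)\<^sup>2 / 2 - ((z - x) \<bullet> v2)\<^sup>2 \<le> ((z - x) \<bullet> v)\<^sup>2" for z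
    proof -
      have sq: "a\<^sup>2 / 2 - b\<^sup>2 \<le> (a + b)\<^sup>2" for a b :: real
      proof -
        have "0 \<le> (a + 2 * b)\<^sup>2 / 2" by simp
        also have "\<dots> = (a + b)\<^sup>2 - (a\<^sup>2 / 2 - b\<^sup>2)" by (simp add: power2_eq_square field_simps)
        finally show ?thesis by simp
      qed
      show ?thesis unfolding v12(1) inner_add_right by (rule sq)
    qed
    then have "(\<Sum>z\<in>S. ((z - x) \<bullet> v1)\<^sup>2 / 2 - ((z - x) \<bullet> v2)\<^sup>2) \<le> (\<Sum>z\<in>S. ((z - x) \<bullet> v)\<^sup>2)"
      by (rule sum_mono)
    then show ?thesis by (simp add: sum_subtractf sum_divide_distrib)
  qed
  have vv: "v \<bullet> v = (norm v1)\<^sup>2 + (norm v2)\<^sup>2"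
    using orth by (simp add: v12(1) inner_add_left inner_add_right inner_commute power2_norm_eq_inner)
  have "E \<bullet> v \<le> \<kappa> * m * r\<^sup>2 * (norm v1 + norm v2)"
  proof -
    have "E \<bullet> v \<le> norm E * norm v" by (rule norm_cauchy_schwarz)
    also have "\<dots> \<le> (\<kappa> * m * r\<^sup>2) * (norm v1 + norm v2)"
      using first \<kappa> m by (intro mult_mono) (auto simp: E_def v12(1) norm_triangle_ineq)
    finally show ?thesis .
  qed
  note Ev = this
  have Ev2: "(\<Sum>z\<in>S. ((z - x) \<bullet> v)\<^sup>2) + m * r ^ 3 * (v \<bullet> v) = E \<bullet> v"
    using dot[of v] by (simp add: power2_eq_square)
  have Ev3: "m * r ^ 3 * (v \<bullet> v) \<ge> m * r ^ 3 * (norm v2)\<^sup>2"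
    unfolding vv using m r by (intro mult_left_mono) auto
  have "m * r\<^sup>2 * (norm v1)\<^sup>2 / \<kappa> / 2 + m * r ^ 3 * (norm v2)\<^sup>2 / 2 \<le> \<kappa> * m * r\<^sup>2 * (norm v1 + norm v2)"
  proof -
    have lin: "A / 2 + C / 2 \<le> R" if "e \<le> R" "W + Y = e" "C \<le> Y" "B / 2 - Q \<le> W" "Q \<le> C / 2" "A \<le> B"
      for A B C Q R W Y e :: real using that by linarith
    show ?thesis by (rule lin[OF Ev Ev2 Ev3 half bound2 second[OF v12(2)]])
  qed
  then have "(m * r\<^sup>2) * ((norm v1)\<^sup>2 / \<kappa> / 2 + r * (norm v2)\<^sup>2 / 2) \<le> (m * r\<^sup>2) * (\<kappa> * (norm v1 + norm v2))"
    by (simp add: algebra_simps power2_eq_square power3_eq_cube)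
  moreover have "0 < m * r\<^sup>2" using m r by simp
  ultimately have main: "(norm v1)\<^sup>2 / \<kappa> / 2 + r * (norm v2)\<^sup>2 / 2 \<le> \<kappa> * (norm v1 + norm v2)"
    by (simp only: mult_le_cancel_left_pos)
  \<comment> \<open>Weighted Young inequality: its quadratic term is the one on the left of
    \<open>main\<close>, so |v1| disappears and a quadratic inequality for s = r |v2|
    remains.\<close>
  have "\<kappa> * norm v1 \<le> (norm v1)\<^sup>2 / \<kappa> / 2 + \<kappa> ^ 3 / 2"
  proof -
    have "0 \<le> (norm v1 - \<kappa>\<^sup>2)\<^sup>2 / \<kappa>" using \<kappa> by simp
    also have "\<dots> = (norm v1)\<^sup>2 / \<kappa> + \<kappa> ^ 3 - 2 * \<kappa> * norm v1"
      using \<kappa> by (simp add: power2_eq_square power3_eq_cube field_simps)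
    finally show ?thesis by simp
  qed
  then have "r * (norm v2)\<^sup>2 / 2 \<le> \<kappa> ^ 3 / 2 + \<kappa> * norm v2" using main by (simp add: algebra_simps)
  then have "r * (r * (norm v2)\<^sup>2 / 2) \<le> r * (\<kappa> ^ 3 / 2 + \<kappa> * norm v2)" using r by (intro mult_left_mono) auto
  then have s1: "(r * norm v2)\<^sup>2 / 2 \<le> r * \<kappa> ^ 3 / 2 + \<kappa> * (r * norm v2)"
    by (simp add: power2_eq_square algebra_simps)
  define s where "s = r * norm v2"
  have s0: "s \<ge> 0" using r by (simp add: s_def)
  have "r * \<kappa> ^ 3 \<le> 1"
  proof -
    have "0 \<le> \<kappa> ^ 3 * r" using \<kappa> r by simp
    moreover have "4 * (\<kappa> ^ 3 * r) \<le> 1" using rk by (simp only: mult.assoc)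
    ultimately have "\<kappa> ^ 3 * r \<le> 1" by linarith
    then show ?thesis by (simp only: mult.commute[of r])
  qed
  then have s2: "s\<^sup>2 \<le> 1 + 2 * \<kappa> * s" using s1 by (simp add: s_def)
  show s3: "r * norm v2 \<le> 3 * \<kappa>\<^sup>2"
  proof (rule ccontr)
    assume "\<not> ?thesis"
    then have "s > 3 * \<kappa>" using k23 by (simp add: s_def)
    then have "s > 0" using \<kappa> by linarith
    then have "s * s > 3 * \<kappa> * s" using \<open>s > 3 * \<kappa>\<close> by (intro mult_strict_right_mono)
    moreover have "1 * 1 \<le> \<kappa> * s" using \<open>s > 3 * \<kappa>\<close> \<kappa> by (intro mult_mono) auto
    ultimately show False using s2 by (simp add: power2_eq_square)
  qed
  \<comment> \<open>The constant 6 \<kappa>^4 collects 2 \<kappa> from the number of neighbours,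
    \<kappa> from the normal deviation and 3 \<kappa>^2 from the bound on r |v2|.\<close>
  have cross: "\<bar>\<Sum>z\<in>S. ((z - x) \<bullet> v2) * ((z - x) \<bullet> v1)\<bar> \<le> 6 * \<kappa> ^ 4 * m * r\<^sup>2 * norm v1"
  proof -
    have "\<bar>\<Sum>z\<in>S. ((z - x) \<bullet> v2) * ((z - x) \<bullet> v1)\<bar> \<le> (\<Sum>z\<in>S. (\<kappa> * r\<^sup>2 * norm v2) * (r * norm v1))"
      unfolding sum_distrib_left
      by (rule order_trans[OF sum_abs], rule sum_mono, unfold abs_mult, rule mult_mono) (use n1 n2 r \<kappa> in auto)
    also have "\<dots> = real (card S) * ((\<kappa> * r\<^sup>2 * norm v1) * (r * norm v2))" by simp
    also have "\<dots> \<le> (2 * \<kappa> * m) * ((\<kappa> * r\<^sup>2 * norm v1) * (3 * \<kappa>\<^sup>2))"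
      by (rule mult_mono[OF N mult_left_mono[OF s3]]) (use r \<kappa> m in auto)
    finally show ?thesis by (simp add: power2_eq_square power4_eq_xxxx mult_ac)
  qed
  have "(\<Sum>z\<in>S. ((z - x) \<bullet> v1)\<^sup>2) + (\<Sum>z\<in>S. ((z - x) \<bullet> v2) * ((z - x) \<bullet> v1)) + m * r ^ 3 * (norm v1)\<^sup>2 = E \<bullet> v1"
    using dot[of v1] orth
    by (simp add: v12(1) inner_add_left inner_add_right distrib_right sum.distrib power2_eq_square inner_commute flip: power2_norm_eq_inner)
  moreover have "E \<bullet> v1 \<le> \<kappa> * m * r\<^sup>2 * norm v1"
    using norm_cauchy_schwarz[of E v1] mult_right_mono[OF first norm_ge_zero[of v1]] by (simp add: E_def)
  moreover have "m * r ^ 3 * (norm v1)\<^sup>2 \<ge> 0" using m r by simp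
  ultimately have "m * r\<^sup>2 * (norm v1)\<^sup>2 / \<kappa> \<le> 6 * \<kappa> ^ 4 * m * r\<^sup>2 * norm v1 + \<kappa> * m * r\<^sup>2 * norm v1"
    using second[OF v12(2)] cross by linarith
  then have "(m * r\<^sup>2) * ((norm v1)\<^sup>2 / \<kappa>) \<le> (m * r\<^sup>2) * ((6 * \<kappa> ^ 4 + \<kappa>) * norm v1)"
    by (simp add: algebra_simps)
  moreover have "0 < m * r\<^sup>2" using m r by simp
  ultimately have "(norm v1)\<^sup>2 / \<kappa> \<le> (6 * \<kappa> ^ 4 + \<kappa>) * norm v1" by (simp only: mult_le_cancel_left_pos)
  then have "norm v1 * norm v1 \<le> (\<kappa> * (6 * \<kappa> ^ 4 + \<kappa>)) * norm v1"
    using \<kappa> by (simp add: power2_eq_square field_simps)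
  then have "norm v1 = 0 \<or> norm v1 \<le> \<kappa> * (6 * \<kappa> ^ 4 + \<kappa>)" by (auto simp: mult_le_cancel_right)
  moreover have "\<kappa> \<le> \<kappa> ^ 4" using power_increasing[of 1 4 \<kappa>] \<kappa> by simp
  then have "\<kappa> * (6 * \<kappa> ^ 4 + \<kappa>) \<le> \<kappa> * (7 * \<kappa> ^ 4)" using \<kappa> by (intro mult_left_mono) auto
  moreover have "\<kappa> * (7 * \<kappa> ^ 4) = 7 * \<kappa> ^ 5" by (simp add: eval_nat_numeral)
  ultimately show "norm v1 \<le> 7 * \<kappa> ^ 5" using \<kappa> by auto
qed

text \<open>The deterministic core: all randomness and geometry enter through the assumed moments.
  By the push-through formula the average is Num / Den. The error of Num is 28 \<kappa>^7 m r^3,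
  namely 7 from the gradient, 20 from the weights on the Taylor remainder and 1 from
  \<open>quad\<close>; that of Den, multiplied by L r^2, adds 11. Division by Den, at least m / (2
  \<kappa>), doubles the sum 39 and adds one power of \<kappa>.\<close>

lemma lle_average_laplacian_bound:
  fixes x :: "real ^ 'p::finite"
  assumes \<kappa>: "\<kappa> \<ge> 1" and r: "0 < r" "22 * \<kappa> ^ 7 * r \<le> 1" and m: "m > 0"
    and S: "S = lle_neighbours \<X> r x" "finite S"
    and T: "subspace T" "a \<in> T" "norm a \<le> \<kappa>" and L: "\<bar>L\<bar> \<le> \<kappa>" and \<alpha>: "1 / \<kappa> \<le> \<alpha>" "\<alpha> \<le> \<kappa>"
    and normal: "\<And>z v. z \<in> S \<Longrightarrow> (\<And>t. t \<in> T \<Longrightarrow> t \<bullet> v = 0) \<Longrightarrow> \<bar>(z - x) \<bullet> v\<bar> \<le> \<kappa> * r\<^sup>2 * norm v"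
    and taylor: "\<And>z. z \<in> S \<Longrightarrow> \<bar>f z - f x - a \<bullet> (z - x)\<bar> \<le> \<kappa> * r\<^sup>2"
    and zeroth: "\<bar>real (card S) - m * \<alpha>\<bar> \<le> \<kappa> * m * r"
    and first: "norm (\<Sum>z\<in>S. z - x) \<le> \<kappa> * m * r\<^sup>2"
    and second: "\<And>t. t \<in> T \<Longrightarrow> (\<Sum>z\<in>S. ((z - x) \<bullet> t)\<^sup>2) \<ge> m * r\<^sup>2 * (norm t)\<^sup>2 / \<kappa>"
    and quad: "\<bar>(\<Sum>z\<in>S. f z - f x - a \<bullet> (z - x)) - m * \<alpha> * L * r\<^sup>2\<bar> \<le> \<kappa> * m * r ^ 3"
  shows "\<bar>1 / r\<^sup>2 * (lle_average \<X> r (m * r ^ 3) f x - f x) - L\<bar> \<le> 78 * \<kappa> ^ 8 * r"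
proof -
  have pw: "\<kappa> ^ i \<le> \<kappa> ^ j" if "i \<le> j" for i j using \<kappa> that by (rule power_increasing[rotated])
  have k1: "1 \<le> \<kappa> ^ i" for i using \<kappa> by simp
  have kr: "\<kappa> ^ i * r \<le> \<kappa> ^ 7 * r" if "i \<le> 7" for i using pw[OF that] r by (intro mult_right_mono) auto
  have r1: "r \<le> 1"
  proof -
    have "r \<le> \<kappa> ^ 7 * r" using kr[of 0] by simp
    moreover have "22 * (\<kappa> ^ 7 * r) \<le> 1" using r(2) by (simp only: mult.assoc)
    ultimately show ?thesis using r(1) by linarith
  qed
  have r4: "r \<le> 1 / (4 * \<kappa> ^ 3)"
  proof -
    have "\<kappa> ^ 3 * r \<le> \<kappa> ^ 7 * r" using kr[of 3] by simp
    moreover have "22 * (\<kappa> ^ 7 * r) \<le> 1" using r(2) by (simp only: mult.assoc)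
    moreover have "0 \<le> \<kappa> ^ 3 * r" using \<kappa> r by simp
    ultimately have "4 * (\<kappa> ^ 3 * r) \<le> 1" by linarith
    then have "r * (4 * \<kappa> ^ 3) \<le> 1" by (simp add: mult_ac)
    then show ?thesis using \<kappa> by (simp add: pos_le_divide_eq)
  qed
  have near: "norm (z - x) \<le> r" if "z \<in> S" for z
    using that by (auto simp: S(1) lle_neighbours_def dist_norm norm_minus_commute)
  have N: "real (card S) \<le> 2 * \<kappa> * m"
  proof -
    have "m * \<alpha> \<le> \<kappa> * m" using \<alpha> m by (simp add: mult.commute)
    moreover have "\<kappa> * m * r \<le> \<kappa> * m" using r1 \<kappa> m by (simp add: mult_left_le)
    ultimately show ?thesis using zeroth by linarith
  qed
  define c where "c = m * r ^ 3"
  have c: "c > 0" using m r by (simp add: c_def)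
  define E where "E = (\<Sum>z\<in>S. z - x)"
  obtain v where v: "(\<Sum>z\<in>S. ((z - x) \<bullet> v) *\<^sub>R (z - x)) + c *\<^sub>R v = E"
    using ex_regularized_solution[OF c] unfolding E_def by blast
  obtain v1 v2 where v12: "v1 \<in> T" "\<And>t. t \<in> T \<Longrightarrow> t \<bullet> v2 = 0" "v = v1 + v2"
    using orthogonal_subspace_decomp_exists[of T v] T(1)
    by (metis orthogonal_def inner_commute span_eq_iff)
  have b: "norm v1 \<le> 7 * \<kappa> ^ 5" "r * norm v2 \<le> 3 * \<kappa>\<^sup>2"
    using regularized_solution_bounds[OF \<kappa> r(1) r4 m N near normal first second v[unfolded c_def E_def] v12(3,1,2)]
    by auto
  define q where "q = (\<lambda>z. f z - f x - a \<bullet> (z - x))"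
  define Num where "Num = (\<Sum>z\<in>S. (1 - (z - x) \<bullet> v) * (f z - f x))"
  define Den where "Den = (\<Sum>z\<in>S. 1 - (z - x) \<bullet> v)"
  \<comment> \<open>The normal part of z - x has a factor r^2 and v2 is O(1/r), the tangential part
    has a factor r and v1 is O(1): both contributions are O(r), so the weights are uniform to
    leading order.\<close>
  have pv: "\<bar>(z - x) \<bullet> v\<bar> \<le> 10 * \<kappa> ^ 5 * r" if z: "z \<in> S" for z
  proof -
    have "\<bar>(z - x) \<bullet> v1\<bar> \<le> norm (z - x) * norm v1" by (rule Cauchy_Schwarz_ineq2)
    also have "\<dots> \<le> r * (7 * \<kappa> ^ 5)" by (rule mult_mono[OF near[OF z] b(1)]) (use r in auto)
    finally have 1: "\<bar>(z - x) \<bullet> v1\<bar> \<le> r * (7 * \<kappa> ^ 5)" .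
    have "\<bar>(z - x) \<bullet> v2\<bar> \<le> \<kappa> * r\<^sup>2 * norm v2" using normal[OF z] v12(2) by blast
    also have "\<dots> = \<kappa> * r * (r * norm v2)" by (simp add: power2_eq_square)
    also have "\<dots> \<le> \<kappa> * r * (3 * \<kappa>\<^sup>2)" using b(2) \<kappa> r by (intro mult_left_mono) auto
    also have "\<dots> = 3 * \<kappa> ^ 3 * r" by (simp add: power2_eq_square power3_eq_cube)
    also have "\<dots> \<le> 3 * \<kappa> ^ 5 * r" using pw[of 3 5] r by (intro mult_right_mono) auto
    finally have "\<bar>(z - x) \<bullet> v2\<bar> \<le> 3 * (\<kappa> ^ 5 * r)" by simp
    moreover have "\<bar>(z - x) \<bullet> v1\<bar> \<le> 7 * (\<kappa> ^ 5 * r)" using 1 by (simp add: mult_ac)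
    ultimately have "\<bar>(z - x) \<bullet> v1 + (z - x) \<bullet> v2\<bar> \<le> 10 * (\<kappa> ^ 5 * r)" by linarith
    then show ?thesis by (simp add: v12(3) inner_add_right mult.assoc)
  qed
  have "Num = (\<Sum>z\<in>S. (1 - (z - x) \<bullet> v) * (a \<bullet> (z - x))) + (\<Sum>z\<in>S. q z) - (\<Sum>z\<in>S. ((z - x) \<bullet> v) * q z)"
    unfolding Num_def q_def sum.distrib[symmetric] sum_subtractf[symmetric]
    by (intro sum.cong refl) (simp add: algebra_simps)
  also have "(\<Sum>z\<in>S. (1 - (z - x) \<bullet> v) * (a \<bullet> (z - x))) = a \<bullet> (E - (\<Sum>z\<in>S. ((z - x) \<bullet> v) *\<^sub>R (z - x)))"
  proof -
    have pull: "(1 - t) * (a \<bullet> w) = a \<bullet> (w - t *\<^sub>R w)" for t w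
      by (simp add: left_diff_distrib inner_diff_right)
    show ?thesis
      unfolding E_def inner_diff_right[of a "\<Sum>z\<in>S. z - x"] inner_sum_right sum_subtractf[symmetric]
      by (intro sum.cong refl) (rule pull)
  qed
  also have "\<dots> = c * (a \<bullet> v1)" using v12(2)[OF T(2)] by (simp add: v[symmetric] v12(3) inner_add_right)
  finally have Num: "Num = c * (a \<bullet> v1) + (\<Sum>z\<in>S. q z) - (\<Sum>z\<in>S. ((z - x) \<bullet> v) * q z)" .
  have e1: "\<bar>c * (a \<bullet> v1)\<bar> \<le> 7 * \<kappa> ^ 7 * m * r ^ 3"
  proof -
    have "\<bar>a \<bullet> v1\<bar> \<le> norm a * norm v1" by (rule Cauchy_Schwarz_ineq2)
    also have "\<dots> \<le> \<kappa> * (7 * \<kappa> ^ 5)" by (rule mult_mono[OF T(3) b(1)]) (use \<kappa> in auto)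
    also have "\<dots> = 7 * \<kappa> ^ 6" by (simp add: eval_nat_numeral)
    also have "\<dots> \<le> 7 * \<kappa> ^ 7" using pw[of 6 7] by simp
    finally have "c * \<bar>a \<bullet> v1\<bar> \<le> c * (7 * \<kappa> ^ 7)" using c by (intro mult_left_mono) auto
    moreover have "\<bar>c * (a \<bullet> v1)\<bar> = c * \<bar>a \<bullet> v1\<bar>" using c by (simp add: abs_mult)
    ultimately show ?thesis by (simp add: c_def mult_ac)
  qed
  have e2: "\<bar>\<Sum>z\<in>S. ((z - x) \<bullet> v) * q z\<bar> \<le> 20 * \<kappa> ^ 7 * m * r ^ 3"
  proof -
    have "\<bar>\<Sum>z\<in>S. ((z - x) \<bullet> v) * q z\<bar> \<le> (\<Sum>z\<in>S. (10 * \<kappa> ^ 5 * r) * (\<kappa> * r\<^sup>2))"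
      using taylor pv \<kappa> r by (intro order_trans[OF sum_abs] sum_mono) (auto simp: abs_mult q_def intro!: mult_mono)
    also have "\<dots> = real (card S) * ((10 * \<kappa> ^ 5 * r) * (\<kappa> * r\<^sup>2))" by simp
    also have "\<dots> \<le> (2 * \<kappa> * m) * ((10 * \<kappa> ^ 5 * r) * (\<kappa> * r\<^sup>2))" using N \<kappa> r by (intro mult_right_mono) auto
    finally show ?thesis by (simp add: eval_nat_numeral mult_ac)
  qed
  have NumE: "\<bar>Num - m * \<alpha> * L * r\<^sup>2\<bar> \<le> 28 * \<kappa> ^ 7 * m * r ^ 3"
  proof -
    have "\<kappa> * (m * r ^ 3) \<le> \<kappa> ^ 7 * (m * r ^ 3)" using pw[of 1 7] m r by (intro mult_right_mono) auto
    moreover have "\<bar>(\<Sum>z\<in>S. q z) - m * \<alpha> * L * r\<^sup>2\<bar> \<le> \<kappa> * (m * r ^ 3)" using quad by (simp add: q_def mult.assoc)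
    moreover have "\<bar>c * (a \<bullet> v1)\<bar> \<le> 7 * (\<kappa> ^ 7 * (m * r ^ 3))"
      "\<bar>\<Sum>z\<in>S. ((z - x) \<bullet> v) * q z\<bar> \<le> 20 * (\<kappa> ^ 7 * (m * r ^ 3))"
      using e1 e2 by (simp_all only: mult.assoc)
    ultimately have "\<bar>Num - m * \<alpha> * L * r\<^sup>2\<bar> \<le> 28 * (\<kappa> ^ 7 * (m * r ^ 3))" unfolding Num by linarith
    then show ?thesis by (simp only: mult.assoc)
  qed
  have DenE: "\<bar>Den - m * \<alpha>\<bar> \<le> 11 * \<kappa> ^ 6 * m * r"
  proof -
    have D: "Den = real (card S) - E \<bullet> v"
      unfolding Den_def E_def sum_subtractf[of "\<lambda>_. 1"] inner_sum_left by simp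
    have nv: "r * norm v \<le> 10 * \<kappa> ^ 5"
    proof -
      have "r * norm v \<le> r * norm v1 + r * norm v2"
        using r norm_triangle_ineq[of v1 v2] by (simp add: v12(3) distrib_left[symmetric])
      also have "r * norm v1 \<le> 1 * (7 * \<kappa> ^ 5)" using r1 r b(1) by (intro mult_mono) auto
      finally show ?thesis using b(2) pw[of 2 5] by simp
    qed
    have "\<bar>E \<bullet> v\<bar> \<le> norm E * norm v" by (rule Cauchy_Schwarz_ineq2)
    also have "\<dots> \<le> (\<kappa> * m * r\<^sup>2) * norm v" using first by (intro mult_right_mono) (auto simp: E_def)
    also have "\<dots> = (\<kappa> * m * r) * (r * norm v)" by (simp add: power2_eq_square)
    also have "\<dots> \<le> (\<kappa> * m * r) * (10 * \<kappa> ^ 5)" using nv \<kappa> m r by (intro mult_left_mono) auto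
    also have "\<dots> = 10 * (\<kappa> ^ 6 * (m * r))" by (simp add: eval_nat_numeral)
    finally have "\<bar>E \<bullet> v\<bar> \<le> 10 * (\<kappa> ^ 6 * (m * r))" .
    moreover have "\<kappa> * (m * r) \<le> \<kappa> ^ 6 * (m * r)" using pw[of 1 6] m r by (intro mult_right_mono) auto
    moreover have "\<bar>real (card S) - m * \<alpha>\<bar> \<le> \<kappa> * (m * r)" using zeroth by (simp only: mult.assoc)
    ultimately have "\<bar>Den - m * \<alpha>\<bar> \<le> 11 * (\<kappa> ^ 6 * (m * r))" unfolding D by linarith
    then show ?thesis by (simp only: mult.assoc)
  qed
  \<comment> \<open>This fixes the threshold 22 \<kappa>^7 r \<le> 1: the error 11 \<kappa>^6 m r of
    the denominator may use up at most half of m / \<kappa>.\<close>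
  have DenL: "Den \<ge> m / (2 * \<kappa>)"
  proof -
    have "11 * \<kappa> ^ 6 * m * r = (22 * \<kappa> ^ 7 * r) * (m / (2 * \<kappa>))" using \<kappa> by (simp add: field_simps eval_nat_numeral)
    also have "\<dots> \<le> 1 * (m / (2 * \<kappa>))" using r m \<kappa> by (intro mult_right_mono) auto
    finally have 1: "11 * \<kappa> ^ 6 * m * r \<le> m / (2 * \<kappa>)" by simp
    have "m * (1 / \<kappa>) \<le> m * \<alpha>" using \<alpha> m by (intro mult_left_mono) auto
    moreover have "m * (1 / \<kappa>) = m / (2 * \<kappa>) + m / (2 * \<kappa>)" using \<kappa> by (simp add: field_simps)
    ultimately show ?thesis using 1 DenE by linarith
  qed
  have Dpos: "Den > 0" using DenL m \<kappa> by (smt (verit) divide_pos_pos)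
  have lle: "lle_average \<X> r (m * r ^ 3) f x - f x = Num / Den"
    using lle_average_push_through[OF c S v[unfolded E_def]] Dpos unfolding Num_def Den_def c_def by simp
  have "\<bar>Num - L * r\<^sup>2 * Den\<bar> \<le> 39 * \<kappa> ^ 7 * m * r ^ 3"
  proof -
    have eq: "Num - L * r\<^sup>2 * Den = (Num - m * \<alpha> * L * r\<^sup>2) - L * r\<^sup>2 * (Den - m * \<alpha>)"
      by (simp add: algebra_simps)
    have "\<bar>L * r\<^sup>2 * (Den - m * \<alpha>)\<bar> \<le> \<kappa> * r\<^sup>2 * (11 * \<kappa> ^ 6 * m * r)"
      unfolding abs_mult using L DenE \<kappa> by (intro mult_mono) auto
    also have "\<dots> = 11 * \<kappa> ^ 7 * m * r ^ 3" by (simp add: eval_nat_numeral)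
    finally show ?thesis unfolding eq using NumE by linarith
  qed
  also have "39 * \<kappa> ^ 7 * m * r ^ 3 = (78 * \<kappa> ^ 8 * r) * (r\<^sup>2 * (m / (2 * \<kappa>)))"
    using \<kappa> by (simp add: eval_nat_numeral)
  also have "\<dots> \<le> (78 * \<kappa> ^ 8 * r) * (r\<^sup>2 * Den)"
    using DenL \<kappa> r by (intro mult_left_mono) auto
  finally have "\<bar>Num - L * r\<^sup>2 * Den\<bar> / (r\<^sup>2 * Den) \<le> 78 * \<kappa> ^ 8 * r"
    using Dpos r by (simp add: divide_le_eq)
  moreover have "1 / r\<^sup>2 * (Num / Den) - L = (Num - L * r\<^sup>2 * Den) / (r\<^sup>2 * Den)"
    using Dpos r by (simp add: field_simps)
  ultimately show ?thesis unfolding lle using Dpos r by (simp add: abs_mult)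
qed

section \<open>Integrals over ellipsoids\<close>

lemma emeasure_lborel_cball_less_top: "emeasure lborel (cball c r) < \<top>" for c :: "'a::euclidean_space"
  using emeasure_bounded_finite[of "cball c r"] by (simp add: less_top)

lemma integrable_bounded_on_cball:
  fixes \<phi> :: "'a::euclidean_space \<Rightarrow> real"
  assumes "\<phi> \<in> borel_measurable borel" "\<And>h. h \<notin> cball 0 R \<Longrightarrow> \<phi> h = 0" "\<And>h. \<bar>\<phi> h\<bar> \<le> B"
  shows "integrable lborel \<phi>"
proof (rule Bochner_Integration.integrable_bound[of lborel "\<lambda>h. B * indicator (cball 0 R) h"])
  show "integrable lborel (\<lambda>h. B * indicator (cball 0 R) h :: real)"
    by (intro integrable_mult_right integrable_real_indicator) (auto simp: emeasure_lborel_cball_less_top)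
  have "norm (\<phi> h) \<le> norm (B * indicator (cball 0 R) h)" for h
    using assms(2)[of h] assms(3)[of h] by (cases "h \<in> cball 0 R") auto
  then show "AE h in lborel. norm (\<phi> h) \<le> norm (B * indicator (cball 0 R) h)" by simp
qed (use assms in simp)

lemma lborel_integral_translate:
  fixes \<phi> :: "'a::euclidean_space \<Rightarrow> real"
  assumes "\<phi> \<in> borel_measurable borel"
  shows "(\<integral>h. \<phi> (c + h) \<partial>lborel) = (\<integral>h. \<phi> h \<partial>lborel)"
proof -
  have "(\<integral>h. \<phi> h \<partial>lborel) = (\<integral>h. \<phi> h \<partial>distr lborel borel ((+) c))"
    by (simp add: lborel_distr_plus)
  also have "\<dots> = (\<integral>h. \<phi> (c + h) \<partial>lborel)"
    using assms by (intro integral_distr) auto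
  finally show ?thesis by simp
qed

lemma lborel_integral_scale:
  fixes \<phi> :: "'a::euclidean_space \<Rightarrow> real"
  assumes "\<phi> \<in> borel_measurable borel" "r \<noteq> 0"
  shows "(\<integral>h. \<phi> h \<partial>lborel) = \<bar>r\<bar> ^ DIM('a) * (\<integral>h. \<phi> (r *\<^sub>R h) \<partial>lborel)"
proof -
  have "(\<integral>h. \<phi> h \<partial>lborel) = (\<integral>h. \<phi> h \<partial>density (distr lborel borel (\<lambda>x. 0 + r *\<^sub>R x)) (\<lambda>_. \<bar>r\<bar> ^ DIM('a)))"
    using lborel_affine[OF assms(2), of "0 :: 'a"] by simp
  also have "\<dots> = (\<integral>h. \<bar>r\<bar> ^ DIM('a) * \<phi> h \<partial>distr lborel borel (\<lambda>x. 0 + r *\<^sub>R x))"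
    using assms(1) by (subst integral_density) auto
  also have "\<dots> = (\<integral>h. \<bar>r\<bar> ^ DIM('a) * \<phi> (r *\<^sub>R h) \<partial>lborel)"
    using assms(1) by (subst integral_distr) auto
  finally show ?thesis by simp
qed

text \<open>Used for the volume of the shell between two concentric ellipsoids whose radii are (1 -
  \<delta>) r and (1 + \<delta>) r.\<close>

lemma power_diff_le_of_le_2:
  fixes x y :: real
  assumes "0 \<le> y" "y \<le> x" "x \<le> 2"
  shows "x ^ n - y ^ n \<le> real n * 2 ^ n * (x - y)"
proof (induction n)
  case (Suc n)
  have "x ^ Suc n - y ^ Suc n = x * (x ^ n - y ^ n) + y ^ n * (x - y)" by (simp add: algebra_simps)
  also have "\<dots> \<le> 2 * (real n * 2 ^ n * (x - y)) + 2 ^ n * (x - y)"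
  proof (intro add_mono mult_right_mono)
    have "0 \<le> x ^ n - y ^ n" using assms by (simp add: power_mono)
    then show "x * (x ^ n - y ^ n) \<le> 2 * (real n * 2 ^ n * (x - y))"
      using assms Suc.IH by (intro mult_mono) auto
    show "y ^ n \<le> 2 ^ n" using assms by (intro power_mono) auto
  qed (use assms in auto)
  also have "\<dots> \<le> 2 * (real n * 2 ^ n * (x - y)) + 2 * 2 ^ n * (x - y)" using assms by simp
  finally show ?case by (simp add: algebra_simps)
qed simp

text \<open>In the application A is the derivative of the embedded chart at a point:
  \<open>Ell r\<close> is the preimage of the ball of radius r under the linearized chart, and
  \<open>Gram\<close> is the Riemannian metric at the point.\<close>

locale ellipsoid =
  fixes A :: "real ^ 'd::finite \<Rightarrow> real ^ 'p::finite" and \<mu> :: real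
  assumes lin: "linear A" and \<mu>: "\<mu> > 0" and lower: "\<And>h. \<mu> * norm h \<le> norm (A h)"
begin

definition Ell :: "real \<Rightarrow> (real ^ 'd) set" where
  "Ell r = {h. norm (A h) \<le> r}"

definition vol :: real where
  "vol = (\<integral>h. indicator (Ell 1) h \<partial>lborel)"

definition Gram :: "real ^ 'd ^ 'd" where
  "Gram = (\<chi> i j. A (axis i 1) \<bullet> A (axis j 1))"

lemma continuous_A: "continuous_on S A"
  using lin linear_continuous_on linear_conv_bounded_linear by blast

lemma borel_A [measurable]: "A \<in> borel_measurable borel"
  by (intro borel_measurable_continuous_onI continuous_A)

lemma sets_Ell [measurable]: "Ell r \<in> sets borel"
  unfolding Ell_def by measurable

lemma Ell_subset: "Ell r \<subseteq> cball 0 (r / \<mu>)"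
proof
  fix h assume "h \<in> Ell r"
  then have "\<mu> * norm h \<le> r" using lower[of h] by (simp add: Ell_def)
  then show "h \<in> cball 0 (r / \<mu>)" using \<mu> by (simp add: field_simps)
qed

lemma norm_Ell: "h \<in> Ell r \<Longrightarrow> norm h \<le> r / \<mu>"
  using Ell_subset[of r] by auto

lemma emeasure_Ell_less_top: "emeasure lborel (Ell r) < \<top>"
  by (rule le_less_trans[OF emeasure_mono[OF Ell_subset] emeasure_lborel_cball_less_top]) simp

lemma integrable_indicator_Ell: "integrable lborel (indicator (Ell r) :: _ \<Rightarrow> real)"
  by (intro integrable_real_indicator) (auto simp: emeasure_Ell_less_top)

lemma integrable_Ell:
  fixes \<phi> :: "real ^ 'd \<Rightarrow> real"
  assumes "\<phi> \<in> borel_measurable borel" "\<And>h. h \<in> Ell r \<Longrightarrow> \<bar>\<phi> h\<bar> \<le> B"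
  shows "integrable lborel (\<lambda>h. indicator (Ell r) h * \<phi> h)"
proof (rule integrable_bounded_on_cball[of _ "r / \<mu>" "\<bar>B\<bar>"])
  show "indicator (Ell r) h * \<phi> h = 0" if "h \<notin> cball 0 (r / \<mu>)" for h
    using that Ell_subset[of r] by (auto simp: indicator_def)
  show "\<bar>indicator (Ell r) h * \<phi> h\<bar> \<le> \<bar>B\<bar>" for h
    using assms(2)[of h] by (auto simp: indicator_def)
qed (use assms in measurable)

lemma integral_Ell_scale:
  fixes \<phi> :: "real ^ 'd \<Rightarrow> real"
  assumes "\<phi> \<in> borel_measurable borel" "r > 0"
  shows "(\<integral>h. indicator (Ell r) h * \<phi> h \<partial>lborel) =
    r ^ CARD('d) * (\<integral>h. indicator (Ell 1) h * \<phi> (r *\<^sub>R h) \<partial>lborel)"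
proof -
  have "indicator (Ell r) (r *\<^sub>R h) = (indicator (Ell 1) h :: real)" for h
    using assms(2) by (auto simp: Ell_def indicator_def linear_scale[OF lin])
  then show ?thesis
    using assms lborel_integral_scale[of "\<lambda>h. indicator (Ell r) h * \<phi> h" r] by simp
qed

lemma integral_Ell_volume: "r > 0 \<Longrightarrow> (\<integral>h. indicator (Ell r) h \<partial>lborel) = r ^ CARD('d) * vol"
  using integral_Ell_scale[of "\<lambda>_. 1" r] by (simp add: vol_def)

lemma measure_Ell: "r > 0 \<Longrightarrow> measure lborel (Ell r) = r ^ CARD('d) * vol"
  using integral_Ell_volume[of r] by simp

lemma vol_ge:
  assumes M: "M > 0" "\<And>h. norm (A h) \<le> M * norm h"
  shows "unit_ball_vol (real CARD('d)) / M ^ CARD('d) \<le> vol"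
proof -
  have sub: "cball 0 (1 / M) \<subseteq> Ell 1"
  proof
    fix h :: "real ^ 'd" assume "h \<in> cball 0 (1 / M)"
    then have "M * norm h \<le> 1" using M(1) by (simp add: field_simps)
    then show "h \<in> Ell 1" using M(2)[of h] by (simp add: Ell_def)
  qed
  have "unit_ball_vol (real CARD('d)) / M ^ CARD('d) = measure lborel (cball (0 :: real ^ 'd) (1 / M))"
    using M by (simp add: content_cball power_divide)
  also have "\<dots> \<le> measure lborel (Ell 1)"
    using sub by (intro measure_mono_fmeasurable)
      (auto simp: fmeasurable_def emeasure_Ell_less_top)
  finally show ?thesis using measure_Ell[of 1] by simp
qed

lemma vol_pos: "vol > 0"
proof -
  obtain M where M: "M > 0" "\<And>h. norm (A h) \<le> M * norm h"
    using lin linear_bounded_pos by blast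
  then have "0 < unit_ball_vol (real CARD('d)) / M ^ CARD('d)" by simp
  then show ?thesis using vol_ge[OF M] by linarith
qed

lemma vol_le: "vol \<le> unit_ball_vol (real CARD('d)) / \<mu> ^ CARD('d)"
proof -
  have "vol = measure lborel (Ell 1)" using measure_Ell[of 1] by simp
  also have "\<dots> \<le> measure lborel (cball (0 :: real ^ 'd) (1 / \<mu>))"
    by (intro measure_mono_fmeasurable Ell_subset) (auto simp: fmeasurable_def emeasure_lborel_cball_less_top)
  also have "\<dots> = unit_ball_vol (real CARD('d)) / \<mu> ^ CARD('d)"
    using \<mu> by (simp add: content_cball power_divide)
  finally show ?thesis .
qed

lemma measure_shell:
  assumes "0 \<le> \<delta>" "\<delta> \<le> 1 / 2" "r > 0"
  shows "(\<integral>h. indicator (Ell (r * (1 + \<delta>))) h - indicator (Ell (r * (1 - \<delta>))) h \<partial>lborel)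
    \<le> 2 * real CARD('d) * 2 ^ CARD('d) * vol * \<delta> * r ^ CARD('d)"
proof -
  have i: "integrable lborel (indicator (Ell r) :: _ \<Rightarrow> real)" for r
    by (rule integrable_indicator_Ell)
  have p: "r * (1 + \<delta>) > 0" "r * (1 - \<delta>) > 0" using assms by auto
  have "(\<integral>h. indicator (Ell (r * (1 + \<delta>))) h - indicator (Ell (r * (1 - \<delta>))) h \<partial>lborel)
     = ((1 + \<delta>) ^ CARD('d) - (1 - \<delta>) ^ CARD('d)) * (vol * r ^ CARD('d))"
    unfolding Bochner_Integration.integral_diff[OF i i] integral_Ell_volume[OF p(1)] integral_Ell_volume[OF p(2)]
    by (simp only: power_mult_distrib) (simp add: algebra_simps)
  also have "\<dots> \<le> (real CARD('d) * 2 ^ CARD('d) * (2 * \<delta>)) * (vol * r ^ CARD('d))"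
    using power_diff_le_of_le_2[of "1 - \<delta>" "1 + \<delta>" "CARD('d)"] assms vol_pos
    by (intro mult_right_mono) auto
  finally show ?thesis by (simp add: mult_ac)
qed

text \<open>The boundary lies in shells of arbitrarily small relative thickness, whose volume is
  proportional to the thickness. It is the only place where difference quotients of
  \<open>tent\<close> need not converge.\<close>

lemma AE_not_boundary: "AE h in lborel. norm (A h) \<noteq> 1"
proof -
  let ?S = "{h. norm (A h) = 1}"
  have [measurable]: "?S \<in> sets borel" by measurable
  have fin: "?S \<in> fmeasurable lborel"
  proof (rule fmeasurableI)
    have "?S \<subseteq> Ell 1" by (auto simp: Ell_def)
    then show "emeasure lborel ?S < \<infinity>"
      using le_less_trans[OF emeasure_mono emeasure_Ell_less_top, of ?S 1] by simp
  qed simp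
  have "measure lborel ?S \<le> K * \<delta>" if K: "K = 2 * real CARD('d) * 2 ^ CARD('d) * vol" and \<delta>: "0 < \<delta>" "\<delta> \<le> 1 / 2" for \<delta> K
  proof -
    have i: "integrable lborel (indicator (Ell r) :: _ \<Rightarrow> real)" for r
      by (rule integrable_indicator_Ell)
    have "measure lborel ?S = (\<integral>h. indicator ?S h \<partial>lborel)" by simp
    also have "\<dots> \<le> (\<integral>h. indicator (Ell (1 * (1 + \<delta>))) h - indicator (Ell (1 * (1 - \<delta>))) h \<partial>lborel)"
    proof (intro integral_mono Bochner_Integration.integrable_diff i)
      show "integrable lborel (indicator ?S :: _ \<Rightarrow> real)"
        using fin by (intro integrable_real_indicator) (auto simp: fmeasurable_def)
    qed (use \<delta> in \<open>auto simp: Ell_def indicator_def\<close>)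
    also have "\<dots> \<le> K * \<delta>" using measure_shell[of \<delta> 1] \<delta> K by simp
    finally show ?thesis .
  qed
  then have "eventually (\<lambda>\<delta>. measure lborel ?S \<le> (2 * real CARD('d) * 2 ^ CARD('d) * vol) * \<delta>) (at_right 0)"
    by (intro eventually_at_rightI[of 0 "1/2"]) auto
  moreover have "((\<lambda>\<delta>. (2 * real CARD('d) * 2 ^ CARD('d) * vol) * \<delta>) \<longlongrightarrow> (2 * real CARD('d) * 2 ^ CARD('d) * vol) * 0) (at_right 0)"
    by (intro tendsto_intros)
  ultimately have "measure lborel ?S \<le> (2 * real CARD('d) * 2 ^ CARD('d) * vol) * 0"
    by (intro tendsto_lowerbound[of "\<lambda>\<delta>. (2 * real CARD('d) * 2 ^ CARD('d) * vol) * \<delta>" _ "at_right 0"]) auto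
  then have "measure lborel ?S = 0" using measure_nonneg[of lborel ?S] by linarith
  then have "?S \<in> null_sets lborel"
    using fin by (auto simp: null_sets_def measure_def fmeasurable_def enn2real_eq_0_iff)
  then show ?thesis by (rule AE_I') auto
qed

lemma A_expand: "A h = (\<Sum>i\<in>UNIV. (h $ i) *\<^sub>R A (axis i 1))"
  by (rule linear_axis_expand[OF lin])

lemma inner_A_Gram: "A h \<bullet> A (axis i 1) = (\<Sum>k\<in>UNIV. Gram $ i $ k * h $ k)"
  by (subst A_expand[of h]) (simp add: inner_sum_left Gram_def inner_commute[of "A (axis i 1)"] mult.commute)

lemma inner_A_A: "A h \<bullet> A k = (\<Sum>i\<in>UNIV. \<Sum>j\<in>UNIV. Gram $ i $ j * h $ j * k $ i)"
proof -
  have "A h \<bullet> A k = (\<Sum>i\<in>UNIV. k $ i * (A h \<bullet> A (axis i 1)))"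
    by (subst A_expand[of k]) (simp add: inner_sum_right)
  then show ?thesis by (simp add: inner_A_Gram sum_distrib_left mult_ac)
qed

text \<open>Vanishing on the boundary of the ellipsoid avoids boundary terms. With the square of the
  norm, the derivative inside is linear in h, so multiplying it by a coordinate produces exactly a
  second moment.\<close>

definition tent :: "real ^ 'd \<Rightarrow> real" where
  "tent h = max 0 (1 - (norm (A h))\<^sup>2)"

lemma tent_measurable [measurable]: "tent \<in> borel_measurable borel"
  unfolding tent_def[abs_def] by measurable

lemma tent_Ell: "tent h = indicator (Ell 1) h * (1 - (norm (A h))\<^sup>2)"
  by (auto simp: tent_def Ell_def indicator_def abs_square_le_1 max_def)

text \<open>The vanishing integral of the derivative of a compactly supported Lipschitz function
  replaces the divergence theorem on the ellipsoid.\<close>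

lemma integral_tent_derivative:
  "(\<integral>h. indicator (Ell 1) h * ((if i = j then 1 - (norm (A h))\<^sup>2 else 0) - 2 * (h $ j) * (A h \<bullet> A (axis i 1))) \<partial>lborel) = 0"
proof -
  let ?e = "axis i (1::real) :: real ^ 'd"
  define \<psi> where "\<psi> = (\<lambda>h. h $ j * tent h)"
  define t where "t = (\<lambda>n. 1 / real (Suc n))"
  \<comment> \<open>A forward difference quotient in direction i, with steps tending to 0. Its
    integral is 0 by translation invariance of Lebesgue measure, and dominated convergence carries
    this over to the derivative D'.\<close>
  define D where "D = (\<lambda>n h. (\<psi> (t n *\<^sub>R ?e + h) - \<psi> h) / t n)"
  define D' where "D' = (\<lambda>h. indicator (Ell 1) h * ((if i = j then 1 - (norm (A h))\<^sup>2 else 0) - 2 * (h $ j) * (A h \<bullet> A ?e)))"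
  obtain M where M: "M > 0" "\<And>h. norm (A h) \<le> M * norm h"
    using lin linear_bounded_pos by blast
  \<comment> \<open>The support of \<psi> has radius at most 1 / \<mu> and all shifts have length at
    most 1, so every difference quotient vanishes outside radius R.\<close>
  define R where "R = 1 / \<mu> + 1"
  have R: "R \<ge> 1" using \<mu> by (simp add: R_def)
  have t: "0 < t n" "t n \<le> 1" for n by (auto simp: t_def)
  have t0: "t \<longlonglongrightarrow> 0" unfolding t_def by (rule LIMSEQ_Suc[OF lim_1_over_n])
  have [measurable]: "\<psi> \<in> borel_measurable borel" unfolding \<psi>_def by measurable
  have [measurable]: "D n \<in> borel_measurable lborel" for n unfolding D_def by measurable
  have [measurable]: "D' \<in> borel_measurable lborel" unfolding D'_def by measurable
  have \<psi>0: "\<psi> h = 0" if "norm h > 1 / \<mu>" for h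
  proof -
    have "1 < \<mu> * norm h" using that \<mu> by (simp add: field_simps)
    then have "1 \<le> (norm (A h))\<^sup>2" using lower[of h] by (intro one_le_power) linarith
    then show ?thesis by (simp add: \<psi>_def tent_def)
  qed
  define B where "B = 1 + R * (M * M * (2 * (R + 1)))"
  have B0: "B \<ge> 0" using M R by (simp add: B_def)
  have t1: "0 \<le> tent h" "tent h \<le> 1" for h by (auto simp: tent_def)
  have lip: "\<bar>\<psi> (s *\<^sub>R ?e + h) - \<psi> h\<bar> \<le> B * s" if s: "0 < s" "s \<le> 1" and h: "norm h \<le> R" for s h
  proof -
    let ?k = "s *\<^sub>R ?e + h"
    have nk: "norm ?k \<le> R + 1" using norm_triangle_ineq[of "s *\<^sub>R ?e" h] s h by simp
    have "\<bar>tent ?k - tent h\<bar> \<le> \<bar>(norm (A ?k))\<^sup>2 - (norm (A h))\<^sup>2\<bar>" unfolding tent_def by linarith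
    also have "(norm (A ?k))\<^sup>2 - (norm (A h))\<^sup>2 = (A ?k - A h) \<bullet> (A ?k + A h)"
      by (simp add: power2_norm_eq_inner inner_diff_left inner_add_right) (simp add: inner_commute)
    also have "\<bar>\<dots>\<bar> \<le> norm (A ?k - A h) * norm (A ?k + A h)" by (rule Cauchy_Schwarz_ineq2)
    also have "\<dots> \<le> (M * s) * (M * (2 * (R + 1)))"
    proof (rule mult_mono)
      have "A ?k - A h = A (s *\<^sub>R ?e)" by (simp add: linear_add[OF lin])
      then show "norm (A ?k - A h) \<le> M * s" using M(2)[of "s *\<^sub>R ?e"] s by simp
      have "norm (A ?k + A h) \<le> M * norm ?k + M * norm h"
        using M(2) by (intro order_trans[OF norm_triangle_ineq] add_mono)
      also have "\<dots> \<le> M * (R + 1) + M * (R + 1)" using M nk h by (intro add_mono mult_left_mono) auto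
      finally show "norm (A ?k + A h) \<le> M * (2 * (R + 1))" by (simp add: algebra_simps)
    qed (use M s in auto)
    finally have tt: "\<bar>tent ?k - tent h\<bar> \<le> (M * M * (2 * (R + 1))) * s" by (simp add: mult_ac)
    have "\<psi> ?k - \<psi> h = (?k $ j - h $ j) * tent ?k + h $ j * (tent ?k - tent h)"
      by (simp add: \<psi>_def algebra_simps)
    also have "\<bar>\<dots>\<bar> \<le> \<bar>?k $ j - h $ j\<bar> * tent ?k + \<bar>h $ j\<bar> * \<bar>tent ?k - tent h\<bar>"
      using t1[of ?k] by (intro order_trans[OF abs_triangle_ineq]) (simp add: abs_mult)
    also have "\<dots> \<le> s * 1 + R * ((M * M * (2 * (R + 1))) * s)"
    proof (intro add_mono mult_mono tt t1)
      show "\<bar>?k $ j - h $ j\<bar> \<le> s" using s by (simp add: axis_def)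
      show "\<bar>h $ j\<bar> \<le> R" using component_le_norm_cart[of h j] h by linarith
    qed (use s R in auto)
    finally show ?thesis by (simp add: B_def algebra_simps)
  qed
  have "(\<integral>h. D n h \<partial>lborel) = 0" for n
  proof -
    have int: "integrable lborel \<psi>"
    proof (rule integrable_bounded_on_cball[of _ "1 / \<mu>" R])
      show "\<bar>\<psi> h\<bar> \<le> R" for h
      proof (cases "norm h > 1 / \<mu>")
        case False
        have "\<bar>\<psi> h\<bar> \<le> \<bar>h $ j\<bar> * 1" unfolding \<psi>_def abs_mult using t1[of h] by (intro mult_left_mono) auto
        then show ?thesis using component_le_norm_cart[of h j] False by (simp add: R_def)
      qed (use \<psi>0 R in auto)
    qed (use \<psi>0 in auto)
    have int2: "integrable lborel (\<lambda>h. \<psi> (t n *\<^sub>R ?e + h))"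
    proof -
      have "integrable (distr lborel borel ((+) (t n *\<^sub>R ?e))) \<psi>" using int by (simp add: lborel_distr_plus)
      then show ?thesis by (subst (asm) integrable_distr_eq) auto
    qed
    show ?thesis unfolding D_def
      using lborel_integral_translate[of \<psi> "t n *\<^sub>R ?e"]
      by (simp add: Bochner_Integration.integral_diff[OF int2 int])
  qed
  moreover have "(\<lambda>n. \<integral>h. D n h \<partial>lborel) \<longlonglongrightarrow> (\<integral>h. D' h \<partial>lborel)"
  proof (rule integral_dominated_convergence[where w = "\<lambda>h. B * indicator (cball 0 R) h"])
    show "integrable lborel (\<lambda>h. B * indicator (cball 0 R) h :: real)"
      by (intro integrable_mult_right integrable_real_indicator) (auto simp: emeasure_lborel_cball_less_top)
    show "AE h in lborel. norm (D n h) \<le> B * indicator (cball 0 R) h" for n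
    proof (intro AE_I2)
      fix h :: "real ^ 'd"
      show "norm (D n h) \<le> B * indicator (cball 0 R) h"
      proof (cases "norm h \<le> R")
        case True
        then show ?thesis using lip[OF t True] t[of n] by (simp add: D_def divide_le_eq)
      next
        case False
        then have "norm h > 1 / \<mu>" by (simp add: R_def)
        moreover have "norm (t n *\<^sub>R ?e + h) > 1 / \<mu>"
          using norm_triangle_ineq2[of h "- (t n *\<^sub>R ?e)"] t[of n] False by (simp add: R_def add.commute)
        ultimately show ?thesis by (simp add: D_def \<psi>0 False)
      qed
    qed
    show "AE h in lborel. (\<lambda>n. D n h) \<longlonglongrightarrow> D' h"
    proof (rule AE_mp[OF AE_not_boundary], rule AE_I2, rule impI)
      fix h assume nb: "norm (A h) \<noteq> 1"
      have sq: "(norm (A (t n *\<^sub>R ?e + h)))\<^sup>2 = (norm (A h))\<^sup>2 + 2 * t n * (A h \<bullet> A ?e) + (t n)\<^sup>2 * (norm (A ?e))\<^sup>2" for n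
        unfolding linear_add[OF lin] linear_scale[OF lin] power2_norm_eq_inner
        by (simp add: inner_add_left inner_add_right inner_commute power2_eq_square algebra_simps)
      have lim: "(\<lambda>n. (norm (A (t n *\<^sub>R ?e + h)))\<^sup>2) \<longlonglongrightarrow> (norm (A h))\<^sup>2 + 2 * 0 * (A h \<bullet> A ?e) + 0\<^sup>2 * (norm (A ?e))\<^sup>2"
        unfolding sq by (intro tendsto_intros t0)
      show "(\<lambda>n. D n h) \<longlonglongrightarrow> D' h"
      proof (cases "norm (A h) < 1")
        case True
        then have lt: "(norm (A h))\<^sup>2 < 1" by (simp add: abs_square_less_1)
        then have "eventually (\<lambda>n. (norm (A (t n *\<^sub>R ?e + h)))\<^sup>2 < 1) sequentially"
          using order_tendstoD(2)[OF lim] by simp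
        then have ev: "eventually (\<lambda>n. D n h = (if i = j then 1 - (norm (A h))\<^sup>2 else 0) - 2 * (h $ j) * (A h \<bullet> A ?e)
            - t n * ((h $ j + (if i = j then t n else 0)) * (norm (A ?e))\<^sup>2 + (if i = j then 2 * (A h \<bullet> A ?e) else 0))) sequentially"
        proof eventually_elim
          case (elim n)
          have "\<psi> (t n *\<^sub>R ?e + h) = ((if i = j then t n else 0) + h $ j) *
              (1 - ((norm (A h))\<^sup>2 + 2 * t n * (A h \<bullet> A ?e) + (t n)\<^sup>2 * (norm (A ?e))\<^sup>2))"
            using elim unfolding \<psi>_def tent_def sq by (simp add: axis_def)
          moreover have "\<psi> h = h $ j * (1 - (norm (A h))\<^sup>2)" using lt by (simp add: \<psi>_def tent_def)
          ultimately show ?case using t(1)[of n] unfolding D_def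
            by (cases "i = j") (simp_all add: field_simps power2_eq_square)
        qed
        have "(\<lambda>n. (if i = j then 1 - (norm (A h))\<^sup>2 else 0) - 2 * (h $ j) * (A h \<bullet> A ?e)
            - t n * ((h $ j + (if i = j then t n else 0)) * (norm (A ?e))\<^sup>2 + (if i = j then 2 * (A h \<bullet> A ?e) else 0))) \<longlonglongrightarrow>
            (if i = j then 1 - (norm (A h))\<^sup>2 else 0) - 2 * (h $ j) * (A h \<bullet> A ?e)
            - 0 * ((h $ j + (if i = j then 0 else 0)) * (norm (A ?e))\<^sup>2 + (if i = j then 2 * (A h \<bullet> A ?e) else 0))"
        proof -
          have "(\<lambda>n. if i = j then t n else 0) \<longlonglongrightarrow> (if i = j then 0 else 0)"
            using t0 by (cases "i = j") auto
          then show ?thesis by (intro tendsto_intros t0)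
        qed
        then have "(\<lambda>n. D n h) \<longlonglongrightarrow> (if i = j then 1 - (norm (A h))\<^sup>2 else 0) - 2 * (h $ j) * (A h \<bullet> A ?e)"
          using tendsto_cong[OF ev] by simp
        then show ?thesis using True by (simp add: D'_def Ell_def)
      next
        case False
        then have gt: "norm (A h) > 1" using nb by linarith
        then have "(norm (A h))\<^sup>2 > 1" by (simp add: one_less_power)
        then have "eventually (\<lambda>n. (norm (A (t n *\<^sub>R ?e + h)))\<^sup>2 > 1) sequentially"
          using order_tendstoD(1)[OF lim] by simp
        then have "eventually (\<lambda>n. D n h = 0) sequentially"
          by eventually_elim (use \<open>(norm (A h))\<^sup>2 > 1\<close> in \<open>simp add: D_def \<psi>_def tent_def\<close>)
        then show ?thesis using gt by (simp add: D'_def Ell_def tendsto_eventually)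
      qed
    qed
  qed auto
  ultimately have "(\<lambda>n :: nat. 0) \<longlonglongrightarrow> (\<integral>h. D' h \<partial>lborel)" by simp
  then have "0 = (\<integral>h. D' h \<partial>lborel)" by (simp only: LIMSEQ_const_iff)
  then show ?thesis unfolding D'_def by (rule sym)
qed

definition second_moment :: "real ^ 'd ^ 'd" where
  "second_moment = (\<chi> i j. \<integral>h. indicator (Ell 1) h * (h $ i * h $ j) \<partial>lborel)"

lemma integrable_Ell_coords: "integrable lborel (\<lambda>h. indicator (Ell r) h * (h $ i * h $ j))"
proof (rule integrable_Ell)
  show "\<bar>h $ i * h $ j\<bar> \<le> (r / \<mu>) * (r / \<mu>)" if "h \<in> Ell r" for h
    using norm_Ell[OF that] component_le_norm_cart[of h i] component_le_norm_cart[of h j]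
    unfolding abs_mult by (intro mult_mono) (auto intro: order_trans[OF norm_ge_zero])
qed simp

text \<open>By \<open>integral_tent_derivative\<close> the product of \<open>Gram\<close> with the
  second moment matrix is \<Phi> / 2 times the identity, where \<Phi> is the integral of
  \<open>tent\<close>. Its trace is the integral of |A h|^2, that is vol - \<Phi>. Hence vol -
  \<Phi> = d \<Phi> / 2, which gives \<Phi> / 2 = vol / (d + 2).\<close>

lemma second_moment_eq: "second_moment = (vol / (real CARD('d) + 2)) *\<^sub>R matrix_inv Gram" and det_Gram: "det Gram > 0"
proof -
  have "inj A"
  proof (subst linear_injective_0[OF lin], safe)
    fix h assume "A h = 0"
    then show "h = 0" using lower[of h] \<mu> by (simp add: mult_le_0_iff)
  qed
  then obtain B :: "real ^ 'd ^ 'd" where B: "\<And>x y. (B *v x) \<bullet> (B *v y) = A x \<bullet> A y" "det B \<noteq> 0"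
    using ex_isometric_matrix[OF lin] by blast
  have "Gram = transpose B ** B"
  proof -
    have "Gram $ i $ j = (B *v axis i 1) \<bullet> (B *v axis j 1)" for i j unfolding B Gram_def by simp
    then show ?thesis
      by (simp add: vec_eq_iff matrix_vector_mult_basis column_def inner_vec_def matrix_mul_entry transpose_def)
  qed
  then have "det Gram = det B ^ 2" by (simp add: det_mul det_transpose power2_eq_square)
  then show dG: "det Gram > 0" using B(2) by simp
  define \<Phi> where "\<Phi> = (\<integral>h. tent h \<partial>lborel)"
  have i1: "integrable lborel (\<lambda>h. indicator (Ell 1) h * (norm (A h))\<^sup>2)"
    by (rule integrable_Ell[of _ _ 1]) (auto simp: Ell_def abs_square_le_1)
  have i0: "integrable lborel (\<lambda>h. indicator (Ell 1) h :: real)" by (rule integrable_indicator_Ell)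
  have it: "integrable lborel tent"
    using integrable_Ell[of "\<lambda>h. 1 - (norm (A h))\<^sup>2" 1 1] unfolding tent_Ell[abs_def]
    by (auto simp: Ell_def abs_square_le_1)
  have sumi: "(\<integral>h. indicator (Ell 1) h * ((h $ j) * (A h \<bullet> A (axis i 1))) \<partial>lborel) = (Gram ** second_moment) $ i $ j" for i j
  proof -
    have "(\<integral>h. indicator (Ell 1) h * ((h $ j) * (A h \<bullet> A (axis i 1))) \<partial>lborel) =
       (\<integral>h. (\<Sum>k\<in>UNIV. Gram $ i $ k * (indicator (Ell 1) h * (h $ k * h $ j))) \<partial>lborel)"
      unfolding inner_A_Gram by (intro Bochner_Integration.integral_cong refl) (simp add: sum_distrib_left mult_ac)
    also have "\<dots> = (\<Sum>k\<in>UNIV. Gram $ i $ k * (\<integral>h. indicator (Ell 1) h * (h $ k * h $ j) \<partial>lborel))"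
      using integrable_Ell_coords by (simp add: Bochner_Integration.integral_sum)
    finally show ?thesis by (simp add: matrix_mul_entry second_moment_def)
  qed
  have ig: "integrable lborel (\<lambda>h. indicator (Ell 1) h * ((h $ j) * (A h \<bullet> A (axis i 1))))" for i j
  proof -
    have "integrable lborel (\<lambda>h. (\<Sum>k\<in>UNIV. Gram $ i $ k * (indicator (Ell 1) h * (h $ k * h $ j))))"
      using integrable_Ell_coords by simp
    then show ?thesis unfolding inner_A_Gram by (simp add: sum_distrib_left mult_ac)
  qed
  have GS: "(Gram ** second_moment) $ i $ j = (if i = j then \<Phi> / 2 else 0)" for i j
  proof -
    have "(\<integral>h. (if i = j then tent h else 0) - 2 * (indicator (Ell 1) h * ((h $ j) * (A h \<bullet> A (axis i 1)))) \<partial>lborel) = 0"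
      using integral_tent_derivative[of i j] unfolding tent_Ell
      by (cases "i = j") (simp_all add: algebra_simps)
    moreover have "(\<integral>h. (if i = j then tent h else 0) - 2 * (indicator (Ell 1) h * ((h $ j) * (A h \<bullet> A (axis i 1)))) \<partial>lborel)
       = (if i = j then \<Phi> else 0) - 2 * (Gram ** second_moment) $ i $ j"
      using it ig by (subst Bochner_Integration.integral_diff; cases "i = j") (auto simp: sumi[symmetric] \<Phi>_def)
    ultimately show ?thesis by (auto split: if_splits)
  qed
  have "\<Phi> = vol - (\<integral>h. indicator (Ell 1) h * (norm (A h))\<^sup>2 \<partial>lborel)"
    unfolding \<Phi>_def tent_Ell vol_def right_diff_distrib mult_1_right
    by (rule Bochner_Integration.integral_diff[OF i0 i1])
  also have "(\<integral>h. indicator (Ell 1) h * (norm (A h))\<^sup>2 \<partial>lborel) = (\<Sum>i\<in>UNIV. (Gram ** second_moment) $ i $ i)"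
  proof -
    have "(norm (A h))\<^sup>2 = (\<Sum>i\<in>UNIV. (h $ i) * (A h \<bullet> A (axis i 1)))" for h
      by (simp only: power2_norm_eq_inner inner_A_A[of h h] inner_A_Gram sum_distrib_left mult_ac)
    then have "(\<integral>h. indicator (Ell 1) h * (norm (A h))\<^sup>2 \<partial>lborel) =
       (\<integral>h. (\<Sum>i\<in>UNIV. indicator (Ell 1) h * ((h $ i) * (A h \<bullet> A (axis i 1)))) \<partial>lborel)"
      by (simp add: sum_distrib_left)
    also have "\<dots> = (\<Sum>i\<in>UNIV. (\<integral>h. indicator (Ell 1) h * ((h $ i) * (A h \<bullet> A (axis i 1))) \<partial>lborel))"
      using ig by (intro Bochner_Integration.integral_sum) auto
    finally show ?thesis by (simp add: sumi)
  qed
  also have "\<dots> = real CARD('d) * (\<Phi> / 2)" by (simp add: GS)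
  finally have \<Phi>: "\<Phi> / 2 = vol / (real CARD('d) + 2)" by (simp add: field_simps)
  have "Gram ** second_moment = (vol / (real CARD('d) + 2)) *\<^sub>R mat 1"
    by (simp add: vec_eq_iff GS \<Phi> mat_def)
  then have "matrix_inv Gram ** (Gram ** second_moment) = (vol / (real CARD('d) + 2)) *\<^sub>R matrix_inv Gram"
    by (simp add: matrix_mul_entry vec_eq_iff mat_def if_distrib[of "\<lambda>x. _ * x"] cong: if_cong)
  then show "second_moment = (vol / (real CARD('d) + 2)) *\<^sub>R matrix_inv Gram"
    using matrix_inv_props[of Gram] dG by (simp add: matrix_mul_assoc)
qed

lemma integral_Ell_second:
  assumes "r > 0"
  shows "(\<integral>h. indicator (Ell r) h * (h $ i * h $ j) \<partial>lborel) =
    r ^ (CARD('d) + 2) * vol / (real CARD('d) + 2) * matrix_inv Gram $ i $ j"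
proof -
  have "(\<integral>h. indicator (Ell r) h * (h $ i * h $ j) \<partial>lborel) = r ^ CARD('d) * (\<integral>h. r\<^sup>2 * (indicator (Ell 1) h * (h $ i * h $ j)) \<partial>lborel)"
    by (subst integral_Ell_scale[OF _ assms]) (auto simp: power2_eq_square mult_ac)
  also have "\<dots> = r ^ CARD('d) * r\<^sup>2 * second_moment $ i $ j" by (simp add: second_moment_def)
  finally show ?thesis by (simp add: second_moment_eq power_add power2_eq_square mult_ac)
qed

text \<open>Integration over the ellipsoid contracts a quadratic form with the inverse metric. With
  a Hessian as the form, this is the source of both the Laplacian and the factor 1 / (d +
  2).\<close>

lemma integral_Ell_quadratic:
  assumes "r > 0"
  shows "(\<integral>h. indicator (Ell r) h * (\<Sum>i\<in>UNIV. \<Sum>j\<in>UNIV. h $ i * h $ j * H i j) \<partial>lborel) =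
    r ^ (CARD('d) + 2) * vol / (real CARD('d) + 2) * (\<Sum>i\<in>UNIV. \<Sum>j\<in>UNIV. matrix_inv Gram $ i $ j * H i j)"
proof -
  have "(\<integral>h. indicator (Ell r) h * (\<Sum>i\<in>UNIV. \<Sum>j\<in>UNIV. h $ i * h $ j * H i j) \<partial>lborel) =
     (\<integral>h. (\<Sum>i\<in>UNIV. \<Sum>j\<in>UNIV. H i j * (indicator (Ell r) h * (h $ i * h $ j))) \<partial>lborel)"
    by (intro Bochner_Integration.integral_cong refl) (simp add: sum_distrib_left mult_ac)
  also have "\<dots> = (\<Sum>i\<in>UNIV. \<Sum>j\<in>UNIV. H i j * (\<integral>h. indicator (Ell r) h * (h $ i * h $ j) \<partial>lborel))"
    using integrable_Ell_coords by (simp add: Bochner_Integration.integral_sum)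
  finally show ?thesis unfolding integral_Ell_second[OF assms] sum_distrib_left by (simp only: mult_ac)
qed

text \<open>The ellipsoid is symmetric about 0. The vanishing of linear terms is what gives the
  first moment an additional power of r.\<close>

lemma integral_Ell_odd:
  fixes \<phi> :: "real ^ 'd \<Rightarrow> real"
  assumes [measurable]: "\<phi> \<in> borel_measurable borel" and odd: "\<And>h. \<phi> (- h) = - \<phi> h"
  shows "(\<integral>h. indicator (Ell r) h * \<phi> h \<partial>lborel) = 0"
proof -
  have "indicator (Ell r) (- h) = (indicator (Ell r) h :: real)" for h
    by (simp add: Ell_def indicator_def linear_neg[OF lin])
  then have "(\<integral>h. indicator (Ell r) h * \<phi> h \<partial>lborel) = - (\<integral>h. indicator (Ell r) h * \<phi> h \<partial>lborel)"
    using lborel_integral_scale[of "\<lambda>h. indicator (Ell r) h * \<phi> h" "- 1"] by (simp add: odd)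
  then show ?thesis by simp
qed

text \<open>Two errors add up: replacing the integrand costs b on a set inside
  \<open>Ell (2 * r)\<close>, and replacing the domain costs a on the shell that contains every
  point where D and \<open>Ell r\<close> differ.\<close>

lemma integral_perturbed_Ell:
  fixes \<phi> \<Phi> :: "real ^ 'd \<Rightarrow> real"
  assumes [measurable]: "D \<in> sets borel" "\<phi> \<in> borel_measurable borel" "\<Phi> \<in> borel_measurable borel"
    and r: "r > 0" and \<delta>: "0 \<le> \<delta>" "\<delta> \<le> 1 / 2"
    and D: "Ell (r * (1 - \<delta>)) \<subseteq> D" "D \<subseteq> Ell (r * (1 + \<delta>))"
    and \<phi>: "\<And>h. h \<in> Ell (2 * r) \<Longrightarrow> \<bar>\<phi> h\<bar> \<le> a" and \<Phi>: "\<And>h. h \<in> D \<Longrightarrow> \<bar>\<Phi> h - \<phi> h\<bar> \<le> b"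
    and ab: "a \<ge> 0" "b \<ge> 0"
  shows "\<bar>(\<integral>h. indicator D h * \<Phi> h \<partial>lborel) - (\<integral>h. indicator (Ell r) h * \<phi> h \<partial>lborel)\<bar>
    \<le> 2 ^ CARD('d) * vol * r ^ CARD('d) * (b + 2 * real CARD('d) * \<delta> * a)"
proof -
  have mono: "Ell s \<subseteq> Ell s'" if "s \<le> s'" for s s' using that by (auto simp: Ell_def)
  have r2: "r * (1 + \<delta>) \<le> 2 * r" "r * (1 - \<delta>) \<le> r" "r \<le> 2 * r" "r \<le> r * (1 + \<delta>)" using r \<delta> by (auto simp: algebra_simps)
  have D2: "D \<subseteq> Ell (2 * r)" using D mono[OF r2(1)] by blast
  have gen: "integrable lborel (\<lambda>h. indicator X h * f h)"
    if "X \<subseteq> Ell (2 * r)" "\<And>h. h \<in> X \<Longrightarrow> \<bar>f h\<bar> \<le> c" "f \<in> borel_measurable borel" "X \<in> sets borel" for X f and c :: real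
  proof (rule integrable_bounded_on_cball[of _ "2 * r / \<mu>" "\<bar>c\<bar>"])
    show "indicator X h * f h = 0" if "h \<notin> cball 0 (2 * r / \<mu>)" for h
      using that \<open>X \<subseteq> Ell (2 * r)\<close> Ell_subset[of "2 * r"] by (auto simp: indicator_def)
    show "\<bar>indicator X h * f h\<bar> \<le> \<bar>c\<bar>" for h using that(2)[of h] by (auto simp: indicator_def)
  qed (use that in measurable)
  have i1: "integrable lborel (\<lambda>h. indicator D h * \<Phi> h)"
  proof (rule gen[OF D2, of _ "a + b"])
    show "\<bar>\<Phi> h\<bar> \<le> a + b" if "h \<in> D" for h using \<Phi>[OF that] \<phi>[of h] D2 that by (auto simp: subset_iff)
  qed auto
  have i2: "integrable lborel (\<lambda>h. indicator (Ell r) h * \<phi> h)"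
    by (rule gen[OF mono[OF r2(3)], of _ a]) (use \<phi> mono[OF r2(3)] in auto)
  have iE: "integrable lborel (indicator (Ell s) :: _ \<Rightarrow> real)" for s
    by (rule integrable_indicator_Ell)
  have i4: "integrable lborel (\<lambda>h. b * indicator (Ell (2 * r)) h + a * (indicator (Ell (r * (1 + \<delta>))) h - indicator (Ell (r * (1 - \<delta>))) h))"
    by (intro Bochner_Integration.integrable_add integrable_mult_right Bochner_Integration.integrable_diff iE)
  have "\<bar>(\<integral>h. indicator D h * \<Phi> h \<partial>lborel) - (\<integral>h. indicator (Ell r) h * \<phi> h \<partial>lborel)\<bar>
     = \<bar>\<integral>h. indicator D h * \<Phi> h - indicator (Ell r) h * \<phi> h \<partial>lborel\<bar>"
    by (simp add: Bochner_Integration.integral_diff[OF i1 i2])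
  also have "\<dots> \<le> (\<integral>h. \<bar>indicator D h * \<Phi> h - indicator (Ell r) h * \<phi> h\<bar> \<partial>lborel)"
    by (rule integral_abs_bound)
  also have "\<dots> \<le> (\<integral>h. b * indicator (Ell (2 * r)) h + a * (indicator (Ell (r * (1 + \<delta>))) h - indicator (Ell (r * (1 - \<delta>))) h) \<partial>lborel)"
  proof (intro integral_mono i4 integrable_abs Bochner_Integration.integrable_diff i1 i2)
    fix h
    have "h \<in> Ell (r * (1 - \<delta>)) \<Longrightarrow> h \<in> Ell r \<and> h \<in> D" "h \<in> Ell r \<Longrightarrow> h \<in> Ell (2 * r) \<and> h \<in> Ell (r * (1 + \<delta>))"
      "h \<in> D \<Longrightarrow> h \<in> Ell (2 * r) \<and> h \<in> Ell (r * (1 + \<delta>))"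
      using mono[OF r2(2)] mono[OF r2(3)] mono[OF r2(4)] D D2 by blast+
    then show "\<bar>indicator D h * \<Phi> h - indicator (Ell r) h * \<phi> h\<bar> \<le>
        b * indicator (Ell (2 * r)) h + a * (indicator (Ell (r * (1 + \<delta>))) h - indicator (Ell (r * (1 - \<delta>))) h)"
      using \<phi>[of h] \<Phi>[of h] ab
      by (cases "h \<in> D"; cases "h \<in> Ell r"; cases "h \<in> Ell (r * (1 - \<delta>))"; cases "h \<in> Ell (2 * r)"; cases "h \<in> Ell (r * (1 + \<delta>))")
         (auto simp: indicator_def)
  qed
  also have "\<dots> = b * ((2 * r) ^ CARD('d) * vol) + a * (\<integral>h. indicator (Ell (r * (1 + \<delta>))) h - indicator (Ell (r * (1 - \<delta>))) h \<partial>lborel)"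
    using r integral_Ell_volume[of "2 * r"]
    by (subst Bochner_Integration.integral_add)
      (auto simp del: Bochner_Integration.integral_diff integral_indicator
        intro!: integrable_mult_right Bochner_Integration.integrable_diff iE)
  also have "\<dots> \<le> b * ((2 * r) ^ CARD('d) * vol) + a * (2 * real CARD('d) * 2 ^ CARD('d) * vol * \<delta> * r ^ CARD('d))"
    by (intro add_left_mono mult_left_mono measure_shell \<delta> r ab)
  also have "\<dots> = 2 ^ CARD('d) * vol * r ^ CARD('d) * (b + 2 * real CARD('d) * \<delta> * a)"
    by (simp add: power_mult_distrib algebra_simps)
  finally show ?thesis .
qed

end

section \<open>Moments of small balls in a chart\<close>

text \<open>Here \<open>A u\<close> is the derivative of \<Psi> at u and \<rho> is the density P
  times sqrt(det g). Base points u stay in the ball of radius s while w ranges over twice that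
  radius, which leaves a full neighbourhood of every base point, and the single constant L makes all
  estimates uniform in u.\<close>

locale local_chart =
  fixes \<Psi> :: "real ^ 'd::finite \<Rightarrow> real ^ 'p::finite" and \<rho> :: "real ^ 'd \<Rightarrow> real"
    and A :: "real ^ 'd \<Rightarrow> real ^ 'd \<Rightarrow> real ^ 'p" and u0 :: "real ^ 'd" and s \<mu> L :: real
  assumes s: "s > 0" and \<mu>: "\<mu> > 0" and L: "L \<ge> 1"
    and cont: "continuous_on (ball u0 (2 * s)) \<Psi>" "continuous_on (ball u0 (2 * s)) \<rho>"
    and linA: "\<And>u. u \<in> cball u0 s \<Longrightarrow> linear (A u)"
    and lowerA: "\<And>u h. u \<in> cball u0 s \<Longrightarrow> \<mu> * norm h \<le> norm (A u h)"
    and upperA: "\<And>u h. u \<in> cball u0 s \<Longrightarrow> norm (A u h) \<le> L * norm h"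
    and chart_lower: "\<And>u w. u \<in> cball u0 s \<Longrightarrow> w \<in> ball u0 (2 * s) \<Longrightarrow> \<mu> * norm (w - u) \<le> norm (\<Psi> w - \<Psi> u)"
    and chart_upper: "\<And>u w. u \<in> cball u0 s \<Longrightarrow> w \<in> ball u0 (2 * s) \<Longrightarrow> norm (\<Psi> w - \<Psi> u) \<le> L * norm (w - u)"
    and taylor: "\<And>u w. u \<in> cball u0 s \<Longrightarrow> w \<in> ball u0 (2 * s) \<Longrightarrow>
       norm (\<Psi> w - \<Psi> u - A u (w - u)) \<le> L * (norm (w - u))\<^sup>2"
    and \<rho>lip: "\<And>u w. u \<in> cball u0 s \<Longrightarrow> w \<in> ball u0 (2 * s) \<Longrightarrow> \<bar>\<rho> w - \<rho> u\<bar> \<le> L * norm (w - u)"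
    and \<rho>bounds: "\<And>w. w \<in> ball u0 (2 * s) \<Longrightarrow> 1 / L \<le> \<rho> w \<and> \<rho> w \<le> L"
begin

abbreviation W where "W \<equiv> ball u0 (2 * s)"

text \<open>The first bound keeps the preimage of a ball of radius r inside \<open>W\<close>, since
  r / \<mu> < s; the second makes the relative error \<open>\<delta>\<close> = L r / \<mu>^2 of the
  ellipsoid approximation at most 1/2.\<close>

definition r1 :: real where "r1 = min (\<mu> * s / 2) (\<mu>\<^sup>2 / (2 * L))"

lemma r1: "r1 > 0"
  using s \<mu> L by (simp add: r1_def)

lemma inW: "u \<in> cball u0 s \<Longrightarrow> norm h < s \<Longrightarrow> u + h \<in> W"
  using norm_triangle_ineq[of "u - u0" h] by (simp add: dist_norm norm_minus_commute algebra_simps)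

lemma sub_W: "u \<in> cball u0 s \<Longrightarrow> u \<in> W"
  using s by auto

lemma ellipsoid_A: "u \<in> cball u0 s \<Longrightarrow> ellipsoid (A u) \<mu>"
  by (intro ellipsoid.intro linA \<mu> lowerA)

text \<open>The constant produced by \<open>integral_perturbed_Ell\<close>, with the volume of the
  ellipsoid replaced by its upper bound so that the base point no longer occurs.\<close>

definition approx_const :: "real \<Rightarrow> nat \<Rightarrow> real" where
  "approx_const K j = 2 ^ CARD('d) * (unit_ball_vol (real CARD('d)) / \<mu> ^ CARD('d)) *
       (2 * K * L / \<mu> ^ Suc j + 2 * real CARD('d) * (L / \<mu>\<^sup>2) * (L * K * (2 / \<mu>) ^ j))"

lemma approx_const_nonneg: "K \<ge> 0 \<Longrightarrow> approx_const K j \<ge> 0"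
  unfolding approx_const_def using L \<mu> by (auto intro!: mult_nonneg_nonneg add_nonneg_nonneg)

text \<open>The second order remainder of \<Psi> is at most L (r / \<mu>)^2 = r \<delta>, so the
  preimage of the ball of radius r lies between the ellipsoids of radii r (1 - \<delta>) and r (1 +
  \<delta>). As \<delta> is O(r), replacing the domain, replacing F by its leading part of order j,
  and freezing \<rho> at u each cost one more power of r.\<close>

lemma integral_approx:
  fixes F \<phi> :: "real ^ 'd \<Rightarrow> real"
  assumes u: "u \<in> cball u0 s" and r: "0 < r" "r \<le> r1" and K: "K \<ge> 0"
    and F: "continuous_on W F" and \<phi>m: "\<phi> \<in> borel_measurable borel"
    and \<phi>: "\<And>h. \<bar>\<phi> h\<bar> \<le> K * norm h ^ j"
    and F\<phi>: "\<And>w. w \<in> W \<Longrightarrow> \<bar>F w - \<phi> (w - u)\<bar> \<le> K * norm (w - u) ^ Suc j"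
  shows "\<bar>(\<integral>w. indicator W w * (indicator (cball (\<Psi> u) r) (\<Psi> w) * (F w * \<rho> w)) \<partial>lborel)
      - \<rho> u * (\<integral>h. indicator (ellipsoid.Ell (A u) r) h * \<phi> h \<partial>lborel)\<bar>
    \<le> approx_const K j * r ^ (CARD('d) + Suc j)"
proof -
  interpret ellipsoid "A u" \<mu> by (rule ellipsoid_A[OF u])
  define \<delta> where "\<delta> = L / \<mu>\<^sup>2 * r"
  have \<delta>: "0 \<le> \<delta>" "\<delta> \<le> 1 / 2"
  proof -
    show "0 \<le> \<delta>" using L r by (simp add: \<delta>_def)
    have "r \<le> \<mu>\<^sup>2 / (2 * L)" using r by (simp add: r1_def)
    then have "\<delta> \<le> L / \<mu>\<^sup>2 * (\<mu>\<^sup>2 / (2 * L))" unfolding \<delta>_def using L by (intro mult_left_mono) auto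
    then show "\<delta> \<le> 1 / 2" using L \<mu> by simp
  qed
  \<comment> \<open>The chart functions are only known to be continuous on \<open>W\<close>;
    extending them by 0 gives Borel functions on the whole space.\<close>
  define Fm where "Fm = (\<lambda>w. indicator W w *\<^sub>R (F w * \<rho> w))"
  have [measurable]: "Fm \<in> borel_measurable borel"
    unfolding Fm_def by (intro borel_measurable_continuous_on_indicator continuous_intros F cont) auto
  define \<Psi>m where "\<Psi>m = (\<lambda>w. indicator W w *\<^sub>R \<Psi> w)"
  have [measurable]: "\<Psi>m \<in> borel_measurable borel"
    unfolding \<Psi>m_def by (intro borel_measurable_continuous_on_indicator continuous_intros cont) auto
  note \<phi>m [measurable]
  have [measurable]: "W \<in> sets borel" by simp
  define D0 where "D0 = {w. w \<in> W \<and> norm (\<Psi>m w - \<Psi> u) \<le> r}"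
  define D where "D = {h. u + h \<in> D0}"
  have [measurable]: "D0 \<in> sets borel" unfolding D0_def by measurable
  have [measurable]: "D \<in> sets borel" unfolding D_def by measurable
  have Dh: "u + h \<in> W \<and> norm (\<Psi> (u + h) - \<Psi> u) \<le> r \<and> norm h \<le> r / \<mu>" if "h \<in> D" for h
  proof -
    have 1: "u + h \<in> W" "norm (\<Psi> (u + h) - \<Psi> u) \<le> r" using that by (auto simp: D_def D0_def \<Psi>m_def)
    then have "\<mu> * norm h \<le> r" using chart_lower[OF u 1(1)] by simp
    then show ?thesis using 1 \<mu> by (simp add: field_simps)
  qed
  have "(\<integral>w. indicator W w * (indicator (cball (\<Psi> u) r) (\<Psi> w) * (F w * \<rho> w)) \<partial>lborel) = (\<integral>w. indicator D0 w * Fm w \<partial>lborel)"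
    by (intro Bochner_Integration.integral_cong refl)
       (auto simp: D0_def Fm_def \<Psi>m_def indicator_def dist_norm norm_minus_commute)
  also have "\<dots> = (\<integral>h. indicator D0 (u + h) * Fm (u + h) \<partial>lborel)"
    by (rule lborel_integral_translate[symmetric]) measurable
  also have "\<dots> = (\<integral>h. indicator D h * Fm (u + h) \<partial>lborel)"
    by (intro Bochner_Integration.integral_cong refl) (auto simp: D_def indicator_def)
  finally have I1: "(\<integral>w. indicator W w * (indicator (cball (\<Psi> u) r) (\<Psi> w) * (F w * \<rho> w)) \<partial>lborel) = (\<integral>h. indicator D h * Fm (u + h) \<partial>lborel)" .
  have I2: "\<rho> u * (\<integral>h. indicator (Ell r) h * \<phi> h \<partial>lborel) = (\<integral>h. indicator (Ell r) h * (\<rho> u * \<phi> h) \<partial>lborel)"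
    by (subst integral_mult_right_zero[symmetric]) (simp add: mult_ac)
  have \<rho>u: "0 \<le> \<rho> u" "\<rho> u \<le> L" using \<rho>bounds[OF sub_W[OF u]] L by (auto intro: order_trans[of 0 "1 / L"])
  have "\<bar>(\<integral>h. indicator D h * Fm (u + h) \<partial>lborel) - (\<integral>h. indicator (Ell r) h * (\<rho> u * \<phi> h) \<partial>lborel)\<bar>
     \<le> 2 ^ CARD('d) * vol * r ^ CARD('d) * (2 * K * L * (r / \<mu>) ^ Suc j + 2 * real CARD('d) * \<delta> * (L * K * (2 * r / \<mu>) ^ j))"
  proof (rule integral_perturbed_Ell[OF _ _ _ r(1) \<delta>])
    show "Ell (r * (1 - \<delta>)) \<subseteq> D"
    proof
      fix h assume h: "h \<in> Ell (r * (1 - \<delta>))"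
      have "norm h \<le> r * (1 - \<delta>) / \<mu>" by (rule norm_Ell[OF h])
      also have "\<dots> \<le> r / \<mu>" using r \<delta> \<mu> by (intro divide_right_mono) (auto simp: mult_left_le)
      finally have nh: "norm h \<le> r / \<mu>" .
      also have "r / \<mu> < s" using r \<mu> s by (simp add: r1_def field_simps)
      finally have inw: "u + h \<in> W" using inW[OF u] by blast
      have "norm (\<Psi> (u + h) - \<Psi> u) \<le> norm (A u h) + norm (\<Psi> (u + h) - \<Psi> u - A u h)"
        using norm_triangle_ineq[of "A u h" "\<Psi> (u + h) - \<Psi> u - A u h"] by simp
      also have "\<dots> \<le> r * (1 - \<delta>) + L * (norm h)\<^sup>2"
        using h taylor[OF u inw] by (intro add_mono) (auto simp: Ell_def)
      also have "L * (norm h)\<^sup>2 \<le> L * (r / \<mu>)\<^sup>2" using nh L by (intro mult_left_mono power_mono) auto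
      also have "r * (1 - \<delta>) + L * (r / \<mu>)\<^sup>2 = r" by (simp add: \<delta>_def power2_eq_square algebra_simps)
      finally show "h \<in> D" using inw by (simp add: D_def D0_def \<Psi>m_def)
    qed
    show "D \<subseteq> Ell (r * (1 + \<delta>))"
    proof
      fix h assume "h \<in> D"
      note h = Dh[OF this]
      have "norm (A u h) \<le> norm (\<Psi> (u + h) - \<Psi> u) + norm (\<Psi> (u + h) - \<Psi> u - A u h)"
        using norm_triangle_ineq4[of "\<Psi> (u + h) - \<Psi> u" "\<Psi> (u + h) - \<Psi> u - A u h"] by simp
      also have "\<dots> \<le> r + L * (norm h)\<^sup>2" using h taylor[OF u, of "u + h"] by (intro add_mono) auto
      also have "L * (norm h)\<^sup>2 \<le> L * (r / \<mu>)\<^sup>2" using h L by (intro mult_left_mono power_mono) auto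
      also have "r + L * (r / \<mu>)\<^sup>2 = r * (1 + \<delta>)" by (simp add: \<delta>_def power2_eq_square algebra_simps)
      finally show "h \<in> Ell (r * (1 + \<delta>))" by (simp add: Ell_def)
    qed
    show "\<bar>\<rho> u * \<phi> h\<bar> \<le> L * K * (2 * r / \<mu>) ^ j" if "h \<in> Ell (2 * r)" for h
    proof -
      have "\<bar>\<rho> u * \<phi> h\<bar> \<le> L * (K * norm h ^ j)" unfolding abs_mult using \<phi>[of h] \<rho>u by (intro mult_mono) auto
      also have "\<dots> \<le> L * (K * (2 * r / \<mu>) ^ j)"
        using norm_Ell[OF that] L K by (intro mult_left_mono power_mono) auto
      finally show ?thesis by simp
    qed
    show "\<bar>Fm (u + h) - \<rho> u * \<phi> h\<bar> \<le> 2 * K * L * (r / \<mu>) ^ Suc j" if "h \<in> D" for h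
    proof -
      note h = Dh[OF that]
      have w: "u + h \<in> W" using h by blast
      have "Fm (u + h) - \<rho> u * \<phi> h = (F (u + h) - \<phi> h) * \<rho> (u + h) + \<phi> h * (\<rho> (u + h) - \<rho> u)"
        using w by (simp add: Fm_def algebra_simps)
      also have "\<bar>\<dots>\<bar> \<le> \<bar>F (u + h) - \<phi> h\<bar> * \<bar>\<rho> (u + h)\<bar> + \<bar>\<phi> h\<bar> * \<bar>\<rho> (u + h) - \<rho> u\<bar>"
        by (metis abs_mult abs_triangle_ineq)
      also have "\<dots> \<le> (K * norm h ^ Suc j) * L + (K * norm h ^ j) * (L * norm h)"
      proof (intro add_mono mult_mono)
        show "\<bar>F (u + h) - \<phi> h\<bar> \<le> K * norm h ^ Suc j" using F\<phi>[OF w] by simp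
        have "0 \<le> 1 / L" using L by simp
        then show "\<bar>\<rho> (u + h)\<bar> \<le> L" using \<rho>bounds[OF w] by linarith
        show "\<bar>\<rho> (u + h) - \<rho> u\<bar> \<le> L * norm h" using \<rho>lip[OF u w] by simp
      qed (use K L \<phi> in auto)
      also have "\<dots> = 2 * K * L * norm h ^ Suc j" by simp
      also have "\<dots> \<le> 2 * K * L * (r / \<mu>) ^ Suc j"
        using h K L by (intro mult_left_mono power_mono) auto
      finally show ?thesis .
    qed
  qed (use K L r \<mu> in \<open>auto intro!: mult_nonneg_nonneg\<close>)
  also have "\<dots> = vol * (2 ^ CARD('d) *
       (2 * K * L / \<mu> ^ Suc j + 2 * real CARD('d) * (L / \<mu>\<^sup>2) * (L * K * (2 / \<mu>) ^ j)) * r ^ (CARD('d) + Suc j))"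
    by (simp add: \<delta>_def power_divide power_mult_distrib power_add algebra_simps)
  also have "\<dots> \<le> (unit_ball_vol (real CARD('d)) / \<mu> ^ CARD('d)) * (2 ^ CARD('d) *
       (2 * K * L / \<mu> ^ Suc j + 2 * real CARD('d) * (L / \<mu>\<^sup>2) * (L * K * (2 / \<mu>) ^ j)) * r ^ (CARD('d) + Suc j))"
    using K L \<mu> r by (intro mult_right_mono vol_le) (auto intro!: mult_nonneg_nonneg add_nonneg_nonneg)
  finally show ?thesis unfolding I1 I2 approx_const_def by (simp add: mult_ac)
qed

end

lemma half_half: "x / y = x / (2 * y) + x / (2 * y)" for x y :: real
  by (cases "y = 0") (auto simp: field_simps)

text \<open>What the LLE average at \<open>x\<close> sees of the geometry: \<open>a\<close> is the gradient of \<open>f\<close>, \<open>T\<close> the tangent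
  space, \<open>\<Delta>\<close> the Laplacian of \<open>f\<close>, and \<open>\<alpha>\<close> the density at \<open>x\<close> times the volume of the unit ball.\<close>

definition lle_geometry ::
  "nat \<Rightarrow> (real ^ 'p::finite) measure \<Rightarrow> (real ^ 'p) set \<Rightarrow> (real ^ 'p \<Rightarrow> real) \<Rightarrow> real \<Rightarrow>
   real ^ 'p \<Rightarrow> real ^ 'p \<Rightarrow> (real ^ 'p) set \<Rightarrow> real \<Rightarrow> real \<Rightarrow> bool" where
  "lle_geometry d \<nu> Z f K x a T \<alpha> \<Delta> \<longleftrightarrow>
     K \<ge> 1 \<and> subspace T \<and> a \<in> T \<and> norm a \<le> K \<and> \<bar>\<Delta>\<bar> \<le> K \<and> 1 / K \<le> \<alpha> \<and> \<alpha> \<le> K \<and>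
     (\<forall>y\<in>Z. norm (y - x) \<le> 1 / K \<longrightarrow> \<bar>f y - f x - a \<bullet> (y - x)\<bar> \<le> K * (norm (y - x))\<^sup>2 \<and>
        (\<forall>v. (\<forall>t\<in>T. t \<bullet> v = 0) \<longrightarrow> \<bar>(y - x) \<bullet> v\<bar> \<le> K * (norm (y - x))\<^sup>2 * norm v)) \<and>
     (\<forall>r. 0 < r \<longrightarrow> r \<le> 1 / K \<longrightarrow>
        \<bar>(\<integral>y. indicator (cball x r) y \<partial>\<nu>) - \<alpha> * r ^ d\<bar> \<le> K * r ^ (d + 1) \<and>
        (\<forall>i. \<bar>\<integral>y. (y - x) $ i * indicator (cball x r) y \<partial>\<nu>\<bar> \<le> K * r ^ (d + 2)) \<and>
        (\<forall>t\<in>T. (norm t)\<^sup>2 * r ^ (d + 2) / K \<le> (\<integral>y. ((y - x) \<bullet> t)\<^sup>2 * indicator (cball x r) y \<partial>\<nu>)) \<and>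
        \<bar>(\<integral>y. (f y - f x - a \<bullet> (y - x)) * indicator (cball x r) y \<partial>\<nu>)
           - \<alpha> * \<Delta> / (2 * (real d + 2)) * r ^ (d + 2)\<bar> \<le> K * r ^ (d + 3))"

lemma lle_geometry_mono:
  assumes g: "lle_geometry d \<nu> Z f K x a T \<alpha> \<Delta>" and K: "K \<le> K'"
  shows "lle_geometry d \<nu> Z f K' x a T \<alpha> \<Delta>"
proof -
  have K1: "K \<ge> 1" using g by (simp add: lle_geometry_def)
  have inv: "1 / K' \<le> 1 / K" using K K1 by (intro divide_left_mono) auto
  have up: "X \<le> K * Y \<Longrightarrow> Y \<ge> 0 \<Longrightarrow> X \<le> K' * Y" for X Y using K by (meson mult_right_mono order_trans)
  have dn: "Y / K \<le> X \<Longrightarrow> Y \<ge> 0 \<Longrightarrow> Y / K' \<le> X" for X Y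
    using K K1 by (meson divide_left_mono order_trans zero_less_one less_le_trans mult_pos_pos)
  show ?thesis
    unfolding lle_geometry_def
  proof (intro conjI ballI allI impI)
    show "K' \<ge> 1" "norm a \<le> K'" "\<bar>\<Delta>\<bar> \<le> K'" "1 / K' \<le> \<alpha>" "\<alpha> \<le> K'" "subspace T" "a \<in> T"
      using g K inv unfolding lle_geometry_def by linarith+
  next
    fix y assume y: "y \<in> Z" "norm (y - x) \<le> 1 / K'"
    then have y': "norm (y - x) \<le> 1 / K" using inv by linarith
    show "\<bar>f y - f x - a \<bullet> (y - x)\<bar> \<le> K' * (norm (y - x))\<^sup>2"
      using g y y' unfolding lle_geometry_def by (intro up) auto
    fix v assume v: "\<forall>t\<in>T. t \<bullet> v = 0"
    have "\<bar>(y - x) \<bullet> v\<bar> \<le> K * ((norm (y - x))\<^sup>2 * norm v)"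
      using g y y' v unfolding lle_geometry_def by (auto simp: mult.assoc)
    then show "\<bar>(y - x) \<bullet> v\<bar> \<le> K' * (norm (y - x))\<^sup>2 * norm v"
      unfolding mult.assoc by (rule up) simp
  next
    fix r :: real assume r: "0 < r" "r \<le> 1 / K'"
    then have r': "r \<le> 1 / K" using inv by linarith
    note gr = g[unfolded lle_geometry_def, THEN conjunct2, THEN conjunct2, THEN conjunct2, THEN conjunct2,
        THEN conjunct2, THEN conjunct2, THEN conjunct2, THEN conjunct2, rule_format, OF r(1) r']
    show "\<bar>(\<integral>y. indicator (cball x r) y \<partial>\<nu>) - \<alpha> * r ^ d\<bar> \<le> K' * r ^ (d + 1)"
      using gr r by (intro up) auto
    show "\<bar>\<integral>y. (y - x) $ i * indicator (cball x r) y \<partial>\<nu>\<bar> \<le> K' * r ^ (d + 2)" for i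
      using gr r by (intro up) auto
    show "(norm t)\<^sup>2 * r ^ (d + 2) / K' \<le> (\<integral>y. ((y - x) \<bullet> t)\<^sup>2 * indicator (cball x r) y \<partial>\<nu>)" if "t \<in> T" for t
      using gr r that by (intro dn) auto
    show "\<bar>(\<integral>y. (f y - f x - a \<bullet> (y - x)) * indicator (cball x r) y \<partial>\<nu>)
           - \<alpha> * \<Delta> / (2 * (real d + 2)) * r ^ (d + 2)\<bar> \<le> K' * r ^ (d + 3)"
      using gr r by (intro up) auto
  qed
qed

lemma lle_geometry_at_scale:
  assumes "lle_geometry d \<nu> Z f K x a T \<alpha> \<Delta>" "0 < r" "r \<le> 1 / K"
  shows "\<bar>(\<integral>y. indicator (cball x r) y \<partial>\<nu>) - \<alpha> * r ^ d\<bar> \<le> K * r ^ (d + 1)"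
    "\<bar>\<integral>y. (y - x) $ i * indicator (cball x r) y \<partial>\<nu>\<bar> \<le> K * r ^ (d + 2)"
    "t \<in> T \<Longrightarrow> (norm t)\<^sup>2 * r ^ (d + 2) / K \<le> (\<integral>y. ((y - x) \<bullet> t)\<^sup>2 * indicator (cball x r) y \<partial>\<nu>)"
    "\<bar>(\<integral>y. (f y - f x - a \<bullet> (y - x)) * indicator (cball x r) y \<partial>\<nu>)
           - \<alpha> * \<Delta> / (2 * (real d + 2)) * r ^ (d + 2)\<bar> \<le> K * r ^ (d + 3)"
  using assms unfolding lle_geometry_def by blast+

text \<open>\<open>H u\<close> is the quadratic Taylor coefficient of f along the chart after the
  ambient linear part \<open>a u\<close> has been removed, so its contraction with the inverse
  metric is the Laplacian. The radius \<open>r0\<close> is one below which a ball meets Z only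
  inside this chart, so that its integrals can be computed in coordinates.\<close>

locale local_chart_function = local_chart +
  fixes \<nu> :: "(real ^ 'b) measure" and Z :: "(real ^ 'b) set" and f :: "real ^ 'b \<Rightarrow> real" and r0 :: real
    and a :: "real ^ 'a \<Rightarrow> real ^ 'b" and H :: "real ^ 'a \<Rightarrow> 'a \<Rightarrow> 'a \<Rightarrow> real"
  assumes r0: "r0 > 0" and f: "continuous_on Z f" and \<Psi>Z: "\<Psi> ` W \<subseteq> Z"
    and covered: "\<And>u. u \<in> cball u0 s \<Longrightarrow> Z \<inter> cball (\<Psi> u) r0 \<subseteq> \<Psi> ` W"
    and chart_integral: "\<And>u r F. u \<in> cball u0 s \<Longrightarrow> 0 < r \<Longrightarrow> r \<le> r0 \<Longrightarrow> continuous_on Z F \<Longrightarrow>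
      (\<integral>y. F y * indicator (cball (\<Psi> u) r) y \<partial>\<nu>) =
      (\<integral>w. indicator W w * (indicator (cball (\<Psi> u) r) (\<Psi> w) * (F (\<Psi> w) * \<rho> w)) \<partial>lborel)"
    and a: "\<And>u. u \<in> cball u0 s \<Longrightarrow> a u \<in> range (A u) \<and> norm (a u) \<le> L"
    and taylor1: "\<And>u w. u \<in> cball u0 s \<Longrightarrow> w \<in> W \<Longrightarrow>
      \<bar>f (\<Psi> w) - f (\<Psi> u) - a u \<bullet> (\<Psi> w - \<Psi> u)\<bar> \<le> L * (norm (w - u))\<^sup>2"
    and taylor2: "\<And>u w. u \<in> cball u0 s \<Longrightarrow> w \<in> W \<Longrightarrow>
      \<bar>f (\<Psi> w) - f (\<Psi> u) - a u \<bullet> (\<Psi> w - \<Psi> u)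
        - (1/2) * (\<Sum>i\<in>UNIV. \<Sum>j\<in>UNIV. (w - u) $ i * (w - u) $ j * H u i j)\<bar> \<le> L * norm (w - u) ^ 3"
    and Hbound: "\<And>u i j. u \<in> cball u0 s \<Longrightarrow> \<bar>H u i j\<bar> \<le> L"
    and trace_bound: "\<And>u. u \<in> cball u0 s \<Longrightarrow>
       \<bar>\<Sum>i\<in>UNIV. \<Sum>j\<in>UNIV. matrix_inv (ellipsoid.Gram (A u)) $ i $ j * H u i j\<bar> \<le> L"
begin

text \<open>Each clause is \<open>integral_approx\<close> with its own order: j = 0 for the mass, j
  = 1 for the mean, whose linear leading part is odd and integrates to 0, and j = 2 for the
  covariance and the Taylor remainder, which are quadratic to leading order.\<close>

lemma lle_geometry_chart:
  "\<exists>K. \<forall>u\<in>cball u0 s. lle_geometry CARD('a) \<nu> Z f K (\<Psi> u) (a u) (range (A u)) (\<rho> u * ellipsoid.vol (A u))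
     (\<Sum>i\<in>UNIV. \<Sum>j\<in>UNIV. matrix_inv (ellipsoid.Gram (A u)) $ i $ j * H u i j)"
proof -
  let ?d = "CARD('a)"
  let ?\<omega> = "unit_ball_vol (real ?d)"
  define tr where "tr = (\<lambda>u. \<Sum>i\<in>UNIV. \<Sum>j\<in>UNIV. matrix_inv (ellipsoid.Gram (A u)) $ i $ j * H u i j)"
  have L0: "L \<ge> 0" "L > 0" using L by auto
  define C0 where "C0 = approx_const 1 0"
  define C1 where "C1 = approx_const L 1"
  \<comment> \<open>The summand 2 L L serves the squared inner products with a unit vector, and L d
    d the quadratic form with coefficients \<open>H\<close>.\<close>
  define K2 where "K2 = 2 * L * L + L * real ?d * real ?d"
  have K2: "K2 \<ge> 0" using L0 by (simp add: K2_def)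
  define C2 where "C2 = approx_const K2 2"
  have C: "C0 \<ge> 0" "C1 \<ge> 0" "C2 \<ge> 0"
    using approx_const_nonneg L0 K2 by (auto simp: C0_def C1_def C2_def)
  note C0 = C(1) and C1 = C(2) and C2 = C(3)
  note C0' = integral_approx[of _ _ 1 _ _ 0, folded C0_def, OF _ _ _ zero_le_one]
  note C1' = integral_approx[of _ _ L _ _ 1, folded C1_def, OF _ _ _ L0(1)]
  note C2' = integral_approx[of _ _ K2 _ _ 2, folded C2_def, OF _ _ _ K2]
  define \<alpha>0 where "\<alpha>0 = ?\<omega> / L ^ ?d / L"
  define \<alpha>1 where "\<alpha>1 = L * (?\<omega> / \<mu> ^ ?d)"
  have \<alpha>0: "\<alpha>0 > 0" using L by (simp add: \<alpha>0_def)
  have \<alpha>1: "\<alpha>1 > 0" using L \<mu> by (simp add: \<alpha>1_def)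
  \<comment> \<open>Every requirement on K is one summand. The last one ensures that for r \<le> 1 /
    K the covariance error C2 r takes at most half of the leading coefficient, while 1 / K fits into
    the other half.\<close>
  define K where "K = 1 + L + L / \<mu>\<^sup>2 + C0 + C1 + C2 + 1 / \<alpha>0 + \<alpha>1 + 1 / r0 + 1 / r1 + 2 * (real ?d + 2) / \<alpha>0 * (1 + C2)"
  have nn: "L / \<mu>\<^sup>2 \<ge> 0" "1 / \<alpha>0 \<ge> 0" "1 / r0 \<ge> 0" "1 / r1 \<ge> 0" "2 * (real ?d + 2) / \<alpha>0 * (1 + C2) \<ge> 0"
    using L0 \<alpha>0 r0 r1 C2 by auto
  have Kge: "K \<ge> 1" "K \<ge> L" "K \<ge> L / \<mu>\<^sup>2" "K \<ge> C0" "K \<ge> C1" "K \<ge> C2" "K \<ge> 1 / \<alpha>0" "K \<ge> \<alpha>1" "K \<ge> 1 / r0" "K \<ge> 1 / r1"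
    "K \<ge> 2 * (real ?d + 2) / \<alpha>0 * (1 + C2)"
    using nn L0 C0 C1 C2 \<alpha>1 unfolding K_def by linarith+
  have invle: "1 / K \<le> x" if "x > 0" "K \<ge> 1 / x" for x :: real
    using that Kge(1) by (simp add: field_simps)
  have rsmall: "1 / K \<le> r0" "1 / K \<le> r1" using invle r0 r1 Kge by auto
  have main: "lle_geometry ?d \<nu> Z f K (\<Psi> u) (a u) (range (A u)) (\<rho> u * ellipsoid.vol (A u)) (tr u)"
    if u: "u \<in> cball u0 s" for u
  proof -
    interpret ellipsoid "A u" \<mu> by (rule ellipsoid_A[OF u])
    have uW: "u \<in> W" by (rule sub_W[OF u])
    have \<rho>u: "1 / L \<le> \<rho> u" "\<rho> u \<le> L" using \<rho>bounds[OF uW] by auto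
    have \<rho>0: "0 < \<rho> u" using \<rho>u(1) L0 by (meson divide_pos_pos less_le_trans zero_less_one)
    have a0: "\<alpha>0 \<le> \<rho> u * vol"
    proof -
      have "\<alpha>0 = 1 / L * (?\<omega> / L ^ ?d)" by (simp add: \<alpha>0_def)
      also have "\<dots> \<le> \<rho> u * vol"
        using \<rho>u \<rho>0 vol_ge[OF L0(2) upperA[OF u]] L0 by (intro mult_mono) auto
      finally show ?thesis .
    qed
    have a1: "\<rho> u * vol \<le> \<alpha>1" unfolding \<alpha>1_def
      using \<rho>u \<rho>0 vol_le vol_pos L0 by (intro mult_mono) auto
    have \<Psi>c: "continuous_on W \<Psi>" by (rule cont(1))
    have fc: "continuous_on W (\<lambda>w. f (\<Psi> w))"
      by (rule continuous_on_compose2[OF f \<Psi>c \<Psi>Z])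
    have [measurable]: "(\<lambda>h. A u h $ i) \<in> borel_measurable borel" for i
      by (intro borel_measurable_continuous_onI continuous_intros continuous_A)
    show ?thesis
      unfolding lle_geometry_def
    proof (intro conjI ballI allI impI)
      show "1 \<le> K" by (rule Kge)
      show "subspace (range (A u))" using linA[OF u] by (simp add: linear_subspace_image)
      show "a u \<in> range (A u)" "norm (a u) \<le> K" using a[OF u] Kge(2) by auto
      show "\<bar>tr u\<bar> \<le> K" using trace_bound[OF u] Kge(2) by (simp add: tr_def)
      show "1 / K \<le> \<rho> u * vol" using invle[OF \<alpha>0 Kge(7)] a0 by linarith
      show "\<rho> u * vol \<le> K" using a1 Kge by linarith
    next
      fix y assume y: "y \<in> Z" "norm (y - \<Psi> u) \<le> 1 / K"
      then have "y \<in> Z \<inter> cball (\<Psi> u) r0" using rsmall by (auto simp: dist_norm norm_minus_commute)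
      then obtain w where w: "w \<in> W" "y = \<Psi> w" using covered[OF u] by blast
      have h: "norm (w - u) \<le> norm (y - \<Psi> u) / \<mu>" using chart_lower[OF u w(1)] \<mu> by (simp add: w field_simps)
      have h2: "L * (norm (w - u))\<^sup>2 \<le> K * (norm (y - \<Psi> u))\<^sup>2"
      proof -
        have "L * (norm (w - u))\<^sup>2 \<le> L * (norm (y - \<Psi> u) / \<mu>)\<^sup>2" using h L0 by (intro mult_left_mono power_mono) auto
        also have "\<dots> = L / \<mu>\<^sup>2 * (norm (y - \<Psi> u))\<^sup>2" by (simp add: power_divide)
        also have "\<dots> \<le> K * (norm (y - \<Psi> u))\<^sup>2" using Kge by (intro mult_right_mono) auto
        finally show ?thesis .
      qed
      show "\<bar>f y - f (\<Psi> u) - a u \<bullet> (y - \<Psi> u)\<bar> \<le> K * (norm (y - \<Psi> u))\<^sup>2"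
        using taylor1[OF u w(1)] h2 unfolding w(2) by linarith
      fix v assume v: "\<forall>t\<in>range (A u). t \<bullet> v = 0"
      have "(y - \<Psi> u) \<bullet> v = (\<Psi> w - \<Psi> u - A u (w - u)) \<bullet> v" using v by (simp add: w inner_diff_left)
      also have "\<bar>\<dots>\<bar> \<le> norm (\<Psi> w - \<Psi> u - A u (w - u)) * norm v" by (rule Cauchy_Schwarz_ineq2)
      also have "\<dots> \<le> (L * (norm (w - u))\<^sup>2) * norm v" by (intro mult_right_mono taylor u w) auto
      also have "\<dots> \<le> K * (norm (y - \<Psi> u))\<^sup>2 * norm v" by (intro mult_right_mono h2) auto
      finally show "\<bar>(y - \<Psi> u) \<bullet> v\<bar> \<le> K * (norm (y - \<Psi> u))\<^sup>2 * norm v" .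
    next
      fix r assume r: "0 < r" "r \<le> 1 / K"
      have rr: "r \<le> r0" "r \<le> r1" using r rsmall by auto
      have CK: "X \<le> K * r ^ n" if "X \<le> C * r ^ n" "C \<le> K" for X C n
        using that r by (meson less_imp_le mult_right_mono order_trans zero_le_power)
      have "(\<integral>y. indicator (cball (\<Psi> u) r) y \<partial>\<nu>) = (\<integral>y. (1 :: real) * indicator (cball (\<Psi> u) r) y \<partial>\<nu>)" by simp
      also have "\<dots> = (\<integral>w. indicator W w * (indicator (cball (\<Psi> u) r) (\<Psi> w) * (1 * \<rho> w)) \<partial>lborel)"
        by (rule chart_integral[OF u r(1) rr(1)]) simp
      finally have m0: "(\<integral>y. indicator (cball (\<Psi> u) r) y \<partial>\<nu>) = (\<integral>w. indicator W w * (indicator (cball (\<Psi> u) r) (\<Psi> w) * (1 * \<rho> w)) \<partial>lborel)" .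
      have "\<bar>(\<integral>w. indicator W w * (indicator (cball (\<Psi> u) r) (\<Psi> w) * (1 * \<rho> w)) \<partial>lborel)
         - \<rho> u * (\<integral>h. indicator (Ell r) h * 1 \<partial>lborel)\<bar> \<le> C0 * r ^ (?d + Suc 0)"
        by (rule C0'[OF u r(1) rr(2)]) auto
      then show "\<bar>(\<integral>y. indicator (cball (\<Psi> u) r) y \<partial>\<nu>) - \<rho> u * vol * r ^ ?d\<bar> \<le> K * r ^ (?d + 1)"
        unfolding m0 using integral_Ell_volume[OF r(1)] Kge(4) by (intro CK[of _ C0]) (auto simp: mult_ac)
    next
      fix r i assume r: "0 < r" "r \<le> 1 / K"
      have rr: "r \<le> r0" "r \<le> r1" using r rsmall by auto
      have m1: "(\<integral>y. (y - \<Psi> u) $ i * indicator (cball (\<Psi> u) r) y \<partial>\<nu>)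
        = (\<integral>w. indicator W w * (indicator (cball (\<Psi> u) r) (\<Psi> w) * ((\<Psi> w - \<Psi> u) $ i * \<rho> w)) \<partial>lborel)"
        by (rule chart_integral[OF u r(1) rr(1)]) (intro continuous_intros)
      have "\<bar>(\<integral>w. indicator W w * (indicator (cball (\<Psi> u) r) (\<Psi> w) * ((\<Psi> w - \<Psi> u) $ i * \<rho> w)) \<partial>lborel)
         - \<rho> u * (\<integral>h. indicator (Ell r) h * (A u h $ i) \<partial>lborel)\<bar> \<le> C1 * r ^ (?d + Suc 1)"
      proof (rule C1'[OF u r(1) rr(2)])
        show "continuous_on W (\<lambda>w. (\<Psi> w - \<Psi> u) $ i)" by (intro continuous_intros \<Psi>c)
        show "\<bar>A u h $ i\<bar> \<le> L * norm h ^ 1" for h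
          using component_le_norm_cart[of "A u h" i] upperA[OF u, of h] by simp
        show "\<bar>(\<Psi> w - \<Psi> u) $ i - A u (w - u) $ i\<bar> \<le> L * norm (w - u) ^ Suc 1" if "w \<in> W" for w
          using component_le_norm_cart[of "\<Psi> w - \<Psi> u - A u (w - u)" i] taylor[OF u that] by (simp add: power2_eq_square)
      qed measurable
      moreover have "(\<integral>h. indicator (Ell r) h * (A u h $ i) \<partial>lborel) = 0"
        by (rule integral_Ell_odd) (auto simp: linear_neg[OF linA[OF u]])
      ultimately have "\<bar>\<integral>y. (y - \<Psi> u) $ i * indicator (cball (\<Psi> u) r) y \<partial>\<nu>\<bar> \<le> C1 * r ^ (?d + 2)"
        unfolding m1 by simp
      also have "\<dots> \<le> K * r ^ (?d + 2)" using Kge r by (intro mult_right_mono) auto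
      finally show "\<bar>\<integral>y. (y - \<Psi> u) $ i * indicator (cball (\<Psi> u) r) y \<partial>\<nu>\<bar> \<le> K * r ^ (?d + 2)" .
    next
      fix r t assume r: "0 < r" "r \<le> 1 / K" and t: "t \<in> range (A u)"
      have rr: "r \<le> r0" "r \<le> r1" using r rsmall by auto
      \<comment> \<open>The claim is homogeneous of degree two in t, so unit vectors
        suffice.\<close>
      have unit: "r ^ (?d + 2) / K \<le> (\<integral>y. ((y - \<Psi> u) \<bullet> t)\<^sup>2 * indicator (cball (\<Psi> u) r) y \<partial>\<nu>)"
        if t: "t \<in> range (A u)" "norm t = 1" for t
      proof -
        obtain k where k: "t = A u k" using t by blast
        have m2: "(\<integral>y. ((y - \<Psi> u) \<bullet> t)\<^sup>2 * indicator (cball (\<Psi> u) r) y \<partial>\<nu>)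
          = (\<integral>w. indicator W w * (indicator (cball (\<Psi> u) r) (\<Psi> w) * (((\<Psi> w - \<Psi> u) \<bullet> t)\<^sup>2 * \<rho> w)) \<partial>lborel)"
          by (rule chart_integral[OF u r(1) rr(1)]) (intro continuous_intros)
        have "\<bar>(\<integral>w. indicator W w * (indicator (cball (\<Psi> u) r) (\<Psi> w) * (((\<Psi> w - \<Psi> u) \<bullet> t)\<^sup>2 * \<rho> w)) \<partial>lborel)
           - \<rho> u * (\<integral>h. indicator (Ell r) h * (A u h \<bullet> t)\<^sup>2 \<partial>lborel)\<bar> \<le> C2 * r ^ (?d + Suc 2)"
        proof (rule C2'[OF u r(1) rr(2)])
          show "continuous_on W (\<lambda>w. ((\<Psi> w - \<Psi> u) \<bullet> t)\<^sup>2)" by (intro continuous_intros \<Psi>c)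
          have in1: "\<bar>v \<bullet> t\<bar> \<le> norm v" for v using Cauchy_Schwarz_ineq2[of v t] t(2) by simp
          have LK: "2 * L * L \<le> K2" using L0 by (simp add: K2_def)
          show "\<bar>(A u h \<bullet> t)\<^sup>2\<bar> \<le> K2 * norm h ^ 2" for h
          proof -
            have "\<bar>A u h \<bullet> t\<bar> \<le> L * norm h" using in1[of "A u h"] upperA[OF u, of h] by linarith
            then have "\<bar>A u h \<bullet> t\<bar>\<^sup>2 \<le> (L * norm h)\<^sup>2" by (rule power_mono) simp
            then have "(A u h \<bullet> t)\<^sup>2 \<le> (L * L) * norm h ^ 2" by (simp add: power2_eq_square mult_ac)
            also have "\<dots> \<le> K2 * norm h ^ 2" using LK L0 by (intro mult_right_mono) (auto intro: order_trans[of _ "2 * L * L"])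
            finally show ?thesis by simp
          qed
          show "\<bar>((\<Psi> w - \<Psi> u) \<bullet> t)\<^sup>2 - (A u (w - u) \<bullet> t)\<^sup>2\<bar> \<le> K2 * norm (w - u) ^ Suc 2" if w: "w \<in> W" for w
          proof -
            let ?x = "\<Psi> w - \<Psi> u" and ?y = "A u (w - u)"
            have "(?x \<bullet> t)\<^sup>2 - (?y \<bullet> t)\<^sup>2 = ((?x - ?y) \<bullet> t) * (?x \<bullet> t + ?y \<bullet> t)"
              unfolding inner_diff_left[of ?x ?y] by (simp add: power2_eq_square algebra_simps)
            also have "\<bar>\<dots>\<bar> \<le> (L * (norm (w - u))\<^sup>2) * (2 * L * norm (w - u))"
              unfolding abs_mult
            proof (rule mult_mono)
              show "\<bar>(?x - ?y) \<bullet> t\<bar> \<le> L * (norm (w - u))\<^sup>2" using in1[of "?x - ?y"] taylor[OF u w] by linarith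
              show "\<bar>?x \<bullet> t + ?y \<bullet> t\<bar> \<le> 2 * L * norm (w - u)"
                using in1[of ?x] in1[of ?y] chart_upper[OF u w] upperA[OF u, of "w - u"] by linarith
            qed (use L0 in auto)
            also have "\<dots> = (2 * L * L) * norm (w - u) ^ Suc 2" by (simp add: eval_nat_numeral)
            also have "\<dots> \<le> K2 * norm (w - u) ^ Suc 2" by (intro mult_right_mono LK) auto
            finally show ?thesis .
          qed
        qed measurable
        moreover have "(\<integral>h. indicator (Ell r) h * (A u h \<bullet> t)\<^sup>2 \<partial>lborel) = r ^ (?d + 2) * vol / (real ?d + 2)"
        proof -
          let ?b = "\<lambda>i. A u (axis i 1) \<bullet> t"
          have "(A u h \<bullet> t)\<^sup>2 = (\<Sum>i\<in>UNIV. \<Sum>j\<in>UNIV. h $ i * h $ j * (?b i * ?b j))" for h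
            by (subst A_expand[of h]) (simp add: inner_sum_left power2_eq_square sum_product mult_ac)
          then have "(\<integral>h. indicator (Ell r) h * (A u h \<bullet> t)\<^sup>2 \<partial>lborel) =
              r ^ (?d + 2) * vol / (real ?d + 2) * (\<Sum>i\<in>UNIV. \<Sum>j\<in>UNIV. matrix_inv Gram $ i $ j * (?b i * ?b j))"
            using integral_Ell_quadratic[OF r(1), of "\<lambda>i j. ?b i * ?b j"] by simp
          \<comment> \<open>With t = A k the vector of the inner products \<open>?b\<close> is Gram
            k, so the double sum is k . Gram k = |A k|^2 = |t|^2.\<close>
          also have "(\<Sum>i\<in>UNIV. \<Sum>j\<in>UNIV. matrix_inv Gram $ i $ j * (?b i * ?b j)) = 1"
          proof -
            have bG: "?b j = (Gram *v k) $ j" for j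
              unfolding k using inner_A_Gram[of k j] by (simp add: matrix_vector_mult_def inner_commute)
            have "(\<Sum>j\<in>UNIV. matrix_inv Gram $ i $ j * ?b j) = k $ i" for i
            proof -
              have "(\<Sum>j\<in>UNIV. matrix_inv Gram $ i $ j * ?b j) = (matrix_inv Gram *v (Gram *v k)) $ i"
                unfolding bG by (simp add: matrix_vector_mult_def)
              then show ?thesis using det_Gram by (simp add: matrix_vector_mul_assoc matrix_inv_props)
            qed
            then have "(\<Sum>i\<in>UNIV. \<Sum>j\<in>UNIV. matrix_inv Gram $ i $ j * (?b i * ?b j)) = (\<Sum>i\<in>UNIV. k $ i * ?b i)"
              by (simp add: sum_distrib_right[symmetric] mult.left_commute[of _ "?b _"] sum_distrib_left[symmetric])
                 (simp add: mult.commute)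
            also have "\<dots> = A u k \<bullet> t" by (subst A_expand[of k]) (simp add: inner_sum_left)
            also have "\<dots> = 1" using t(2) by (simp add: k[symmetric] dot_square_norm)
            finally show ?thesis .
          qed
          finally show ?thesis by simp
        qed
        ultimately have low: "\<rho> u * (r ^ (?d + 2) * vol / (real ?d + 2)) - C2 * r ^ (?d + 3) \<le> (\<integral>y. ((y - \<Psi> u) \<bullet> t)\<^sup>2 * indicator (cball (\<Psi> u) r) y \<partial>\<nu>)"
          unfolding m2 by (simp add: eval_nat_numeral)
        have q1: "\<alpha>0 / (real ?d + 2) \<le> \<rho> u * vol / (real ?d + 2)" using a0 by (intro divide_right_mono) auto
        have q2: "C2 * r \<le> \<alpha>0 / (2 * (real ?d + 2))" "1 / K \<le> \<alpha>0 / (2 * (real ?d + 2))"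
        proof -
          have "2 * (real ?d + 2) / \<alpha>0 * (1 + C2) * (1 / K) \<le> K * (1 / K)" using Kge by (intro mult_right_mono) auto
          then have "(1 + C2) * (1 / K) \<le> \<alpha>0 / (2 * (real ?d + 2))" using \<alpha>0 Kge(1) by (simp add: field_simps)
          moreover have "C2 * r \<le> C2 * (1 / K)" using r C2 by (intro mult_left_mono) auto
          moreover have "0 \<le> C2 * (1 / K)" "0 \<le> 1 / K" using C2 Kge(1) by auto
          ultimately show "C2 * r \<le> \<alpha>0 / (2 * (real ?d + 2))" "1 / K \<le> \<alpha>0 / (2 * (real ?d + 2))"
            unfolding distrib_right mult_1_left by linarith+
        qed
        have "1 / K \<le> \<rho> u * vol / (real ?d + 2) - C2 * r"
        proof -
          have "\<alpha>0 / (real ?d + 2) = \<alpha>0 / (2 * (real ?d + 2)) + \<alpha>0 / (2 * (real ?d + 2))"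
            using half_half[of \<alpha>0 "real ?d + 2"] .
          moreover have "q \<le> z - p" if "x = y + y" "x \<le> z" "p \<le> y" "q \<le> y" for x y z p q :: real
            using that by linarith
          ultimately show ?thesis using q1 q2 by blast
        qed
        then have "1 / K * r ^ (?d + 2) \<le> (\<rho> u * vol / (real ?d + 2) - C2 * r) * r ^ (?d + 2)"
          using r by (intro mult_right_mono) auto
        also have "\<dots> = \<rho> u * (r ^ (?d + 2) * vol / (real ?d + 2)) - C2 * r ^ (?d + 3)"
          by (simp add: algebra_simps eval_nat_numeral)
        finally show ?thesis using low by simp
      qed
      show "(norm t)\<^sup>2 * r ^ (?d + 2) / K \<le> (\<integral>y. ((y - \<Psi> u) \<bullet> t)\<^sup>2 * indicator (cball (\<Psi> u) r) y \<partial>\<nu>)"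
      proof (cases "t = 0")
        case False
        define t' where "t' = (1 / norm t) *\<^sub>R t"
        have t': "t' \<in> range (A u)" "norm t' = 1"
        proof -
          have "subspace (range (A u))" using linA[OF u] by (simp add: linear_subspace_image)
          then show "t' \<in> range (A u)" unfolding t'_def using t by (rule subspace_mul)
          show "norm t' = 1" using False by (simp add: t'_def)
        qed
        have tt: "t = norm t *\<^sub>R t'" using False by (simp add: t'_def)
        have "(\<integral>y. ((y - \<Psi> u) \<bullet> t)\<^sup>2 * indicator (cball (\<Psi> u) r) y \<partial>\<nu>) =
            (\<integral>y. (norm t)\<^sup>2 * (((y - \<Psi> u) \<bullet> t')\<^sup>2 * indicator (cball (\<Psi> u) r) y) \<partial>\<nu>)"
          by (subst tt) (simp add: power_mult_distrib mult_ac)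
        also have "\<dots> = (norm t)\<^sup>2 * (\<integral>y. ((y - \<Psi> u) \<bullet> t')\<^sup>2 * indicator (cball (\<Psi> u) r) y \<partial>\<nu>)" by simp
        also have "\<dots> \<ge> (norm t)\<^sup>2 * (r ^ (?d + 2) / K)" by (intro mult_left_mono unit t') auto
        finally show ?thesis by simp
      qed simp
    next
      fix r assume r: "0 < r" "r \<le> 1 / K"
      have rr: "r \<le> r0" "r \<le> r1" using r rsmall by auto
      let ?q = "\<lambda>y. f y - f (\<Psi> u) - a u \<bullet> (y - \<Psi> u)"
      let ?\<phi> = "\<lambda>h. (1/2) * (\<Sum>i\<in>UNIV. \<Sum>j\<in>UNIV. h $ i * h $ j * H u i j)"
      have mq: "(\<integral>y. ?q y * indicator (cball (\<Psi> u) r) y \<partial>\<nu>)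
        = (\<integral>w. indicator W w * (indicator (cball (\<Psi> u) r) (\<Psi> w) * (?q (\<Psi> w) * \<rho> w)) \<partial>lborel)"
        by (rule chart_integral[OF u r(1) rr(1)]) (intro continuous_intros f)
      have "\<bar>(\<integral>w. indicator W w * (indicator (cball (\<Psi> u) r) (\<Psi> w) * (?q (\<Psi> w) * \<rho> w)) \<partial>lborel)
         - \<rho> u * (\<integral>h. indicator (Ell r) h * ?\<phi> h \<partial>lborel)\<bar> \<le> C2 * r ^ (?d + Suc 2)"
      proof (rule C2'[OF u r(1) rr(2)])
        show "continuous_on W (\<lambda>w. ?q (\<Psi> w))" by (intro continuous_intros \<Psi>c fc)
        show "\<bar>?\<phi> h\<bar> \<le> K2 * norm h ^ 2" for h
        proof -
          have "\<bar>\<Sum>i\<in>UNIV. \<Sum>j\<in>UNIV. h $ i * h $ j * H u i j\<bar> \<le> (\<Sum>i\<in>(UNIV::'a set). \<Sum>j\<in>(UNIV::'a set). norm h * norm h * L)"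
          proof (intro order_trans[OF sum_abs] sum_mono)
            show "\<bar>h $ i * h $ j * H u i j\<bar> \<le> norm h * norm h * L" for i j
              unfolding abs_mult using Hbound[OF u] L0 component_le_norm_cart[of h] by (intro mult_mono) auto
          qed
          also have "\<dots> = (L * real ?d * real ?d) * norm h ^ 2" by (simp add: power2_eq_square)
          finally have 1: "\<bar>\<Sum>i\<in>UNIV. \<Sum>j\<in>UNIV. h $ i * h $ j * H u i j\<bar> \<le> (L * real ?d * real ?d) * norm h ^ 2" .
          have 2: "(L * real ?d * real ?d) * norm h ^ 2 \<le> K2 * norm h ^ 2"
            using L0 by (intro mult_right_mono) (auto simp: K2_def)
          show ?thesis using 1 2 by (simp add: abs_mult)
        qed
        show "\<bar>?q (\<Psi> w) - ?\<phi> (w - u)\<bar> \<le> K2 * norm (w - u) ^ Suc 2" if w: "w \<in> W" for w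
        proof -
          have "L \<le> K2"
          proof -
            have "1 * L \<le> 2 * L * L" using L by (intro mult_right_mono) auto
            moreover have "0 \<le> L * real ?d * real ?d" using L0 by simp
            ultimately show ?thesis by (simp add: K2_def)
          qed
          then have "L * norm (w - u) ^ 3 \<le> K2 * norm (w - u) ^ 3" by (intro mult_right_mono) auto
          then show ?thesis using taylor2[OF u w] by (simp only: eval_nat_numeral)
        qed
      qed measurable
      note bound = this
      have i\<phi>: "(\<integral>h. indicator (Ell r) h * ?\<phi> h \<partial>lborel) = r ^ (?d + 2) * vol / (real ?d + 2) * tr u / 2"
      proof -
        have "(\<integral>h. indicator (Ell r) h * ?\<phi> h \<partial>lborel) = (\<integral>h. 1/2 * (indicator (Ell r) h * (\<Sum>i\<in>UNIV. \<Sum>j\<in>UNIV. h $ i * h $ j * H u i j)) \<partial>lborel)"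
          by (simp add: mult_ac)
        also have "\<dots> = 1/2 * (\<integral>h. (indicator (Ell r) h * (\<Sum>i\<in>UNIV. \<Sum>j\<in>UNIV. h $ i * h $ j * H u i j)) \<partial>lborel)"
          by (rule integral_mult_right_zero)
        finally have half: "(\<integral>h. indicator (Ell r) h * ?\<phi> h \<partial>lborel) =
            1/2 * (r ^ (?d + 2) * vol / (real ?d + 2) * tr u)"
          unfolding integral_Ell_quadratic[OF r(1)] tr_def .
        have "1/2 * Y = Y / 2" for Y :: real by simp
        then show ?thesis unfolding half .
      qed
      have rearrange: "\<rho> u * (r ^ (?d + 2) * vol / (real ?d + 2) * tr u / 2) = \<rho> u * vol * tr u / (2 * (real ?d + 2)) * r ^ (?d + 2)"
      proof -
        have "p * (R * v / n * t / 2) = p * v * t / (2 * n) * R" for p R v n t :: real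
          by (cases "n = 0") (auto simp: field_simps)
        then show ?thesis .
      qed
      have "\<bar>(\<integral>y. ?q y * indicator (cball (\<Psi> u) r) y \<partial>\<nu>)
           - \<rho> u * vol * tr u / (2 * (real ?d + 2)) * r ^ (?d + 2)\<bar> \<le> C2 * r ^ (?d + Suc 2)"
        using bound unfolding mq i\<phi> rearrange .
      also have "\<dots> \<le> K * r ^ (?d + Suc 2)" using Kge r by (intro mult_right_mono) auto
      finally show "\<bar>(\<integral>y. ?q y * indicator (cball (\<Psi> u) r) y \<partial>\<nu>)
           - \<rho> u * vol * tr u / (2 * (real ?d + 2)) * r ^ (?d + 2)\<bar> \<le> K * r ^ (?d + 3)"
        by (simp add: eval_nat_numeral)
    qed
  qed
  then show ?thesis unfolding tr_def by blast
qed

end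

section \<open>Bounded Lipschitz functions and local bounds for immersions\<close>

definition lipschitz_bounded :: "'a::real_normed_vector set \<Rightarrow> ('a \<Rightarrow> real) \<Rightarrow> bool" where
  "lipschitz_bounded S f \<longleftrightarrow>
     (\<exists>K\<ge>0. \<forall>u\<in>S. \<bar>f u\<bar> \<le> K \<and> (\<forall>w\<in>S. \<bar>f w - f u\<bar> \<le> K * norm (w - u)))"

lemma lipschitz_bounded_const: "lipschitz_bounded S (\<lambda>_. c)"
  unfolding lipschitz_bounded_def by (intro exI[of _ "\<bar>c\<bar>"]) auto

lemma lipschitz_bounded_add:
  assumes "lipschitz_bounded S f" "lipschitz_bounded S g"
  shows "lipschitz_bounded S (\<lambda>x. f x + g x)"
proof -
  obtain K K' where K: "K \<ge> 0" "\<And>u. u \<in> S \<Longrightarrow> \<bar>f u\<bar> \<le> K" "\<And>u w. u \<in> S \<Longrightarrow> w \<in> S \<Longrightarrow> \<bar>f w - f u\<bar> \<le> K * norm (w - u)"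
    and K': "K' \<ge> 0" "\<And>u. u \<in> S \<Longrightarrow> \<bar>g u\<bar> \<le> K'" "\<And>u w. u \<in> S \<Longrightarrow> w \<in> S \<Longrightarrow> \<bar>g w - g u\<bar> \<le> K' * norm (w - u)"
    using assms unfolding lipschitz_bounded_def by blast
  have "\<bar>f u + g u\<bar> \<le> K + K'" if "u \<in> S" for u using K(2)[OF that] K'(2)[OF that] by linarith
  moreover have "\<bar>f w + g w - (f u + g u)\<bar> \<le> (K + K') * norm (w - u)" if "u \<in> S" "w \<in> S" for u w
    using K(3)[OF that] K'(3)[OF that] unfolding distrib_right by linarith
  ultimately show ?thesis using K K' unfolding lipschitz_bounded_def by (intro exI[of _ "K + K'"]) auto
qed

text \<open>Boundedness is part of the predicate for this reason: the product rule for differences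
  needs bounds on the factors. The factor 2 lets one constant serve as bound and as Lipschitz
  constant.\<close>

lemma lipschitz_bounded_mult:
  assumes "lipschitz_bounded S f" "lipschitz_bounded S g"
  shows "lipschitz_bounded S (\<lambda>x. f x * g x)"
proof -
  obtain K K' where K: "K \<ge> 0" "\<And>u. u \<in> S \<Longrightarrow> \<bar>f u\<bar> \<le> K" "\<And>u w. u \<in> S \<Longrightarrow> w \<in> S \<Longrightarrow> \<bar>f w - f u\<bar> \<le> K * norm (w - u)"
    and K': "K' \<ge> 0" "\<And>u. u \<in> S \<Longrightarrow> \<bar>g u\<bar> \<le> K'" "\<And>u w. u \<in> S \<Longrightarrow> w \<in> S \<Longrightarrow> \<bar>g w - g u\<bar> \<le> K' * norm (w - u)"
    using assms unfolding lipschitz_bounded_def by blast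
  have "\<bar>f u * g u\<bar> \<le> 2 * K * K'" if "u \<in> S" for u
  proof -
    have "\<bar>f u * g u\<bar> \<le> K * K'" unfolding abs_mult using K K' that by (intro mult_mono) auto
    moreover have "0 \<le> K * K'" using K K' by simp
    ultimately show ?thesis by linarith
  qed
  moreover have "\<bar>f w * g w - f u * g u\<bar> \<le> 2 * K * K' * norm (w - u)" if "u \<in> S" "w \<in> S" for u w
  proof -
    have "\<bar>f w * g w - f u * g u\<bar> = \<bar>(f w - f u) * g w + f u * (g w - g u)\<bar>" by (simp add: algebra_simps)
    also have "\<dots> \<le> \<bar>f w - f u\<bar> * \<bar>g w\<bar> + \<bar>f u\<bar> * \<bar>g w - g u\<bar>"
      by (metis abs_mult abs_triangle_ineq)
    also have "\<dots> \<le> (K * norm (w - u)) * K' + K * (K' * norm (w - u))"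
      using K K' that by (intro add_mono mult_mono) auto
    finally show ?thesis by (simp add: algebra_simps)
  qed
  ultimately show ?thesis using K K' unfolding lipschitz_bounded_def by (intro exI[of _ "2 * K * K'"]) auto
qed

lemma lipschitz_bounded_sum:
  assumes "finite I" "\<And>i. i \<in> I \<Longrightarrow> lipschitz_bounded S (f i)"
  shows "lipschitz_bounded S (\<lambda>x. \<Sum>i\<in>I. f i x)"
  using assms by (induction I) (auto intro: lipschitz_bounded_const lipschitz_bounded_add)

lemma lipschitz_bounded_prod:
  assumes "finite I" "\<And>i. i \<in> I \<Longrightarrow> lipschitz_bounded S (f i)"
  shows "lipschitz_bounded S (\<lambda>x. \<Prod>i\<in>I. f i x)"
  using assms by (induction I) (auto intro: lipschitz_bounded_const lipschitz_bounded_mult)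

lemma lipschitz_bounded_det:
  fixes G :: "'a::real_normed_vector \<Rightarrow> real ^ 'd::finite ^ 'd"
  assumes "\<And>i j. lipschitz_bounded S (\<lambda>x. G x $ i $ j)"
  shows "lipschitz_bounded S (\<lambda>x. det (G x))"
  unfolding det_def
  by (intro lipschitz_bounded_sum lipschitz_bounded_mult lipschitz_bounded_const lipschitz_bounded_prod assms)
     (auto simp: finite_permutations)

text \<open>A difference of square roots is the difference of the arguments divided by the sum of
  the roots, and this sum stays above sqrt c. It is applied to det g, which has a positive minimum
  on a compact set.\<close>

lemma lipschitz_bounded_sqrt:
  assumes f: "lipschitz_bounded S f" and c: "c > 0" "\<And>x. x \<in> S \<Longrightarrow> c \<le> f x"
  shows "lipschitz_bounded S (\<lambda>x. sqrt (f x))"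
proof -
  obtain K where K: "K \<ge> 0" "\<And>u. u \<in> S \<Longrightarrow> \<bar>f u\<bar> \<le> K" "\<And>u w. u \<in> S \<Longrightarrow> w \<in> S \<Longrightarrow> \<bar>f w - f u\<bar> \<le> K * norm (w - u)"
    using f unfolding lipschitz_bounded_def by blast
  have sc: "sqrt c > 0" using c by simp
  have "\<bar>sqrt (f w) - sqrt (f u)\<bar> \<le> K / sqrt c * norm (w - u)" if uw: "u \<in> S" "w \<in> S" for u w
  proof -
    have pos: "sqrt c \<le> sqrt (f w)" "sqrt c \<le> sqrt (f u)" using c uw by auto
    have "(sqrt (f w) - sqrt (f u)) * (sqrt (f w) + sqrt (f u)) = f w - f u"
      using c(2)[OF uw(1)] c(2)[OF uw(2)] c(1)
      by (simp add: algebra_simps)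
    then have "\<bar>sqrt (f w) - sqrt (f u)\<bar> * (sqrt (f w) + sqrt (f u)) = \<bar>f w - f u\<bar>"
      using pos sc by (metis abs_mult abs_of_pos add_pos_pos less_le_trans)
    moreover have "\<bar>sqrt (f w) - sqrt (f u)\<bar> * sqrt c \<le> \<bar>sqrt (f w) - sqrt (f u)\<bar> * (sqrt (f w) + sqrt (f u))"
    proof (rule mult_left_mono)
      show "sqrt c \<le> sqrt (f w) + sqrt (f u)" using pos sc by linarith
    qed simp
    ultimately have "\<bar>sqrt (f w) - sqrt (f u)\<bar> * sqrt c \<le> K * norm (w - u)" using K(3)[OF uw] by linarith
    then show ?thesis using sc by (simp add: field_simps)
  qed
  moreover have "\<bar>sqrt (f u)\<bar> \<le> sqrt K" if "u \<in> S" for u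
    using K(2)[OF that] c(2)[OF that] c(1) by auto
  ultimately have "\<forall>u\<in>S. \<bar>sqrt (f u)\<bar> \<le> sqrt K + K / sqrt c \<and> (\<forall>w\<in>S. \<bar>sqrt (f w) - sqrt (f u)\<bar> \<le> (sqrt K + K / sqrt c) * norm (w - u))"
    using K(1) sc by (auto simp: distrib_right intro: add_increasing add_increasing2)
  then show ?thesis unfolding lipschitz_bounded_def using K(1) sc by (intro exI[of _ "sqrt K + K / sqrt c"]) auto
qed

lemma Ck_on_lipschitz_bounded:
  fixes h :: "real ^ 'd::finite \<Rightarrow> real"
  assumes h: "Ck_on 1 U h" and S: "S \<subseteq> U" "convex S" "compact S"
  shows "lipschitz_bounded S h"
proof -
  obtain K where K: "K \<ge> 0" "\<And>u w. u \<in> S \<Longrightarrow> w \<in> S \<Longrightarrow> \<bar>h w - h u\<bar> \<le> K * norm (w - u)"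
    using Ck_on_lipschitz[OF h S] by auto
  have "continuous_on S h" using Ck_on_continuous[OF h] S(1) by (rule continuous_on_subset)
  then have "bounded (h ` S)" using S(3) by (intro compact_imp_bounded compact_continuous_image)
  then obtain B where B: "\<And>u. u \<in> S \<Longrightarrow> \<bar>h u\<bar> \<le> B" by (auto simp: bounded_iff)
  have "\<bar>h w - h u\<bar> \<le> (K + \<bar>B\<bar>) * norm (w - u)" if "u \<in> S" "w \<in> S" for u w
    using K(2)[OF that] by (simp add: distrib_right add_increasing2)
  moreover have "\<bar>h u\<bar> \<le> K + \<bar>B\<bar>" if "u \<in> S" for u using B[OF that] K(1) by linarith
  ultimately show ?thesis unfolding lipschitz_bounded_def using K(1) by (intro exI[of _ "K + \<bar>B\<bar>"]) auto
qed

text \<open>At u0 the derivative stretches by at least m. On a ball so small that the derivative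
  moves by at most m / 2, half of this survives, and the mean value inequality for \<Psi> minus its
  linear part at u0 transfers it to increments of \<Psi>.\<close>

lemma immersion_local_lower_bound:
  fixes \<Psi> :: "real ^ 'd::finite \<Rightarrow> real ^ 'p::finite"
  assumes \<Psi>: "Ck_on 2 U \<Psi>" and U: "open U" "u0 \<in> U" and inj: "inj (frechet_derivative \<Psi> (at u0))"
  shows "\<exists>s>0. \<exists>\<mu>>0. cball u0 (2 * s) \<subseteq> U \<and>
    (\<forall>u\<in>cball u0 (2 * s). \<forall>h. \<mu> * norm h \<le> norm (frechet_derivative \<Psi> (at u) h)) \<and>
    (\<forall>u\<in>cball u0 (2 * s). \<forall>w\<in>cball u0 (2 * s). \<mu> * norm (w - u) \<le> norm (\<Psi> w - \<Psi> u))"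
proof -
  have \<Psi>2: "Ck_on (Suc 1) U \<Psi>" using \<Psi> by (simp add: numeral_2_eq_2)
  let ?D = "\<lambda>u. frechet_derivative \<Psi> (at u)"
  have lin: "linear (?D u)" if "u \<in> U" for u using Ck_on_linear[OF \<Psi>2 that] .
  obtain m where m: "m > 0" "\<And>h. m * norm h \<le> norm (?D u0 h)"
    using linear_inj_bounded_below_pos[OF lin[OF U(2)] inj] by blast
  obtain e where e: "e > 0" "cball u0 e \<subseteq> U" using U open_contains_cball by blast
  have "\<exists>K\<ge>0. \<forall>u\<in>cball u0 e. \<forall>w\<in>cball u0 e. norm (?D w (axis i 1) - ?D u (axis i 1)) \<le> K * norm (w - u)" for i
    by (rule Ck_on_lipschitz[OF Ck_on_direction[OF \<Psi>2] e(2)]) auto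
  then obtain B where B: "\<And>i. B i \<ge> 0" "\<And>i u w. u \<in> cball u0 e \<Longrightarrow> w \<in> cball u0 e \<Longrightarrow>
      norm (?D w (axis i 1) - ?D u (axis i 1)) \<le> B i * norm (w - u)"
    by metis
  define K where "K = (\<Sum>i\<in>UNIV. B i) + 1"
  have K: "K > 0" using B(1) by (simp add: K_def add_nonneg_pos sum_nonneg)
  define s where "s = min (e / 2) (m / (4 * K))"
  have s: "s > 0" "2 * s \<le> e" "K * (2 * s) \<le> m / 2"
  proof -
    show "s > 0" "2 * s \<le> e" using e m K by (auto simp: s_def)
    have "s \<le> m / (4 * K)" by (simp add: s_def)
    then show "K * (2 * s) \<le> m / 2" using K by (simp add: field_simps)
  qed
  have sub: "cball u0 (2 * s) \<subseteq> cball u0 e" using s by auto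
  have close: "norm (?D w h - ?D u0 h) \<le> m / 2 * norm h" if w: "w \<in> cball u0 (2 * s)" for w h
  proof -
    have wU: "w \<in> U" "w \<in> cball u0 e" using w sub e by auto
    have "norm (?D w h - ?D u0 h) \<le> (\<Sum>i\<in>UNIV. B i * norm (w - u0)) * norm h"
      using B(2)[of u0 w] wU e by (intro linear_axis_bound linear_compose_sub lin U wU) auto
    also have "(\<Sum>i\<in>UNIV. B i * norm (w - u0)) \<le> K * (2 * s)"
      unfolding sum_distrib_right[symmetric] K_def using w B(1)
      by (intro mult_mono) (auto simp: dist_norm norm_minus_commute sum_nonneg)
    then have "(\<Sum>i\<in>UNIV. B i * norm (w - u0)) * norm h \<le> m / 2 * norm h" using s by (intro mult_right_mono) auto
    finally show ?thesis .
  qed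
  have 1: "m / 2 * norm h \<le> norm (?D u h)" if "u \<in> cball u0 (2 * s)" for u h
  proof -
    have "norm (?D u0 h) \<le> norm (?D u h) + norm (?D u h - ?D u0 h)"
      using norm_triangle_ineq4[of "?D u h" "?D u h - ?D u0 h"] by simp
    then show ?thesis using close[OF that, of h] m(2)[of h] by linarith
  qed
  have 2: "m / 2 * norm (w - u) \<le> norm (\<Psi> w - \<Psi> u)" if uw: "u \<in> cball u0 (2 * s)" "w \<in> cball u0 (2 * s)" for u w
  proof -
    have bl: "bounded_linear (?D u0)" using lin[OF U(2)] by (simp add: linear_conv_bounded_linear)
    have "norm ((\<Psi> w - ?D u0 w) - (\<Psi> u - ?D u0 u)) \<le> m / 2 * norm (w - u)"
    proof (rule differentiable_bound[of "cball u0 (2 * s)" "\<lambda>x. \<Psi> x - ?D u0 x" "\<lambda>x h. ?D x h - ?D u0 h"])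
      fix x assume x: "x \<in> cball u0 (2 * s)"
      then have xU: "x \<in> U" using sub e by auto
      show "((\<lambda>x. \<Psi> x - ?D u0 x) has_derivative (\<lambda>h. ?D x h - ?D u0 h)) (at x within cball u0 (2 * s))"
        by (intro has_derivative_diff has_derivative_at_withinI[OF Ck_on_has_derivative[OF \<Psi>2 xU]]
              bounded_linear_imp_has_derivative[OF bl])
      show "onorm (\<lambda>h. ?D x h - ?D u0 h) \<le> m / 2"
        using close[OF x] m by (intro onorm_bound) auto
    qed (use uw in auto)
    moreover have "(\<Psi> w - ?D u0 w) - (\<Psi> u - ?D u0 u) = (\<Psi> w - \<Psi> u) - ?D u0 (w - u)"
      by (simp add: linear_diff[OF lin[OF U(2)]])
    ultimately have "norm ((\<Psi> w - \<Psi> u) - ?D u0 (w - u)) \<le> m / 2 * norm (w - u)" by simp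
    moreover have "norm (?D u0 (w - u)) \<le> norm (\<Psi> w - \<Psi> u) + norm ((\<Psi> w - \<Psi> u) - ?D u0 (w - u))"
      using norm_triangle_ineq4[of "\<Psi> w - \<Psi> u" "(\<Psi> w - \<Psi> u) - ?D u0 (w - u)"] by simp
    ultimately show ?thesis using m(2)[of "w - u"] by linarith
  qed
  show ?thesis
    using s(1) m(1) sub e(2) 1 2 by (intro exI[of _ s] conjI exI[of _ "m / 2"]) auto
qed

lemma second_derivative_expand:
  fixes h :: "real ^ 'd::finite \<Rightarrow> 'b::real_normed_vector"
  assumes h: "Ck_on 3 U h" and U: "open U" "u \<in> U"
  shows "frechet_derivative (\<lambda>x. frechet_derivative h (at x) v) (at u) v =
    (\<Sum>i\<in>UNIV. \<Sum>j\<in>UNIV. (v $ i * v $ j) *\<^sub>R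
       frechet_derivative (\<lambda>x. frechet_derivative h (at x) (axis j 1)) (at u) (axis i 1))"
proof -
  define B where "B = (\<lambda>a b. frechet_derivative (\<lambda>x. frechet_derivative h (at x) a) (at u) b)"
  have h3: "Ck_on (Suc 2) U h" using h by (simp add: numeral_3_eq_3 numeral_2_eq_2)
  have lin: "linear (B a)" for a unfolding B_def
    using Ck_on_linear[of 1 U "\<lambda>x. frechet_derivative h (at x) a" u] Ck_on_direction[OF h3, of a] U
    by (simp add: numeral_2_eq_2)
  have sym: "B a b = B b a" for a b unfolding B_def by (rule Ck_on_second_symmetric[OF h U])
  have "B v v = (\<Sum>i\<in>UNIV. (v $ i) *\<^sub>R B v (axis i 1))" by (rule linear_axis_expand[OF lin])
  also have "\<dots> = (\<Sum>i\<in>UNIV. (v $ i) *\<^sub>R B (axis i 1) v)" by (intro sum.cong refl) (simp only: sym[of v])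
  also have "\<dots> = (\<Sum>i\<in>UNIV. \<Sum>j\<in>UNIV. (v $ i * v $ j) *\<^sub>R B (axis i 1) (axis j 1))"
    by (subst linear_axis_expand[OF lin, of _ v]) (simp add: scaleR_sum_right)
  also have "\<dots> = (\<Sum>i\<in>UNIV. \<Sum>j\<in>UNIV. (v $ i * v $ j) *\<^sub>R B (axis j 1) (axis i 1))"
    by (intro sum.cong refl) (simp only: sym)
  finally show ?thesis unfolding B_def .
qed

text \<open>Data found in different charts have to agree, both to define one gradient on Z and to
  reach the chart chosen inside \<open>laplace_beltrami\<close>. The difference b of the two
  gradients satisfies b . (y - x) = O(r^2) on Z, so its component in either tangent space
  contradicts the lower covariance bound unless it is 0. As a1 and a2 lie in these tangent spaces, b
  . b = 0. The mass then determines \<alpha>, and the integral of the Taylor remainder determines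
  \<Delta>.\<close>

lemma lle_geometry_unique:
  assumes g1: "lle_geometry d \<nu> Z f K1 x a1 T1 \<alpha>1 \<Delta>1" and g2: "lle_geometry d \<nu> Z f K2 x a2 T2 \<alpha>2 \<Delta>2"
    and \<nu>: "finite_measure \<nu>" "space \<nu> = Z" "\<And>r. (indicator (cball x r) :: _ \<Rightarrow> real) \<in> borel_measurable \<nu>"
  shows "a1 = a2" "\<Delta>1 = \<Delta>2"
proof -
  define K where "K = max K1 K2"
  have g: "lle_geometry d \<nu> Z f K x a1 T1 \<alpha>1 \<Delta>1" "lle_geometry d \<nu> Z f K x a2 T2 \<alpha>2 \<Delta>2"
    using g1 g2 by (auto intro: lle_geometry_mono simp: K_def)
  have K1: "K \<ge> 1" using g(1) by (simp add: lle_geometry_def)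
  define b where "b = a1 - a2"
  have quad: "\<bar>b \<bullet> (y - x)\<bar> \<le> 2 * K * (norm (y - x))\<^sup>2" if "y \<in> Z" "norm (y - x) \<le> 1 / K" for y
  proof -
    have "\<bar>f y - f x - a1 \<bullet> (y - x)\<bar> \<le> K * (norm (y - x))\<^sup>2" "\<bar>f y - f x - a2 \<bullet> (y - x)\<bar> \<le> K * (norm (y - x))\<^sup>2"
      using g that unfolding lle_geometry_def by blast+
    then show ?thesis unfolding b_def inner_diff_left by linarith
  qed
  have int: "integrable \<nu> (indicator (cball x r) :: _ \<Rightarrow> real)" for r
    by (rule finite_measure.integrable_const_bound[OF \<nu>(1), of _ 1]) (auto simp: \<nu>(3) indicator_def)
  have orth: "t \<bullet> b = 0" if g: "lle_geometry d \<nu> Z f K x a T \<alpha> \<Delta>" and t: "t \<in> T" for a T \<alpha> \<Delta> t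
  proof -
    have T: "subspace T" using g by (simp add: lle_geometry_def)
    obtain b1 b2 where b: "b = b1 + b2" "b1 \<in> T" "\<And>t. t \<in> T \<Longrightarrow> t \<bullet> b2 = 0"
      using orthogonal_subspace_decomp_exists[of T b] T
      by (metis orthogonal_def inner_commute span_eq_iff)
    define C where "C = 2 * K + K * norm b2"
    have C: "C \<ge> 0" using K1 by (simp add: C_def)
    have small: "\<bar>(y - x) \<bullet> b1\<bar> \<le> C * r\<^sup>2" if y: "y \<in> Z" "norm (y - x) \<le> r" and r: "r \<le> 1 / K" for y r
    proof -
      have y': "norm (y - x) \<le> 1 / K" using y r by linarith
      have "\<bar>(y - x) \<bullet> b2\<bar> \<le> K * (norm (y - x))\<^sup>2 * norm b2"
        using g b(3) y(1) y' unfolding lle_geometry_def by blast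
      moreover have "(y - x) \<bullet> b1 = b \<bullet> (y - x) - (y - x) \<bullet> b2" by (simp add: b(1) inner_add_left inner_commute[of "y - x"])
      ultimately have "\<bar>(y - x) \<bullet> b1\<bar> \<le> 2 * K * (norm (y - x))\<^sup>2 + K * (norm (y - x))\<^sup>2 * norm b2"
        using quad[OF y(1) y'] by linarith
      also have "\<dots> = C * (norm (y - x))\<^sup>2" by (simp add: C_def algebra_simps)
      also have "\<dots> \<le> C * r\<^sup>2" using y C by (intro mult_left_mono power_mono) auto
      finally show ?thesis .
    qed
    \<comment> \<open>Integrating the square of (y - x) . b1 over the ball gives at least |b1|^2
      r^(d+2) / K, but at most (C r^2)^2 times the mass 2 K r^d. The upper bound is smaller by a
      factor r^2, which forces b1 = 0 as r tends to 0.\<close>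
    have "(norm b1)\<^sup>2 / K \<le> C\<^sup>2 * 2 * K * r\<^sup>2" if r: "0 < r" "r < 1 / K" for r
    proof -
      have rK: "r \<le> 1 / K" using r by simp
      have r1: "r \<le> 1" using rK K1 by (meson divide_le_eq_1 order_trans zero_less_one less_le_trans)
      have "(norm b1)\<^sup>2 * r ^ (d + 2) / K \<le> (\<integral>y. ((y - x) \<bullet> b1)\<^sup>2 * indicator (cball x r) y \<partial>\<nu>)"
        using lle_geometry_at_scale(3)[OF g r(1) rK b(2)] .
      also have "\<dots> \<le> (\<integral>y. (C * r\<^sup>2)\<^sup>2 * indicator (cball x r) y \<partial>\<nu>)"
      proof (rule integral_mono')
        show "integrable \<nu> (\<lambda>y. (C * r\<^sup>2)\<^sup>2 * indicator (cball x r) y)" by (intro integrable_mult_right int)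
        show "((y - x) \<bullet> b1)\<^sup>2 * indicator (cball x r) y \<le> (C * r\<^sup>2)\<^sup>2 * indicator (cball x r) y" if "y \<in> space \<nu>" for y
        proof (cases "y \<in> cball x r")
          case True
          then have "\<bar>(y - x) \<bullet> b1\<bar> \<le> \<bar>C * r\<^sup>2\<bar>"
            using small[of y r] that \<nu>(2) rK by (force simp: dist_norm norm_minus_commute)
          then have "((y - x) \<bullet> b1)\<^sup>2 \<le> (C * r\<^sup>2)\<^sup>2" by (simp only: abs_le_square_iff)
          then show ?thesis by (simp only: indicator_simps(1)[OF True] mult_1_right)
        qed simp
      qed simp
      also have "\<dots> = (C * r\<^sup>2)\<^sup>2 * (\<integral>y. indicator (cball x r) y \<partial>\<nu>)" by (rule integral_mult_right_zero)
      also have "\<dots> \<le> (C * r\<^sup>2)\<^sup>2 * (2 * K * r ^ d)"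
      proof (intro mult_left_mono)
        have "\<alpha> * r ^ d \<le> K * r ^ d" using g r by (intro mult_right_mono) (auto simp: lle_geometry_def)
        moreover have "K * r ^ (d + 1) \<le> K * r ^ d" using K1 r r1 by (simp add: mult_left_le_one_le)
        ultimately show "(\<integral>y. indicator (cball x r) y \<partial>\<nu>) \<le> 2 * K * r ^ d"
          using lle_geometry_at_scale(1)[OF g r(1) rK] by linarith
      qed simp
      finally have "r ^ (d + 2) * ((norm b1)\<^sup>2 / K) \<le> r ^ (d + 2) * (C\<^sup>2 * 2 * K * r\<^sup>2)"
        by (simp add: power_mult_distrib power_add power2_eq_square mult_ac)
      moreover have "0 < r ^ (d + 2)" using r by simp
      ultimately show ?thesis by (simp only: mult_le_cancel_left_pos)
    qed
    then have "eventually (\<lambda>r. (norm b1)\<^sup>2 / K \<le> C\<^sup>2 * 2 * K * r\<^sup>2) (at_right 0)"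
      using K1 by (intro eventually_at_rightI[of 0 "1 / K"]) auto
    moreover have "((\<lambda>r. C\<^sup>2 * 2 * K * r\<^sup>2) \<longlongrightarrow> C\<^sup>2 * 2 * K * 0\<^sup>2) (at_right 0)" by (intro tendsto_intros)
    ultimately have "(norm b1)\<^sup>2 / K \<le> C\<^sup>2 * 2 * K * 0\<^sup>2"
      by (intro tendsto_lowerbound[of "\<lambda>r. C\<^sup>2 * 2 * K * r\<^sup>2" _ "at_right 0"]) auto
    then have "b1 = 0" using K1 by (simp add: divide_le_0_iff)
    then show ?thesis using b t by simp
  qed
  have "a1 \<in> T1" "a2 \<in> T2" using g by (auto simp: lle_geometry_def)
  then have "a1 \<bullet> b = 0" "a2 \<bullet> b = 0" using orth[OF g(1)] orth[OF g(2)] by auto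
  then have "b \<bullet> b = 0" by (simp add: b_def inner_diff_left)
  then show a: "a1 = a2" by (simp add: b_def)
  have lim0: "A = B" if "\<And>r. 0 < r \<Longrightarrow> r < 1 / K \<Longrightarrow> \<bar>A - B\<bar> \<le> 2 * K * r" for A B :: real
  proof -
    have "eventually (\<lambda>r. \<bar>A - B\<bar> \<le> 2 * K * r) (at_right 0)"
      using K1 that by (intro eventually_at_rightI[of 0 "1 / K"]) auto
    moreover have "((\<lambda>r. 2 * K * r) \<longlongrightarrow> 2 * K * 0) (at_right 0)" by (intro tendsto_intros)
    ultimately have "\<bar>A - B\<bar> \<le> 2 * K * 0"
      by (intro tendsto_lowerbound[of "\<lambda>r. 2 * K * r" _ "at_right 0"]) auto
    then show ?thesis by simp
  qed
  have \<alpha>: "\<alpha>1 = \<alpha>2"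
  proof (rule lim0)
    fix r assume r: "0 < r" "r < 1 / K"
    then have rK: "r \<le> 1 / K" by simp
    have "\<bar>\<alpha>1 * r ^ d - \<alpha>2 * r ^ d\<bar> \<le> 2 * (K * r ^ (d + 1))"
      using lle_geometry_at_scale(1)[OF g(1) r(1) rK] lle_geometry_at_scale(1)[OF g(2) r(1) rK] by linarith
    moreover have "\<bar>\<alpha>1 * r ^ d - \<alpha>2 * r ^ d\<bar> = r ^ d * \<bar>\<alpha>1 - \<alpha>2\<bar>"
      using r by (simp add: left_diff_distrib[symmetric] abs_mult mult.commute)
    ultimately have "r ^ d * \<bar>\<alpha>1 - \<alpha>2\<bar> \<le> r ^ d * (2 * K * r)" by (simp add: mult_ac)
    then show "\<bar>\<alpha>1 - \<alpha>2\<bar> \<le> 2 * K * r" using r by (simp add: mult_le_cancel_left_pos)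
  qed
  have "\<alpha>1 * \<Delta>1 / (2 * (real d + 2)) = \<alpha>1 * \<Delta>2 / (2 * (real d + 2))" (is "?A = ?B")
  proof (rule lim0)
    fix r assume r: "0 < r" "r < 1 / K"
    then have rK: "r \<le> 1 / K" by simp
    have "\<bar>?A * r ^ (d + 2) - ?B * r ^ (d + 2)\<bar> \<le> 2 * (K * r ^ (d + 3))"
    proof -
      have tri: "\<bar>A - B\<bar> \<le> 2 * e" if "\<bar>X - A\<bar> \<le> e" "\<bar>X - B\<bar> \<le> e" for A B X e :: real
        using that by linarith
      show ?thesis
        using lle_geometry_at_scale(4)[OF g(1) r(1) rK] lle_geometry_at_scale(4)[OF g(2) r(1) rK]
        unfolding a \<alpha> by (rule tri)
    qed
    moreover have "\<bar>?A * r ^ (d + 2) - ?B * r ^ (d + 2)\<bar> = r ^ (d + 2) * \<bar>?A - ?B\<bar>"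
      using r by (simp only: left_diff_distrib[symmetric] abs_mult) simp
    ultimately have "r ^ (d + 2) * \<bar>?A - ?B\<bar> \<le> r ^ (d + 2) * (2 * K * r)"
      by (simp only: power_add[of r d] power3_eq_cube power2_eq_square mult_ac)
    moreover have "0 < r ^ (d + 2)" using r by simp
    ultimately show "\<bar>?A - ?B\<bar> \<le> 2 * K * r" by (simp only: mult_le_cancel_left_pos)
  qed
  moreover have "\<alpha>1 > 0" using g(1) K1 unfolding lle_geometry_def
    by (meson divide_pos_pos less_le_trans zero_less_one)
  ultimately show "\<Delta>1 = \<Delta>2" by (simp add: field_simps)
qed

section \<open>The sampling measure\<close>

locale sampled_manifold =
  fixes M :: "'m::topological_space set"
    and \<A> :: "('d::finite, 'm) param set"
    and g :: "('d, 'm) param \<Rightarrow> real ^ 'd \<Rightarrow> real ^ 'd ^ 'd"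
    and \<iota> :: "'m \<Rightarrow> real ^ 'p::finite"
    and V :: "'m measure"
    and P f :: "real ^ 'p \<Rightarrow> real"
    and P_m P_M :: real
    and \<nu> :: "(real ^ 'p) measure"
  assumes \<nu>_def: "\<nu> = density (embedded_volume M \<iota> V) (\<lambda>y. ennreal (P y))"
    and manifold: "smooth_manifold M \<A>" "compact M"
    and embedding: "isometric_embedding M \<A> g \<iota>"
    and volume: "riemannian_volume M \<A> g V"
    and density_regular: "Ck_manifold_map 5 \<A> (P \<circ> \<iota>)"
    and density_bounds: "0 < P_m" "\<forall>y\<in>\<iota> ` M. P_m \<le> P y \<and> P y \<le> P_M"
    and density_prob: "prob_space \<nu>"
    and f_regular: "Ck_manifold_map 3 \<A> (f \<circ> \<iota>)"
begin

abbreviation Z where "Z \<equiv> \<iota> ` M"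

lemma chart_facts:
  assumes "(U, \<psi>) \<in> \<A>"
  shows "open U" "openin (top_of_set M) (\<psi> ` U)" "homeomorphism U (\<psi> ` U) \<psi> (inv_into U \<psi>)"
    "\<psi> ` U \<subseteq> M" "inj_on \<psi> U" "continuous_on U \<psi>"
proof -
  show 1: "open U" "openin (top_of_set M) (\<psi> ` U)" "homeomorphism U (\<psi> ` U) \<psi> (inv_into U \<psi>)"
    using manifold(1) assms unfolding smooth_manifold_def by blast+
  show "\<psi> ` U \<subseteq> M" using openin_subset[OF 1(2)] by simp
  show "inj_on \<psi> U" using 1(3) unfolding homeomorphism_def by (metis inj_on_inverseI)
  show "continuous_on U \<psi>" using 1(3) unfolding homeomorphism_def by blast
qed

lemma charts_cover: "x \<in> M \<Longrightarrow> \<exists>U \<psi>. (U, \<psi>) \<in> \<A> \<and> x \<in> \<psi> ` U"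
  using manifold(1) unfolding smooth_manifold_def by blast

lemma homeo_\<iota>: "homeomorphism M Z \<iota> (inv_into M \<iota>)"
  using embedding by (simp add: isometric_embedding_def)

lemma continuous_\<iota>: "continuous_on M \<iota>"
  using homeo_\<iota> unfolding homeomorphism_def by blast

lemma inj_\<iota>: "inj_on \<iota> M"
  using homeo_\<iota> unfolding homeomorphism_def by (metis inj_on_inverseI)

lemma compact_Z: "compact Z"
  using continuous_\<iota> manifold(2) by (rule compact_continuous_image)

lemma smooth_chart: "(U, \<psi>) \<in> \<A> \<Longrightarrow> Ck_on k U (\<iota> \<circ> \<psi>)"
  using embedding unfolding isometric_embedding_def Ck_manifold_map_def by blast

lemma immersion: "(U, \<psi>) \<in> \<A> \<Longrightarrow> u \<in> U \<Longrightarrow> inj (frechet_derivative (\<iota> \<circ> \<psi>) (at u))"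
  using embedding unfolding isometric_embedding_def by force

lemma metric_entry: "(U, \<psi>) \<in> \<A> \<Longrightarrow> u \<in> U \<Longrightarrow> g (U, \<psi>) u $ i $ j =
    frechet_derivative (\<iota> \<circ> \<psi>) (at u) (axis i 1) \<bullet> frechet_derivative (\<iota> \<circ> \<psi>) (at u) (axis j 1)"
  using embedding unfolding isometric_embedding_def by force

lemma chart_image_open:
  assumes c: "(U, \<psi>) \<in> \<A>" and W: "open W" "W \<subseteq> U"
  shows "openin (top_of_set M) (\<psi> ` W)" "openin (top_of_set Z) ((\<iota> \<circ> \<psi>) ` W)"
proof -
  have "openin (top_of_set U) W" using W by (simp add: open_openin_trans open_subset)
  then have "openin (top_of_set (\<psi> ` U)) (\<psi> ` W)"
    using homeomorphism_imp_open_map[OF chart_facts(3)[OF c]] by blast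
  then show 1: "openin (top_of_set M) (\<psi> ` W)" using chart_facts(2)[OF c] openin_trans by blast
  show "openin (top_of_set Z) ((\<iota> \<circ> \<psi>) ` W)"
    using homeomorphism_imp_open_map[OF homeo_\<iota> 1] by (simp add: image_comp)
qed

lemma homeo_chart:
  assumes c: "(U, \<psi>) \<in> \<A>"
  shows "inj_on (\<iota> \<circ> \<psi>) U" "continuous_on U (\<iota> \<circ> \<psi>)"
proof -
  show "inj_on (\<iota> \<circ> \<psi>) U"
    by (rule comp_inj_on[OF chart_facts(5)[OF c] inj_on_subset[OF inj_\<iota> chart_facts(4)[OF c]]])
  show "continuous_on U (\<iota> \<circ> \<psi>)"
    by (rule continuous_on_compose[OF chart_facts(6)[OF c] continuous_on_subset[OF continuous_\<iota> chart_facts(4)[OF c]]])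
qed

text \<open>Continuity on the compact set \<open>Z\<close> only has to be checked in compact pieces of charts.\<close>

lemma continuous_on_chart_piece:
  fixes h :: "real ^ 'p \<Rightarrow> 'b::topological_space"
  assumes c: "(U, \<psi>) \<in> \<A>" and S: "compact S" "S \<subseteq> U" and h: "continuous_on S (h \<circ> (\<iota> \<circ> \<psi>))"
  shows "continuous_on ((\<iota> \<circ> \<psi>) ` S) h"
proof -
  have inj: "inj_on (\<iota> \<circ> \<psi>) S" using homeo_chart(1)[OF c] S(2) by (rule inj_on_subset)
  have cont: "continuous_on S (\<iota> \<circ> \<psi>)" using homeo_chart(2)[OF c] S(2) by (rule continuous_on_subset)
  have inv: "continuous_on ((\<iota> \<circ> \<psi>) ` S) (inv_into S (\<iota> \<circ> \<psi>))"
    by (rule continuous_on_inv[OF cont S(1)]) (use inv_into_f_f[OF inj] in blast)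
  have "continuous_on ((\<iota> \<circ> \<psi>) ` S) ((h \<circ> (\<iota> \<circ> \<psi>)) \<circ> inv_into S (\<iota> \<circ> \<psi>))"
    by (rule continuous_on_compose[OF inv]) (rule continuous_on_subset[OF h], use inv_into_f_f[OF inj] in auto)
  then show ?thesis
  proof (rule continuous_on_eq)
    fix y assume "y \<in> (\<iota> \<circ> \<psi>) ` S"
    from f_inv_into_f[OF this] show "((h \<circ> (\<iota> \<circ> \<psi>)) \<circ> inv_into S (\<iota> \<circ> \<psi>)) y = h y" by simp
  qed
qed

text \<open>The passage from local to uniform constants: the images of the open balls cover the
  compact set Z, and the closed balls of a finite subcover are compact pieces on which Q
  holds.\<close>

lemma finite_chart_cover:
  assumes Q: "\<And>U \<psi> u0. (U, \<psi>) \<in> \<A> \<Longrightarrow> u0 \<in> U \<Longrightarrow> \<exists>s>0. cball u0 s \<subseteq> U \<and> Q U \<psi> u0 s"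
  shows "\<exists>I. finite I \<and> (\<forall>(U, \<psi>, u0, s)\<in>I. (U, \<psi>) \<in> \<A> \<and> u0 \<in> U \<and> s > 0 \<and> cball u0 s \<subseteq> U \<and> Q U \<psi> u0 s)
     \<and> Z = (\<Union>(U, \<psi>, u0, s)\<in>I. (\<iota> \<circ> \<psi>) ` cball u0 s)"
proof -
  define J where "J = {(U, \<psi>, u0, s). (U, \<psi>) \<in> \<A> \<and> u0 \<in> U \<and> s > 0 \<and> cball u0 s \<subseteq> U \<and> Q U \<psi> u0 s}"
  let ?O = "\<lambda>(U, \<psi>, u0, s). (\<iota> \<circ> \<psi>) ` ball u0 s"
  have op: "openin (top_of_set Z) (?O j)" if "j \<in> J" for j
  proof -
    obtain U \<psi> u0 s where j: "j = (U, \<psi>, u0, s)" by (cases j)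
    have "ball u0 s \<subseteq> U" using that j ball_subset_cball[of u0 s] by (auto simp: J_def)
    then show ?thesis using chart_image_open(2)[of U \<psi> "ball u0 s"] that j by (auto simp: J_def)
  qed
  have cov: "Z \<subseteq> \<Union>(?O ` J)"
  proof
    fix y assume "y \<in> Z"
    then obtain x where x: "x \<in> M" "y = \<iota> x" by blast
    obtain U \<psi> where c: "(U, \<psi>) \<in> \<A>" "x \<in> \<psi> ` U" using charts_cover[OF x(1)] by blast
    then obtain u0 where u0: "u0 \<in> U" "x = \<psi> u0" by blast
    obtain s where s: "s > 0" "cball u0 s \<subseteq> U" "Q U \<psi> u0 s" using Q[OF c(1) u0(1)] by blast
    have "(U, \<psi>, u0, s) \<in> J" using c u0 s by (simp add: J_def)
    moreover have "y \<in> ?O (U, \<psi>, u0, s)" using s x u0 by simp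
    ultimately show "y \<in> \<Union>(?O ` J)" by blast
  qed
  obtain D where D: "D \<subseteq> ?O ` J" "finite D" "Z \<subseteq> \<Union>D"
    using compact_Z[unfolded compact_eq_openin_cover] op cov by (metis (no_types, lifting) imageE)
  obtain I where I: "I \<subseteq> J" "finite I" "D = ?O ` I"
    using finite_subset_image[OF D(2,1)] by blast
  have "Z = (\<Union>(U, \<psi>, u0, s)\<in>I. (\<iota> \<circ> \<psi>) ` cball u0 s)"
  proof (intro equalityI subsetI)
    fix y assume "y \<in> Z"
    then obtain j where j: "j \<in> I" "y \<in> ?O j" using D(3) I(3) by blast
    obtain U \<psi> u0 s where "j = (U, \<psi>, u0, s)" by (cases j)
    then have "(U, \<psi>, u0, s) \<in> I" "y \<in> (\<iota> \<circ> \<psi>) ` ball u0 s" using j by auto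
    moreover have "(\<iota> \<circ> \<psi>) ` ball u0 s \<subseteq> (\<iota> \<circ> \<psi>) ` cball u0 s" by (intro image_mono ball_subset_cball)
    ultimately show "y \<in> (\<Union>(U, \<psi>, u0, s)\<in>I. (\<iota> \<circ> \<psi>) ` cball u0 s)" by blast
  next
    fix y assume "y \<in> (\<Union>(U, \<psi>, u0, s)\<in>I. (\<iota> \<circ> \<psi>) ` cball u0 s)"
    then obtain U \<psi> u0 s w where w: "(U, \<psi>, u0, s) \<in> I" "y = \<iota> (\<psi> w)" "w \<in> cball u0 s" by fastforce
    have "(U, \<psi>) \<in> \<A> \<and> cball u0 s \<subseteq> U" using w(1) I(1) by (auto simp: J_def)
    then have "(U, \<psi>) \<in> \<A>" "w \<in> U" using w(3) by auto
    then show "y \<in> Z" using chart_facts(4)[of U \<psi>] w(2) by blast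
  qed
  moreover have "\<forall>(U, \<psi>, u0, s)\<in>I. (U, \<psi>) \<in> \<A> \<and> u0 \<in> U \<and> s > 0 \<and> cball u0 s \<subseteq> U \<and> Q U \<psi> u0 s"
    using I(1) by (auto simp: J_def)
  ultimately show ?thesis using I(2) by blast
qed

lemma continuous_on_Z_chartwise:
  fixes h :: "real ^ 'p \<Rightarrow> 'b::topological_space"
  assumes h: "\<And>U \<psi> u0. (U, \<psi>) \<in> \<A> \<Longrightarrow> u0 \<in> U \<Longrightarrow> \<exists>s>0. cball u0 s \<subseteq> U \<and> continuous_on (cball u0 s) (h \<circ> (\<iota> \<circ> \<psi>))"
  shows "continuous_on Z h"
proof -
  have "\<exists>I. finite I \<and> (\<forall>(U, \<psi>, u0, s)\<in>I. (U, \<psi>) \<in> \<A> \<and> u0 \<in> U \<and> s > 0 \<and> cball u0 s \<subseteq> U \<and>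
      continuous_on (cball u0 s) (h \<circ> (\<iota> \<circ> \<psi>))) \<and> Z = (\<Union>(U, \<psi>, u0, s)\<in>I. (\<iota> \<circ> \<psi>) ` cball u0 s)"
    by (rule finite_chart_cover) (rule h)
  then obtain I where I: "finite I" "\<forall>(U, \<psi>, u0, s)\<in>I. (U, \<psi>) \<in> \<A> \<and> u0 \<in> U \<and> s > 0 \<and> cball u0 s \<subseteq> U \<and> continuous_on (cball u0 s) (h \<circ> (\<iota> \<circ> \<psi>))"
    "Z = (\<Union>(U, \<psi>, u0, s)\<in>I. (\<iota> \<circ> \<psi>) ` cball u0 s)"
    by (elim exE conjE) (rule that)
  have pc: "continuous_on (case j of (U, \<psi>, u0, s) \<Rightarrow> (\<iota> \<circ> \<psi>) ` cball u0 s) h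
      \<and> closed (case j of (U, \<psi>, u0, s) \<Rightarrow> (\<iota> \<circ> \<psi>) ` cball u0 s)" if j: "j \<in> I" for j
  proof -
    obtain U \<psi> u0 s where je: "j = (U, \<psi>, u0, s)" by (cases j)
    have c: "(U, \<psi>) \<in> \<A>" "cball u0 s \<subseteq> U" "continuous_on (cball u0 s) (h \<circ> (\<iota> \<circ> \<psi>))" using I(2) j je by auto
    have "continuous_on ((\<iota> \<circ> \<psi>) ` cball u0 s) h" by (rule continuous_on_chart_piece[OF c(1) _ c(2,3)]) simp
    moreover have "compact ((\<iota> \<circ> \<psi>) ` cball u0 s)"
      using homeo_chart(2)[OF c(1)] c(2) by (intro compact_continuous_image) (auto intro: continuous_on_subset)
    ultimately show ?thesis by (simp add: je compact_imp_closed)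
  qed
  show ?thesis unfolding I(3)
    by (rule continuous_on_closed_Union) (use I(1) pc in auto)
qed

lemma continuous_P: "continuous_on Z P" and continuous_f: "continuous_on Z f"
proof -
  have "\<exists>s>0. cball u0 s \<subseteq> U \<and> continuous_on (cball u0 s) (h \<circ> (\<iota> \<circ> \<psi>))"
    if h: "Ck_manifold_map k \<A> (h \<circ> \<iota>)" and c: "(U, \<psi>) \<in> \<A>" "u0 \<in> U" for k and h :: "real ^ 'p \<Rightarrow> real" and U \<psi> u0
  proof -
    obtain s where s: "s > 0" "cball u0 s \<subseteq> U" using chart_facts(1)[OF c(1)] c(2) open_contains_cball by blast
    have "Ck_on k U (h \<circ> \<iota> \<circ> \<psi>)" using h c(1) unfolding Ck_manifold_map_def by blast
    then have "continuous_on U (h \<circ> (\<iota> \<circ> \<psi>))" using Ck_on_continuous by (metis comp_assoc)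
    then show ?thesis using s continuous_on_subset by blast
  qed
  then show "continuous_on Z P" "continuous_on Z f"
    using density_regular f_regular by (auto intro!: continuous_on_Z_chartwise)
qed

lemma space_V: "space V = M" and sets_V: "sets V = sets (restrict_space borel M)"
  using volume by (auto simp: riemannian_volume_def)

lemma space_N: "space (embedded_volume M \<iota> V) = Z" and sets_N: "sets (embedded_volume M \<iota> V) = sets (restrict_space borel Z)"
  by (auto simp: embedded_volume_def space_restrict_space)

lemma space_\<nu>: "space \<nu> = Z" and sets_\<nu>: "sets \<nu> = sets (restrict_space borel Z)"
  by (auto simp: \<nu>_def space_N sets_N)

lemma measurable_\<nu>I:
  assumes "h \<in> borel_measurable (restrict_space borel Z)"
  shows "h \<in> borel_measurable \<nu>"
  using assms measurable_cong_sets[OF sets_\<nu> refl] by blast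

lemma continuous_measurable_Z: "continuous_on Z h \<Longrightarrow> h \<in> borel_measurable (restrict_space borel Z)"
  by (rule borel_measurable_continuous_on_restrict)

lemma measurable_\<iota>: "\<iota> \<in> V \<rightarrow>\<^sub>M restrict_space borel Z"
proof -
  have "\<iota> \<in> borel_measurable (restrict_space borel M)"
    by (rule borel_measurable_continuous_on_restrict[OF continuous_\<iota>])
  then have "\<iota> \<in> V \<rightarrow>\<^sub>M borel" using measurable_cong_sets[OF sets_V refl] by blast
  then show ?thesis by (intro measurable_restrict_space2) (auto simp: space_V)
qed

text \<open>\<open>riemannian_volume\<close> prescribes the measure of sets inside one chart, so V
  restricted to the chart image is the image of Lebesgue measure with density sqrt(det g). Outside W
  the parametrization is replaced by a constant to obtain a measurable map on the whole space; the
  density vanishes there.\<close>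

lemma chart_volume:
  assumes c: "(U, \<psi>) \<in> \<A>" and W: "open W" "W \<subseteq> U" "u0 \<in> W"
    and s: "continuous_on W (\<lambda>u. sqrt (det (g (U, \<psi>) u)))"
  shows "density V (indicator (\<psi> ` W)) =
    distr (density lborel (\<lambda>u. ennreal (indicator W u * sqrt (det (g (U, \<psi>) u))))) V (\<lambda>u. if u \<in> W then \<psi> u else \<psi> u0)"
    (is "?\<mu>1 = ?\<mu>2")
    and "(\<lambda>u. if u \<in> W then \<psi> u else \<psi> u0) \<in> borel \<rightarrow>\<^sub>M V"
    and "(\<lambda>u. indicator W u * sqrt (det (g (U, \<psi>) u))) \<in> borel_measurable borel"
    and "\<psi> ` W \<in> sets V"
proof -
  let ?\<psi> = "\<lambda>u. if u \<in> W then \<psi> u else \<psi> u0"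
  show sm [measurable]: "(\<lambda>u. indicator W u * sqrt (det (g (U, \<psi>) u))) \<in> borel_measurable borel"
    using borel_measurable_continuous_on_indicator[OF _ s] W(1) by simp
  have inM: "?\<psi> u \<in> M" for u using chart_facts(4)[OF c] W by auto
  have "\<psi> \<in> borel_measurable (restrict_space borel W)"
    using chart_facts(6)[OF c] W by (intro borel_measurable_continuous_on_restrict) (rule continuous_on_subset)
  then have "?\<psi> \<in> borel_measurable borel"
    using W(1) by (subst measurable_If_restrict_space_iff) auto
  then have "?\<psi> \<in> borel \<rightarrow>\<^sub>M restrict_space borel M" using inM by (intro measurable_restrict_space2) auto
  then show pm [measurable]: "?\<psi> \<in> borel \<rightarrow>\<^sub>M V" using measurable_cong_sets[OF refl sets_V] by blast
  show Wm [measurable]: "\<psi> ` W \<in> sets V"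
  proof -
    obtain T where T: "open T" "\<psi> ` W = M \<inter> T" using chart_image_open(1)[OF c W(1,2)] by (auto simp: openin_open)
    then show ?thesis unfolding sets_V sets_restrict_space by auto
  qed
  note vol = volume[unfolded riemannian_volume_def, THEN conjunct2, THEN conjunct2]
  show "?\<mu>1 = ?\<mu>2"
  proof (rule measure_eqI)
    fix B assume "B \<in> sets ?\<mu>1"
    then have B [measurable]: "B \<in> sets V" by simp
    have BW: "\<psi> ` W \<inter> B \<in> sets V" by measurable
    have "emeasure ?\<mu>1 B = (\<integral>\<^sup>+ x. indicator (\<psi> ` W) x * indicator B x \<partial>V)" by (subst emeasure_density) auto
    also have "\<dots> = (\<integral>\<^sup>+ x. indicator (\<psi> ` W \<inter> B) x \<partial>V)" by (simp add: indicator_inter_arith[symmetric])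
    also have "\<dots> = emeasure V (\<psi> ` W \<inter> B)" using BW by simp
    also have "\<dots> = (\<integral>\<^sup>+u. ennreal (sqrt (det (g (U, \<psi>) u))) * indicator {u \<in> U. \<psi> u \<in> \<psi> ` W \<inter> B} u \<partial>lborel)"
      by (rule bspec[OF vol c, unfolded prod.case, rule_format, OF BW]) (use W(2) in blast)
    also have "\<dots> = (\<integral>\<^sup>+u. ennreal (indicator W u * sqrt (det (g (U, \<psi>) u))) * indicator (?\<psi> -` B \<inter> space (density lborel (\<lambda>u. ennreal (indicator W u * sqrt (det (g (U, \<psi>) u)))))) u \<partial>lborel)"
    proof (intro nn_integral_cong)
      fix u
      have "u \<in> U \<and> \<psi> u \<in> \<psi> ` W \<longleftrightarrow> u \<in> W" using chart_facts(5)[OF c] W(2) by (auto dest: inj_onD)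
      then show "ennreal (sqrt (det (g (U, \<psi>) u))) * indicator {u \<in> U. \<psi> u \<in> \<psi> ` W \<inter> B} u =
         ennreal (indicator W u * sqrt (det (g (U, \<psi>) u))) * indicator (?\<psi> -` B \<inter> space (density lborel (\<lambda>u. ennreal (indicator W u * sqrt (det (g (U, \<psi>) u)))))) u"
        by (auto simp: indicator_def)
    qed
    also have "\<dots> = emeasure (density lborel (\<lambda>u. ennreal (indicator W u * sqrt (det (g (U, \<psi>) u))))) (?\<psi> -` B \<inter> space (density lborel (\<lambda>u. ennreal (indicator W u * sqrt (det (g (U, \<psi>) u))))))"
      by (subst emeasure_density) (auto intro: measurable_sets[OF pm, of B, simplified])
    also have "\<dots> = emeasure ?\<mu>2 B" by (subst emeasure_distr) auto
    finally show "emeasure ?\<mu>1 B = emeasure ?\<mu>2 B" .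
  qed simp
qed

text \<open>The density P, the image under \<iota> and the chart are removed one after the other. By
  the covering hypothesis the integrand vanishes at points of M outside the chart image, so
  restricting V to this image does not change the integral.\<close>

lemma chart_integral:
  assumes c: "(U, \<psi>) \<in> \<A>" and W: "open W" "W \<subseteq> U" "u0 \<in> W"
    and s: "continuous_on W (\<lambda>u. sqrt (det (g (U, \<psi>) u)))" "\<And>u. u \<in> W \<Longrightarrow> 0 \<le> sqrt (det (g (U, \<psi>) u))"
    and cov: "Z \<inter> cball x r \<subseteq> (\<iota> \<circ> \<psi>) ` W" and F: "continuous_on Z F"
  shows "(\<integral>y. F y * indicator (cball x r) y \<partial>\<nu>) =
    (\<integral>w. indicator W w * (indicator (cball x r) ((\<iota> \<circ> \<psi>) w) *
      (F ((\<iota> \<circ> \<psi>) w) * (P ((\<iota> \<circ> \<psi>) w) * sqrt (det (g (U, \<psi>) w))))) \<partial>lborel)"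
proof -
  let ?N = "embedded_volume M \<iota> V" and ?R = "restrict_space borel Z"
  let ?\<psi> = "\<lambda>u. if u \<in> W then \<psi> u else \<psi> u0"
  let ?s = "\<lambda>u. indicator W u * sqrt (det (g (U, \<psi>) u))"
  note cv = chart_volume[OF c W s(1)]
  note [measurable] = cv(2,3,4)
  have meas: "h \<in> borel_measurable ?N \<longleftrightarrow> h \<in> borel_measurable ?R" for h :: "_ \<Rightarrow> real"
    using measurable_cong_sets[OF sets_N refl] by blast
  have Fm [measurable]: "F \<in> borel_measurable ?R" and Pm [measurable]: "P \<in> borel_measurable ?R"
    by (intro continuous_measurable_Z F continuous_P)+
  have idm [measurable]: "(\<lambda>y. y) \<in> borel_measurable ?R" by (rule measurable_restrict_space1) simp
  have im [measurable]: "(\<lambda>y. indicator (cball x r) y :: real) \<in> borel_measurable ?R"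
    by (rule measurable_restrict_space1, rule borel_measurable_indicator) simp
  define h where "h = (\<lambda>y. P y * (F y * indicator (cball x r) y))"
  have hm [measurable]: "h \<in> borel_measurable ?R" unfolding h_def by measurable
  note \<iota>m [measurable] = measurable_\<iota>
  have h\<iota> [measurable]: "(\<lambda>x. h (\<iota> x)) \<in> borel_measurable V" by measurable
  have "(\<integral>y. F y * indicator (cball x r) y \<partial>\<nu>) = (\<integral>y. P y *\<^sub>R (F y * indicator (cball x r) y) \<partial>?N)"
    unfolding \<nu>_def
  proof (rule integral_density)
    show "(\<lambda>y. F y * indicator (cball x r) y) \<in> borel_measurable ?N" unfolding meas by measurable
    show "P \<in> borel_measurable ?N" unfolding meas by measurable
    show "AE y in ?N. 0 \<le> P y" using density_bounds by (intro AE_I2) (force simp: space_N)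
  qed
  also have "\<dots> = (\<integral>y. h y \<partial>?N)" by (simp add: h_def)
  also have "\<dots> = (\<integral>x. h (\<iota> x) \<partial>V)" unfolding embedded_volume_def by (rule integral_distr[OF \<iota>m hm])
  also have "\<dots> = (\<integral>x. indicator (\<psi> ` W) x *\<^sub>R h (\<iota> x) \<partial>V)"
  proof (intro Bochner_Integration.integral_cong refl)
    fix z assume "z \<in> space V"
    then have zM: "z \<in> M" by (simp add: space_V)
    show "h (\<iota> z) = indicator (\<psi> ` W) z *\<^sub>R h (\<iota> z)"
    proof (cases "\<iota> z \<in> cball x r")
      case True
      then obtain w where w: "w \<in> W" "\<iota> z = \<iota> (\<psi> w)" using cov zM by force
      then have "z = \<psi> w" using inj_\<iota> zM chart_facts(4)[OF c] W(2) by (meson imageI inj_onD subsetD)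
      then show ?thesis using w by simp
    qed (simp add: h_def)
  qed
  also have "\<dots> = (\<integral>x. h (\<iota> x) \<partial>density V (indicator (\<psi> ` W)))"
  proof -
    have "(\<integral>x. h (\<iota> x) \<partial>density V (\<lambda>x. ennreal (indicator (\<psi> ` W) x))) = (\<integral>x. indicator (\<psi> ` W) x *\<^sub>R h (\<iota> x) \<partial>V)"
      by (rule integral_density) auto
    moreover have "(\<lambda>x. ennreal (indicator (\<psi> ` W) x)) = indicator (\<psi> ` W)" by (auto simp: indicator_def)
    ultimately show ?thesis by simp
  qed
  also have "\<dots> = (\<integral>u. h (\<iota> (?\<psi> u)) \<partial>density lborel (\<lambda>u. ennreal (?s u)))"
    unfolding cv(1) by (rule integral_distr) auto
  also have "\<dots> = (\<integral>u. ?s u *\<^sub>R h (\<iota> (?\<psi> u)) \<partial>lborel)"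
  proof (rule integral_density)
    show "(\<lambda>u. h (\<iota> (?\<psi> u))) \<in> borel_measurable lborel"
      using measurable_compose[OF cv(2) h\<iota>] by simp
    show "AE u in lborel. 0 \<le> ?s u" using s(2) by (intro AE_I2) (auto simp: indicator_def)
  qed simp
  also have "\<dots> = (\<integral>w. indicator W w * (indicator (cball x r) ((\<iota> \<circ> \<psi>) w) *
      (F ((\<iota> \<circ> \<psi>) w) * (P ((\<iota> \<circ> \<psi>) w) * sqrt (det (g (U, \<psi>) w))))) \<partial>lborel)"
    by (intro Bochner_Integration.integral_cong refl) (auto simp: h_def indicator_def)
  finally show ?thesis .
qed

end

section \<open>Uniform local geometry\<close>

lemma continuous_on_compact_bounded:
  fixes h :: "'a::topological_space \<Rightarrow> 'b::real_normed_vector"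
  assumes "continuous_on S h" "compact S"
  shows "\<exists>B\<ge>0. \<forall>x\<in>S. norm (h x) \<le> B"
proof -
  have "bounded (h ` S)" using assms by (intro compact_imp_bounded compact_continuous_image)
  then obtain B where B: "\<And>x. x \<in> S \<Longrightarrow> norm (h x) \<le> B" by (auto simp: bounded_iff)
  then have "\<forall>x\<in>S. norm (h x) \<le> \<bar>B\<bar>" by (meson abs_ge_self order_trans)
  then show ?thesis by (intro exI[of _ "\<bar>B\<bar>"]) simp
qed

lemma lipschitz_bounded_continuous:
  assumes "lipschitz_bounded S h"
  shows "continuous_on S h"
proof -
  obtain K where K: "K \<ge> 0" "\<And>u w. u \<in> S \<Longrightarrow> w \<in> S \<Longrightarrow> \<bar>h w - h u\<bar> \<le> K * norm (w - u)"
    using assms unfolding lipschitz_bounded_def by blast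
  then have "K-lipschitz_on S h" by (intro lipschitz_onI) (auto simp: dist_norm)
  then show ?thesis by (rule lipschitz_on_continuous_on)
qed

lemma Ck_on_component_lipschitz_bounded:
  fixes h :: "real ^ 'd::finite \<Rightarrow> real ^ 'p::finite"
  assumes h: "Ck_on 1 U h" and S: "S \<subseteq> U" "convex S" "compact S"
  shows "lipschitz_bounded S (\<lambda>x. h x $ k)"
proof -
  obtain K where K: "K \<ge> 0" "\<And>u w. u \<in> S \<Longrightarrow> w \<in> S \<Longrightarrow> norm (h w - h u) \<le> K * norm (w - u)"
    using Ck_on_lipschitz[OF h S] by auto
  obtain B where B: "B \<ge> 0" "\<And>u. u \<in> S \<Longrightarrow> norm (h u) \<le> B"
    using continuous_on_compact_bounded[OF continuous_on_subset[OF Ck_on_continuous[OF h] S(1)] S(3)] by blast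
  have "\<bar>h w $ k - h u $ k\<bar> \<le> (K + B) * norm (w - u)" if "u \<in> S" "w \<in> S" for u w
  proof -
    have "\<bar>h w $ k - h u $ k\<bar> \<le> norm (h w - h u)" using component_le_norm_cart[of "h w - h u" k] by simp
    moreover have "0 \<le> B * norm (w - u)" using B(1) by simp
    ultimately show ?thesis using K(2)[OF that] unfolding distrib_right by linarith
  qed
  moreover have "\<bar>h u $ k\<bar> \<le> K + B" if "u \<in> S" for u
    using component_le_norm_cart[of "h u" k] B(2)[OF that] K(1) by linarith
  ultimately show ?thesis unfolding lipschitz_bounded_def using K(1) B(1) by (intro exI[of _ "K + B"]) auto
qed

lemma continuous_on_matrix_inv:
  fixes G :: "'a::real_normed_vector \<Rightarrow> real ^ 'd::finite ^ 'd"
  assumes G: "\<And>i j. lipschitz_bounded S (\<lambda>x. G x $ i $ j)" and d: "\<And>x. x \<in> S \<Longrightarrow> det (G x) \<noteq> 0"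
  shows "continuous_on S (\<lambda>x. matrix_inv (G x) $ i $ j)"
proof -
  have "lipschitz_bounded S (\<lambda>x. (\<chi> k l. if l = i then axis j (1::real) $ k else G x $ k $ l) $ k $ l)" for k l
    by (cases "l = i") (auto intro: G lipschitz_bounded_const)
  then have num: "continuous_on S (\<lambda>x. det (\<chi> k l. if l = i then axis j (1::real) $ k else G x $ k $ l))"
    by (intro lipschitz_bounded_continuous lipschitz_bounded_det)
  have "continuous_on S (\<lambda>x. det (\<chi> k l. if l = i then axis j 1 $ k else G x $ k $ l) / det (G x))"
    by (rule continuous_on_divide[OF num lipschitz_bounded_continuous[OF lipschitz_bounded_det[OF G]]]) (use d in blast)
  then show ?thesis
    by (rule continuous_on_eq) (simp add: matrix_inv_entry[OF d])
qed

context sampled_manifold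
begin

text \<open>Remote parts of the manifold must not come close to the base point in the ambient space.
  The chart image is Z intersected with an open set T, and the image of K is compact and disjoint
  from the complement of T, hence at positive distance from it.\<close>

lemma chart_covers_small_balls:
  assumes c: "(U, \<psi>) \<in> \<A>" and K: "compact K" "K \<subseteq> W" and W: "open W" "W \<subseteq> U"
  shows "\<exists>r0>0. \<forall>u\<in>K. Z \<inter> cball ((\<iota> \<circ> \<psi>) u) r0 \<subseteq> (\<iota> \<circ> \<psi>) ` W"
proof -
  obtain T where T: "open T" "(\<iota> \<circ> \<psi>) ` W = Z \<inter> T"
    using chart_image_open(2)[OF c W] by (auto simp: openin_open)
  have "compact ((\<iota> \<circ> \<psi>) ` K)"
    using homeo_chart(2)[OF c] K W by (intro compact_continuous_image) (auto intro: continuous_on_subset)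
  moreover have "(\<iota> \<circ> \<psi>) ` K \<inter> (- T) = {}" using T K by blast
  ultimately obtain e where e: "e > 0" "\<forall>x\<in>(\<iota> \<circ> \<psi>) ` K. \<forall>y\<in>- T. e \<le> dist x y"
    using separate_compact_closed[of "(\<iota> \<circ> \<psi>) ` K" "- T"] T(1) by (auto simp: closed_def)
  have "Z \<inter> cball ((\<iota> \<circ> \<psi>) u) (e / 2) \<subseteq> (\<iota> \<circ> \<psi>) ` W" if "u \<in> K" for u
  proof
    fix y assume y: "y \<in> Z \<inter> cball ((\<iota> \<circ> \<psi>) u) (e / 2)"
    then have "dist ((\<iota> \<circ> \<psi>) u) y < e" using e(1) by auto
    then have "y \<in> T" using e(2) that by force
    then show "y \<in> (\<iota> \<circ> \<psi>) ` W" using T(2) y by blast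
  qed
  then show ?thesis using e(1) by (intro exI[of _ "e / 2"]) auto
qed

text \<open>Supplies the hypotheses of \<open>local_chart_function\<close> on a small coordinate
  ball. Continuity of the gradient field a is recorded because the sampling argument needs its
  measurability.\<close>

lemma local_geometry:
  assumes c: "(U, \<psi>) \<in> \<A>" and u0: "u0 \<in> U"
  shows "\<exists>s>0. cball u0 s \<subseteq> U \<and> (\<exists>K a. continuous_on (cball u0 s) a \<and>
    (\<forall>u\<in>cball u0 s. \<exists>T \<alpha>. lle_geometry CARD('d) \<nu> Z f K ((\<iota> \<circ> \<psi>) u) (a u) T \<alpha>
       (laplace_coord (g (U, \<psi>)) ((f \<circ> \<iota>) \<circ> \<psi>) u)))"
proof -
  define \<Psi> where "\<Psi> = \<iota> \<circ> \<psi>"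
  define F where "F = (f \<circ> \<iota>) \<circ> \<psi>"
  define G where "G = g (U, \<psi>)"
  define D where "D = (\<lambda>u. frechet_derivative \<Psi> (at u))"
  define DF where "DF = (\<lambda>u. frechet_derivative F (at u))"
  have oU: "open U" by (rule chart_facts(1)[OF c])
  have C\<Psi>: "Ck_on k U \<Psi>" for k unfolding \<Psi>_def by (rule smooth_chart[OF c])
  have CF: "Ck_on 3 U F" using f_regular c unfolding F_def Ck_manifold_map_def by blast
  have CF2: "Ck_on 2 U F" by (rule Ck_on_mono[OF _ CF]) simp
  have CP: "Ck_on 1 U (P \<circ> \<Psi>)"
  proof -
    have "Ck_on 5 U (P \<circ> \<iota> \<circ> \<psi>)" using density_regular c unfolding Ck_manifold_map_def by blast
    then have "Ck_on 5 U (P \<circ> \<Psi>)" by (simp add: \<Psi>_def comp_assoc)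
    then show ?thesis by (rule Ck_on_mono[rotated]) simp
  qed
  have immers: "inj (D u)" if "u \<in> U" for u unfolding D_def \<Psi>_def by (rule immersion[OF c that])
  have Gent: "G u $ i $ j = D u (axis i 1) \<bullet> D u (axis j 1)" if "u \<in> U" for u i j
    unfolding G_def D_def \<Psi>_def by (rule metric_entry[OF c that])
  have linD: "linear (D u)" if "u \<in> U" for u unfolding D_def by (rule Ck_on_linear[OF C\<Psi> that])
  have F1: "Ck_on (Suc 2) U F" using CF by (simp add: numeral_3_eq_3 numeral_2_eq_2)
  have linDF: "linear (DF u)" if "u \<in> U" for u unfolding DF_def by (rule Ck_on_linear[OF F1 that])
  obtain s \<mu> where s: "s > 0" and \<mu>: "\<mu> > 0" and sub: "cball u0 (2 * s) \<subseteq> U"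
    and lowD: "\<And>u h. u \<in> cball u0 (2 * s) \<Longrightarrow> \<mu> * norm h \<le> norm (D u h)"
    and low\<Psi>: "\<And>u w. u \<in> cball u0 (2 * s) \<Longrightarrow> w \<in> cball u0 (2 * s) \<Longrightarrow> \<mu> * norm (w - u) \<le> norm (\<Psi> w - \<Psi> u)"
    using immersion_local_lower_bound[OF C\<Psi> oU u0 immers[OF u0, unfolded D_def]] unfolding D_def by blast
  \<comment> \<open>One compact convex set containing the base points, up to radius s, and the
    points w, up to radius 2 s. All constants below come from its compactness.\<close>
  define S where "S = cball u0 (2 * s)"
  have S: "S \<subseteq> U" "convex S" "compact S" using sub by (auto simp: S_def)
  have SW: "ball u0 (2 * s) \<subseteq> S" "cball u0 s \<subseteq> S" "cball u0 s \<subseteq> ball u0 (2 * s)" using s by (auto simp: S_def)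
  have ell: "ellipsoid (D u) \<mu>" if "u \<in> S" for u
    using that S(1) \<mu> lowD unfolding S_def by (intro ellipsoid.intro linD) auto
  have Gram: "ellipsoid.Gram (D u) = G u" if "u \<in> S" for u
  proof -
    interpret ellipsoid "D u" \<mu> by (rule ell[OF that])
    show ?thesis using Gent that S(1) by (auto simp: Gram_def vec_eq_iff)
  qed
  have detG: "det (G u) > 0" if "u \<in> S" for u
    using ellipsoid.det_Gram[OF ell[OF that]] Gram[OF that] by simp
  have lipD: "lipschitz_bounded S (\<lambda>u. D u (axis i 1) $ k)" for i k
    unfolding D_def using Ck_on_direction[OF C\<Psi>[of "Suc 1"], of "axis i 1"]
    by (intro Ck_on_component_lipschitz_bounded[OF _ S]) auto
  have lipG: "lipschitz_bounded S (\<lambda>u. G u $ i $ j)" for i j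
  proof -
    have "lipschitz_bounded S (\<lambda>u. \<Sum>k\<in>UNIV. D u (axis i 1) $ k * D u (axis j 1) $ k)"
      by (intro lipschitz_bounded_sum lipschitz_bounded_mult lipD) auto
    moreover have "G u $ i $ j = (\<Sum>k\<in>UNIV. D u (axis i 1) $ k * D u (axis j 1) $ k)" if "u \<in> S" for u
      using Gent[of u i j] that S(1) by (auto simp: inner_vec_def)
    ultimately show ?thesis unfolding lipschitz_bounded_def by simp
  qed
  have lipdet: "lipschitz_bounded S (\<lambda>u. det (G u))" by (rule lipschitz_bounded_det[OF lipG])
  obtain c0 where c0: "c0 > 0" "\<And>u. u \<in> S \<Longrightarrow> c0 \<le> det (G u)"
  proof -
    have "S \<noteq> {}" using s by (auto simp: S_def)
    then obtain x where "x \<in> S" "\<forall>u\<in>S. det (G x) \<le> det (G u)"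
      using continuous_attains_inf[OF S(3) _ lipschitz_bounded_continuous[OF lipdet]] by blast
    then show ?thesis using that[of "det (G x)"] detG by blast
  qed
  have lipsq: "lipschitz_bounded S (\<lambda>u. sqrt (det (G u)))" by (rule lipschitz_bounded_sqrt[OF lipdet c0])
  define \<rho> where "\<rho> = (\<lambda>w. P (\<Psi> w) * sqrt (det (G w)))"
  have lip\<rho>: "lipschitz_bounded S \<rho>"
    unfolding \<rho>_def using lipschitz_bounded_mult[OF Ck_on_lipschitz_bounded[OF CP S] lipsq] by (simp add: o_def)
  have \<Psi>Z: "\<Psi> u \<in> Z" if "u \<in> U" for u using chart_facts(4)[OF c] that by (auto simp: \<Psi>_def)
  have \<rho>low: "P_m * sqrt c0 \<le> \<rho> u" if "u \<in> S" for u
  proof -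
    have "P_m \<le> P (\<Psi> u)" using density_bounds(2) \<Psi>Z[of u] that S(1) by blast
    then show ?thesis unfolding \<rho>_def using density_bounds(1) that c0 by (intro mult_mono) auto
  qed
  have \<rho>0: "P_m * sqrt c0 > 0" using density_bounds c0 by simp
  obtain K\<rho> where K\<rho>: "K\<rho> \<ge> 0" "\<And>u. u \<in> S \<Longrightarrow> \<bar>\<rho> u\<bar> \<le> K\<rho>" "\<And>u w. u \<in> S \<Longrightarrow> w \<in> S \<Longrightarrow> \<bar>\<rho> w - \<rho> u\<bar> \<le> K\<rho> * norm (w - u)"
    using lip\<rho> unfolding lipschitz_bounded_def by blast
  have contGi: "continuous_on S (\<lambda>u. matrix_inv (G u) $ i $ j)" for i j
    by (rule continuous_on_matrix_inv[OF lipG]) (use detG in force)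
  have contD: "continuous_on S (\<lambda>u. D u v)" for v
    unfolding D_def using Ck_on_continuous[OF Ck_on_direction[OF C\<Psi>]] S(1) continuous_on_subset by blast
  have contDF: "continuous_on S (\<lambda>u. DF u v)" for v
    unfolding DF_def using Ck_on_continuous[OF Ck_on_direction[OF F1]] S(1) continuous_on_subset by blast
  \<comment> \<open>The Riemannian gradient of f as an ambient vector: the differential with its
    index raised by the inverse metric, pushed forward by the embedding.\<close>
  define a where "a = (\<lambda>u. \<Sum>l\<in>UNIV. \<Sum>j\<in>UNIV. (matrix_inv (G u) $ l $ j * DF u (axis j 1)) *\<^sub>R D u (axis l 1))"
  have conta: "continuous_on S a" unfolding a_def by (intro continuous_intros contGi contD contDF)
  define D2 where "D2 = (\<lambda>u j i. frechet_derivative (\<lambda>x. D x (axis j 1)) (at u) (axis i 1))"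
  define DF2 where "DF2 = (\<lambda>u j i. frechet_derivative (\<lambda>x. DF x (axis j 1)) (at u) (axis i 1))"
  have contD2: "continuous_on S (\<lambda>u. D2 u j i)" for i j
  proof -
    have "Ck_on 1 U (\<lambda>u. D2 u j i)" unfolding D2_def D_def by (intro Ck_on_direction C\<Psi>)
    then show ?thesis using Ck_on_continuous S(1) continuous_on_subset by blast
  qed
  have contDF2: "continuous_on S (\<lambda>u. DF2 u j i)" for i j
  proof -
    have "Ck_on (Suc 1) U (\<lambda>x. DF x (axis j 1))" using Ck_on_direction[OF F1] unfolding DF_def by (simp add: numeral_2_eq_2)
    then have "Ck_on 1 U (\<lambda>u. DF2 u j i)" unfolding DF2_def by (rule Ck_on_direction)
    then show ?thesis using Ck_on_continuous S(1) continuous_on_subset by blast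
  qed
  \<comment> \<open>The second derivative at u of the function F - a . \<Psi> with the vector a
    frozen at u. Its first derivative vanishes there by \<open>grad\<close> below, so
    \<open>H\<close> is the leading term of the Taylor remainder of f.\<close>
  define H where "H = (\<lambda>u i j. DF2 u j i - a u \<bullet> D2 u j i)"
  have contH: "continuous_on S (\<lambda>u. H u i j)" for i j
    unfolding H_def by (intro continuous_intros conta contD2 contDF2)
  define tr where "tr = (\<lambda>u. \<Sum>i\<in>UNIV. \<Sum>j\<in>UNIV. matrix_inv (G u) $ i $ j * H u i j)"
  have conttr: "continuous_on S tr" unfolding tr_def by (intro continuous_intros contGi contH)
  have grad: "a u \<bullet> D u h = DF u h" if u: "u \<in> S" for u h
  proof -
    have uU: "u \<in> U" using u S(1) by blast
    have "a u \<bullet> D u (axis i 1) = DF u (axis i 1)" for i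
    proof -
      have "a u \<bullet> D u (axis i 1) = (\<Sum>l\<in>UNIV. \<Sum>j\<in>UNIV. G u $ i $ l * matrix_inv (G u) $ l $ j * DF u (axis j 1))"
        unfolding a_def using Gent[OF uU] by (simp add: inner_sum_left) (simp add: inner_commute mult_ac)
      also have "\<dots> = (\<Sum>j\<in>UNIV. (G u ** matrix_inv (G u)) $ i $ j * DF u (axis j 1))"
        by (subst sum.swap) (simp add: matrix_mul_entry sum_distrib_right)
      also have "\<dots> = DF u (axis i 1)"
        using detG[OF u] by (simp add: matrix_inv_props mat_def if_distrib[of "\<lambda>x. x * _"] cong: if_cong)
      finally show ?thesis .
    qed
    then show ?thesis
      by (subst linear_axis_expand[OF linD[OF uU]], subst linear_axis_expand[OF linDF[OF uU]]) (simp add: inner_sum_right)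
  qed
  obtain K1 where K1: "K1 \<ge> 0" "\<And>u w. u \<in> S \<Longrightarrow> w \<in> S \<Longrightarrow> norm (\<Psi> w - \<Psi> u - D u (w - u)) \<le> K1 * norm (w - u) ^ 2"
    using Ck_on_taylor1[OF C\<Psi> S] unfolding D_def by blast
  obtain K2 where K2: "K2 \<ge> 0" "\<And>u w. u \<in> S \<Longrightarrow> w \<in> S \<Longrightarrow>
      norm (\<Psi> w - \<Psi> u - D u (w - u) - (1/2) *\<^sub>R frechet_derivative (\<lambda>x. D x (w - u)) (at u) (w - u)) \<le> K2 * norm (w - u) ^ 3"
    using Ck_on_taylor2[OF C\<Psi> oU S] unfolding D_def by blast
  obtain K3 where K3: "K3 \<ge> 0" "\<And>u w. u \<in> S \<Longrightarrow> w \<in> S \<Longrightarrow> norm (F w - F u - DF u (w - u)) \<le> K3 * norm (w - u) ^ 2"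
    using Ck_on_taylor1[OF CF2 S] unfolding DF_def by blast
  obtain K4 where K4: "K4 \<ge> 0" "\<And>u w. u \<in> S \<Longrightarrow> w \<in> S \<Longrightarrow>
      norm (F w - F u - DF u (w - u) - (1/2) *\<^sub>R frechet_derivative (\<lambda>x. DF x (w - u)) (at u) (w - u)) \<le> K4 * norm (w - u) ^ 3"
    using Ck_on_taylor2[OF CF oU S] unfolding DF_def by blast
  obtain K5 where K5: "K5 \<ge> 0" "\<And>u w. u \<in> S \<Longrightarrow> w \<in> S \<Longrightarrow> norm (\<Psi> w - \<Psi> u) \<le> K5 * norm (w - u)"
    using Ck_on_lipschitz[OF C\<Psi> S] by blast
  have "\<exists>B\<ge>0. \<forall>u\<in>S. norm (D u (axis i 1)) \<le> B" for i
    by (rule continuous_on_compact_bounded[OF contD S(3)])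
  then obtain B6 where B6: "\<And>i. B6 i \<ge> 0" "\<And>i u. u \<in> S \<Longrightarrow> norm (D u (axis i 1)) \<le> B6 i" by metis
  define K6 where "K6 = (\<Sum>i\<in>UNIV. B6 i)"
  have K6: "K6 \<ge> 0" "\<And>u h. u \<in> S \<Longrightarrow> norm (D u h) \<le> K6 * norm h"
    using B6 S(1) by (auto simp: K6_def intro!: sum_nonneg linear_axis_bound linD)
  obtain Ba where Ba: "Ba \<ge> 0" "\<And>u. u \<in> S \<Longrightarrow> norm (a u) \<le> Ba"
    using continuous_on_compact_bounded[OF conta S(3)] by blast
  have "\<exists>B\<ge>0. \<forall>u\<in>S. norm (H u (fst p) (snd p)) \<le> B" for p
    by (rule continuous_on_compact_bounded[OF contH S(3)])
  then obtain BH where BH: "\<And>p. BH p \<ge> 0" "\<And>p u. u \<in> S \<Longrightarrow> norm (H u (fst p) (snd p)) \<le> BH p" by metis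
  define K7 where "K7 = (\<Sum>p\<in>UNIV. BH p)"
  have K7: "K7 \<ge> 0" "\<And>u i j. u \<in> S \<Longrightarrow> \<bar>H u i j\<bar> \<le> K7"
  proof -
    show "K7 \<ge> 0" using BH(1) by (simp add: K7_def sum_nonneg)
    show "\<bar>H u i j\<bar> \<le> K7" if "u \<in> S" for u i j
      using BH(2)[OF that, of "(i, j)"] member_le_sum[of "(i, j)" UNIV BH] BH(1) by (simp add: K7_def)
  qed
  obtain K8 where K8: "K8 \<ge> 0" "\<And>u. u \<in> S \<Longrightarrow> norm (tr u) \<le> K8"
    using continuous_on_compact_bounded[OF conttr S(3)] by blast
  obtain r0 where r0: "r0 > 0" "\<And>u. u \<in> cball u0 s \<Longrightarrow> Z \<inter> cball (\<Psi> u) r0 \<subseteq> \<Psi> ` ball u0 (2 * s)"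
    using chart_covers_small_balls[OF c compact_cball SW(3) open_ball order_trans[OF SW(1) S(1)]]
    unfolding \<Psi>_def by blast
  \<comment> \<open>The products with Ba arise because the remainder of F - a . \<Psi> combines the
    remainder of F with |a| times that of \<Psi>. The last summand turns the lower bound for the
    density into 1 / L.\<close>
  define L where "L = 1 + K1 + K3 + Ba * K1 + K4 + Ba * K2 + K5 + K6 + Ba + K7 + K8 + K\<rho> + 1 / (P_m * sqrt c0)"
  have "Ba * K1 \<ge> 0" "Ba * K2 \<ge> 0" "1 / (P_m * sqrt c0) > 0" using Ba K1 K2 \<rho>0 by simp_all
  then have L: "L \<ge> 1" "L \<ge> K1" "L \<ge> K3 + Ba * K1" "L \<ge> K4 + Ba * K2" "L \<ge> K5" "L \<ge> K6" "L \<ge> Ba" "L \<ge> K7" "L \<ge> K8" "L \<ge> K\<rho>" "L \<ge> 1 / (P_m * sqrt c0)"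
    unfolding L_def using K1(1) K2(1) K3(1) K4(1) K5(1) K6(1) K7(1) K8(1) Ba(1) K\<rho>(1) by linarith+
  have up: "X \<le> L * Y" if "X \<le> C * Y" "C \<le> L" "Y \<ge> 0" for X C Y :: real
    using that by (meson mult_right_mono order_trans)
  have inS: "u \<in> S" if "u \<in> cball u0 s" for u using that SW by blast
  have inS2: "w \<in> S" if "w \<in> ball u0 (2 * s)" for w using that SW by blast
  have tay2: "\<bar>F w - F u - a u \<bullet> (\<Psi> w - \<Psi> u) - (1/2) * (\<Sum>i\<in>UNIV. \<Sum>j\<in>UNIV. (w - u) $ i * (w - u) $ j * H u i j)\<bar>
       \<le> (K4 + Ba * K2) * norm (w - u) ^ 3" if u: "u \<in> S" and w: "w \<in> S" for u w
  proof -
    have uU: "u \<in> U" using u S(1) by blast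
    let ?h = "w - u"
    define X where "X = F w - F u - DF u ?h - (1/2) *\<^sub>R frechet_derivative (\<lambda>x. DF x ?h) (at u) ?h"
    define Y where "Y = \<Psi> w - \<Psi> u - D u ?h - (1/2) *\<^sub>R frechet_derivative (\<lambda>x. D x ?h) (at u) ?h"
    have eF: "frechet_derivative (\<lambda>x. DF x ?h) (at u) ?h = (\<Sum>i\<in>UNIV. \<Sum>j\<in>UNIV. (?h $ i * ?h $ j) * DF2 u j i)"
      unfolding DF_def DF2_def using second_derivative_expand[OF CF oU uU] by simp
    have e\<Psi>: "frechet_derivative (\<lambda>x. D x ?h) (at u) ?h = (\<Sum>i\<in>UNIV. \<Sum>j\<in>UNIV. (?h $ i * ?h $ j) *\<^sub>R D2 u j i)"
      unfolding D_def D2_def by (rule second_derivative_expand[OF C\<Psi> oU uU])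
    have "(\<Sum>i\<in>UNIV. \<Sum>j\<in>UNIV. ?h $ i * ?h $ j * H u i j) =
        frechet_derivative (\<lambda>x. DF x ?h) (at u) ?h - a u \<bullet> frechet_derivative (\<lambda>x. D x ?h) (at u) ?h"
      unfolding eF e\<Psi> H_def by (simp add: inner_sum_right right_diff_distrib sum_subtractf)
    then have "F w - F u - a u \<bullet> (\<Psi> w - \<Psi> u) - (1/2) * (\<Sum>i\<in>UNIV. \<Sum>j\<in>UNIV. ?h $ i * ?h $ j * H u i j) = X - a u \<bullet> Y"
      unfolding X_def Y_def using grad[OF u, of ?h] by (simp add: inner_diff_right algebra_simps)
    also have "\<bar>X - a u \<bullet> Y\<bar> \<le> \<bar>X\<bar> + norm (a u) * norm Y"
      using Cauchy_Schwarz_ineq2[of "a u" Y] by linarith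
    also have "\<dots> \<le> K4 * norm ?h ^ 3 + Ba * (K2 * norm ?h ^ 3)"
      using K4(2)[OF u w] K2(2)[OF u w] Ba u unfolding X_def Y_def by (intro add_mono mult_mono) auto
    finally show ?thesis by (simp add: algebra_simps)
  qed
  have tay1: "\<bar>F w - F u - a u \<bullet> (\<Psi> w - \<Psi> u)\<bar> \<le> (K3 + Ba * K1) * norm (w - u) ^ 2" if u: "u \<in> S" and w: "w \<in> S" for u w
  proof -
    let ?h = "w - u"
    define X where "X = F w - F u - DF u ?h"
    define Y where "Y = \<Psi> w - \<Psi> u - D u ?h"
    have "F w - F u - a u \<bullet> (\<Psi> w - \<Psi> u) = X - a u \<bullet> Y"
      unfolding X_def Y_def using grad[OF u, of ?h] by (simp add: inner_diff_right)
    also have "\<bar>X - a u \<bullet> Y\<bar> \<le> \<bar>X\<bar> + norm (a u) * norm Y"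
      using Cauchy_Schwarz_ineq2[of "a u" Y] by linarith
    also have "\<dots> \<le> K3 * norm ?h ^ 2 + Ba * (K1 * norm ?h ^ 2)"
      using K3(2)[OF u w] K1(2)[OF u w] Ba u unfolding X_def Y_def by (intro add_mono mult_mono) auto
    finally show ?thesis by (simp add: algebra_simps)
  qed
  interpret local_chart_function \<Psi> \<rho> D u0 s \<mu> L \<nu> Z f r0 a H
  proof (intro local_chart_function.intro local_chart.intro local_chart_function_axioms.intro)
    show "s > 0" "\<mu> > 0" "L \<ge> 1" "r0 > 0" by (rule s \<mu> L r0)+
    show "continuous_on (ball u0 (2 * s)) \<Psi>"
      using Ck_on_continuous[OF C\<Psi>] SW(1) S(1) by (auto intro: continuous_on_subset)
    show "continuous_on (ball u0 (2 * s)) \<rho>"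
      using lipschitz_bounded_continuous[OF lip\<rho>] SW(1) by (rule continuous_on_subset)
    show "continuous_on Z f" by (rule continuous_f)
    show "\<Psi> ` ball u0 (2 * s) \<subseteq> Z" using \<Psi>Z SW(1) S(1) by blast
  next
    fix u assume u: "u \<in> cball u0 s"
    note uS = inS[OF u]
    show "linear (D u)" using linD uS S(1) by blast
    show "\<mu> * norm h \<le> norm (D u h)" for h using lowD uS unfolding S_def by blast
    show "norm (D u h) \<le> L * norm h" for h by (rule up[OF K6(2)[OF uS] L(6)]) simp
    show "Z \<inter> cball (\<Psi> u) r0 \<subseteq> \<Psi> ` ball u0 (2 * s)" by (rule r0(2)[OF u])
    show "\<bar>H u i j\<bar> \<le> L" for i j using K7(2)[OF uS, of i j] L by linarith
    show "\<bar>\<Sum>i\<in>UNIV. \<Sum>j\<in>UNIV. matrix_inv (ellipsoid.Gram (D u)) $ i $ j * H u i j\<bar> \<le> L"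
      using K8(2)[OF uS] L Gram[OF uS] by (simp add: tr_def)
    have "a u = D u (\<Sum>l\<in>UNIV. \<Sum>j\<in>UNIV. (matrix_inv (G u) $ l $ j * DF u (axis j 1)) *\<^sub>R axis l 1)"
      unfolding a_def using linD[of u] uS S(1) by (simp add: linear_sum linear_scale subset_iff)
    then show "a u \<in> range (D u) \<and> norm (a u) \<le> L" using Ba(2)[OF uS] L by auto
  next
    fix u w assume u: "u \<in> cball u0 s" and w: "w \<in> ball u0 (2 * s)"
    note uS = inS[OF u] and wS = inS2[OF w]
    show "\<mu> * norm (w - u) \<le> norm (\<Psi> w - \<Psi> u)" using low\<Psi> uS wS unfolding S_def by blast
    show "norm (\<Psi> w - \<Psi> u) \<le> L * norm (w - u)" by (rule up[OF K5(2)[OF uS wS] L(5)]) simp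
    show "norm (\<Psi> w - \<Psi> u - D u (w - u)) \<le> L * (norm (w - u))\<^sup>2" by (rule up[OF K1(2)[OF uS wS] L(2)]) simp
    show "\<bar>\<rho> w - \<rho> u\<bar> \<le> L * norm (w - u)" by (rule up[OF K\<rho>(3)[OF uS wS] L(10)]) simp
    have FE: "f (\<Psi> v) = F v" for v by (simp add: F_def \<Psi>_def)
    show "\<bar>f (\<Psi> w) - f (\<Psi> u) - a u \<bullet> (\<Psi> w - \<Psi> u)\<bar> \<le> L * (norm (w - u))\<^sup>2"
      unfolding FE by (rule up[OF tay1[OF uS wS] L(3)]) simp
    show "\<bar>f (\<Psi> w) - f (\<Psi> u) - a u \<bullet> (\<Psi> w - \<Psi> u) - 1 / 2 * (\<Sum>i\<in>UNIV. \<Sum>j\<in>UNIV. (w - u) $ i * (w - u) $ j * H u i j)\<bar>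
        \<le> L * norm (w - u) ^ 3"
      unfolding FE by (rule up[OF tay2[OF uS wS] L(4)]) simp
  next
    fix w assume w: "w \<in> ball u0 (2 * s)"
    note wS = inS2[OF w]
    have "1 / L \<le> P_m * sqrt c0"
      using L(1) L(11) \<rho>0 by (simp add: field_simps)
    then show "1 / L \<le> \<rho> w \<and> \<rho> w \<le> L" using \<rho>low[OF wS] K\<rho>(2)[OF wS] L by linarith
  next
    fix u r and F' :: "real ^ 'p \<Rightarrow> real"
    assume u: "u \<in> cball u0 s" and r: "0 < r" "r \<le> r0" and F': "continuous_on Z F'"
    have "Z \<inter> cball (\<Psi> u) r \<subseteq> Z \<inter> cball (\<Psi> u) r0" using r by auto
    then have cov: "Z \<inter> cball (\<Psi> u) r \<subseteq> (\<iota> \<circ> \<psi>) ` ball u0 (2 * s)" using r0(2)[OF u] unfolding \<Psi>_def by blast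
    have sq: "continuous_on (ball u0 (2 * s)) (\<lambda>u. sqrt (det (g (U, \<psi>) u)))"
      using lipschitz_bounded_continuous[OF lipsq] SW(1) unfolding G_def by (rule continuous_on_subset)
    have sq0: "0 \<le> sqrt (det (g (U, \<psi>) u))" if "u \<in> ball u0 (2 * s)" for u
      using detG[OF inS2[OF that]] by (simp add: G_def)
    show "(\<integral>y. F' y * indicator (cball (\<Psi> u) r) y \<partial>\<nu>) =
      (\<integral>w. indicator (ball u0 (2 * s)) w * (indicator (cball (\<Psi> u) r) (\<Psi> w) * (F' (\<Psi> w) * \<rho> w)) \<partial>lborel)"
      unfolding \<rho>_def G_def \<Psi>_def
    proof (rule chart_integral[OF c open_ball _ _ sq sq0 cov[unfolded \<Psi>_def] F'])
      show "ball u0 (2 * s) \<subseteq> U" using SW(1) S(1) by blast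
      show "u0 \<in> ball u0 (2 * s)" using s by simp
    qed
  qed
  obtain K where K: "\<And>u. u \<in> cball u0 s \<Longrightarrow> lle_geometry CARD('d) \<nu> Z f K (\<Psi> u) (a u) (range (D u)) (\<rho> u * ellipsoid.vol (D u))
     (\<Sum>i\<in>UNIV. \<Sum>j\<in>UNIV. matrix_inv (ellipsoid.Gram (D u)) $ i $ j * H u i j)"
    using lle_geometry_chart by blast
  have lap: "(\<Sum>i\<in>UNIV. \<Sum>j\<in>UNIV. matrix_inv (ellipsoid.Gram (D u)) $ i $ j * H u i j) = laplace_coord G F u"
    if u: "u \<in> cball u0 s" for u
  proof -
    have uU: "u \<in> U" using inS[OF u] S(1) by blast
    show ?thesis
      unfolding Gram[OF inS[OF u]]
      unfolding H_def a_def D2_def DF2_def D_def DF_def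
      by (rule laplace_coord_embedded[OF oU uU C\<Psi> CF2 immers[unfolded D_def] Gent[unfolded D_def], symmetric])
  qed
  have "\<forall>u\<in>cball u0 s. \<exists>T \<alpha>. lle_geometry CARD('d) \<nu> Z f K (\<Psi> u) (a u) T \<alpha> (laplace_coord G F u)"
  proof
    fix u assume u: "u \<in> cball u0 s"
    from K[OF u] have "lle_geometry CARD('d) \<nu> Z f K (\<Psi> u) (a u) (range (D u)) (\<rho> u * ellipsoid.vol (D u)) (laplace_coord G F u)"
      unfolding lap[OF u] .
    then show "\<exists>T \<alpha>. lle_geometry CARD('d) \<nu> Z f K (\<Psi> u) (a u) T \<alpha> (laplace_coord G F u)" by blast
  qed
  moreover have "continuous_on (cball u0 s) a" using conta SW(2) by (rule continuous_on_subset)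
  moreover have "cball u0 s \<subseteq> U" using SW(2) S(1) by blast
  ultimately show ?thesis using s unfolding \<Psi>_def G_def F_def by blast
qed

lemma finite_measure_\<nu>: "finite_measure \<nu>"
  using density_prob by (simp add: prob_space_def)

lemma indicator_cball_measurable: "(indicator (cball x r) :: _ \<Rightarrow> real) \<in> borel_measurable \<nu>"
  by (rule measurable_\<nu>I, rule measurable_restrict_space1, rule borel_measurable_indicator) simp

lemmas geometry_unique = lle_geometry_unique[OF _ _ finite_measure_\<nu> space_\<nu> indicator_cball_measurable]

text \<open>The gradient is picked at each point by choice; uniqueness identifies it with the
  continuous gradient found in every chart, so the choice is continuous. Applying the local result
  also in the chart selected by \<open>laplace_beltrami\<close> shows in the same way that every
  local Laplacian is the global one. A finite cover then provides a common constant.\<close>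

lemma global_geometry:
  "\<exists>K a. continuous_on Z a \<and> (\<forall>x\<in>M. \<exists>T \<alpha>.
     lle_geometry CARD('d) \<nu> Z f K (\<iota> x) (a (\<iota> x)) T \<alpha> (laplace_beltrami \<A> g (f \<circ> \<iota>) x))"
proof -
  define Geo where "Geo = (\<lambda>K y b \<Delta>. \<exists>T \<alpha>. lle_geometry CARD('d) \<nu> Z f K y b T \<alpha> \<Delta>)"
  define a where "a = (\<lambda>y. SOME b. \<exists>K \<Delta>. Geo K y b \<Delta>)"
  have a_eq: "a y = b" if "Geo K y b \<Delta>" for K y b \<Delta>
  proof -
    have "\<exists>K \<Delta>. Geo K y (a y) \<Delta>" unfolding a_def using that by (intro someI[of "\<lambda>b. \<exists>K \<Delta>. Geo K y b \<Delta>"]) blast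
    then show ?thesis using that geometry_unique(1) unfolding Geo_def by blast
  qed
  have lap_eq: "\<Delta> = laplace_beltrami \<A> g (f \<circ> \<iota>) x" if G: "Geo K (\<iota> x) b \<Delta>" and x: "x \<in> M" for K x b \<Delta>
  proof -
    define c where "c = (SOME c. c \<in> \<A> \<and> x \<in> snd c ` fst c)"
    have "\<exists>c. c \<in> \<A> \<and> x \<in> snd c ` fst c" using charts_cover[OF x] by force
    then have c: "c \<in> \<A> \<and> x \<in> snd c ` fst c" unfolding c_def by (rule someI_ex)
    obtain U \<psi> where ce: "c = (U, \<psi>)" by (cases c)
    define u where "u = inv_into U \<psi> x"
    have u: "u \<in> U" "\<psi> u = x" using c unfolding u_def ce by (auto intro: inv_into_into f_inv_into_f)
    have "(U, \<psi>) \<in> \<A>" using c ce by simp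
    from local_geometry[OF this u(1)] obtain s K' b' T \<alpha> where "s > 0"
      "\<forall>v\<in>cball u s. \<exists>T \<alpha>. lle_geometry CARD('d) \<nu> Z f K' ((\<iota> \<circ> \<psi>) v) (b' v) T \<alpha> (laplace_coord (g (U, \<psi>)) ((f \<circ> \<iota>) \<circ> \<psi>) v)"
      by blast
    then have "Geo K' ((\<iota> \<circ> \<psi>) u) (b' u) (laplace_coord (g (U, \<psi>)) ((f \<circ> \<iota>) \<circ> \<psi>) u)"
      unfolding Geo_def by (meson centre_in_cball less_imp_le)
    then have "\<Delta> = laplace_coord (g (U, \<psi>)) ((f \<circ> \<iota>) \<circ> \<psi>) u"
      using G geometry_unique(2) unfolding Geo_def by (simp add: u(2)) blast
    then show ?thesis
      unfolding laplace_beltrami_def Let_def c_def[symmetric] ce by (simp add: u_def)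
  qed
  have cont: "continuous_on Z a"
  proof (rule continuous_on_Z_chartwise)
    fix U \<psi> u0 assume c: "(U, \<psi>) \<in> \<A>" "u0 \<in> U"
    obtain s K b where s: "s > 0" "cball u0 s \<subseteq> U" "continuous_on (cball u0 s) b"
      "\<And>u. u \<in> cball u0 s \<Longrightarrow> Geo K ((\<iota> \<circ> \<psi>) u) (b u) (laplace_coord (g (U, \<psi>)) ((f \<circ> \<iota>) \<circ> \<psi>) u)"
      using local_geometry[OF c] unfolding Geo_def by blast
    have "continuous_on (cball u0 s) (a \<circ> (\<iota> \<circ> \<psi>))"
      by (rule continuous_on_eq[OF s(3)]) (use a_eq[OF s(4)] in simp)
    then show "\<exists>s>0. cball u0 s \<subseteq> U \<and> continuous_on (cball u0 s) (a \<circ> (\<iota> \<circ> \<psi>))" using s by blast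
  qed
  define Q where "Q = (\<lambda>(U :: (real ^ 'd) set) \<psi> (u0 :: real ^ 'd) s. \<exists>K. \<forall>u\<in>cball u0 s. \<exists>b \<Delta>. Geo K ((\<iota> \<circ> \<psi>) u) b \<Delta>)"
  have "\<exists>I. finite I \<and> (\<forall>(U, \<psi>, u0, s)\<in>I. (U, \<psi>) \<in> \<A> \<and> u0 \<in> U \<and> s > 0 \<and> cball u0 s \<subseteq> U \<and> Q U \<psi> u0 s)
     \<and> Z = (\<Union>(U, \<psi>, u0, s)\<in>I. (\<iota> \<circ> \<psi>) ` cball u0 s)"
  proof (rule finite_chart_cover)
    fix U \<psi> u0 assume c: "(U, \<psi>) \<in> \<A>" "u0 \<in> U"
    show "\<exists>s>0. cball u0 s \<subseteq> U \<and> Q U \<psi> u0 s"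
    proof -
      from local_geometry[OF c] obtain s K b where s: "s > 0" "cball u0 s \<subseteq> U"
        "continuous_on (cball u0 s) b"
        "\<forall>u\<in>cball u0 s. \<exists>T \<alpha>. lle_geometry CARD('d) \<nu> Z f K ((\<iota> \<circ> \<psi>) u) (b u) T \<alpha>
           (laplace_coord (g (U, \<psi>)) ((f \<circ> \<iota>) \<circ> \<psi>) u)"
        by (elim exE conjE) (rule that)
      have "Q U \<psi> u0 s" unfolding Q_def
        by (intro exI[of _ K] ballI exI) (unfold Geo_def, rule bspec[OF s(4)])
      then show ?thesis using s by (intro exI[of _ s] conjI)
    qed
  qed
  then obtain I where I: "finite I" "\<forall>(U, \<psi>, u0, s)\<in>I. (U, \<psi>) \<in> \<A> \<and> u0 \<in> U \<and> s > 0 \<and> cball u0 s \<subseteq> U \<and> Q U \<psi> u0 s"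
     "Z = (\<Union>(U, \<psi>, u0, s)\<in>I. (\<iota> \<circ> \<psi>) ` cball u0 s)"
    by (elim exE conjE) (rule that)
  let ?piece = "\<lambda>(U, \<psi>, u0, s). (\<iota> \<circ> \<psi>) ` cball u0 s"
  have "\<forall>j\<in>I. \<exists>K. \<forall>y\<in>?piece j. \<exists>b \<Delta>. Geo K y b \<Delta>"
  proof
    fix j assume "j \<in> I"
    moreover obtain U \<psi> u0 s where j: "j = (U, \<psi>, u0, s)" by (cases j)
    ultimately have "Q U \<psi> u0 s" using I(2) by auto
    then show "\<exists>K. \<forall>y\<in>?piece j. \<exists>b \<Delta>. Geo K y b \<Delta>" unfolding Q_def j by auto
  qed
  from bchoice[OF this] obtain k where k: "\<forall>j\<in>I. \<forall>y\<in>?piece j. \<exists>b \<Delta>. Geo (k j) y b \<Delta>"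
    by (elim exE) (rule that)
  \<comment> \<open>The element 0 keeps the maximum defined when the cover is empty.\<close>
  define K where "K = Max (insert 0 (k ` I))"
  have kK: "k j \<le> K" if "j \<in> I" for j unfolding K_def using I(1) that by (intro Max_ge) auto
  have "\<exists>T \<alpha>. lle_geometry CARD('d) \<nu> Z f K (\<iota> x) (a (\<iota> x)) T \<alpha> (laplace_beltrami \<A> g (f \<circ> \<iota>) x)" if x: "x \<in> M" for x
  proof -
    have "\<iota> x \<in> (\<Union>j\<in>I. ?piece j)" using x I(3) by blast
    then obtain j where j: "j \<in> I" "\<iota> x \<in> ?piece j" by blast
    obtain b \<Delta> where G: "Geo (k j) (\<iota> x) b \<Delta>" using bspec[OF bspec[OF k j(1)] j(2)] by blast
    have "b = a (\<iota> x)" "\<Delta> = laplace_beltrami \<A> g (f \<circ> \<iota>) x" using a_eq[OF G] lap_eq[OF G x] by auto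
    then show ?thesis using G lle_geometry_mono[OF _ kK[OF j(1)]] unfolding Geo_def by blast
  qed
  then show ?thesis using cont by blast
qed

end

section \<open>Concentration of sample sums\<close>

text \<open>For x = -y with y positive, exp y \<ge> 1 + y reduces the claim to (1 + y) (1 - y + y^2)
  = 1 + y^3 \<ge> 1.\<close>

lemma exp_le_quadratic:
  fixes x :: real
  assumes "\<bar>x\<bar> \<le> 1"
  shows "exp x \<le> 1 + x + x\<^sup>2"
proof (cases "x \<ge> 0")
  case True
  then show ?thesis using exp_bound[of x] assms by simp
next
  case False
  define y where "y = - x"
  have y: "0 \<le> y" "y \<le> 1" using False assms by (auto simp: y_def)
  have "1 \<le> (1 + y) * (1 - y + y\<^sup>2)"
  proof -
    have "(1 + y) * (1 - y + y\<^sup>2) = 1 + y ^ 3" by (simp add: algebra_simps power2_eq_square power3_eq_cube)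
    then show ?thesis using y by simp
  qed
  also have "\<dots> \<le> exp y * (1 - y + y\<^sup>2)"
  proof (rule mult_right_mono)
    show "1 + y \<le> exp y" by (rule exp_ge_add_one_self)
    show "0 \<le> 1 - y + y\<^sup>2" using y by simp
  qed
  finally have "exp (- y) \<le> exp (- y) * (exp y * (1 - y + y\<^sup>2))" by simp
  also have "\<dots> = 1 - y + y\<^sup>2" by (simp add: exp_minus)
  finally show ?thesis by (simp add: y_def)
qed

text \<open>The exponent contains the second moment and not the range of h; this matters because the
  test functions have size 1 but second moment of order r^d. Centring only multiplies by exp (- (s *
  m)), which cancels the linear term, so a bound on the second moment about 0 is enough.\<close>

lemma (in prob_space) centred_exponential_moment:
  assumes h: "h \<in> borel_measurable M" "\<And>z. z \<in> space M \<Longrightarrow> \<bar>h z\<bar> \<le> 1"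
    and \<sigma>: "(\<integral>z. (h z)\<^sup>2 \<partial>M) \<le> \<sigma>" and s: "0 \<le> s" "s \<le> 1"
  shows "(\<integral>\<^sup>+z. ennreal (exp (s * (h z - (\<integral>y. h y \<partial>M)))) \<partial>M) \<le> ennreal (exp (s\<^sup>2 * \<sigma>))"
proof -
  note [measurable] = h(1)
  define m where "m = (\<integral>y. h y \<partial>M)"
  have int: "integrable M h" "integrable M (\<lambda>z. (h z)\<^sup>2)"
    using h(2) by (auto intro!: integrable_const_bound[of _ 1] simp: abs_square_le_1)
  have "(\<integral>\<^sup>+z. ennreal (exp (s * h z)) \<partial>M) \<le> (\<integral>\<^sup>+z. ennreal (1 + s * h z + s\<^sup>2 * (h z)\<^sup>2) \<partial>M)"
  proof (intro nn_integral_mono ennreal_leI)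
    fix z assume z: "z \<in> space M"
    have "\<bar>s * h z\<bar> \<le> 1" unfolding abs_mult using mult_mono[of "\<bar>s\<bar>" 1 "\<bar>h z\<bar>" 1] h(2)[OF z] s by simp
    from exp_le_quadratic[OF this] show "exp (s * h z) \<le> 1 + s * h z + s\<^sup>2 * (h z)\<^sup>2"
      by (simp add: power_mult_distrib)
  qed
  also have "\<dots> = ennreal (\<integral>z. 1 + s * h z + s\<^sup>2 * (h z)\<^sup>2 \<partial>M)"
  proof (rule nn_integral_eq_integral)
    show "integrable M (\<lambda>z. 1 + s * h z + s\<^sup>2 * (h z)\<^sup>2)" using int by simp
    show "AE z in M. 0 \<le> 1 + s * h z + s\<^sup>2 * (h z)\<^sup>2"
    proof (rule AE_I2)
      fix z assume z: "z \<in> space M"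
      have "\<bar>s * h z\<bar> \<le> 1" unfolding abs_mult using mult_mono[of "\<bar>s\<bar>" 1 "\<bar>h z\<bar>" 1] h(2)[OF z] s by simp
      moreover have "0 \<le> s\<^sup>2 * (h z)\<^sup>2" by simp
      ultimately show "0 \<le> 1 + s * h z + s\<^sup>2 * (h z)\<^sup>2" by linarith
    qed
  qed
  also have "(\<integral>z. 1 + s * h z + s\<^sup>2 * (h z)\<^sup>2 \<partial>M) = 1 + s * m + s\<^sup>2 * (\<integral>z. (h z)\<^sup>2 \<partial>M)"
    using int by (simp add: m_def prob_space)
  also have "\<dots> \<le> 1 + (s * m + s\<^sup>2 * \<sigma>)" using mult_left_mono[OF \<sigma>, of "s\<^sup>2"] by simp
  also have "\<dots> \<le> exp (s * m + s\<^sup>2 * \<sigma>)" by (rule exp_ge_add_one_self)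
  finally have main: "(\<integral>\<^sup>+z. ennreal (exp (s * h z)) \<partial>M) \<le> ennreal (exp (s * m + s\<^sup>2 * \<sigma>))"
    by (simp add: ennreal_leI)
  have "(\<integral>\<^sup>+z. ennreal (exp (s * (h z - m))) \<partial>M) = (\<integral>\<^sup>+z. ennreal (exp (- (s * m))) * ennreal (exp (s * h z)) \<partial>M)"
    by (intro nn_integral_cong) (simp add: ennreal_mult'[symmetric] exp_add[symmetric] right_diff_distrib)
  also have "\<dots> = ennreal (exp (- (s * m))) * (\<integral>\<^sup>+z. ennreal (exp (s * h z)) \<partial>M)"
    by (rule nn_integral_cmult) measurable
  also have "\<dots> \<le> ennreal (exp (- (s * m))) * ennreal (exp (s * m + s\<^sup>2 * \<sigma>))"
    by (intro mult_left_mono main) simp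
  also have "\<dots> = ennreal (exp (s\<^sup>2 * \<sigma>))"
    by (simp add: ennreal_mult'[symmetric] exp_add[symmetric])
  finally show ?thesis unfolding m_def .
qed

lemma prod_le_power_card_ennreal:
  fixes F :: "'i \<Rightarrow> ennreal"
  assumes "finite J" "\<And>j. j \<in> J \<Longrightarrow> F j \<le> c"
  shows "(\<Prod>j\<in>J. F j) \<le> c ^ card J"
  using assms by (induction J) (auto intro: mult_mono)

text \<open>Independence and common law are stated together as one equation for the joint law, the
  form in which Fubini's theorem can separate one sample from the others.\<close>

locale iid_family = \<Omega>: prob_space \<Omega> + \<nu>: prob_space \<nu> for \<Omega> :: "'w measure" and \<nu> :: "'a measure" +
  fixes X :: "nat \<Rightarrow> 'w \<Rightarrow> 'a" and n :: nat
  assumes X [measurable]: "\<And>i. i < n \<Longrightarrow> X i \<in> \<Omega> \<rightarrow>\<^sub>M \<nu>"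
    and joint: "distr \<Omega> (PiM {..<n} (\<lambda>_. \<nu>)) (\<lambda>\<omega>. \<lambda>i\<in>{..<n}. X i \<omega>) = PiM {..<n} (\<lambda>_. \<nu>)"
begin

lemma X_space: "i < n \<Longrightarrow> \<omega> \<in> space \<Omega> \<Longrightarrow> X i \<omega> \<in> space \<nu>"
  using measurable_space[OF X] .

text \<open>Conditioning on the base point: the coordinate k is integrated last, and for fixed y the
  remaining samples are still independent with law \<nu>. The factors may depend on j so that a
  single pair can be singled out as well.\<close>

lemma nn_integral_pair_product:
  assumes k: "k < n" and \<phi>: "\<And>j. case_prod (\<phi> j) \<in> borel_measurable (\<nu> \<Otimes>\<^sub>M \<nu>)"
  shows "(\<integral>\<^sup>+\<omega>. (\<Prod>j\<in>{..<n} - {k}. \<phi> j (X k \<omega>) (X j \<omega>)) \<partial>\<Omega>) =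
    (\<integral>\<^sup>+y. (\<Prod>j\<in>{..<n} - {k}. (\<integral>\<^sup>+z. \<phi> j y z \<partial>\<nu>)) \<partial>\<nu>)"
proof -
  let ?J = "{..<n} - {k}"
  interpret product_sigma_finite "\<lambda>_ :: nat. \<nu>" by standard
  have ins: "{..<n} = insert k ?J" using k by auto
  define G where "G = (\<lambda>x :: nat \<Rightarrow> 'a. \<Prod>j\<in>?J. \<phi> j (x k) (x j))"
  have Gm [measurable]: "G \<in> borel_measurable (PiM {..<n} (\<lambda>_. \<nu>))"
    unfolding G_def
  proof (rule borel_measurable_prod_ennreal)
    fix j assume j: "j \<in> ?J"
    have "(\<lambda>x. (x k, x j)) \<in> PiM {..<n} (\<lambda>_. \<nu>) \<rightarrow>\<^sub>M \<nu> \<Otimes>\<^sub>M \<nu>"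
      using j k by (intro measurable_Pair measurable_component_singleton) auto
    from measurable_compose[OF this \<phi>[of j]]
    show "(\<lambda>x. \<phi> j (x k) (x j)) \<in> borel_measurable (PiM {..<n} (\<lambda>_. \<nu>))" by simp
  qed
  have Xm: "(\<lambda>\<omega>. \<lambda>i\<in>{..<n}. X i \<omega>) \<in> \<Omega> \<rightarrow>\<^sub>M PiM {..<n} (\<lambda>_. \<nu>)"
    by (intro measurable_restrict) auto
  have "(\<integral>\<^sup>+\<omega>. (\<Prod>j\<in>?J. \<phi> j (X k \<omega>) (X j \<omega>)) \<partial>\<Omega>) = (\<integral>\<^sup>+\<omega>. G (\<lambda>i\<in>{..<n}. X i \<omega>) \<partial>\<Omega>)"
    unfolding G_def using k by (intro nn_integral_cong prod.cong) auto
  also have "\<dots> = (\<integral>\<^sup>+x. G x \<partial>distr \<Omega> (PiM {..<n} (\<lambda>_. \<nu>)) (\<lambda>\<omega>. \<lambda>i\<in>{..<n}. X i \<omega>))"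
    by (rule nn_integral_distr[OF Xm, symmetric]) (use Gm joint in simp)
  also have "\<dots> = (\<integral>\<^sup>+x. G x \<partial>PiM (insert k ?J) (\<lambda>_. \<nu>))" by (simp only: joint ins[symmetric])
  also have "\<dots> = (\<integral>\<^sup>+y. (\<integral>\<^sup>+x. G (x(k := y)) \<partial>PiM ?J (\<lambda>_. \<nu>)) \<partial>\<nu>)"
    by (rule product_nn_integral_insert_rev) (use Gm ins in auto)
  also have "\<dots> = (\<integral>\<^sup>+y. (\<integral>\<^sup>+x. (\<Prod>j\<in>?J. \<phi> j y (x j)) \<partial>PiM ?J (\<lambda>_. \<nu>)) \<partial>\<nu>)"
    unfolding G_def by (intro nn_integral_cong prod.cong) auto
  also have "\<dots> = (\<integral>\<^sup>+y. (\<Prod>j\<in>?J. (\<integral>\<^sup>+z. \<phi> j y z \<partial>\<nu>)) \<partial>\<nu>)"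
  proof (intro nn_integral_cong product_nn_integral_prod)
    fix y j assume "y \<in> space \<nu>"
    from measurable_compose[OF measurable_Pair1'[OF this] \<phi>[of j]]
    show "\<phi> j y \<in> borel_measurable \<nu>" by simp
  qed simp
  finally show ?thesis .
qed

text \<open>Exponential Markov inequality. The centring is by the mean given X k, and the
  conditional moment generating function is bounded uniformly in the value of X k.\<close>

lemma chernoff_one_sided:
  assumes k: "k < n" and h: "case_prod h \<in> borel_measurable (\<nu> \<Otimes>\<^sub>M \<nu>)"
    and h1: "\<And>y z. y \<in> space \<nu> \<Longrightarrow> z \<in> space \<nu> \<Longrightarrow> \<bar>h y z\<bar> \<le> 1"
    and \<sigma>: "\<And>y. y \<in> space \<nu> \<Longrightarrow> (\<integral>z. (h y z)\<^sup>2 \<partial>\<nu>) \<le> \<sigma>" "0 \<le> \<sigma>"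
    and s: "0 \<le> s" "s \<le> 1"
  shows "measure \<Omega> {\<omega> \<in> space \<Omega>. t < (\<Sum>j\<in>{..<n} - {k}. h (X k \<omega>) (X j \<omega>) - (\<integral>z. h (X k \<omega>) z \<partial>\<nu>))}
     \<le> exp (real n * s\<^sup>2 * \<sigma> - s * t)"
proof -
  let ?J = "{..<n} - {k}"
  define m where "m = (\<lambda>y. \<integral>z. h y z \<partial>\<nu>)"
  note [measurable] = h
  have mm [measurable]: "m \<in> borel_measurable \<nu>" unfolding m_def by measurable
  have Xk [measurable]: "X k \<in> \<Omega> \<rightarrow>\<^sub>M \<nu>" by (rule X[OF k])
  define Y where "Y = (\<lambda>\<omega>. \<Sum>j\<in>?J. h (X k \<omega>) (X j \<omega>) - m (X k \<omega>))"
  have Ym [measurable]: "Y \<in> borel_measurable \<Omega>"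
    unfolding Y_def
  proof (rule borel_measurable_sum)
    fix j assume j: "j \<in> ?J"
    then have [measurable]: "X j \<in> \<Omega> \<rightarrow>\<^sub>M \<nu>" by (intro X) auto
    have "(\<lambda>\<omega>. (X k \<omega>, X j \<omega>)) \<in> \<Omega> \<rightarrow>\<^sub>M \<nu> \<Otimes>\<^sub>M \<nu>" by measurable
    from measurable_compose[OF this h] have "(\<lambda>\<omega>. h (X k \<omega>) (X j \<omega>)) \<in> borel_measurable \<Omega>" by simp
    then show "(\<lambda>\<omega>. h (X k \<omega>) (X j \<omega>) - m (X k \<omega>)) \<in> borel_measurable \<Omega>" by measurable
  qed
  define \<phi> where "\<phi> = (\<lambda>(j :: nat) y z. ennreal (exp (s * (h y z - m y))))"
  have \<phi>m: "case_prod (\<phi> j) \<in> borel_measurable (\<nu> \<Otimes>\<^sub>M \<nu>)" for j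
  proof -
    have "(\<lambda>p. ennreal (exp (s * (case_prod h p - m (fst p))))) \<in> borel_measurable (\<nu> \<Otimes>\<^sub>M \<nu>)" by measurable
    then show ?thesis by (simp add: \<phi>_def case_prod_beta')
  qed
  have "(\<integral>\<^sup>+\<omega>. ennreal (exp (s * Y \<omega>)) \<partial>\<Omega>) = (\<integral>\<^sup>+\<omega>. (\<Prod>j\<in>?J. \<phi> j (X k \<omega>) (X j \<omega>)) \<partial>\<Omega>)"
    by (intro nn_integral_cong) (simp add: \<phi>_def Y_def sum_distrib_left exp_sum prod_ennreal)
  also have "\<dots> = (\<integral>\<^sup>+y. (\<Prod>j\<in>?J. (\<integral>\<^sup>+z. \<phi> j y z \<partial>\<nu>)) \<partial>\<nu>)"
    by (rule nn_integral_pair_product[OF k \<phi>m])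
  also have "\<dots> \<le> (\<integral>\<^sup>+y. ennreal (exp (real n * s\<^sup>2 * \<sigma>)) \<partial>\<nu>)"
  proof (rule nn_integral_mono)
    fix y assume y: "y \<in> space \<nu>"
    have hy: "h y \<in> borel_measurable \<nu>" using measurable_compose[OF measurable_Pair1'[OF y] h] by simp
    have "(\<Prod>j\<in>?J. (\<integral>\<^sup>+z. \<phi> j y z \<partial>\<nu>)) \<le> ennreal (exp (s\<^sup>2 * \<sigma>)) ^ card ?J"
      unfolding \<phi>_def m_def
      by (intro prod_le_power_card_ennreal \<nu>.centred_exponential_moment hy h1 y \<sigma> s) auto
    also have "\<dots> = ennreal (exp (real (card ?J) * (s\<^sup>2 * \<sigma>)))" by (simp add: ennreal_power exp_of_nat_mult)
    also have "\<dots> \<le> ennreal (exp (real n * s\<^sup>2 * \<sigma>))"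
    proof (intro ennreal_leI, simp only: exp_le_cancel_iff mult.assoc, intro mult_right_mono)
      show "real (card ?J) \<le> real n" using card_mono[of "{..<n}" ?J] by simp
    qed (use \<sigma> in simp)
    finally show "(\<Prod>j\<in>?J. (\<integral>\<^sup>+z. \<phi> j y z \<partial>\<nu>)) \<le> ennreal (exp (real n * s\<^sup>2 * \<sigma>))" .
  qed
  also have "\<dots> = ennreal (exp (real n * s\<^sup>2 * \<sigma>))" by (simp add: \<nu>.emeasure_space_1)
  finally have mgf: "(\<integral>\<^sup>+\<omega>. ennreal (exp (s * Y \<omega>)) \<partial>\<Omega>) \<le> ennreal (exp (real n * s\<^sup>2 * \<sigma>))" .
  have "emeasure \<Omega> {\<omega> \<in> space \<Omega>. t < Y \<omega>} = (\<integral>\<^sup>+\<omega>. indicator {\<omega> \<in> space \<Omega>. t < Y \<omega>} \<omega> \<partial>\<Omega>)"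
    by (subst nn_integral_indicator) auto
  also have "\<dots> \<le> (\<integral>\<^sup>+\<omega>. ennreal (exp (- (s * t))) * ennreal (exp (s * Y \<omega>)) \<partial>\<Omega>)"
  proof (rule nn_integral_mono)
    fix \<omega> assume "\<omega> \<in> space \<Omega>"
    have "1 \<le> exp (- (s * t)) * exp (s * Y \<omega>)" if "t < Y \<omega>"
      using that s mult_left_mono[of t "Y \<omega>" s] by (simp add: exp_add[symmetric])
    then show "indicator {\<omega> \<in> space \<Omega>. t < Y \<omega>} \<omega> \<le> ennreal (exp (- (s * t))) * ennreal (exp (s * Y \<omega>))"
      by (auto simp: indicator_def ennreal_mult'[symmetric])
  qed
  also have "\<dots> = ennreal (exp (- (s * t))) * (\<integral>\<^sup>+\<omega>. ennreal (exp (s * Y \<omega>)) \<partial>\<Omega>)"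
    by (rule nn_integral_cmult) measurable
  also have "\<dots> \<le> ennreal (exp (- (s * t))) * ennreal (exp (real n * s\<^sup>2 * \<sigma>))"
    by (intro mult_left_mono mgf) simp
  also have "\<dots> = ennreal (exp (real n * s\<^sup>2 * \<sigma> - s * t))"
    by (simp add: ennreal_mult'[symmetric] exp_add[symmetric])
  finally have "emeasure \<Omega> {\<omega> \<in> space \<Omega>. t < Y \<omega>} \<le> ennreal (exp (real n * s\<^sup>2 * \<sigma> - s * t))" .
  then have "measure \<Omega> {\<omega> \<in> space \<Omega>. t < Y \<omega>} \<le> exp (real n * s\<^sup>2 * \<sigma> - s * t)"
    by (simp add: \<Omega>.emeasure_eq_measure)
  then show ?thesis unfolding Y_def m_def .
qed

lemma chernoff_two_sided:
  assumes k: "k < n" and h: "case_prod h \<in> borel_measurable (\<nu> \<Otimes>\<^sub>M \<nu>)"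
    and h1: "\<And>y z. y \<in> space \<nu> \<Longrightarrow> z \<in> space \<nu> \<Longrightarrow> \<bar>h y z\<bar> \<le> 1"
    and \<sigma>: "\<And>y. y \<in> space \<nu> \<Longrightarrow> (\<integral>z. (h y z)\<^sup>2 \<partial>\<nu>) \<le> \<sigma>" "0 \<le> \<sigma>"
    and s: "0 \<le> s" "s \<le> 1"
  shows "\<exists>B\<in>sets \<Omega>. measure \<Omega> B \<le> 2 * exp (real n * s\<^sup>2 * \<sigma> - s * t) \<and>
    (\<forall>\<omega>\<in>space \<Omega> - B. \<bar>\<Sum>j\<in>{..<n} - {k}. h (X k \<omega>) (X j \<omega>) - (\<integral>z. h (X k \<omega>) z \<partial>\<nu>)\<bar> \<le> t)"
proof -
  let ?Y = "\<lambda>h \<omega>. \<Sum>j\<in>{..<n} - {k}. h (X k \<omega>) (X j \<omega>) - (\<integral>z. h (X k \<omega>) z \<partial>\<nu>)"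
  let ?h' = "\<lambda>y z. - h y z"
  let ?B = "\<lambda>h. {\<omega> \<in> space \<Omega>. t < ?Y h \<omega>}"
  have h': "case_prod ?h' \<in> borel_measurable (\<nu> \<Otimes>\<^sub>M \<nu>)"
    using borel_measurable_uminus[OF h] by (simp add: case_prod_beta')
  have meas: "?B g \<in> sets \<Omega>" if g: "case_prod g \<in> borel_measurable (\<nu> \<Otimes>\<^sub>M \<nu>)" for g :: "'a \<Rightarrow> 'a \<Rightarrow> real"
  proof -
    note [measurable] = g
    have Xk [measurable]: "X k \<in> \<Omega> \<rightarrow>\<^sub>M \<nu>" by (rule X[OF k])
    have m [measurable]: "(\<lambda>y. \<integral>z. g y z \<partial>\<nu>) \<in> borel_measurable \<nu>" by measurable
    have [measurable]: "?Y g \<in> borel_measurable \<Omega>"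
    proof (rule borel_measurable_sum)
      fix j assume j: "j \<in> {..<n} - {k}"
      then have [measurable]: "X j \<in> \<Omega> \<rightarrow>\<^sub>M \<nu>" by (intro X) auto
      have "(\<lambda>\<omega>. (X k \<omega>, X j \<omega>)) \<in> \<Omega> \<rightarrow>\<^sub>M \<nu> \<Otimes>\<^sub>M \<nu>" by measurable
      from measurable_compose[OF this g] have "(\<lambda>\<omega>. g (X k \<omega>) (X j \<omega>)) \<in> borel_measurable \<Omega>" by simp
      moreover have "(\<lambda>\<omega>. \<integral>z. g (X k \<omega>) z \<partial>\<nu>) \<in> borel_measurable \<Omega>" using measurable_compose[OF Xk m] by simp
      ultimately show "(\<lambda>\<omega>. g (X k \<omega>) (X j \<omega>) - (\<integral>z. g (X k \<omega>) z \<partial>\<nu>)) \<in> borel_measurable \<Omega>" by (rule borel_measurable_diff)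
    qed
    show ?thesis by measurable
  qed
  have "measure \<Omega> (?B h \<union> ?B ?h') \<le> measure \<Omega> (?B h) + measure \<Omega> (?B ?h')"
    by (rule measure_Un_le) (rule meas[OF h] meas[OF h'])+
  also have "\<dots> \<le> exp (real n * s\<^sup>2 * \<sigma> - s * t) + exp (real n * s\<^sup>2 * \<sigma> - s * t)"
    by (intro add_mono chernoff_one_sided k h h' \<sigma>(2) s) (use h1 \<sigma>(1) in auto)
  finally have "measure \<Omega> (?B h \<union> ?B ?h') \<le> 2 * exp (real n * s\<^sup>2 * \<sigma> - s * t)" by simp
  moreover have "\<bar>?Y h \<omega>\<bar> \<le> t" if "\<omega> \<in> space \<Omega> - (?B h \<union> ?B ?h')" for \<omega>
  proof -
    have "?Y ?h' \<omega> = - ?Y h \<omega>" by (simp add: sum_negf[symmetric])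
    moreover have "?Y h \<omega> \<le> t" "?Y ?h' \<omega> \<le> t" using that by (simp_all add: not_less)
    ultimately show ?thesis by linarith
  qed
  moreover have "?B h \<union> ?B ?h' \<in> sets \<Omega>" using meas[OF h] meas[OF h'] by blast
  ultimately show ?thesis by blast
qed

text \<open>LLE works with the set of sample points, concentration with their indices; the two kinds
  of sums agree when the samples are distinct. Given X i = y, a coincidence means that X j hits the
  null set {y}.\<close>

lemma almost_surely_distinct:
  assumes ij: "i < n" "j < n" "i \<noteq> j"
    and diag: "{p \<in> space (\<nu> \<Otimes>\<^sub>M \<nu>). fst p = snd p} \<in> sets (\<nu> \<Otimes>\<^sub>M \<nu>)"
    and atomless: "\<And>y. y \<in> space \<nu> \<Longrightarrow> emeasure \<nu> {y} = 0"
  shows "{\<omega> \<in> space \<Omega>. X i \<omega> = X j \<omega>} \<in> null_sets \<Omega>"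
proof -
  let ?D = "{p \<in> space (\<nu> \<Otimes>\<^sub>M \<nu>). fst p = snd p}"
  have [measurable]: "X i \<in> \<Omega> \<rightarrow>\<^sub>M \<nu>" "X j \<in> \<Omega> \<rightarrow>\<^sub>M \<nu>" using X ij by auto
  have pm: "(\<lambda>\<omega>. (X i \<omega>, X j \<omega>)) \<in> \<Omega> \<rightarrow>\<^sub>M \<nu> \<Otimes>\<^sub>M \<nu>" by measurable
  have eq: "{\<omega> \<in> space \<Omega>. X i \<omega> = X j \<omega>} = (\<lambda>\<omega>. (X i \<omega>, X j \<omega>)) -` ?D \<inter> space \<Omega>"
    using X_space ij by (auto simp: space_pair_measure)
  have meas: "{\<omega> \<in> space \<Omega>. X i \<omega> = X j \<omega>} \<in> sets \<Omega>"
    unfolding eq by (rule measurable_sets[OF pm diag])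
  \<comment> \<open>The indicator sits at the index j and all other factors are 1, so the product
    over indices reduces to the pair i, j.\<close>
  define \<phi> where "\<phi> = (\<lambda>l y z. if l = j then indicator ?D (y, z) else (1 :: ennreal))"
  have \<phi>m: "case_prod (\<phi> l) \<in> borel_measurable (\<nu> \<Otimes>\<^sub>M \<nu>)" for l
  proof (cases "l = j")
    case True
    have "case_prod (\<phi> l) = indicator ?D" using True by (auto simp: \<phi>_def fun_eq_iff)
    then show ?thesis using diag by simp
  qed (simp add: \<phi>_def case_prod_beta')
  have "emeasure \<Omega> {\<omega> \<in> space \<Omega>. X i \<omega> = X j \<omega>} = (\<integral>\<^sup>+\<omega>. indicator {\<omega> \<in> space \<Omega>. X i \<omega> = X j \<omega>} \<omega> \<partial>\<Omega>)"
    using meas by simp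
  also have "\<dots> = (\<integral>\<^sup>+\<omega>. (\<Prod>l\<in>{..<n} - {i}. \<phi> l (X i \<omega>) (X l \<omega>)) \<partial>\<Omega>)"
  proof (rule nn_integral_cong)
    fix \<omega> assume w: "\<omega> \<in> space \<Omega>"
    have "(\<Prod>l\<in>{..<n} - {i}. \<phi> l (X i \<omega>) (X l \<omega>)) = (\<Prod>l\<in>{..<n} - {i}. if l = j then indicator ?D (X i \<omega>, X j \<omega>) else 1)"
      by (intro prod.cong) (auto simp: \<phi>_def)
    also have "\<dots> = indicator ?D (X i \<omega>, X j \<omega>)" using ij by (subst prod.delta) auto
    finally show "indicator {\<omega> \<in> space \<Omega>. X i \<omega> = X j \<omega>} \<omega> = (\<Prod>l\<in>{..<n} - {i}. \<phi> l (X i \<omega>) (X l \<omega>))"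
      using X_space ij w by (auto simp: indicator_def space_pair_measure)
  qed
  also have "\<dots> = (\<integral>\<^sup>+y. (\<Prod>l\<in>{..<n} - {i}. (\<integral>\<^sup>+z. \<phi> l y z \<partial>\<nu>)) \<partial>\<nu>)"
    by (rule nn_integral_pair_product[OF ij(1) \<phi>m])
  also have "\<dots> = (\<integral>\<^sup>+y. 0 \<partial>\<nu>)"
  proof (rule nn_integral_cong)
    fix y assume y: "y \<in> space \<nu>"
    have "(\<integral>\<^sup>+z. \<phi> j y z \<partial>\<nu>) \<le> emeasure \<nu> {y}"
    proof -
      have sing: "{y} \<in> sets \<nu>"
      proof -
        have "{y} = Pair y -` ?D \<inter> space \<nu>" using y by (auto simp: space_pair_measure)
        then show ?thesis using measurable_sets[OF measurable_Pair1'[OF y] diag] by simp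
      qed
      have "(\<integral>\<^sup>+z. \<phi> j y z \<partial>\<nu>) \<le> (\<integral>\<^sup>+z. indicator {y} z \<partial>\<nu>)"
        by (intro nn_integral_mono) (auto simp: \<phi>_def indicator_def)
      then show ?thesis using sing by simp
    qed
    then have "(\<integral>\<^sup>+z. \<phi> j y z \<partial>\<nu>) = 0" using atomless[OF y] by simp
    then show "(\<Prod>l\<in>{..<n} - {i}. (\<integral>\<^sup>+z. \<phi> l y z \<partial>\<nu>)) = 0"
      using ij by (intro prod_zero bexI[of _ j]) auto
  qed
  finally show ?thesis using meas by (intro null_setsI) simp_all
qed

text \<open>A union bound over the n base points and the test functions, with the factor 2 for the
  two tails. Coincidences of samples form a null set and are removed at no cost.\<close>

lemma uniform_concentration:
  assumes fin: "finite \<H>" and h: "\<And>h. h \<in> \<H> \<Longrightarrow> case_prod h \<in> borel_measurable (\<nu> \<Otimes>\<^sub>M \<nu>)"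
    and h1: "\<And>h y z. h \<in> \<H> \<Longrightarrow> y \<in> space \<nu> \<Longrightarrow> z \<in> space \<nu> \<Longrightarrow> \<bar>h y z\<bar> \<le> 1"
    and \<sigma>: "\<And>h y. h \<in> \<H> \<Longrightarrow> y \<in> space \<nu> \<Longrightarrow> (\<integral>z. (h y z)\<^sup>2 \<partial>\<nu>) \<le> \<sigma>" "0 \<le> \<sigma>"
    and s: "0 \<le> s" "s \<le> 1"
    and diag: "{p \<in> space (\<nu> \<Otimes>\<^sub>M \<nu>). fst p = snd p} \<in> sets (\<nu> \<Otimes>\<^sub>M \<nu>)"
    and atomless: "\<And>y. y \<in> space \<nu> \<Longrightarrow> emeasure \<nu> {y} = 0"
  shows "\<exists>E\<in>sets \<Omega>. measure \<Omega> E \<ge> 1 - real n * real (card \<H>) * (2 * exp (real n * s\<^sup>2 * \<sigma> - s * t)) \<and>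
    (\<forall>\<omega>\<in>E. \<omega> \<in> space \<Omega> \<and> inj_on (\<lambda>i. X i \<omega>) {..<n} \<and>
      (\<forall>k<n. \<forall>h\<in>\<H>. \<bar>\<Sum>j\<in>{..<n} - {k}. h (X k \<omega>) (X j \<omega>) - (\<integral>z. h (X k \<omega>) z \<partial>\<nu>)\<bar> \<le> t))"
proof -
  let ?b = "2 * exp (real n * s\<^sup>2 * \<sigma> - s * t)"
  let ?I = "{..<n} \<times> \<H>"
  have "\<forall>p\<in>?I. \<exists>B. B \<in> sets \<Omega> \<and> measure \<Omega> B \<le> ?b \<and>
    (\<forall>\<omega>\<in>space \<Omega> - B. \<bar>\<Sum>j\<in>{..<n} - {fst p}. snd p (X (fst p) \<omega>) (X j \<omega>) - (\<integral>z. snd p (X (fst p) \<omega>) z \<partial>\<nu>)\<bar> \<le> t)"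
  proof
    fix p assume p: "p \<in> ?I"
    then have "fst p < n" "snd p \<in> \<H>" by auto
    from chernoff_two_sided[OF this(1) h[OF this(2)] h1[OF this(2)] \<sigma>(1)[OF this(2)] \<sigma>(2) s, of t]
    show "\<exists>B. B \<in> sets \<Omega> \<and> measure \<Omega> B \<le> ?b \<and>
    (\<forall>\<omega>\<in>space \<Omega> - B. \<bar>\<Sum>j\<in>{..<n} - {fst p}. snd p (X (fst p) \<omega>) (X j \<omega>) - (\<integral>z. snd p (X (fst p) \<omega>) z \<partial>\<nu>)\<bar> \<le> t)"
      unfolding Bex_def .
  qed
  from bchoice[OF this] obtain B where B: "\<forall>p\<in>?I. B p \<in> sets \<Omega> \<and> measure \<Omega> (B p) \<le> ?b \<and>
    (\<forall>\<omega>\<in>space \<Omega> - B p. \<bar>\<Sum>j\<in>{..<n} - {fst p}. snd p (X (fst p) \<omega>) (X j \<omega>) - (\<integral>z. snd p (X (fst p) \<omega>) z \<partial>\<nu>)\<bar> \<le> t)"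
    by (elim exE) (rule that)
  define C where "C = (\<Union>i\<in>{..<n}. \<Union>j\<in>{..<n} - {i}. {\<omega> \<in> space \<Omega>. X i \<omega> = X j \<omega>})"
  have C: "C \<in> null_sets \<Omega>"
    unfolding C_def by (intro null_sets.finite_UN) (auto intro: almost_surely_distinct diag atomless)
  define B' where "B' = (\<Union>p\<in>?I. B p)"
  have finI: "finite ?I" using fin by simp
  have B'm: "B' \<in> sets \<Omega>" unfolding B'_def using finI B by (intro sets.finite_UN) auto
  have "measure \<Omega> B' \<le> (\<Sum>p\<in>?I. measure \<Omega> (B p))"
    unfolding B'_def using finI B by (intro measure_UNION_le) auto
  also have "\<dots> \<le> (\<Sum>p\<in>?I. ?b)" using B by (intro sum_mono) auto
  also have "\<dots> = real n * real (card \<H>) * ?b" by (simp add: card_cartesian_product)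
  finally have mB: "measure \<Omega> B' \<le> real n * real (card \<H>) * ?b" .
  have Cm: "C \<in> sets \<Omega>" "measure \<Omega> C = 0" using C by (auto simp: null_sets_def measure_def)
  have BC: "B' \<union> C \<in> sets \<Omega>" using B'm Cm by blast
  have "measure \<Omega> (B' \<union> C) \<le> real n * real (card \<H>) * ?b"
    using measure_Un_le[OF B'm Cm(1)] mB Cm(2) by linarith
  then have "measure \<Omega> (space \<Omega> - (B' \<union> C)) \<ge> 1 - real n * real (card \<H>) * ?b"
    using \<Omega>.prob_compl[OF BC] by linarith
  moreover have "\<omega> \<in> space \<Omega> \<and> inj_on (\<lambda>i. X i \<omega>) {..<n} \<and>
      (\<forall>k<n. \<forall>h\<in>\<H>. \<bar>\<Sum>j\<in>{..<n} - {k}. h (X k \<omega>) (X j \<omega>) - (\<integral>z. h (X k \<omega>) z \<partial>\<nu>)\<bar> \<le> t)"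
    if w: "\<omega> \<in> space \<Omega> - (B' \<union> C)" for \<omega>
  proof (intro conjI allI impI ballI)
    show "\<omega> \<in> space \<Omega>" using w by blast
    show "inj_on (\<lambda>i. X i \<omega>) {..<n}"
    proof (rule inj_onI, rule ccontr)
      fix i j assume "i \<in> {..<n}" "j \<in> {..<n}" "X i \<omega> = X j \<omega>" "i \<noteq> j"
      then have "\<omega> \<in> C" using w unfolding C_def by blast
      then show False using w by blast
    qed
    fix k h assume "k < n" "h \<in> \<H>"
    then have "(k, h) \<in> ?I" by simp
    moreover from this have "\<omega> \<in> space \<Omega> - B (k, h)" using w unfolding B'_def by blast
    ultimately show "\<bar>\<Sum>j\<in>{..<n} - {k}. h (X k \<omega>) (X j \<omega>) - (\<integral>z. h (X k \<omega>) z \<partial>\<nu>)\<bar> \<le> t"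
      using B by fastforce
  qed
  moreover have "space \<Omega> - (B' \<union> C) \<in> sets \<Omega>" using BC by blast
  ultimately show ?thesis by blast
qed

end

lemma iid_samples_family:
  assumes iid: "iid_samples \<Omega> N P n X" and n: "n > 0" and \<nu>: "prob_space (density N (\<lambda>y. ennreal (P y)))"
  shows "iid_family \<Omega> (density N (\<lambda>y. ennreal (P y))) X n"
proof -
  let ?\<nu> = "density N (\<lambda>y. ennreal (P y))"
  interpret \<Omega>: prob_space \<Omega> using iid by (simp add: iid_samples_def)
  have D: "distributed \<Omega> N (X i) (\<lambda>y. ennreal (P y))" if "i < n" for i using iid that by (simp add: iid_samples_def)
  have XN: "X i \<in> \<Omega> \<rightarrow>\<^sub>M N" "distr \<Omega> N (X i) = ?\<nu>" if "i < n" for i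
    using D[OF that] by (auto simp: distributed_def)
  have X: "X i \<in> \<Omega> \<rightarrow>\<^sub>M ?\<nu>" if "i < n" for i using XN(1)[OF that] by simp
  have sets: "sets (PiM {..<n} (\<lambda>_. ?\<nu>)) = sets (PiM {..<n} (\<lambda>_. N))" by (intro sets_PiM_cong) auto
  have "distr \<Omega> (PiM {..<n} (\<lambda>_. N)) (\<lambda>\<omega>. \<lambda>i\<in>{..<n}. X i \<omega>) = PiM {..<n} (\<lambda>i. distr \<Omega> N (X i))"
    using \<Omega>.indep_vars_iff_distr_eq_PiM'[where I = "{..<n}" and M' = "\<lambda>_. N" and X = X] iid n XN by (auto simp: iid_samples_def)
  also have "\<dots> = PiM {..<n} (\<lambda>_. ?\<nu>)" using XN by (intro PiM_cong) auto
  also have "distr \<Omega> (PiM {..<n} (\<lambda>_. N)) (\<lambda>\<omega>. \<lambda>i\<in>{..<n}. X i \<omega>) = distr \<Omega> (PiM {..<n} (\<lambda>_. ?\<nu>)) (\<lambda>\<omega>. \<lambda>i\<in>{..<n}. X i \<omega>)"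
    by (rule distr_cong) (use sets in auto)
  finally have joint: "distr \<Omega> (PiM {..<n} (\<lambda>_. ?\<nu>)) (\<lambda>\<omega>. \<lambda>i\<in>{..<n}. X i \<omega>) = PiM {..<n} (\<lambda>_. ?\<nu>)" .
  show ?thesis
    using \<Omega>.prob_space_axioms \<nu> X joint by (intro iid_family.intro iid_family_axioms.intro) auto
qed

section \<open>LLE at concentrated samples\<close>

text \<open>Passes from the set of neighbours to indices. Injectivity ensures that no two samples
  merge and that removing the point \<open>z k\<close> removes exactly the index k.\<close>

lemma sum_lle_neighbours:
  fixes z :: "nat \<Rightarrow> real ^ 'p::finite" and F :: "real ^ 'p \<Rightarrow> 'b::real_vector"
  assumes inj: "inj_on z {..<n}" and k: "k < n"
  shows "(\<Sum>y\<in>lle_neighbours (z ` {..<n}) r (z k). F y) =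
    (\<Sum>j\<in>{..<n} - {k}. indicator (cball (z k) r) (z j) *\<^sub>R F (z j))"
proof -
  let ?J = "{j \<in> {..<n} - {k}. z j \<in> cball (z k) r}"
  have S: "lle_neighbours (z ` {..<n}) r (z k) = z ` ?J"
    using inj k by (auto simp: lle_neighbours_def inj_on_def)
  have "(\<Sum>y\<in>lle_neighbours (z ` {..<n}) r (z k). F y) = (\<Sum>j\<in>?J. F (z j))"
    unfolding S by (subst sum.reindex) (auto intro: inj_on_subset[OF inj])
  also have "\<dots> = (\<Sum>j\<in>{..<n} - {k}. if z j \<in> cball (z k) r then F (z j) else 0)"
    by (rule sum.inter_filter) simp
  also have "\<dots> = (\<Sum>j\<in>{..<n} - {k}. indicator (cball (z k) r) (z j) *\<^sub>R F (z j))"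
    by (intro sum.cong) (auto simp: indicator_def)
  finally show ?thesis .
qed

text \<open>Only n - 1 samples differ from the base point, while the target is n times the mean. The
  missing mean is at most 2 K r^d, and n r \<ge> 1 makes this a multiple of the deviation n
  r^(d+1).\<close>

lemma concentrated_sum:
  fixes z :: "nat \<Rightarrow> real ^ 'p::finite" and F :: "real ^ 'p \<Rightarrow> real"
  assumes inj: "inj_on z {..<n}" and k: "k < n" and n: "1 \<le> real n * r" and r: "0 < r" and K: "K \<ge> 1"
    and mean: "\<bar>\<integral>y. F y * indicator (cball (z k) r) y \<partial>\<nu>\<bar> \<le> 2 * K * r ^ d"
    and conc: "\<bar>\<Sum>j\<in>{..<n} - {k}. F (z j) * indicator (cball (z k) r) (z j) - (\<integral>y. F y * indicator (cball (z k) r) y \<partial>\<nu>)\<bar>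
       \<le> real n * r ^ (d + 1)"
  shows "\<bar>(\<Sum>y\<in>lle_neighbours (z ` {..<n}) r (z k). F y) - real n * (\<integral>y. F y * indicator (cball (z k) r) y \<partial>\<nu>)\<bar>
    \<le> 3 * K * (real n * r ^ (d + 1))"
proof -
  let ?I = "\<integral>y. F y * indicator (cball (z k) r) y \<partial>\<nu>"
  have "(\<Sum>j\<in>{..<n} - {k}. F (z j) * indicator (cball (z k) r) (z j) - ?I) =
      (\<Sum>y\<in>lle_neighbours (z ` {..<n}) r (z k). F y) - (real n - 1) * ?I"
    using k by (simp add: sum_lle_neighbours[OF inj k] sum_subtractf mult.commute of_nat_diff)
  then have "\<bar>(\<Sum>y\<in>lle_neighbours (z ` {..<n}) r (z k). F y) - (real n - 1) * ?I\<bar> \<le> real n * r ^ (d + 1)"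
    using conc by simp
  moreover have "\<bar>?I\<bar> \<le> 2 * K * (real n * r ^ (d + 1))"
  proof -
    have "r ^ d * 1 \<le> r ^ d * (real n * r)" using n r by (intro mult_left_mono) auto
    then have "2 * K * r ^ d \<le> 2 * K * (real n * r ^ (d + 1))" using K by (simp add: mult_ac)
    then show ?thesis using mean by linarith
  qed
  moreover have "1 * (real n * r ^ (d + 1)) \<le> K * (real n * r ^ (d + 1))"
    using K r by (intro mult_right_mono) auto
  moreover have "(\<Sum>y\<in>lle_neighbours (z ` {..<n}) r (z k). F y) - real n * ?I =
     ((\<Sum>y\<in>lle_neighbours (z ` {..<n}) r (z k). F y) - (real n - 1) * ?I) - ?I"
    by (simp add: algebra_simps)
  ultimately show ?thesis by linarith
qed

section \<open>Test functions and the LLE average at one sample\<close>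

definition mass_test :: "real \<Rightarrow> real ^ 'p::finite \<Rightarrow> real ^ 'p \<Rightarrow> real" where
  "mass_test r x y = indicator (cball x r) y"

definition mean_test :: "real \<Rightarrow> 'p \<Rightarrow> real ^ 'p::finite \<Rightarrow> real ^ 'p \<Rightarrow> real" where
  "mean_test r i x y = (y - x) $ i / r * indicator (cball x r) y"

definition cov_test :: "real \<Rightarrow> 'p \<Rightarrow> 'p \<Rightarrow> real ^ 'p::finite \<Rightarrow> real ^ 'p \<Rightarrow> real" where
  "cov_test r i j x y = (y - x) $ i * (y - x) $ j / r\<^sup>2 * indicator (cball x r) y"

definition taylor_test ::
  "(real ^ 'p \<Rightarrow> real) \<Rightarrow> (real ^ 'p \<Rightarrow> real ^ 'p) \<Rightarrow> real \<Rightarrow> real \<Rightarrow> real ^ 'p::finite \<Rightarrow> real ^ 'p \<Rightarrow> real" where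
  "taylor_test f a K r x y = (f y - f x - a x \<bullet> (y - x)) / (K * r\<^sup>2) * indicator (cball x r) y"

text \<open>Each test is divided by its size on the ball, r, r^2 or K r^2, so it is bounded by 1 and
  its second moment by the mass of the ball. The common deviation n r^(d+1) then scales back to the
  accuracy that \<open>lle_average_laplacian_bound\<close> asks of each moment.\<close>

definition tests ::
  "(real ^ 'p \<Rightarrow> real) \<Rightarrow> (real ^ 'p \<Rightarrow> real ^ 'p) \<Rightarrow> real \<Rightarrow> real \<Rightarrow> (real ^ 'p::finite \<Rightarrow> real ^ 'p \<Rightarrow> real) set" where
  "tests f a K r = {mass_test r, taylor_test f a K r} \<union> range (mean_test r) \<union> range (\<lambda>(i, j). cov_test r i j)"

lemma finite_tests: "finite (tests f a K r)"
  by (simp add: tests_def)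

lemma card_tests:
  fixes f :: "real ^ 'p::finite \<Rightarrow> real"
  shows "card (tests f a K r) \<le> 2 + CARD('p) + CARD('p) * CARD('p)"
proof -
  define A where "A = {mass_test r, taylor_test f a K r}"
  define B :: "(real ^ 'p \<Rightarrow> real ^ 'p \<Rightarrow> real) set" where "B = range (mean_test r)"
  define C :: "(real ^ 'p \<Rightarrow> real ^ 'p \<Rightarrow> real) set" where "C = range (\<lambda>(i, j). cov_test r i j)"
  have "card A \<le> 2" by (simp add: A_def card_insert_if)
  moreover have "card B \<le> CARD('p)" unfolding B_def by (rule card_image_le) simp
  moreover have "card C \<le> card (UNIV :: ('p \<times> 'p) set)" unfolding C_def by (rule card_image_le) simp
  moreover have "card (A \<union> B \<union> C) \<le> card A + card B + card C"
    by (rule order_trans[OF card_Un_le add_right_mono[OF card_Un_le]])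
  moreover have "card (UNIV :: ('p \<times> 'p) set) = CARD('p) * CARD('p)" by simp
  ultimately show ?thesis unfolding tests_def A_def B_def C_def by linarith
qed

locale geometry_at =
  fixes d :: nat and \<nu> :: "(real ^ 'p::finite) measure" and Z f K x and a :: "real ^ 'p \<Rightarrow> real ^ 'p" and T \<alpha> \<Delta>
  assumes geo: "lle_geometry d \<nu> Z f K x (a x) T \<alpha> \<Delta>"
    and \<nu>: "finite_measure \<nu>" "space \<nu> = Z" and ind: "\<And>r. (indicator (cball x r) :: _ \<Rightarrow> real) \<in> borel_measurable \<nu>"
begin

lemma K: "K \<ge> 1" and T: "subspace T" "a x \<in> T" "norm (a x) \<le> K" and \<Delta>: "\<bar>\<Delta>\<bar> \<le> K" and \<alpha>: "1 / K \<le> \<alpha>" "\<alpha> \<le> K"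
  using geo by (auto simp: lle_geometry_def)

lemma integrable_ball: "integrable \<nu> (indicator (cball x r) :: _ \<Rightarrow> real)"
  by (rule finite_measure.integrable_const_bound[OF \<nu>(1), of _ 1]) (auto simp: ind indicator_def)

lemma ball_mass:
  assumes r: "0 < r" "r \<le> 1 / K"
  shows "(\<integral>y. indicator (cball x r) y \<partial>\<nu>) \<le> 2 * K * r ^ d"
proof -
  have r1: "r \<le> 1" using r K by (meson divide_le_eq_1 order_trans zero_less_one less_le_trans)
  have "\<alpha> * r ^ d \<le> K * r ^ d" using \<alpha> r by (intro mult_right_mono) auto
  moreover have "K * r ^ (d + 1) \<le> K * r ^ d" using K r r1 by (simp add: mult_left_le_one_le)
  ultimately show ?thesis using lle_geometry_at_scale(1)[OF geo r] by linarith
qed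

lemma mean_bound:
  assumes r: "0 < r" "r \<le> 1 / K" and h: "\<And>y. y \<in> Z \<Longrightarrow> \<bar>h y\<bar> \<le> indicator (cball x r) y"
  shows "\<bar>\<integral>y. h y \<partial>\<nu>\<bar> \<le> 2 * K * r ^ d"
proof -
  have "\<bar>\<integral>y. h y \<partial>\<nu>\<bar> \<le> (\<integral>y. \<bar>h y\<bar> \<partial>\<nu>)" by (rule integral_abs_bound)
  also have "\<dots> \<le> (\<integral>y. indicator (cball x r) y \<partial>\<nu>)"
    by (rule integral_mono'[OF integrable_ball]) (use h \<nu> in auto)
  finally show ?thesis using ball_mass[OF r] by linarith
qed

lemma second_moment_bound:
  assumes r: "0 < r" "r \<le> 1 / K" and h: "\<And>y. y \<in> Z \<Longrightarrow> \<bar>h y\<bar> \<le> indicator (cball x r) y"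
  shows "(\<integral>y. (h y)\<^sup>2 \<partial>\<nu>) \<le> 2 * K * r ^ d"
proof -
  have "(\<integral>y. (h y)\<^sup>2 \<partial>\<nu>) \<le> (\<integral>y. indicator (cball x r) y \<partial>\<nu>)"
  proof (rule integral_mono'[OF integrable_ball])
    fix y assume "y \<in> space \<nu>"
    then have "\<bar>h y\<bar> \<le> indicator (cball x r) y" using h \<nu> by simp
    then show "(h y)\<^sup>2 \<le> indicator (cball x r) y"
      by (cases "y \<in> cball x r") (auto simp: abs_square_le_1)
  qed simp
  then show ?thesis using ball_mass[OF r] by linarith
qed

lemma tests_bounded:
  assumes r: "0 < r" "r \<le> 1 / K" and h: "h \<in> tests f a K r" and y: "y \<in> Z"
  shows "\<bar>h x y\<bar> \<le> indicator (cball x r) y"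
proof (cases "y \<in> cball x r")
  case True
  then have n: "norm (y - x) \<le> r" by (simp add: dist_norm norm_minus_commute)
  have c: "\<bar>(y - x) $ i\<bar> \<le> r" for i using component_le_norm_cart[of "y - x" i] n by linarith
  have q: "\<bar>f y - f x - a x \<bullet> (y - x)\<bar> \<le> K * r\<^sup>2"
  proof -
    have "\<bar>f y - f x - a x \<bullet> (y - x)\<bar> \<le> K * (norm (y - x))\<^sup>2"
      using geo y n r unfolding lle_geometry_def by (meson order_trans)
    also have "\<dots> \<le> K * r\<^sup>2" using n K by (intro mult_left_mono power_mono) auto
    finally show ?thesis .
  qed
  have c2: "\<bar>(y - x) $ i * (y - x) $ j\<bar> \<le> r\<^sup>2" for i j
    unfolding abs_mult power2_eq_square using c r by (intro mult_mono) auto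
  have "\<bar>mass_test r x y\<bar> \<le> 1" by (simp add: mass_test_def)
  moreover have "\<bar>mean_test r i x y\<bar> \<le> 1" for i
    using c[of i] r unfolding mean_test_def indicator_simps(1)[OF True] by (simp add: abs_divide divide_le_eq)
  moreover have "\<bar>cov_test r i j x y\<bar> \<le> 1" for i j
    using c2[of i j] r unfolding cov_test_def indicator_simps(1)[OF True] by (simp add: abs_divide divide_le_eq)
  moreover have "\<bar>taylor_test f a K r x y\<bar> \<le> 1"
    using q r K unfolding taylor_test_def indicator_simps(1)[OF True] by (simp add: abs_divide divide_le_eq abs_mult)
  ultimately show ?thesis using h True unfolding tests_def by auto
next
  case False
  then show ?thesis using h unfolding tests_def mass_test_def mean_test_def cov_test_def taylor_test_def by auto
qed

text \<open>The constant \<kappa> dominates the errors of all moments: 4 K for the mass, 4 K p for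
  the mean, where p coordinates are summed, and 4 K^2 for the Taylor remainder. The part 12 K^2 p^2
  keeps the sampled covariance, whose error sums over p^2 entries, bounded below on the tangent
  space.\<close>

lemma concentrated_lle_average:
  fixes z :: "nat \<Rightarrow> real ^ 'p"
  defines "\<kappa> \<equiv> 12 * K\<^sup>2 * (real CARD('p) + 1)\<^sup>2"
  assumes coord: "\<And>i j. (\<lambda>y. (y - x) $ i * (y - x) $ j) \<in> borel_measurable \<nu>"
    and inj: "inj_on z {..<n}" and k: "k < n" "z k = x" and zZ: "\<And>j. j < n \<Longrightarrow> z j \<in> Z"
    and n: "1 \<le> real n * r" and r: "0 < r" "22 * \<kappa> ^ 7 * r \<le> 1"
    and conc: "\<And>h. h \<in> tests f a K r \<Longrightarrow>
      \<bar>\<Sum>j\<in>{..<n} - {k}. h x (z j) - (\<integral>y. h x y \<partial>\<nu>)\<bar> \<le> real n * r ^ (d + 1)"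
  shows "\<bar>1 / r\<^sup>2 * (lle_average (z ` {..<n}) r (real n * r ^ (d + 3)) f x - f x) - 1 / (2 * (real d + 2)) * \<Delta>\<bar>
    \<le> 78 * \<kappa> ^ 8 * r"
proof -
  let ?p = "real CARD('p)"
  define S where "S = lle_neighbours (z ` {..<n}) r x"
  define m where "m = real n * r ^ d"
  have n0: "real n > 0" using n r by (metis less_le_trans mult_le_0_iff not_le zero_less_one order_less_imp_le)
  have m0: "m > 0" using n0 r by (simp add: m_def)
  have p1: "?p \<ge> 1" by (simp add: Suc_leI)
  have kap: "12 * K \<le> \<kappa>" "12 * K\<^sup>2 \<le> \<kappa>" "12 * K\<^sup>2 * ?p\<^sup>2 \<le> \<kappa>" "12 * K * ?p \<le> \<kappa>" "1 \<le> \<kappa>"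
  proof -
    have KK: "K \<le> K\<^sup>2" using K by (simp add: power2_eq_square)
    have P: "1 \<le> (?p + 1)\<^sup>2" "?p\<^sup>2 \<le> (?p + 1)\<^sup>2" "?p \<le> (?p + 1)\<^sup>2" using p1 by (auto simp: power2_eq_square algebra_simps)
    have K0: "0 \<le> 12 * K\<^sup>2" by simp
    show 2: "12 * K\<^sup>2 \<le> \<kappa>" unfolding \<kappa>_def using mult_left_mono[OF P(1) K0] by simp
    show "12 * K\<^sup>2 * ?p\<^sup>2 \<le> \<kappa>" unfolding \<kappa>_def by (rule mult_left_mono[OF P(2) K0])
    have "12 * K\<^sup>2 * ?p \<le> \<kappa>" unfolding \<kappa>_def by (rule mult_left_mono[OF P(3) K0])
    moreover have "12 * K * ?p \<le> 12 * K\<^sup>2 * ?p" using KK p1 by (intro mult_right_mono) auto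
    ultimately show "12 * K * ?p \<le> \<kappa>" by linarith
    show "12 * K \<le> \<kappa>" "1 \<le> \<kappa>" using 2 KK K by linarith+
  qed
  have \<kappa>r: "\<kappa> * r \<le> 1"
  proof -
    have "\<kappa> ^ 1 \<le> \<kappa> ^ 7" using kap(5) by (intro power_increasing) auto
    then have "\<kappa> * r \<le> \<kappa> ^ 7 * r" using r by (intro mult_right_mono) auto
    moreover have "22 * (\<kappa> ^ 7 * r) \<le> 1" using r(2) by (simp only: mult.assoc)
    moreover have "0 \<le> \<kappa> ^ 7 * r" using kap r by simp
    ultimately show ?thesis by linarith
  qed
  have rK: "r \<le> 1 / K"
  proof -
    have "K * r \<le> \<kappa> * r" using kap K r by (intro mult_right_mono) auto
    then have "K * r \<le> 1" using \<kappa>r by linarith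
    then show ?thesis using K by (simp add: field_simps)
  qed
  have S_Z: "y \<in> Z" "norm (y - x) \<le> r" if "y \<in> S" for y
    using that zZ by (auto simp: S_def lle_neighbours_def dist_norm norm_minus_commute)
  have finS: "finite S" by (simp add: S_def lle_neighbours_def)
  have step: "\<bar>(\<Sum>y\<in>S. F y) - real n * (\<integral>y. F y * indicator (cball x r) y \<partial>\<nu>)\<bar> \<le> 3 * K * (m * r)"
    if h: "h \<in> tests f a K r" "\<And>y. h x y = F y * indicator (cball x r) y" for h F
  proof -
    have "\<bar>\<integral>y. F y * indicator (cball x r) y \<partial>\<nu>\<bar> \<le> 2 * K * r ^ d"
      using mean_bound[OF r(1) rK tests_bounded[OF r(1) rK h(1)]] unfolding h(2) .
    moreover have "\<bar>\<Sum>j\<in>{..<n} - {k}. F (z j) * indicator (cball x r) (z j) - (\<integral>y. F y * indicator (cball x r) y \<partial>\<nu>)\<bar>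
       \<le> real n * r ^ (d + 1)"
      using conc[OF h(1)] unfolding h(2) .
    ultimately have "\<bar>(\<Sum>y\<in>S. F y) - real n * (\<integral>y. F y * indicator (cball x r) y \<partial>\<nu>)\<bar> \<le> 3 * K * (real n * r ^ (d + 1))"
      unfolding S_def using concentrated_sum[OF inj k(1) n r(1) K, where F = F and d = d and \<nu> = \<nu>] unfolding k(2) by blast
    then show ?thesis by (simp add: m_def mult_ac)
  qed
  have zeroth: "\<bar>real (card S) - m * \<alpha>\<bar> \<le> \<kappa> * m * r"
  proof -
    have "mass_test r \<in> tests f a K r" by (simp add: tests_def)
    from step[OF this, of "\<lambda>_. 1"]
    have 1: "\<bar>real (card S) - real n * (\<integral>y. indicator (cball x r) y \<partial>\<nu>)\<bar> \<le> 3 * K * (m * r)"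
      by (simp add: mass_test_def)
    have "\<bar>real n * (\<integral>y. indicator (cball x r) y \<partial>\<nu>) - m * \<alpha>\<bar> = real n * \<bar>(\<integral>y. indicator (cball x r) y \<partial>\<nu>) - \<alpha> * r ^ d\<bar>"
    proof -
      have "real n * (\<integral>y. indicator (cball x r) y \<partial>\<nu>) - m * \<alpha> = real n * ((\<integral>y. indicator (cball x r) y \<partial>\<nu>) - \<alpha> * r ^ d)"
        by (simp only: m_def right_diff_distrib mult_ac)
      then show ?thesis by (simp only: abs_mult abs_of_nat)
    qed
    also have "\<dots> \<le> real n * (K * r ^ (d + 1))"
      using lle_geometry_at_scale(1)[OF geo r(1) rK] n0 by (intro mult_left_mono) auto
    also have "\<dots> = K * (m * r)" by (simp add: m_def mult_ac)
    finally have "\<bar>real (card S) - m * \<alpha>\<bar> \<le> 4 * K * (m * r)" using 1 by linarith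
    also have "\<dots> \<le> \<kappa> * (m * r)" using kap K m0 r by (intro mult_right_mono) auto
    finally show ?thesis by simp
  qed
  have first: "norm (\<Sum>y\<in>S. y - x) \<le> \<kappa> * m * r\<^sup>2"
  proof -
    have "\<bar>(\<Sum>y\<in>S. y - x) $ i\<bar> \<le> 4 * K * (m * r\<^sup>2)" for i
    proof -
      have "mean_test r i \<in> tests f a K r" by (simp add: tests_def)
      from step[OF this, of "\<lambda>y. (y - x) $ i / r"]
      have "\<bar>(\<Sum>y\<in>S. (y - x) $ i / r) - real n * (\<integral>y. (y - x) $ i / r * indicator (cball x r) y \<partial>\<nu>)\<bar> \<le> 3 * K * (m * r)"
        by (simp add: mean_test_def)
      moreover have "(\<Sum>y\<in>S. (y - x) $ i / r) = (\<Sum>y\<in>S. y - x) $ i / r" by (simp only: sum_divide_distrib[symmetric] sum_component)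
      moreover have "(\<integral>y. (y - x) $ i / r * indicator (cball x r) y \<partial>\<nu>) = (\<integral>y. (y - x) $ i * indicator (cball x r) y \<partial>\<nu>) / r"
        by (simp add: times_divide_eq_left)
      ultimately have "\<bar>(\<Sum>y\<in>S. y - x) $ i / r - real n * ((\<integral>y. (y - x) $ i * indicator (cball x r) y \<partial>\<nu>) / r)\<bar> \<le> 3 * K * (m * r)"
        by simp
      then have "r * \<bar>(\<Sum>y\<in>S. y - x) $ i / r - real n * ((\<integral>y. (y - x) $ i * indicator (cball x r) y \<partial>\<nu>) / r)\<bar> \<le> r * (3 * K * (m * r))"
        using r by (intro mult_left_mono) auto
      moreover have "r * \<bar>A / r - real n * (B / r)\<bar> = \<bar>A - real n * B\<bar>" for A B
      proof -
        have "r * \<bar>A / r - real n * (B / r)\<bar> = \<bar>r * (A / r - real n * (B / r))\<bar>" using r by (simp add: abs_mult)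
        then show ?thesis using r by (simp add: right_diff_distrib)
      qed
      ultimately have 1: "\<bar>(\<Sum>y\<in>S. y - x) $ i - real n * (\<integral>y. (y - x) $ i * indicator (cball x r) y \<partial>\<nu>)\<bar> \<le> 3 * K * (m * r\<^sup>2)"
        by (simp only: power2_eq_square mult_ac)
      have "\<bar>real n * (\<integral>y. (y - x) $ i * indicator (cball x r) y \<partial>\<nu>)\<bar> \<le> real n * (K * r ^ (d + 2))"
        unfolding abs_mult using lle_geometry_at_scale(2)[OF geo r(1) rK] n0 by (intro mult_mono) auto
      also have "\<dots> = K * (m * r\<^sup>2)" by (simp add: m_def power_add power2_eq_square mult_ac)
      finally show ?thesis using 1 by linarith
    qed
    then have "(\<Sum>i\<in>UNIV. \<bar>(\<Sum>y\<in>S. y - x) $ i\<bar>) \<le> (\<Sum>i\<in>(UNIV :: 'p set). 4 * K * (m * r\<^sup>2))" by (intro sum_mono)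
    then have "norm (\<Sum>y\<in>S. y - x) \<le> (4 * K * ?p) * (m * r\<^sup>2)"
      using norm_le_l1_cart[of "\<Sum>y\<in>S. y - x"] by (simp add: mult_ac)
    also have "\<dots> \<le> \<kappa> * (m * r\<^sup>2)"
    proof (intro mult_right_mono)
      have "0 \<le> K * ?p" using K by simp
      then show "4 * K * ?p \<le> \<kappa>" using kap(4) by linarith
    qed (use m0 r in auto)
    finally show ?thesis by simp
  qed
  have second: "m * r\<^sup>2 * (norm t)\<^sup>2 / \<kappa> \<le> (\<Sum>y\<in>S. ((y - x) \<bullet> t)\<^sup>2)" if t: "t \<in> T" for t
  proof -
    let ?F = "\<lambda>i j y. (y - x) $ i * (y - x) $ j"
    let ?M = "\<lambda>i j. \<integral>y. ?F i j y * indicator (cball x r) y \<partial>\<nu>"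
    have ent: "\<bar>(\<Sum>y\<in>S. ?F i j y) - real n * ?M i j\<bar> \<le> 3 * K * (m * r ^ 3)" for i j
    proof -
      have "cov_test r i j \<in> tests f a K r" by (auto simp: tests_def)
      from step[OF this, of "\<lambda>y. ?F i j y / r\<^sup>2"]
      have "\<bar>(\<Sum>y\<in>S. ?F i j y / r\<^sup>2) - real n * (\<integral>y. ?F i j y / r\<^sup>2 * indicator (cball x r) y \<partial>\<nu>)\<bar> \<le> 3 * K * (m * r)"
        by (simp add: cov_test_def)
      moreover have "(\<Sum>y\<in>S. ?F i j y / r\<^sup>2) = (\<Sum>y\<in>S. ?F i j y) / r\<^sup>2" by (simp only: sum_divide_distrib[symmetric])
      moreover have "(\<integral>y. ?F i j y / r\<^sup>2 * indicator (cball x r) y \<partial>\<nu>) = ?M i j / r\<^sup>2"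
        by (simp add: times_divide_eq_left)
      ultimately have "\<bar>(\<Sum>y\<in>S. ?F i j y) / r\<^sup>2 - real n * (?M i j / r\<^sup>2)\<bar> \<le> 3 * K * (m * r)"
        by simp
      then have "r\<^sup>2 * \<bar>(\<Sum>y\<in>S. ?F i j y) / r\<^sup>2 - real n * (?M i j / r\<^sup>2)\<bar> \<le> r\<^sup>2 * (3 * K * (m * r))"
        using r by (intro mult_left_mono) auto
      moreover have "r\<^sup>2 * \<bar>A / r\<^sup>2 - real n * (B / r\<^sup>2)\<bar> = \<bar>A - real n * B\<bar>" for A B
      proof -
        have "r\<^sup>2 * \<bar>A / r\<^sup>2 - real n * (B / r\<^sup>2)\<bar> = \<bar>r\<^sup>2 * (A / r\<^sup>2 - real n * (B / r\<^sup>2))\<bar>" by (simp add: abs_mult)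
        then show ?thesis using r by (simp add: right_diff_distrib)
      qed
      ultimately show ?thesis by (simp only: power2_eq_square power3_eq_cube mult_ac)
    qed
    have sq: "((y - x) \<bullet> t)\<^sup>2 = (\<Sum>i\<in>UNIV. \<Sum>j\<in>UNIV. t $ i * t $ j * ?F i j y)" for y
      by (simp only: power2_eq_square inner_vec_def inner_real_def sum_product mult_ac)
    have int: "integrable \<nu> (\<lambda>y. ?F i j y * indicator (cball x r) y)" for i j
    proof (rule finite_measure.integrable_const_bound[OF \<nu>(1), of _ "r\<^sup>2"])
      have "\<bar>?F i j y * indicator (cball x r) y\<bar> \<le> r\<^sup>2" for y
      proof (cases "y \<in> cball x r")
        case True
        then have "\<bar>(y - x) $ i\<bar> \<le> r" for i
          using component_le_norm_cart[of "y - x" i] by (simp add: dist_norm norm_minus_commute)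
        then have "\<bar>(y - x) $ i\<bar> * \<bar>(y - x) $ j\<bar> \<le> r * r" using r by (intro mult_mono) auto
        then show ?thesis unfolding indicator_simps(1)[OF True] by (simp add: abs_mult power2_eq_square)
      qed simp
      then show "AE y in \<nu>. norm (?F i j y * indicator (cball x r) y) \<le> r\<^sup>2" by simp
    qed (intro borel_measurable_times coord ind)
    have "(\<integral>y. ((y - x) \<bullet> t)\<^sup>2 * indicator (cball x r) y \<partial>\<nu>) =
        (\<integral>y. (\<Sum>i\<in>UNIV. \<Sum>j\<in>UNIV. t $ i * t $ j * (?F i j y * indicator (cball x r) y)) \<partial>\<nu>)"
      unfolding sq sum_distrib_right by (simp only: mult.assoc)
    also have "\<dots> = (\<Sum>i\<in>UNIV. \<Sum>j\<in>UNIV. t $ i * t $ j * ?M i j)"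
      using int by (simp add: Bochner_Integration.integral_sum)
    finally have I: "(\<integral>y. ((y - x) \<bullet> t)\<^sup>2 * indicator (cball x r) y \<partial>\<nu>) = (\<Sum>i\<in>UNIV. \<Sum>j\<in>UNIV. t $ i * t $ j * ?M i j)" .
    have Ssum: "(\<Sum>y\<in>S. ((y - x) \<bullet> t)\<^sup>2) = (\<Sum>i\<in>UNIV. \<Sum>j\<in>UNIV. t $ i * t $ j * (\<Sum>y\<in>S. ?F i j y))"
    proof -
      have "(\<Sum>y\<in>S. ((y - x) \<bullet> t)\<^sup>2) = (\<Sum>i\<in>UNIV. \<Sum>y\<in>S. \<Sum>j\<in>UNIV. t $ i * t $ j * ?F i j y)"
        unfolding sq by (rule sum.swap)
      also have "\<dots> = (\<Sum>i\<in>UNIV. \<Sum>j\<in>UNIV. \<Sum>y\<in>S. t $ i * t $ j * ?F i j y)"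
        by (intro sum.cong refl sum.swap)
      finally show ?thesis by (simp only: sum_distrib_left)
    qed
    have "\<bar>(\<Sum>y\<in>S. ((y - x) \<bullet> t)\<^sup>2) - real n * (\<integral>y. ((y - x) \<bullet> t)\<^sup>2 * indicator (cball x r) y \<partial>\<nu>)\<bar>
       = \<bar>\<Sum>i\<in>UNIV. \<Sum>j\<in>UNIV. t $ i * t $ j * ((\<Sum>y\<in>S. ?F i j y) - real n * ?M i j)\<bar>"
    proof -
      have "(\<Sum>i\<in>UNIV. \<Sum>j\<in>UNIV. t $ i * t $ j * A i j) - real n * (\<Sum>i\<in>UNIV. \<Sum>j\<in>UNIV. t $ i * t $ j * B i j) =
          (\<Sum>i\<in>UNIV. \<Sum>j\<in>UNIV. t $ i * t $ j * (A i j - real n * B i j))" for A B :: "'p \<Rightarrow> 'p \<Rightarrow> real"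
        by (simp add: right_diff_distrib sum_subtractf sum_distrib_left mult_ac)
      then show ?thesis unfolding Ssum I by simp
    qed
    also have "\<dots> \<le> (\<Sum>i\<in>(UNIV :: 'p set). \<Sum>j\<in>(UNIV :: 'p set). norm t * norm t * (3 * K * (m * r ^ 3)))"
    proof (intro order_trans[OF sum_abs] sum_mono)
      fix i j
      have "\<bar>t $ i\<bar> * \<bar>t $ j\<bar> \<le> norm t * norm t" by (intro mult_mono component_le_norm_cart) auto
      then show "\<bar>t $ i * t $ j * ((\<Sum>y\<in>S. ?F i j y) - real n * ?M i j)\<bar> \<le> norm t * norm t * (3 * K * (m * r ^ 3))"
        unfolding abs_mult using ent[of i j] by (rule mult_mono) auto
    qed
    also have "\<dots> = 3 * K * ?p\<^sup>2 * r * (m * r\<^sup>2 * (norm t)\<^sup>2)" by (simp add: power2_eq_square power3_eq_cube)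
    finally have dev: "\<bar>(\<Sum>y\<in>S. ((y - x) \<bullet> t)\<^sup>2) - real n * (\<integral>y. ((y - x) \<bullet> t)\<^sup>2 * indicator (cball x r) y \<partial>\<nu>)\<bar>
      \<le> 3 * K * ?p\<^sup>2 * r * (m * r\<^sup>2 * (norm t)\<^sup>2)" .
    define Y where "Y = m * r\<^sup>2 * (norm t)\<^sup>2"
    have Y0: "Y \<ge> 0" using m0 by (simp add: Y_def)
    have "real n * ((norm t)\<^sup>2 * r ^ (d + 2) / K) \<le> real n * (\<integral>y. ((y - x) \<bullet> t)\<^sup>2 * indicator (cball x r) y \<partial>\<nu>)"
      using lle_geometry_at_scale(3)[OF geo r(1) rK t] n0 by (intro mult_left_mono) auto
    also have "real n * ((norm t)\<^sup>2 * r ^ (d + 2) / K) = 1 / K * Y" by (simp add: Y_def m_def power_add power2_eq_square mult_ac)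
    finally have low: "1 / K * Y \<le> real n * (\<integral>y. ((y - x) \<bullet> t)\<^sup>2 * indicator (cball x r) y \<partial>\<nu>)" .
    \<comment> \<open>As \<kappa> r \<le> 1, the sampling error takes at most a quarter of the
      population bound 1 / K, and 1 / \<kappa> is at most a twelfth of it.\<close>
    have "3 * K * ?p\<^sup>2 * r + 1 / \<kappa> \<le> 1 / K"
    proof -
      have "12 * K * ?p\<^sup>2 * r \<le> 1 / K"
      proof -
        have "12 * K\<^sup>2 * ?p\<^sup>2 * r \<le> \<kappa> * r" using kap r by (intro mult_right_mono) auto
        then have "12 * K\<^sup>2 * ?p\<^sup>2 * r \<le> 1" using \<kappa>r by linarith
        then have "(12 * K * ?p\<^sup>2 * r) * K \<le> 1" by (simp add: power2_eq_square mult_ac)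
        then show ?thesis using K by (simp only: pos_le_divide_eq)
      qed
      moreover have "1 / \<kappa> \<le> 1 / (12 * K)" using kap K by (intro divide_left_mono) auto
      moreover have "1 / (12 * K) = (1 / K) / 12" by simp
      moreover have "0 \<le> 1 / K" using K by simp
      ultimately show ?thesis by linarith
    qed
    then have "(3 * K * ?p\<^sup>2 * r + 1 / \<kappa>) * Y \<le> 1 / K * Y" using Y0 by (rule mult_right_mono)
    then have "1 / \<kappa> * Y \<le> (\<Sum>y\<in>S. ((y - x) \<bullet> t)\<^sup>2)"
      using dev low unfolding Y_def[symmetric] distrib_right by linarith
    then show ?thesis by (simp add: Y_def)
  qed
  have quad: "\<bar>(\<Sum>y\<in>S. f y - f x - a x \<bullet> (y - x)) - m * \<alpha> * (1 / (2 * (real d + 2)) * \<Delta>) * r\<^sup>2\<bar> \<le> \<kappa> * m * r ^ 3"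
  proof -
    let ?q = "\<lambda>y. f y - f x - a x \<bullet> (y - x)"
    let ?I = "\<integral>y. ?q y * indicator (cball x r) y \<partial>\<nu>"
    have Kr: "K * r\<^sup>2 > 0" using K r by simp
    have "taylor_test f a K r \<in> tests f a K r" by (simp add: tests_def)
    from step[OF this, of "\<lambda>y. ?q y / (K * r\<^sup>2)"]
    have "\<bar>(\<Sum>y\<in>S. ?q y / (K * r\<^sup>2)) - real n * (\<integral>y. ?q y / (K * r\<^sup>2) * indicator (cball x r) y \<partial>\<nu>)\<bar> \<le> 3 * K * (m * r)"
      by (simp add: taylor_test_def)
    moreover have "(\<Sum>y\<in>S. ?q y / (K * r\<^sup>2)) = (\<Sum>y\<in>S. ?q y) / (K * r\<^sup>2)" by (simp only: sum_divide_distrib[symmetric])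
    moreover have "(\<integral>y. ?q y / (K * r\<^sup>2) * indicator (cball x r) y \<partial>\<nu>) = ?I / (K * r\<^sup>2)"
      by (simp only: times_divide_eq_left integral_divide_zero)
    ultimately have "\<bar>(\<Sum>y\<in>S. ?q y) / (K * r\<^sup>2) - real n * (?I / (K * r\<^sup>2))\<bar> \<le> 3 * K * (m * r)"
      by simp
    then have "(K * r\<^sup>2) * \<bar>(\<Sum>y\<in>S. ?q y) / (K * r\<^sup>2) - real n * (?I / (K * r\<^sup>2))\<bar> \<le> (K * r\<^sup>2) * (3 * K * (m * r))"
      using Kr by (intro mult_left_mono) auto
    moreover have "(K * r\<^sup>2) * \<bar>A / (K * r\<^sup>2) - real n * (B / (K * r\<^sup>2))\<bar> = \<bar>A - real n * B\<bar>" for A B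
    proof -
      have "(K * r\<^sup>2) * \<bar>A / (K * r\<^sup>2) - real n * (B / (K * r\<^sup>2))\<bar> = \<bar>(K * r\<^sup>2) * (A / (K * r\<^sup>2) - real n * (B / (K * r\<^sup>2)))\<bar>"
        using Kr by (simp only: abs_mult[of "K * r\<^sup>2"] abs_of_pos)
      also have "(K * r\<^sup>2) * (A / (K * r\<^sup>2) - real n * (B / (K * r\<^sup>2))) = A - real n * B"
        using Kr K r by (simp add: right_diff_distrib)
      finally show ?thesis .
    qed
    ultimately have 1: "\<bar>(\<Sum>y\<in>S. ?q y) - real n * ?I\<bar> \<le> 3 * (K\<^sup>2 * (m * r ^ 3))"
      by (simp only: power2_eq_square power3_eq_cube mult_ac)
    have "real n * \<bar>?I - \<alpha> * \<Delta> / (2 * (real d + 2)) * r ^ (d + 2)\<bar> \<le> real n * (K * r ^ (d + 3))"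
      using lle_geometry_at_scale(4)[OF geo r(1) rK] n0 by (intro mult_left_mono) auto
    moreover have "real n * \<bar>?I - \<alpha> * \<Delta> / (2 * (real d + 2)) * r ^ (d + 2)\<bar> =
        \<bar>real n * ?I - m * \<alpha> * (1 / (2 * (real d + 2)) * \<Delta>) * r\<^sup>2\<bar>"
    proof -
      have "real n * \<bar>?I - \<alpha> * \<Delta> / (2 * (real d + 2)) * r ^ (d + 2)\<bar> = \<bar>real n * (?I - \<alpha> * \<Delta> / (2 * (real d + 2)) * r ^ (d + 2))\<bar>"
        by (simp only: abs_mult abs_of_nat)
      also have "real n * (?I - \<alpha> * \<Delta> / (2 * (real d + 2)) * r ^ (d + 2)) = real n * ?I - m * \<alpha> * (1 / (2 * (real d + 2)) * \<Delta>) * r\<^sup>2"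
        by (simp only: right_diff_distrib m_def power_add times_divide_eq_left times_divide_eq_right mult_1_left mult_ac)
      finally show ?thesis .
    qed
    moreover have "real n * (K * r ^ (d + 3)) = K * (m * r ^ 3)" by (simp only: m_def power_add mult_ac)
    ultimately have 2: "\<bar>real n * ?I - m * \<alpha> * (1 / (2 * (real d + 2)) * \<Delta>) * r\<^sup>2\<bar> \<le> K * (m * r ^ 3)" by simp
    have mr: "0 \<le> m * r ^ 3" using m0 r by simp
    have "K * (m * r ^ 3) \<le> K\<^sup>2 * (m * r ^ 3)"
      using K mr by (intro mult_right_mono) (auto simp: power2_eq_square)
    have "\<bar>(\<Sum>y\<in>S. ?q y) - m * \<alpha> * (1 / (2 * (real d + 2)) * \<Delta>) * r\<^sup>2\<bar> \<le> 4 * (K\<^sup>2 * (m * r ^ 3))"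
    proof -
      have "\<bar>A - B\<bar> \<le> 4 * v" if "u \<le> v" "\<bar>A - N\<bar> \<le> 3 * v" "\<bar>N - B\<bar> \<le> u" for A B N u v :: real
        using that by linarith
      from this[OF \<open>K * (m * r ^ 3) \<le> K\<^sup>2 * (m * r ^ 3)\<close> 1 2] show ?thesis .
    qed
    also have "\<dots> = (4 * K\<^sup>2) * (m * r ^ 3)" by simp
    also have "\<dots> \<le> \<kappa> * (m * r ^ 3)"
    proof (intro mult_right_mono mr)
      have "0 \<le> K\<^sup>2" by simp
      then show "4 * K\<^sup>2 \<le> \<kappa>" using kap(2) by linarith
    qed
    finally show ?thesis by (simp only: mult.assoc)
  qed
  have up: "X * Y \<le> \<kappa> * Y'" if "X \<le> K" "0 \<le> Y" "Y \<le> Y'" for X Y Y'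
  proof -
    have "X * Y \<le> K * Y" using that by (intro mult_right_mono)
    also have "\<dots> \<le> \<kappa> * Y'" using that kap K by (intro mult_mono) auto
    finally show ?thesis .
  qed
  have c: "real n * r ^ (d + 3) = m * r ^ 3" by (simp add: m_def power_add)
  show ?thesis
    unfolding c
  proof (rule lle_average_laplacian_bound[OF kap(5) r m0 S_def finS T(1,2)])
    show "norm (a x) \<le> \<kappa>" using T(3) kap K by linarith
    have "\<bar>1 / (2 * (real d + 2)) * \<Delta>\<bar> \<le> 1 * \<bar>\<Delta>\<bar>"
      unfolding abs_mult by (intro mult_right_mono) auto
    then show "\<bar>1 / (2 * (real d + 2)) * \<Delta>\<bar> \<le> \<kappa>" using \<Delta> kap K by linarith
    have "1 / \<kappa> \<le> 1 / K" using kap K by (intro divide_left_mono) auto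
    then show "1 / \<kappa> \<le> \<alpha>" using \<alpha> by linarith
    show "\<alpha> \<le> \<kappa>" using \<alpha> kap K by linarith
    fix y assume y: "y \<in> S"
    have ny: "norm (y - x) \<le> 1 / K" using S_Z(2)[OF y] rK by linarith
    have n2: "(norm (y - x))\<^sup>2 \<le> r\<^sup>2" using S_Z(2)[OF y] by (intro power_mono) auto
    have gy: "\<bar>f y - f x - a x \<bullet> (y - x)\<bar> \<le> K * (norm (y - x))\<^sup>2 \<and>
        (\<forall>v. (\<forall>t\<in>T. t \<bullet> v = 0) \<longrightarrow> \<bar>(y - x) \<bullet> v\<bar> \<le> K * (norm (y - x))\<^sup>2 * norm v)"
      using geo S_Z(1)[OF y] ny unfolding lle_geometry_def by blast
    show "\<bar>f y - f x - a x \<bullet> (y - x)\<bar> \<le> \<kappa> * r\<^sup>2"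
      using gy up[OF order_refl _ n2] by fastforce
    fix v assume "\<And>t. t \<in> T \<Longrightarrow> t \<bullet> v = 0"
    then have "\<bar>(y - x) \<bullet> v\<bar> \<le> K * (norm (y - x))\<^sup>2 * norm v" using gy by blast
    also have "\<dots> \<le> \<kappa> * r\<^sup>2 * norm v" using up[OF order_refl _ n2] by (intro mult_right_mono) auto
    finally show "\<bar>(y - x) \<bullet> v\<bar> \<le> \<kappa> * r\<^sup>2 * norm v" .
  qed (fact zeroth first second quad)+
qed

end

section \<open>Probability estimate for the samples and the limit\<close>

context sampled_manifold
begin

lemma measurable_pair_fst: "(fst :: _ \<Rightarrow> real ^ 'p) \<in> borel_measurable (\<nu> \<Otimes>\<^sub>M \<nu>)"
  and measurable_pair_snd: "(snd :: _ \<Rightarrow> real ^ 'p) \<in> borel_measurable (\<nu> \<Otimes>\<^sub>M \<nu>)"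
proof -
  have id: "(\<lambda>y. y) \<in> borel_measurable \<nu>"
    by (rule measurable_\<nu>I) (rule measurable_restrict_space1, simp)
  show "(fst :: _ \<Rightarrow> real ^ 'p) \<in> borel_measurable (\<nu> \<Otimes>\<^sub>M \<nu>)" by (rule measurable_compose[OF measurable_fst id])
  show "(snd :: _ \<Rightarrow> real ^ 'p) \<in> borel_measurable (\<nu> \<Otimes>\<^sub>M \<nu>)" by (rule measurable_compose[OF measurable_snd id])
qed

text \<open>Joint measurability is required because the base point is random as well. This is where
  the continuity of the gradient field enters.\<close>

lemma tests_measurable:
  assumes a: "continuous_on Z a" and h: "h \<in> tests f a K r"
  shows "case_prod h \<in> borel_measurable (\<nu> \<Otimes>\<^sub>M \<nu>)"
proof -
  let ?N = "\<nu> \<Otimes>\<^sub>M \<nu>"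
  note [measurable] = measurable_pair_fst measurable_pair_snd
  have f\<nu>: "f \<in> borel_measurable \<nu>" and a\<nu>: "a \<in> borel_measurable \<nu>"
    by (intro measurable_\<nu>I continuous_measurable_Z continuous_f a)+
  have [measurable]: "(\<lambda>p. f (fst p)) \<in> borel_measurable ?N"
    by (rule measurable_compose[OF measurable_fst f\<nu>])
  have [measurable]: "(\<lambda>p. f (snd p)) \<in> borel_measurable ?N"
    by (rule measurable_compose[OF measurable_snd f\<nu>])
  have [measurable]: "(\<lambda>p. a (fst p)) \<in> borel_measurable ?N"
    by (rule measurable_compose[OF measurable_fst a\<nu>])
  have ind: "(\<lambda>p. indicator (cball (fst p) r) (snd p) :: real) = (\<lambda>p. if dist (fst p) (snd p) \<le> r then 1 else 0)"
    by (auto simp: indicator_def)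
  have indm [measurable]: "(\<lambda>p. indicator (cball (fst p) r) (snd p) :: real) \<in> borel_measurable ?N"
    unfolding ind by measurable
  have sub [measurable]: "(\<lambda>p. snd p - fst p) \<in> borel_measurable ?N" by measurable
  have comp [measurable]: "(\<lambda>p. (snd p - fst p) $ i) \<in> borel_measurable ?N" for i
    by (rule measurable_compose[OF sub]) simp
  have "(\<lambda>p. mass_test r (fst p) (snd p)) \<in> borel_measurable ?N" unfolding mass_test_def by measurable
  moreover have "(\<lambda>p. mean_test r i (fst p) (snd p)) \<in> borel_measurable ?N" for i
    unfolding mean_test_def by measurable
  moreover have "(\<lambda>p. cov_test r i j (fst p) (snd p)) \<in> borel_measurable ?N" for i j
    unfolding cov_test_def by measurable
  moreover have "(\<lambda>p. taylor_test f a K r (fst p) (snd p)) \<in> borel_measurable ?N"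
    unfolding taylor_test_def by measurable
  ultimately show ?thesis using h unfolding tests_def case_prod_beta' by auto
qed

lemma diagonal_measurable: "{p \<in> space (\<nu> \<Otimes>\<^sub>M \<nu>). fst p = snd p} \<in> sets (\<nu> \<Otimes>\<^sub>M \<nu>)"
proof -
  note [measurable] = measurable_pair_fst measurable_pair_snd
  have "{p \<in> space (\<nu> \<Otimes>\<^sub>M \<nu>). dist (fst p) (snd p) = 0} \<in> sets (\<nu> \<Otimes>\<^sub>M \<nu>)" by measurable
  then show ?thesis by simp
qed

lemma geometry_atI:
  assumes "lle_geometry CARD('d) \<nu> Z f K x (a x) T \<alpha> \<Delta>"
  shows "geometry_at CARD('d) \<nu> Z f K x a T \<alpha> \<Delta>"
  using assms finite_measure_\<nu> space_\<nu> indicator_cball_measurable by (rule geometry_at.intro)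

text \<open>Balls of radius r have mass O(r^d), and d is at least 1 because it is the cardinality of
  a type.\<close>

lemma atomless:
  assumes g: "lle_geometry CARD('d) \<nu> Z f K y b T \<alpha> \<Delta>" and y: "y \<in> Z"
  shows "emeasure \<nu> {y} = 0"
proof -
  interpret geometry_at "CARD('d)" \<nu> Z f K y "\<lambda>_. b" T \<alpha> \<Delta> by (rule geometry_atI[OF g])
  have sets: "{y} \<in> sets \<nu>"
  proof -
    have "{y} = Z \<inter> {y}" using y by blast
    then show ?thesis unfolding sets_\<nu> sets_restrict_space by (rule image_eqI) simp
  qed
  have "measure \<nu> {y} \<le> 2 * K * r" if r: "0 < r" "r < 1 / K" for r
  proof -
    have rK: "r \<le> 1 / K" using r by simp
    have r1: "r \<le> 1" using rK K by (meson divide_le_eq_1 order_trans zero_less_one less_le_trans)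
    have "measure \<nu> {y} = (\<integral>z. indicator {y} z \<partial>\<nu>)" using sets by simp
    also have "\<dots> \<le> (\<integral>z. indicator (cball y r) z \<partial>\<nu>)"
      by (rule integral_mono'[OF integrable_ball]) (use r in \<open>auto simp: indicator_def\<close>)
    also have "\<dots> \<le> 2 * K * r ^ CARD('d)" by (rule ball_mass[OF r(1) rK])
    also have "\<dots> \<le> 2 * K * r ^ 1"
      using r r1 K by (intro mult_left_mono power_decreasing) (auto simp: Suc_leI)
    finally show ?thesis by simp
  qed
  then have "eventually (\<lambda>r. measure \<nu> {y} \<le> 2 * K * r) (at_right 0)"
    using K by (intro eventually_at_rightI[of 0 "1 / K"]) auto
  moreover have "((\<lambda>r. 2 * K * r) \<longlongrightarrow> 2 * K * 0) (at_right 0)" by (intro tendsto_intros)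
  ultimately have "measure \<nu> {y} \<le> 2 * K * 0"
    by (intro tendsto_lowerbound[of "\<lambda>r. 2 * K * r" _ "at_right 0"]) auto
  then have "measure \<nu> {y} = 0" using measure_nonneg[of \<nu> "{y}"] by linarith
  then show ?thesis using finite_measure.emeasure_eq_measure[OF finite_measure_\<nu>] by simp
qed

text \<open>The theorem for one n and one radius, with explicit conditions in place of limits.
  Asking for deviations of relative size r, the size of the deterministic error, leads to the
  condition that n r^(d+2) dominates ln n.\<close>

lemma lle_pointwise_bound:
  "\<exists>C>0. \<exists>r0>0. \<exists>K\<ge>1. \<exists>n0::nat. \<forall>n \<ge> n0. \<forall>r. 0 < r \<longrightarrow> r \<le> r0 \<longrightarrow> 1 \<le> real n * r \<longrightarrow>
     32 * K * ln (real n) \<le> real n * r ^ (CARD('d) + 2) \<longrightarrow>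
    (\<forall>(\<Omega> :: 'w measure) X. iid_samples \<Omega> (embedded_volume M \<iota> V) P n X \<longrightarrow>
       (\<exists>E\<in>sets \<Omega>. measure \<Omega> E > 1 - 1 / real n ^ 2 \<and>
          (\<forall>\<omega>\<in>E. \<forall>k<n.
             \<bar>1 / r\<^sup>2 * (lle_average ((\<lambda>i. X i \<omega>) ` {..<n}) r (real n * r ^ (CARD('d) + 3)) f (X k \<omega>) - f (X k \<omega>))
              - 1 / (2 * (real CARD('d) + 2)) * laplace_beltrami \<A> g (f \<circ> \<iota>) (inv_into M \<iota> (X k \<omega>))\<bar> \<le> C * r)))"
proof -
  let ?d = "CARD('d)"
  obtain K0 a where a: "continuous_on Z a" and geo0: "\<forall>x\<in>M. \<exists>T \<alpha>.
     lle_geometry ?d \<nu> Z f K0 (\<iota> x) (a (\<iota> x)) T \<alpha> (laplace_beltrami \<A> g (f \<circ> \<iota>) x)"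
    using global_geometry by blast
  define K where "K = max 1 K0"
  have K: "K \<ge> 1" by (simp add: K_def)
  define lap where "lap = (\<lambda>y. laplace_beltrami \<A> g (f \<circ> \<iota>) (inv_into M \<iota> y))"
  have geo: "\<exists>T \<alpha>. lle_geometry ?d \<nu> Z f K y (a y) T \<alpha> (lap y)" if y: "y \<in> Z" for y
  proof -
    define x where "x = inv_into M \<iota> y"
    have x: "x \<in> M" "\<iota> x = y" using y unfolding x_def by (auto intro: inv_into_into f_inv_into_f)
    obtain T \<alpha> where "lle_geometry ?d \<nu> Z f K0 (\<iota> x) (a (\<iota> x)) T \<alpha> (laplace_beltrami \<A> g (f \<circ> \<iota>) x)"
      using geo0 x(1) by blast
    then have "lle_geometry ?d \<nu> Z f K y (a y) T \<alpha> (lap y)"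
      unfolding x(2) lap_def x_def[symmetric] by (rule lle_geometry_mono) (simp add: K_def)
    then show ?thesis by blast
  qed
  define \<kappa> where "\<kappa> = 12 * K\<^sup>2 * (real CARD('p) + 1)\<^sup>2"
  have \<kappa>: "\<kappa> > 0" using K by (simp add: \<kappa>_def add_nonneg_pos)
  define C where "C = 78 * \<kappa> ^ 8"
  \<comment> \<open>The bound 1 / K is the range of validity of the local geometry, the other one is
    the threshold of the deterministic estimate.\<close>
  define r0 where "r0 = min (1 / K) (1 / (22 * \<kappa> ^ 7))"
  have r0: "r0 > 0" using K \<kappa> by (simp add: r0_def)
  define c where "c = real (2 + CARD('p) + CARD('p) * CARD('p))"
  \<comment> \<open>The failure probability is at most n c (2 / n^4) = (2 c / n) / n^2, which is
    below 1 / n^2 once n > 2 c.\<close>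
  define n0 where "n0 = nat \<lceil>2 * c\<rceil> + 1"
  have "\<exists>E\<in>sets \<Omega>. measure \<Omega> E > 1 - 1 / real n ^ 2 \<and>
          (\<forall>\<omega>\<in>E. \<forall>k<n.
             \<bar>1 / r\<^sup>2 * (lle_average ((\<lambda>i. X i \<omega>) ` {..<n}) r (real n * r ^ (?d + 3)) f (X k \<omega>) - f (X k \<omega>))
              - 1 / (2 * (real ?d + 2)) * lap (X k \<omega>)\<bar> \<le> C * r)"
    if n: "n \<ge> n0" and r: "0 < r" "r \<le> r0" "1 \<le> real n * r" and big: "32 * K * ln (real n) \<le> real n * r ^ (?d + 2)"
      and iid: "iid_samples \<Omega> (embedded_volume M \<iota> V) P n X" for n r and \<Omega> :: "'w measure" and X
  proof -
    have n2: "real n > 2 * c" using n unfolding n0_def by linarith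
    have npos: "n > 0" using n by (simp add: n0_def)
    have rK: "r \<le> 1 / K" using r by (simp add: r0_def)
    have r\<kappa>: "22 * \<kappa> ^ 7 * r \<le> 1"
    proof -
      have "r \<le> 1 / (22 * \<kappa> ^ 7)" using r by (simp add: r0_def)
      then show ?thesis using \<kappa> by (simp add: field_simps)
    qed
    interpret iid_family \<Omega> \<nu> X n
      unfolding \<nu>_def by (rule iid_samples_family[OF iid npos]) (use density_prob in \<open>simp add: \<nu>_def\<close>)
    \<comment> \<open>This s minimizes the Chernoff exponent for second moment 2 K r^d and deviation
      n r^(d+1). The minimum is -n r^(d+2) / (8 K), and the condition with 32 K turns it into -4 ln
      n.\<close>
    define s where "s = r / (4 * K)"
    have s: "0 \<le> s" "s \<le> 1"
    proof -
      show "0 \<le> s" using r K by (simp add: s_def)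
      have "r \<le> 1" using rK K by (meson divide_le_eq_1 order_trans zero_less_one less_le_trans)
      then show "s \<le> 1" using K by (simp add: s_def divide_le_eq)
    qed
    let ?H = "tests f a K r"
    let ?b = "real n * s\<^sup>2 * (2 * K * r ^ ?d) - s * (real n * r ^ (?d + 1))"
    have bd: "\<bar>h y z\<bar> \<le> indicator (cball y r) z" if "h \<in> ?H" "y \<in> Z" "z \<in> Z" for h y z
    proof -
      obtain T \<alpha> where "lle_geometry ?d \<nu> Z f K y (a y) T \<alpha> (lap y)" using geo \<open>y \<in> Z\<close> by blast
      then interpret geometry_at ?d \<nu> Z f K y a T \<alpha> "lap y" by (rule geometry_atI)
      show ?thesis by (rule tests_bounded[OF r(1) rK that(1,3)])
    qed
    have "\<exists>E\<in>sets \<Omega>. measure \<Omega> E \<ge> 1 - real n * real (card ?H) * (2 * exp ?b) \<and>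
      (\<forall>\<omega>\<in>E. \<omega> \<in> space \<Omega> \<and> inj_on (\<lambda>i. X i \<omega>) {..<n} \<and>
      (\<forall>k<n. \<forall>h\<in>?H. \<bar>\<Sum>j\<in>{..<n} - {k}. h (X k \<omega>) (X j \<omega>) - (\<integral>z. h (X k \<omega>) z \<partial>\<nu>)\<bar> \<le> real n * r ^ (?d + 1)))"
    proof (rule uniform_concentration[OF finite_tests _ _ _ _ s diagonal_measurable])
      show "case_prod h \<in> borel_measurable (\<nu> \<Otimes>\<^sub>M \<nu>)" if "h \<in> ?H" for h by (rule tests_measurable[OF a that])
      show "\<bar>h y z\<bar> \<le> 1" if "h \<in> ?H" "y \<in> space \<nu>" "z \<in> space \<nu>" for h y z
        using bd[of h y z] that indicator_le_1[of "cball y r" z, where 'a = real] unfolding space_\<nu> by (meson order_trans)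
      show "(\<integral>z. (h y z)\<^sup>2 \<partial>\<nu>) \<le> 2 * K * r ^ ?d" if h: "h \<in> ?H" "y \<in> space \<nu>" for h y
      proof -
        have y: "y \<in> Z" using h space_\<nu> by simp
        obtain T \<alpha> where "lle_geometry ?d \<nu> Z f K y (a y) T \<alpha> (lap y)" using geo y by blast
        then interpret geometry_at ?d \<nu> Z f K y a T \<alpha> "lap y" by (rule geometry_atI)
        show ?thesis by (rule second_moment_bound[OF r(1) rK bd[OF h(1) y]])
      qed
      show "0 \<le> 2 * K * r ^ ?d" using K r by simp
      show "emeasure \<nu> {y} = 0" if "y \<in> space \<nu>" for y
        using geo[of y] atomless[of K y] that unfolding space_\<nu> by blast
    qed
    then obtain E where E: "E \<in> sets \<Omega>" "measure \<Omega> E \<ge> 1 - real n * real (card ?H) * (2 * exp ?b)"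
      "\<And>\<omega>. \<omega> \<in> E \<Longrightarrow> \<omega> \<in> space \<Omega> \<and> inj_on (\<lambda>i. X i \<omega>) {..<n} \<and>
      (\<forall>k<n. \<forall>h\<in>?H. \<bar>\<Sum>j\<in>{..<n} - {k}. h (X k \<omega>) (X j \<omega>) - (\<integral>z. h (X k \<omega>) z \<partial>\<nu>)\<bar> \<le> real n * r ^ (?d + 1))"
      by blast
    have prob: "measure \<Omega> E > 1 - 1 / real n ^ 2"
    proof -
      have "?b = - (real n * r ^ (?d + 2) / (8 * K))"
        using K by (simp add: s_def power_divide power_add power2_eq_square field_simps)
      also have "\<dots> \<le> - (32 * K * ln (real n) / (8 * K))"
        using big K by (intro le_imp_neg_le divide_right_mono) auto
      also have "\<dots> = - (4 * ln (real n))" using K by simp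
      finally have "exp ?b \<le> exp (- (4 * ln (real n)))" by simp
      also have "\<dots> = 1 / real n ^ 4"
        using npos exp_of_nat_mult[of 4 "ln (real n)"] by (simp add: exp_minus divide_inverse)
      finally have eb: "exp ?b \<le> 1 / real n ^ 4" .
      have cc: "real (card ?H) \<le> c" unfolding c_def using card_tests[of f a K r] by (simp only: of_nat_le_iff)
      have "real n * real (card ?H) * (2 * exp ?b) \<le> real n * c * (2 * (1 / real n ^ 4))"
        using eb cc by (intro mult_mono) (auto simp: c_def)
      also have "\<dots> = (2 * c / real n) * (1 / real n ^ 2)" using npos by (simp add: field_simps eval_nat_numeral)
      also have "\<dots> < 1 * (1 / real n ^ 2)"
      proof (rule mult_strict_right_mono)
        show "2 * c / real n < 1" using n2 npos by (simp add: divide_less_eq)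
      qed (use npos in simp)
      finally show ?thesis using E(2) by linarith
    qed
    have "\<bar>1 / r\<^sup>2 * (lle_average ((\<lambda>i. X i \<omega>) ` {..<n}) r (real n * r ^ (?d + 3)) f (X k \<omega>) - f (X k \<omega>))
              - 1 / (2 * (real ?d + 2)) * lap (X k \<omega>)\<bar> \<le> C * r"
      if w: "\<omega> \<in> E" and k: "k < n" for \<omega> k
    proof -
      note Ew = E(3)[OF w]
      have XZ: "X j \<omega> \<in> Z" if "j < n" for j using X_space[OF that] Ew space_\<nu> by blast
      obtain T \<alpha> where "lle_geometry ?d \<nu> Z f K (X k \<omega>) (a (X k \<omega>)) T \<alpha> (lap (X k \<omega>))" using geo XZ[OF k] by blast
      then interpret geometry_at ?d \<nu> Z f K "X k \<omega>" a T \<alpha> "lap (X k \<omega>)" by (rule geometry_atI)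
      have coord: "(\<lambda>y. (y - X k \<omega>) $ i * (y - X k \<omega>) $ j) \<in> borel_measurable \<nu>" for i j
        by (intro measurable_\<nu>I continuous_measurable_Z continuous_intros)
      show ?thesis
        unfolding C_def \<kappa>_def
      proof (rule concentrated_lle_average[where z = "\<lambda>j. X j \<omega>" and n = n and k = k, OF coord])
        show "inj_on (\<lambda>i. X i \<omega>) {..<n}" using Ew by blast
        show "22 * (12 * K\<^sup>2 * (real CARD('p) + 1)\<^sup>2) ^ 7 * r \<le> 1" using r\<kappa> unfolding \<kappa>_def .
        show "X j \<omega> \<in> Z" if "j < n" for j by (rule XZ[OF that])
        show "\<bar>\<Sum>j\<in>{..<n} - {k}. h (X k \<omega>) (X j \<omega>) - (\<integral>y. h (X k \<omega>) y \<partial>\<nu>)\<bar> \<le> real n * r ^ (?d + 1)"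
          if "h \<in> tests f a K r" for h using Ew k that by blast
      qed (use k r in simp_all)
    qed
    then show ?thesis using E(1) prob by blast
  qed
  moreover have "C > 0" using \<kappa> by (simp add: C_def)
  ultimately show ?thesis using r0 K unfolding lap_def by blast
qed

text \<open>It remains to see that the conditions of \<open>lle_pointwise_bound\<close> hold
  eventually. The square of the assumed rate is ln n / (n \<epsilon>^(d+2)), so its convergence to 0
  is the required comparison of n \<epsilon>^(d+2) with ln n. The constant is fixed before the
  sequence \<epsilon> is.\<close>

theorem lle_converges:
  "\<exists>K>0. \<forall>\<epsilon> :: nat \<Rightarrow> real.
    (\<forall>n. \<epsilon> n > 0) \<longrightarrow> \<epsilon> \<longlonglongrightarrow> 0 \<longrightarrow>
    (\<lambda>n. sqrt (ln (real n)) / (sqrt (real n) * \<epsilon> n powr (real CARD('d) / 2 + 1))) \<longlonglongrightarrow> 0 \<longrightarrow>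
    (\<forall>\<^sub>F n in sequentially. \<forall>(\<Omega> :: 'w measure) X.
       iid_samples \<Omega> (embedded_volume M \<iota> V) P n X \<longrightarrow>
       (\<exists>E\<in>sets \<Omega>. measure \<Omega> E > 1 - 1 / real n ^ 2 \<and>
          (\<forall>\<omega>\<in>E. \<forall>k<n.
             \<bar>1 / (\<epsilon> n)\<^sup>2 *
                (lle_average ((\<lambda>i. X i \<omega>) ` {..<n}) (\<epsilon> n) (real n * \<epsilon> n ^ (CARD('d) + 3)) f (X k \<omega>)
                   - f (X k \<omega>))
              - 1 / (2 * (real CARD('d) + 2)) *
                laplace_beltrami \<A> g (f \<circ> \<iota>) (inv_into M \<iota> (X k \<omega>))\<bar>
             \<le> K * (\<epsilon> n +
                  sqrt (ln (real n)) / (sqrt (real n) * \<epsilon> n powr (real CARD('d) / 2 + 1))))))"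
proof -
  let ?d = "CARD('d)"
  obtain C r0 K and n0 :: nat where C: "C > 0" and r0: "r0 > 0" and K: "K \<ge> 1"
    and main: "\<forall>n \<ge> n0. \<forall>r. 0 < r \<longrightarrow> r \<le> r0 \<longrightarrow> 1 \<le> real n * r \<longrightarrow>
     32 * K * ln (real n) \<le> real n * r ^ (?d + 2) \<longrightarrow>
    (\<forall>(\<Omega> :: 'w measure) X. iid_samples \<Omega> (embedded_volume M \<iota> V) P n X \<longrightarrow>
       (\<exists>E\<in>sets \<Omega>. measure \<Omega> E > 1 - 1 / real n ^ 2 \<and>
          (\<forall>\<omega>\<in>E. \<forall>k<n.
             \<bar>1 / r\<^sup>2 * (lle_average ((\<lambda>i. X i \<omega>) ` {..<n}) r (real n * r ^ (?d + 3)) f (X k \<omega>) - f (X k \<omega>))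
              - 1 / (2 * (real ?d + 2)) * laplace_beltrami \<A> g (f \<circ> \<iota>) (inv_into M \<iota> (X k \<omega>))\<bar> \<le> C * r)))"
    using lle_pointwise_bound[where 'w = 'w] by (elim exE conjE) (rule that)
  show ?thesis
  proof (intro exI[of _ C] conjI C allI impI)
    fix \<epsilon> :: "nat \<Rightarrow> real"
    define \<delta> where "\<delta> = (\<lambda>n. sqrt (ln (real n)) / (sqrt (real n) * \<epsilon> n powr (real ?d / 2 + 1)))"
    assume \<epsilon>: "\<forall>n. \<epsilon> n > 0" "\<epsilon> \<longlonglongrightarrow> 0"
      and "(\<lambda>n. sqrt (ln (real n)) / (sqrt (real n) * \<epsilon> n powr (real ?d / 2 + 1))) \<longlonglongrightarrow> 0"
    then have \<delta>: "\<delta> \<longlonglongrightarrow> 0" unfolding \<delta>_def by simp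
    \<comment> \<open>Chosen so that a rate below \<eta> gives, after squaring, 32 K ln n \<le> n
      r^(d+2).\<close>
    define \<eta> where "\<eta> = 1 / sqrt (32 * K)"
    have \<eta>: "\<eta> > 0" using K by (simp add: \<eta>_def)
    have "eventually (\<lambda>n. \<epsilon> n < min r0 1) sequentially"
      using order_tendstoD(2)[OF \<epsilon>(2), of "min r0 1"] r0 by simp
    moreover have "eventually (\<lambda>n. \<delta> n < \<eta>) sequentially" by (rule order_tendstoD(2)[OF \<delta> \<eta>])
    \<comment> \<open>From n \<ge> 3 follows ln n \<ge> 1. With r \<le> 1 this yields 1 \<le> 32 K
      ln n \<le> n r^(d+2) \<le> n r, the remaining condition.\<close>
    moreover have "eventually (\<lambda>n. n \<ge> max n0 3) sequentially" by (rule eventually_ge_at_top)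
    ultimately show "\<forall>\<^sub>F n in sequentially. \<forall>(\<Omega> :: 'w measure) X.
       iid_samples \<Omega> (embedded_volume M \<iota> V) P n X \<longrightarrow>
       (\<exists>E\<in>sets \<Omega>. measure \<Omega> E > 1 - 1 / real n ^ 2 \<and>
          (\<forall>\<omega>\<in>E. \<forall>k<n.
             \<bar>1 / (\<epsilon> n)\<^sup>2 *
                (lle_average ((\<lambda>i. X i \<omega>) ` {..<n}) (\<epsilon> n) (real n * \<epsilon> n ^ (CARD('d) + 3)) f (X k \<omega>)
                   - f (X k \<omega>))
              - 1 / (2 * (real CARD('d) + 2)) *
                laplace_beltrami \<A> g (f \<circ> \<iota>) (inv_into M \<iota> (X k \<omega>))\<bar>
             \<le> C * (\<epsilon> n +
                  sqrt (ln (real n)) / (sqrt (real n) * \<epsilon> n powr (real CARD('d) / 2 + 1)))))"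
    proof eventually_elim
      case (elim n)
      define r where "r = \<epsilon> n"
      have r: "0 < r" "r \<le> r0" "r \<le> 1" and n: "n \<ge> n0" "n \<ge> 3" using elim \<epsilon>(1) by (auto simp: r_def)
      have ln1: "1 \<le> ln (real n)"
      proof -
        have "exp 1 \<le> real n" using exp_le n(2) by linarith
        then show ?thesis using n(2) by (subst ln_ge_iff) auto
      qed
      have rp: "(r powr (real ?d / 2 + 1))\<^sup>2 = r ^ (?d + 2)"
      proof -
        have "(r powr (real ?d / 2 + 1))\<^sup>2 = r powr (real (?d + 2))"
          by (simp add: power2_eq_square powr_add[symmetric] add.commute)
        then show ?thesis using r(1) by (simp only: powr_realpow)
      qed
      have big: "32 * K * ln (real n) \<le> real n * r ^ (?d + 2)"
      proof -
        have "\<delta> n \<ge> 0" unfolding \<delta>_def using ln1 by simp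
        then have "(\<delta> n)\<^sup>2 \<le> \<eta>\<^sup>2" using elim(2) by (intro power_mono) auto
        moreover have "(\<delta> n)\<^sup>2 = ln (real n) / (real n * r ^ (?d + 2))"
          unfolding \<delta>_def r_def[symmetric] power_divide power_mult_distrib rp using ln1 by simp
        moreover have "\<eta>\<^sup>2 = 1 / (32 * K)" using K by (simp add: \<eta>_def power_divide)
        ultimately have "ln (real n) / (real n * r ^ (?d + 2)) \<le> 1 / (32 * K)" by simp
        moreover have "real n * r ^ (?d + 2) > 0" using n r by simp
        ultimately have "ln (real n) \<le> 1 / (32 * K) * (real n * r ^ (?d + 2))" by (simp only: pos_divide_le_eq)
        then have "32 * K * ln (real n) \<le> 32 * K * (1 / (32 * K) * (real n * r ^ (?d + 2)))"
          using K by (intro mult_left_mono) auto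
        then show ?thesis using K by simp
      qed
      have nr: "1 \<le> real n * r"
      proof -
        have "1 * 1 \<le> 32 * K * ln (real n)" using K ln1 by (intro mult_mono) auto
        moreover have "real n * r ^ (?d + 2) \<le> real n * r ^ 1"
          using r by (intro mult_left_mono power_decreasing) auto
        ultimately show ?thesis using big by simp
      qed
      have le: "C * r \<le> C * (r + \<delta> n)"
      proof -
        have "\<delta> n \<ge> 0" unfolding \<delta>_def using ln1 by simp
        then show ?thesis using C by (intro mult_left_mono) auto
      qed
      note main' = main[rule_format, OF n(1) r(1,2) nr big]
      show ?case
      proof (intro allI impI)
        fix \<Omega> :: "'w measure" and X
        assume "iid_samples \<Omega> (embedded_volume M \<iota> V) P n X"
        from main'[OF this] show "\<exists>E\<in>sets \<Omega>. measure \<Omega> E > 1 - 1 / real n ^ 2 \<and>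
          (\<forall>\<omega>\<in>E. \<forall>k<n.
             \<bar>1 / (\<epsilon> n)\<^sup>2 *
                (lle_average ((\<lambda>i. X i \<omega>) ` {..<n}) (\<epsilon> n) (real n * \<epsilon> n ^ (CARD('d) + 3)) f (X k \<omega>)
                   - f (X k \<omega>))
              - 1 / (2 * (real CARD('d) + 2)) *
                laplace_beltrami \<A> g (f \<circ> \<iota>) (inv_into M \<iota> (X k \<omega>))\<bar>
             \<le> C * (\<epsilon> n +
                  sqrt (ln (real n)) / (sqrt (real n) * \<epsilon> n powr (real CARD('d) / 2 + 1))))"
          using le unfolding \<delta>_def r_def by (meson order_trans)
      qed
    qed
  qed
qed

end

theorem theorem3p3:
  fixes M :: "'m::topological_space set"
    and \<A> :: "('d::finite, 'm) param set"
    and g :: "('d, 'm) param \<Rightarrow> real ^ 'd \<Rightarrow> real ^ 'd ^ 'd"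
    and \<iota> :: "'m \<Rightarrow> real ^ 'p::finite"
    and V :: "'m measure"
    and P f :: "real ^ 'p \<Rightarrow> real"
    and P_m P_M :: real
    and \<nu> :: "(real ^ 'p) measure"
  defines "\<nu> \<equiv> density (embedded_volume M \<iota> V) (\<lambda>y. ennreal (P y))"
  assumes manifold: "smooth_manifold M \<A>" "compact M"
    and metric: "riemannian_metric \<A> g"
    and embedding: "isometric_embedding M \<A> g \<iota>"
    and volume: "riemannian_volume M \<A> g V"
    and density_regular: "Ck_manifold_map 5 \<A> (P \<circ> \<iota>)"
    and density_bounds: "0 < P_m" "\<forall>y\<in>\<iota> ` M. P_m \<le> P y \<and> P y \<le> P_M"
    and density_prob: "prob_space \<nu>"
    and geometry:
      "\<forall>x\<in>M. geometry_case0 CARD('d) (local_cov \<nu> (\<iota> x)) \<or>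
         geometry_case1 CARD('d) (P (\<iota> x)) (local_cov \<nu> (\<iota> x)) (embedded_tangent_space \<A> \<iota> x) \<or>
         geometry_case2 CARD('d) (P (\<iota> x)) (local_cov \<nu> (\<iota> x)) (embedded_tangent_space \<A> \<iota> x)"
    and f_regular: "Ck_manifold_map 3 \<A> (f \<circ> \<iota>)"
  shows "\<exists>K>0. \<forall>\<epsilon> :: nat \<Rightarrow> real.
    (\<forall>n. \<epsilon> n > 0) \<longrightarrow> \<epsilon> \<longlonglongrightarrow> 0 \<longrightarrow>
    (\<lambda>n. sqrt (ln (real n)) / (sqrt (real n) * \<epsilon> n powr (real CARD('d) / 2 + 1))) \<longlonglongrightarrow> 0 \<longrightarrow>
    (\<forall>\<^sub>F n in sequentially. \<forall>(\<Omega> :: 'w measure) X.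
       iid_samples \<Omega> (embedded_volume M \<iota> V) P n X \<longrightarrow>
       (\<exists>E\<in>sets \<Omega>. measure \<Omega> E > 1 - 1 / real n ^ 2 \<and>
          (\<forall>\<omega>\<in>E. \<forall>k<n.
             \<bar>1 / (\<epsilon> n)\<^sup>2 *
                (lle_average ((\<lambda>i. X i \<omega>) ` {..<n}) (\<epsilon> n) (real n * \<epsilon> n ^ (CARD('d) + 3)) f (X k \<omega>)
                   - f (X k \<omega>))
              - 1 / (2 * (real CARD('d) + 2)) *
                laplace_beltrami \<A> g (f \<circ> \<iota>) (inv_into M \<iota> (X k \<omega>))\<bar>
             \<le> K * (\<epsilon> n +
                  sqrt (ln (real n)) / (sqrt (real n) * \<epsilon> n powr (real CARD('d) / 2 + 1))))))"
proof -
  interpret sampled_manifold M \<A> g \<iota> V P f P_m P_M \<nu>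
    using manifold embedding volume density_regular density_bounds density_prob f_regular
    by (intro sampled_manifold.intro) (simp_all add: \<nu>_def)
  show ?thesis by (rule lle_converges)
qed

end
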